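(* Let $I=[0,1]$, $m,d\in\mathbb{N}$, $\mathcal{D}=\{1,\dots,d\}$, and let $\Lambda$ be a downward closed set of subsets of $\mathcal{D}$ with $n=\max_{\mathfrak{u}\in\Lambda}|\mathfrak{u}|$. For a fixed $p\in\mathbb{N}$ let $\boldsymbol{p}=\{p_{\mathfrak{u}}=p+|\mathfrak{u}|\in\mathbb{N}:\mathfrak{u}\in\Lambda\}$ and let $X=X^{(d)}_{\Lambda,\boldsymbol{p}}$ be the sampling point set defined in the context, with $N=|X|$ points. Put $\rho_1(m,n)=(m+1)(n-1)$, $\rho_2(n)=\frac32(n-1)$, $F_1(N)=(\log N)^{\rho_1(m,n)}N^{-m}$ and $F_2(N)=(\log N)^{\rho_2(n)}N^{-1/2}$, and let $\lambda>0$. Then there is a constant $C>0$, depending on $d$ and $m$, such that for all $f=f_1+f_2\in H^m_{\mathrm{mix}}(I^d)$ with $f_1\in H^m_{\mathrm{mix},\Lambda}(I^d)$ and $f_2\in H^m_{\mathrm{mix},\complement\Lambda}(I^d)$ the bound $$\|f-Q_{X,\lambda,\Lambda}(f)\|_{L_2(I^d)}\le C\left[(\log N)^{\rho_1(m,n)}N^{-m}+(\log N)^{\rho_2(n)}N^{-1/2}\sqrt\lambda\right]\|f\|_{H^m_{\mathrm{mix}}(I^d)}$$ $$\qquad+C\left[(\log N)^{\rho_1(m,n)}N^{-m}\frac1{\sqrt\lambda}+(\log N)^{\rho_2(n)}N^{-1/2}\right]\|f_2\|_{\ell_2(X)}+\|f_2\|_{L_2(I^d)}$$ holds. The particular choice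 $\sqrt\lambda=F_1(N)/F_2(N)$ yields $$\|f-Q_{X,\lambda,\Lambda}(f)\|_{L_2(I^d)}\le C(\log N)^{\rho_1(m,n)}N^{-m}\|f\|_{H^m_{\mathrm{mix}}(I^d)}+C(\log N)^{\rho_2(n)}N^{-1/2}\|f_2\|_{\ell_2(X)}+\|f_2\|_{L_2(I^d)}$$ $$\qquad\le C\left[(\log N)^{\rho_1(m,n)}N^{-m}\|f\|_{H^m_{\mathrm{mix}}(I^d)}+(\log N)^{\rho_2(n)}\|f_2\|_{L_\infty(I^d)}\right].$$
   Context: Here $\mathbb{N}=\{1,2,\dots\}$. A set $\Lambda$ of subsets of $\mathcal{D}$ is downward closed if $\mathfrak{u}\in\Lambda$ and $\mathfrak{v}\subseteq\mathfrak{u}$ imply $\mathfrak{v}\in\Lambda$. For $\boldsymbol{x}\in I^d$, $\boldsymbol{x}_{\mathfrak{u}}=(x_j)_{j\in\mathfrak{u}}$, and $(\boldsymbol{x};\boldsymbol{0})_{\mathfrak{u}}\in I^d$ is the point with entries $x_j$ for $j\in\mathfrak{u}$ and $0$ for $j\notin\mathfrak{u}$. For a finite set $Y=\{y_1,\dots,y_M\}\subseteq I$, $h_Y=\sup_{x\in I}\min_j|x-y_j|$, $q_Y=\frac12\min_{j\neq k}|y_j-y_k|$; a sequence of point sets is quasi-uniform if the ratios $h_Y/q_Y$ are uniformly bounded along it. Sampling points: let $Y^{(\ell)}\subseteq I$, $\ell\in\mathbb{N}$, be a sequence of quasi-uniform point sets with $|Y^{(1)}|=1$ and $|Y^{(\ell)}|=2^{\ell-1}+1$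 for $\ell\ge2$. For $\emptyset\ne\mathfrak{u}\subseteq\mathcal{D}$ with $k=|\mathfrak{u}|$ and an integer $s\ge k$, let $\widetilde{X}_{\mathfrak{u},s}=\bigcup Y^{(\ell_1)}\times\cdots\times Y^{(\ell_k)}\subseteq I^{k}$, the union being over $\boldsymbol\ell\in\mathbb{N}^k$ with $s-k+1\le\ell_1+\dots+\ell_k\le s$. For $\mathfrak{u}=\emptyset$ set $\widetilde X_{\emptyset,s}=Y^{(s)}$. The points of these low-dimensional sets are extended using the anchor $\boldsymbol{0}\in I^d$, yielding point sets $X_{\mathfrak{u},s}\subseteq I^d$; here the extension of $\widetilde{\boldsymbol{x}}$ has the entries of $\widetilde{\boldsymbol{x}}$ at the positions $j\in\mathfrak{u}$ and the entry $0$ at all positions $j\in\mathcal{D}\setminus\mathfrak{u}$. Finally $X^{(d)}_{\Lambda,\boldsymbol{p}}=\bigcup_{\mathfrak{u}\in\Lambda}X_{\mathfrak{u},p_{\mathfrak{u}}}$, and $\|g\|_{\ell_2(X)}=(\sum_{\boldsymbol x\in X}|g(\boldsymbol x)|^2)^{1/2}$. $H^m_{\mathrm{mix}}(I^d)$ is the $d$-fold Hilbert space tensor product of $H^m([0,1])$, where $H^m([0,1])$ has inner product $\langle f,g\rangle=\sum_{r=0}^{m-1}f^{(r)}(0)g^{(r)}(0)+\int_0^1f^{(m)}g^{(m)}$. As a set, it is $\{f\in L_2(I^d):D^{\boldsymbol\alpha}f\in L_2(I^d)\ \forall\,\boldsymbol\alpha\in\mathbb{N}_0^d,\ \|\boldsymbol\alpha\|_\infty\le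 m\}$, which embeds into $C(I^d)$. $H^m_{\mathrm{mix},\Lambda}(I^d)$ is the closed subspace of all $f\in H^m_{\mathrm{mix}}(I^d)$ of the form $f(\boldsymbol{x})=\sum_{\mathfrak{u}\in\Lambda}f_{\mathfrak{u}}(\boldsymbol{x}_{\mathfrak{u}})$, and $H^m_{\mathrm{mix},\complement\Lambda}(I^d)$ is its orthogonal complement in $H^m_{\mathrm{mix}}(I^d)$. (The orthogonal projection onto $H^m_{\mathrm{mix},\Lambda}(I^d)$ is $P_\Lambda f(\boldsymbol{x})=\sum_{\mathfrak{u}\in\Lambda}\sum_{\mathfrak{v}\subseteq\mathfrak{u}}(-1)^{|\mathfrak{u}|-|\mathfrak{v}|}f((\boldsymbol{x};\boldsymbol{0})_{\mathfrak{v}})$.) Penalized least squares: $Q_{X,\lambda,\Lambda}(f)$ is the minimizer over $s\in H^m_{\mathrm{mix},\Lambda}(I^d)$ of $\sum_{\boldsymbol x\in X}|f(\boldsymbol{x})-s(\boldsymbol{x})|^2+\lambda\|s\|^2_{H^m_{\mathrm{mix}}(I^d)}$.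
   Formalization: The point set X is read with multiplicity: for u = ∅ the anchor 0 counts |Y^(p)| times in N, in the least squares sum and in the ℓ2(X) norm (counted once, the bound fails); Λ is nonempty with n ≥ 1, since for n = 0 the bound is undefined or false. *)

theory Defs
  imports "HOL-Probability.Probability" "HOL-Library.Multiset"
begin

section \<open>The unit cube\<close>

text \<open>
  Points of $I^d$ are extensional functions on $\{1,\dots,d\}$. A function on $I^d$ is represented
  by the function on \<^typ>\<open>nat \<Rightarrow> real\<close> that vanishes outside the cube, so that the
  representation is unique and compatible with pointwise addition and scaling.
\<close>

definition cube :: "nat \<Rightarrow> (nat \<Rightarrow> real) set" where
  "cube d = (\<Pi>\<^sub>E j\<in>{1..d}. {0..1})"

definition cube_measure :: "nat \<Rightarrow> (nat \<Rightarrow> real) measure" where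
  "cube_measure d = Pi\<^sub>M {1..d} (\<lambda>_. restrict_space lborel {0..1})"

definition L2_cube_norm :: "nat \<Rightarrow> ((nat \<Rightarrow> real) \<Rightarrow> real) \<Rightarrow> real" where
  "L2_cube_norm d f = sqrt (\<integral>x. (f x)\<^sup>2 \<partial>cube_measure d)"

definition Linf_cube_norm :: "nat \<Rightarrow> ((nat \<Rightarrow> real) \<Rightarrow> real) \<Rightarrow> real" where
  "Linf_cube_norm d f = real_of_ereal (esssup (cube_measure d) (\<lambda>x. ereal \<bar>f x\<bar>))"


section \<open>The Sobolev space $H^m([0,1])$\<close>

text \<open>
  \<open>sobolev_derivs m f D\<close>: \<open>f\<close> (restricted to $[0,1]$) lies in $H^m([0,1])$ and \<open>D r\<close> is its
  \<open>r\<close>-th derivative, $0 \le r \le m$. For $r < m$ the function \<open>D r\<close> is absolutely continuous, being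
  the indefinite integral of \<open>D (r + 1)\<close>, and is uniquely determined on $[0,1]$; \<open>D m\<close> is square
  integrable and determined almost everywhere.
\<close>

definition sobolev_derivs :: "nat \<Rightarrow> (real \<Rightarrow> real) \<Rightarrow> (nat \<Rightarrow> real \<Rightarrow> real) \<Rightarrow> bool" where
  "sobolev_derivs m f D \<longleftrightarrow>
     (\<forall>x\<in>{0..1}. D 0 x = f x) \<and>
     (\<forall>r<m. set_integrable lborel {0..1} (D (Suc r)) \<and>
        (\<forall>x\<in>{0..1}. D r x = D r 0 + (LBINT t:{0..x}. D (Suc r) t))) \<and>
     set_borel_measurable lborel {0..1} (D m) \<and>
     set_integrable lborel {0..1} (\<lambda>t. (D m t)\<^sup>2)"

definition sobolev :: "nat \<Rightarrow> (real \<Rightarrow> real) set" where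
  "sobolev m = {f. \<exists>D. sobolev_derivs m f D}"

definition sobolev_inner :: "nat \<Rightarrow> (real \<Rightarrow> real) \<Rightarrow> (real \<Rightarrow> real) \<Rightarrow> real" where
  "sobolev_inner m f g = (THE c. \<exists>D E. sobolev_derivs m f D \<and> sobolev_derivs m g E \<and>
      c = (\<Sum>r<m. D r 0 * E r 0) + (LBINT t:{0..1}. D m t * E m t))"


section \<open>The Hilbert space tensor product $H^m_{\mathrm{mix}}(I^d)$\<close>

text \<open>
  An element of the algebraic tensor product is given as a finite sum of elementary tensors
  $\bigotimes_{j=1}^d F_j$, that is, by a list of families \<open>F\<close>.
\<close>

definition tensors :: "nat \<Rightarrow> nat \<Rightarrow> (nat \<Rightarrow> real \<Rightarrow> real) list set" where
  "tensors m d = {S. \<forall>F\<in>set S. \<forall>j\<in>{1..d}. F j \<in> sobolev m}"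

definition tensor_fun :: "nat \<Rightarrow> (nat \<Rightarrow> real \<Rightarrow> real) list \<Rightarrow> (nat \<Rightarrow> real) \<Rightarrow> real" where
  "tensor_fun d S x = (\<Sum>F\<leftarrow>S. \<Prod>j=1..d. F j (x j))"

definition tensor_inner ::
    "nat \<Rightarrow> nat \<Rightarrow> (nat \<Rightarrow> real \<Rightarrow> real) list \<Rightarrow> (nat \<Rightarrow> real \<Rightarrow> real) list \<Rightarrow> real" where
  "tensor_inner m d S T = (\<Sum>F\<leftarrow>S. \<Sum>G\<leftarrow>T. \<Prod>j=1..d. sobolev_inner m (F j) (G j))"

definition tensor_dist ::
    "nat \<Rightarrow> nat \<Rightarrow> (nat \<Rightarrow> real \<Rightarrow> real) list \<Rightarrow> (nat \<Rightarrow> real \<Rightarrow> real) list \<Rightarrow> real" where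
  "tensor_dist m d S T =
     sqrt (tensor_inner m d S S - 2 * tensor_inner m d S T + tensor_inner m d T T)"

text \<open>
  The completion of the algebraic tensor product, realized as a space of functions: since point
  evaluations are continuous, an abstract limit of a Cauchy sequence is identified with the
  pointwise limit of that sequence.
\<close>

definition tensor_approx ::
    "nat \<Rightarrow> nat \<Rightarrow> (nat \<Rightarrow> (nat \<Rightarrow> real \<Rightarrow> real) list) \<Rightarrow> ((nat \<Rightarrow> real) \<Rightarrow> real) \<Rightarrow> bool" where
  "tensor_approx m d S f \<longleftrightarrow>
     (\<forall>k. S k \<in> tensors m d) \<and>
     (\<forall>e>0. \<exists>K. \<forall>k\<ge>K. \<forall>l\<ge>K. tensor_dist m d (S k) (S l) < e) \<and>
     (\<forall>x\<in>cube d. (\<lambda>k. tensor_fun d (S k) x) \<longlonglongrightarrow> f x)"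

definition hmix :: "nat \<Rightarrow> nat \<Rightarrow> ((nat \<Rightarrow> real) \<Rightarrow> real) set" where
  "hmix m d = {f. (\<forall>x. x \<notin> cube d \<longrightarrow> f x = 0) \<and> (\<exists>S. tensor_approx m d S f)}"

definition hmix_inner ::
    "nat \<Rightarrow> nat \<Rightarrow> ((nat \<Rightarrow> real) \<Rightarrow> real) \<Rightarrow> ((nat \<Rightarrow> real) \<Rightarrow> real) \<Rightarrow> real" where
  "hmix_inner m d f g = (THE c. \<exists>S T. tensor_approx m d S f \<and> tensor_approx m d T g \<and>
      (\<lambda>k. tensor_inner m d (S k) (T k)) \<longlonglongrightarrow> c)"

definition hmix_norm :: "nat \<Rightarrow> nat \<Rightarrow> ((nat \<Rightarrow> real) \<Rightarrow> real) \<Rightarrow> real" where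
  "hmix_norm m d f = sqrt (hmix_inner m d f f)"


section \<open>Effective-variable subspaces\<close>

definition downward_closed :: "'a set set \<Rightarrow> bool" where
  "downward_closed \<Lambda> \<longleftrightarrow> (\<forall>u\<in>\<Lambda>. \<forall>v\<subseteq>u. v \<in> \<Lambda>)"

text \<open>The point $x_u$ is \<open>restrict x u\<close>.\<close>

definition hmix_sub :: "nat \<Rightarrow> nat \<Rightarrow> nat set set \<Rightarrow> ((nat \<Rightarrow> real) \<Rightarrow> real) set" where
  "hmix_sub m d \<Lambda> = {f \<in> hmix m d.
     \<exists>g :: nat set \<Rightarrow> (nat \<Rightarrow> real) \<Rightarrow> real. \<forall>x\<in>cube d. f x = (\<Sum>u\<in>\<Lambda>. g u (restrict x u))}"

definition hmix_compl :: "nat \<Rightarrow> nat \<Rightarrow> nat set set \<Rightarrow> ((nat \<Rightarrow> real) \<Rightarrow> real) set" where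
  "hmix_compl m d \<Lambda> = {f \<in> hmix m d. \<forall>g\<in>hmix_sub m d \<Lambda>. hmix_inner m d f g = 0}"


section \<open>Sampling points\<close>

definition fill_distance :: "real set \<Rightarrow> real" where
  "fill_distance Y = (SUP x\<in>{0..1}. Min ((\<lambda>y. \<bar>x - y\<bar>) ` Y))"

definition separation_radius :: "real set \<Rightarrow> real" where
  "separation_radius Y = Min {\<bar>y - z\<bar> | y z. y \<in> Y \<and> z \<in> Y \<and> y \<noteq> z} / 2"

text \<open>
  For a singleton the minimum in the separation radius is over the empty set, so the ratio imposes
  no condition there.
\<close>

definition quasi_uniform :: "(nat \<Rightarrow> real set) \<Rightarrow> bool" where
  "quasi_uniform Y \<longleftrightarrow>
     (\<exists>\<kappa>. \<forall>l\<ge>1. card (Y l) \<ge> 2 \<longrightarrow> fill_distance (Y l) / separation_radius (Y l) \<le> \<kappa>)"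

definition sampling_sequence :: "(nat \<Rightarrow> real set) \<Rightarrow> bool" where
  "sampling_sequence Y \<longleftrightarrow>
     (\<forall>l\<ge>1. finite (Y l) \<and> Y l \<subseteq> {0..1}) \<and>
     card (Y 1) = 1 \<and> (\<forall>l\<ge>2. card (Y l) = 2 ^ (l - 1) + 1) \<and>
     quasi_uniform Y"

text \<open>
  Coordinates of the low-dimensional points are indexed by the elements of \<open>u\<close> rather than by
  $1,\dots,|u|$. The condition $s - k + 1 \le |\ell|_1$ is written without subtraction.
\<close>

definition sparse_grid :: "(nat \<Rightarrow> real set) \<Rightarrow> nat set \<Rightarrow> nat \<Rightarrow> (nat \<Rightarrow> real) set" where
  "sparse_grid Y u s = (\<Union>l \<in> {l \<in> u \<rightarrow>\<^sub>E {1..}. s + 1 \<le> (\<Sum>j\<in>u. l j) + card u \<and> (\<Sum>j\<in>u. l j) \<le> s}.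
      \<Pi>\<^sub>E j\<in>u. Y (l j))"

definition anchor_extend :: "nat \<Rightarrow> nat set \<Rightarrow> (nat \<Rightarrow> real) \<Rightarrow> nat \<Rightarrow> real" where
  "anchor_extend d u x = (\<lambda>j\<in>{1..d}. if j \<in> u then x j else 0)"

text \<open>
  Point sets carry multiplicities: every low-dimensional point is extended to one sampling point.
  For nonempty \<open>u\<close> the extension is injective and all multiplicities are one. For \<open>u = {}\<close> the
  low-dimensional set is \<open>Y s\<close>, and each of its elements is extended to the anchor, which thus occurs
  \<open>card (Y s)\<close> times. The multiplicity matters: if the anchor were counted only once, the sampling
  inequality $\|g\|_{L_2} \le C (N^{-m} \|g\|_{H^m_{\mathrm{mix}}} + N^{-1/2} \|g\|_{\ell_2(X)})$
  would fail already for $d = 2$ and \<open>\<Lambda> = {{}, {1}, {2}}\<close>, because of the term $g(0)$.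
\<close>

definition sample_points_at ::
    "nat \<Rightarrow> (nat \<Rightarrow> real set) \<Rightarrow> nat set \<Rightarrow> nat \<Rightarrow> (nat \<Rightarrow> real) multiset" where
  "sample_points_at d Y u s =
     (if u = {} then image_mset (\<lambda>y. \<lambda>j\<in>{1..d}. 0) (mset_set (Y s))
      else image_mset (anchor_extend d u) (mset_set (sparse_grid Y u s)))"

text \<open>
  The supremum is the union of multisets (maximum of multiplicities), so a point that belongs to
  several of the sets is not counted repeatedly.
\<close>

definition sample_points ::
    "nat \<Rightarrow> (nat \<Rightarrow> real set) \<Rightarrow> nat set set \<Rightarrow> (nat set \<Rightarrow> nat) \<Rightarrow> (nat \<Rightarrow> real) multiset" where
  "sample_points d Y \<Lambda> p = (SUP u\<in>\<Lambda>. sample_points_at d Y u (p u))"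

definition l2_sample_norm :: "(nat \<Rightarrow> real) multiset \<Rightarrow> ((nat \<Rightarrow> real) \<Rightarrow> real) \<Rightarrow> real" where
  "l2_sample_norm X g = sqrt (\<Sum>x\<in>#X. (g x)\<^sup>2)"


section \<open>Penalized least squares\<close>

definition pls_functional :: "nat \<Rightarrow> nat \<Rightarrow> (nat \<Rightarrow> real) multiset \<Rightarrow> real \<Rightarrow>
    ((nat \<Rightarrow> real) \<Rightarrow> real) \<Rightarrow> ((nat \<Rightarrow> real) \<Rightarrow> real) \<Rightarrow> real" where
  "pls_functional m d X lam f s = (\<Sum>x\<in>#X. (f x - s x)\<^sup>2) + lam * (hmix_norm m d s)\<^sup>2"

definition pls :: "nat \<Rightarrow> nat \<Rightarrow> (nat \<Rightarrow> real) multiset \<Rightarrow> real \<Rightarrow> nat set set \<Rightarrow>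
    ((nat \<Rightarrow> real) \<Rightarrow> real) \<Rightarrow> (nat \<Rightarrow> real) \<Rightarrow> real" where
  "pls m d X lam \<Lambda> f =
     (THE s. is_arg_min (pls_functional m d X lam f) (\<lambda>s. s \<in> hmix_sub m d \<Lambda>) s)"


section \<open>Exponents and rates\<close>

definition rho1 :: "nat \<Rightarrow> nat \<Rightarrow> real" where
  "rho1 m n = (real m + 1) * (real n - 1)"

definition rho2 :: "nat \<Rightarrow> real" where
  "rho2 n = 3 / 2 * (real n - 1)"

definition rate1 :: "nat \<Rightarrow> nat \<Rightarrow> nat \<Rightarrow> real" where
  "rate1 m n N = ln (real N) powr rho1 m n * real N powr (- real m)"

definition rate2 :: "nat \<Rightarrow> nat \<Rightarrow> real" where
  "rate2 n N = ln (real N) powr rho2 n * real N powr (- (1 / 2))"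

end

theory Submission
  imports Defs
begin

text \<open>
  By optimality of $s = Q_{X,\lambda,\Lambda}(f)$ against $f_1$, both $\|f_1 - s\|_{H^m_{\mathrm{mix}}}$
  and $\|f_1 - s\|_{\ell_2(X)}$ are controlled, so everything rests on the sampling inequality
  $\|g\|_{L_2} \le C (F_1(N) \|g\|_{H^m_{\mathrm{mix}}} + F_2(N) \|g\|_{\ell_2(X)})$ for $g$ in
  $H^m_{\mathrm{mix},\Lambda}$. Such a $g$ is a linear combination of its anchored restrictions
  $g((x;0)_v)$, $v \in \Lambda$, with coefficients depending on $\Lambda$ only, and the restriction to $v$ is
  approximated by the Smolyak combination of univariate quasi-interpolants that uses exactly the points
  of $X_{v,p+|v|}$. Operator norms on the tensor product are products of univariate operator norms, by
  the Schur product theorem for Gram matrices. The inner product of the completion is well defined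
  because every functional $\langle\cdot,G\rangle$ on $H^m([0,1])$ is an operator norm limit of
  combinations of point evaluations, so that a Cauchy sequence of tensors converging pointwise to $0$
  has norms converging to $0$.
\<close>

section \<open>Positive semidefinite kernels\<close>

text \<open>The exponents come from trading the level \<open>p\<close> for the number of points. The
  Smolyak error on \<open>v\<close> is of order \<open>p^(n-1) 2^(-m p)\<close>, the stability
  constant of order \<open>p^(n-1) 2^(-p/2)\<close>, and \<open>N\<close> lies between
  \<open>2^p\<close> and a multiple of \<open>p^(n-1) 2^p\<close>. Replacing \<open>2^(-p)\<close>
  by \<open>p^(n-1) / N\<close> raises the powers of \<open>p\<close> to \<open>(m+1)(n-1)\<close>
  and \<open>3/2 (n-1)\<close>, and \<open>p\<close> is at most \<open>2 ln N\<close>. Two obstacles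
  shape the route. The points are merely quasi-uniform, so the univariate operators are
  discontinuous piecewise polynomials that do not map into \<open>H^m\<close>; only their errors, as
  maps from \<open>H^m\<close> to \<open>L_2\<close>, are tensorized. And an element of the mixed
  space is known only as the pointwise limit of a Cauchy sequence of lists of elementary tensors, so
  each estimate is proved for finite sums, with constants independent of the sum, and then carried
  to the limit.\<close>

definition psd_on :: "'a set \<Rightarrow> ('a \<Rightarrow> 'a \<Rightarrow> real) \<Rightarrow> bool" where
  "psd_on A K \<longleftrightarrow> (\<forall>i\<in>A. \<forall>j\<in>A. K i j = K j i) \<and>
     (\<forall>c. 0 \<le> (\<Sum>i\<in>A. \<Sum>j\<in>A. c i * c j * K i j))"

lemma psd_onD:
  assumes "psd_on A K"
  shows "0 \<le> (\<Sum>i\<in>A. \<Sum>j\<in>A. c i * c j * K i j)"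
  using assms by (auto simp: psd_on_def)

lemma psd_on_add:
  assumes "psd_on A K" "psd_on A L"
  shows "psd_on A (\<lambda>i j. K i j + L i j)"
  unfolding psd_on_def
proof (intro conjI allI ballI)
  fix i j assume "i \<in> A" "j \<in> A"
  then show "K i j + L i j = K j i + L j i"
    using assms by (simp add: psd_on_def)
next
  fix c
  have "(\<Sum>i\<in>A. \<Sum>j\<in>A. c i * c j * (K i j + L i j)) =
    (\<Sum>i\<in>A. \<Sum>j\<in>A. c i * c j * K i j) + (\<Sum>i\<in>A. \<Sum>j\<in>A. c i * c j * L i j)"
    by (simp add: distrib_left sum.distrib)
  then show "0 \<le> (\<Sum>i\<in>A. \<Sum>j\<in>A. c i * c j * (K i j + L i j))"
    using assms by (simp add: psd_onD)
qed

lemma sum_sum_insert: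
  fixes g :: "'a \<Rightarrow> 'a \<Rightarrow> real"
  assumes "finite A" "a \<notin> A"
  shows "(\<Sum>i\<in>insert a A. \<Sum>j\<in>insert a A. g i j)
    = g a a + (\<Sum>j\<in>A. g a j) + (\<Sum>i\<in>A. g i a) + (\<Sum>i\<in>A. \<Sum>j\<in>A. g i j)"
  using assms by (simp add: sum.distrib)

lemma psd_on_subset:
  assumes "psd_on B K" "A \<subseteq> B" "finite B"
  shows "psd_on A K"
  unfolding psd_on_def
proof (intro conjI allI ballI)
  fix i j assume "i \<in> A" "j \<in> A"
  then show "K i j = K j i" using assms by (auto simp: psd_on_def)
next
  fix c :: "'a \<Rightarrow> real"
  let ?c = "\<lambda>i. if i \<in> A then c i else 0"
  have "0 \<le> (\<Sum>i\<in>B. \<Sum>j\<in>B. ?c i * ?c j * K i j)"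
    using assms by (simp add: psd_onD)
  also have "\<dots> = (\<Sum>i\<in>B. if i \<in> A then (\<Sum>j\<in>A. c i * c j * K i j) else 0)"
    using assms by (intro sum.cong refl) (auto intro!: sum.mono_neutral_cong_right)
  also have "\<dots> = (\<Sum>i\<in>A. \<Sum>j\<in>A. c i * c j * K i j)"
    using assms by (auto intro!: sum.mono_neutral_cong_right)
  finally show "0 \<le> (\<Sum>i\<in>A. \<Sum>j\<in>A. c i * c j * K i j)" .
qed

text \<open>Cholesky factorization, eliminating one index at a time.\<close>

lemma psd_on_factor:
  assumes "finite A" "psd_on A K"
  shows "\<exists>v. \<forall>i\<in>A. \<forall>j\<in>A. K i j = (\<Sum>b\<in>A. v b i * v b j)"
  using assms
proof (induction A arbitrary: K rule: finite_induct)
  case empty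
  then show ?case by simp
next
  case (insert a A)
  have sym: "K i j = K j i" if "i \<in> insert a A" "j \<in> insert a A" for i j
    using insert.prems that unfolding psd_on_def by blast
  \<comment> \<open>The form at the vector with entry \<open>t\<close> at the pivot \<open>a\<close>
    and entries \<open>c\<close> on \<open>A\<close>. All facts about the pivot are obtained by
    choosing \<open>t\<close>.\<close>
  have full: "0 \<le> t * t * K a a + 2 * t * (\<Sum>j\<in>A. c j * K a j) + (\<Sum>i\<in>A. \<Sum>j\<in>A. c i * c j * K i j)"
    for t c
  proof -
    let ?c = "c(a := t)"
    have "0 \<le> (\<Sum>i\<in>insert a A. \<Sum>j\<in>insert a A. ?c i * ?c j * K i j)"
      by (rule psd_onD[OF insert.prems])
    also have "\<dots> = t * t * K a a + (\<Sum>j\<in>A. t * ?c j * K a j) + (\<Sum>i\<in>A. ?c i * t * K i a)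
        + (\<Sum>i\<in>A. \<Sum>j\<in>A. ?c i * ?c j * K i j)"
      using insert.hyps by (subst sum_sum_insert) auto
    also have "(\<Sum>j\<in>A. t * ?c j * K a j) = t * (\<Sum>j\<in>A. c j * K a j)"
      unfolding sum_distrib_left using insert.hyps by (intro sum.cong) auto
    also have "(\<Sum>i\<in>A. ?c i * t * K i a) = t * (\<Sum>j\<in>A. c j * K a j)"
      unfolding sum_distrib_left using insert.hyps sym by (intro sum.cong) auto
    also have "(\<Sum>i\<in>A. \<Sum>j\<in>A. ?c i * ?c j * K i j) = (\<Sum>i\<in>A. \<Sum>j\<in>A. c i * c j * K i j)"
      using insert.hyps by (intro sum.cong refl) auto
    finally show ?thesis by (simp add: algebra_simps)
  qed
  have Kaa: "K a a \<ge> 0" using full[of 1 "\<lambda>_. 0"] by simp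
  \<comment> \<open>\<open>w\<close> is the column of the Cholesky factor that belongs to
    \<open>a\<close>, and \<open>K'\<close> is the Schur complement left after eliminating
    \<open>a\<close>. For a vanishing pivot \<open>w\<close> is zero, in accordance with the fact
    that the whole row of \<open>a\<close> then vanishes.\<close>
  define w where "w i = (if K a a = 0 then 0 else K a i / sqrt (K a a))" for i
  define K' where "K' i j = K i j - w i * w j" for i j
  have psdA: "psd_on A K"
    by (rule psd_on_subset[OF insert.prems]) (use insert.hyps in auto)
  have zero: "K a i = 0" if "K a a = 0" "i \<in> A" for i
  proof (rule ccontr)
    assume ne: "K a i \<noteq> 0"
    \<comment> \<open>With the unit vector at \<open>i\<close> and this \<open>t\<close> the form
      takes the value \<open>-1\<close>.\<close>
    define t where "t = - (K i i + 1) / (2 * K a i)"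
    let ?c = "\<lambda>j. if j = i then 1 else 0 :: real"
    have s1: "(\<Sum>j\<in>A. ?c j * K a j) = K a i"
      using insert.hyps(1) that by (simp add: if_distrib[of "\<lambda>x. x * _"] cong: if_cong)
    have s2: "(\<Sum>i\<in>A. \<Sum>j\<in>A. ?c i * ?c j * K i j) = K i i"
    proof -
      have "(\<Sum>i'\<in>A. \<Sum>j\<in>A. ?c i' * ?c j * K i' j) = (\<Sum>i'\<in>A. ?c i' * K i' i)"
        using insert.hyps(1) that
        by (intro sum.cong refl) (simp add: if_distrib[of "\<lambda>x. x * _"] if_distrib[of "\<lambda>x. _ * x"] cong: if_cong)
      also have "\<dots> = K i i"
        using insert.hyps(1) that by (simp add: if_distrib[of "\<lambda>x. x * _"] cong: if_cong)
      finally show ?thesis .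
    qed
    have "0 \<le> 2 * t * K a i + K i i" using full[of t ?c] s1 s2 that by simp
    moreover have "2 * t * K a i = - (K i i + 1)" using ne by (simp add: t_def)
    ultimately show False by simp
  qed
  have "psd_on A K'"
    unfolding psd_on_def
  proof (intro conjI allI ballI)
    fix i j assume "i \<in> A" "j \<in> A"
    then show "K' i j = K' j i" using sym by (simp add: K'_def)
  next
    fix c
    let ?S = "\<Sum>j\<in>A. c j * K a j"
    have "(\<Sum>i\<in>A. \<Sum>j\<in>A. c i * c j * K' i j)
      = (\<Sum>i\<in>A. \<Sum>j\<in>A. c i * c j * K i j) - (\<Sum>i\<in>A. \<Sum>j\<in>A. (c i * w i) * (c j * w j))"
      unfolding K'_def by (simp add: sum_subtractf[symmetric] algebra_simps)
    also have "(\<Sum>i\<in>A. \<Sum>j\<in>A. (c i * w i) * (c j * w j)) = (\<Sum>i\<in>A. c i * w i)\<^sup>2"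
      by (simp add: power2_eq_square sum_product)
    finally have eq: "(\<Sum>i\<in>A. \<Sum>j\<in>A. c i * c j * K' i j)
      = (\<Sum>i\<in>A. \<Sum>j\<in>A. c i * c j * K i j) - (\<Sum>i\<in>A. c i * w i)\<^sup>2" .
    show "0 \<le> (\<Sum>i\<in>A. \<Sum>j\<in>A. c i * c j * K' i j)"
    proof (cases "K a a = 0")
      case True
      then show ?thesis unfolding eq w_def using psd_onD[OF psdA] by simp
    next
      case False
      have "(\<Sum>i\<in>A. c i * w i) = ?S / sqrt (K a a)"
        using False by (simp add: w_def sum_divide_distrib)
      then have "(\<Sum>i\<in>A. c i * w i)\<^sup>2 = ?S\<^sup>2 / K a a"
        using Kaa by (simp add: power_divide)
      \<comment> \<open>The value \<open>t = - ?S / K a a\<close> minimizes the quadratic in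
        \<open>t\<close>, and the minimum is the form of the Schur complement.\<close>
      moreover have "0 \<le> - ?S\<^sup>2 / K a a + (\<Sum>i\<in>A. \<Sum>j\<in>A. c i * c j * K i j)"
        using full[of "- ?S / K a a" c] False by (simp add: power2_eq_square field_simps)
      ultimately show ?thesis unfolding eq by simp
    qed
  qed
  from insert.IH[OF this] obtain v where v: "\<forall>i\<in>A. \<forall>j\<in>A. K' i j = (\<Sum>b\<in>A. v b i * v b j)" by blast
  define v' where "v' b i = (if b = a then w i else if i = a then 0 else v b i)" for b i
  have wa: "w a * w j = K a j" if "j \<in> insert a A" for j
    using that zero Kaa by (auto simp: w_def)
  have "K i j = (\<Sum>b\<in>insert a A. v' b i * v' b j)" if ij: "i \<in> insert a A" "j \<in> insert a A" for i j
  proof -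
    have e: "(\<Sum>b\<in>insert a A. v' b i * v' b j) = w i * w j + (\<Sum>b\<in>A. v' b i * v' b j)"
      using insert.hyps by (simp add: v'_def)
    show ?thesis
    proof (cases "i = a \<or> j = a")
      case True
      have "(\<Sum>b\<in>A. v' b i * v' b j) = 0"
        using insert.hyps True by (intro sum.neutral) (auto simp: v'_def)
      then show ?thesis using e True wa[OF ij(1)] wa[OF ij(2)] sym[OF ij] by (auto simp: mult.commute)
    next
      case False
      have "(\<Sum>b\<in>A. v' b i * v' b j) = (\<Sum>b\<in>A. v b i * v b j)"
        using insert.hyps False by (intro sum.cong) (auto simp: v'_def)
      also have "\<dots> = K' i j" using v False ij by auto
      finally show ?thesis using e by (simp add: K'_def)
    qed
  qed
  then show ?case by blast
qed

text \<open>Writing \<open>K\<close> as a sum of rank one kernels \<open>v b i * v b j\<close> turns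
  the form of the entrywise product at \<open>c\<close> into a sum over \<open>b\<close> of forms of
  \<open>L\<close> at the vectors \<open>c i * v b i\<close>.\<close>

lemma psd_on_mult:
  assumes "finite A" "psd_on A K" "psd_on A L"
  shows "psd_on A (\<lambda>i j. K i j * L i j)"
  unfolding psd_on_def
proof (intro conjI allI ballI)
  fix i j assume "i \<in> A" "j \<in> A"
  then show "K i j * L i j = K j i * L j i" using assms unfolding psd_on_def by auto
next
  fix c
  obtain v where v: "\<forall>i\<in>A. \<forall>j\<in>A. K i j = (\<Sum>b\<in>A. v b i * v b j)"
    using psd_on_factor assms by blast
  have "(\<Sum>i\<in>A. \<Sum>j\<in>A. c i * c j * (K i j * L i j))
      = (\<Sum>i\<in>A. \<Sum>j\<in>A. \<Sum>b\<in>A. (c i * v b i) * (c j * v b j) * L i j)"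
    using v by (intro sum.cong refl) (simp add: sum_distrib_left sum_distrib_right algebra_simps)
  also have "\<dots> = (\<Sum>i\<in>A. \<Sum>b\<in>A. \<Sum>j\<in>A. (c i * v b i) * (c j * v b j) * L i j)"
    by (intro sum.cong refl sum.swap)
  also have "\<dots> = (\<Sum>b\<in>A. \<Sum>i\<in>A. \<Sum>j\<in>A. (c i * v b i) * (c j * v b j) * L i j)"
    by (rule sum.swap)
  also have "\<dots> \<ge> 0"
    by (intro sum_nonneg psd_onD[OF assms(3)])
  finally show "0 \<le> (\<Sum>i\<in>A. \<Sum>j\<in>A. c i * c j * (K i j * L i j))" .
qed

lemma psd_on_one: "psd_on A (\<lambda>i j. 1)"
  unfolding psd_on_def by (simp flip: sum_product)

lemma psd_on_zero: "psd_on A (\<lambda>i j. 0)"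
  unfolding psd_on_def by simp

text \<open>The induction splits the new difference as
  \<open>L * (prod L - prod K) + (L - K) * prod K\<close>, with \<open>prod\<close> over the old
  index set. This uses that the products of the \<open>K\<close> are positive semidefinite too,
  hence the conjunction.\<close>

lemma psd_on_prod_mono:
  assumes "finite A" "finite J" "\<And>j. j \<in> J \<Longrightarrow> psd_on A (K j)"
    and "\<And>j. j \<in> J \<Longrightarrow> psd_on A (\<lambda>a b. L j a b - K j a b)"
  shows "psd_on A (\<lambda>a b. \<Prod>j\<in>J. K j a b) \<and> psd_on A (\<lambda>a b. (\<Prod>j\<in>J. L j a b) - (\<Prod>j\<in>J. K j a b))"
  using assms(2-)
proof (induction J rule: finite_induct)
  case empty
  then show ?case by (simp add: psd_on_one psd_on_zero)
next
  case (insert j J)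
  then have IH: "psd_on A (\<lambda>a b. \<Prod>j\<in>J. K j a b)"
    "psd_on A (\<lambda>a b. (\<Prod>j\<in>J. L j a b) - (\<Prod>j\<in>J. K j a b))" by auto
  have Kj: "psd_on A (K j)" and LK: "psd_on A (\<lambda>a b. L j a b - K j a b)" using insert.prems by auto
  have Lj: "psd_on A (L j)" using psd_on_add[OF Kj LK] by simp
  have "psd_on A (\<lambda>a b. L j a b * ((\<Prod>j\<in>J. L j a b) - (\<Prod>j\<in>J. K j a b))
      + (L j a b - K j a b) * (\<Prod>j\<in>J. K j a b))"
    by (intro psd_on_add psd_on_mult assms(1) IH Lj LK)
  also have "(\<lambda>a b. L j a b * ((\<Prod>j\<in>J. L j a b) - (\<Prod>j\<in>J. K j a b))
      + (L j a b - K j a b) * (\<Prod>j\<in>J. K j a b))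
     = (\<lambda>a b. (\<Prod>j\<in>insert j J. L j a b) - (\<Prod>j\<in>insert j J. K j a b))"
    using insert.hyps by (simp add: fun_eq_iff algebra_simps)
  finally have 1: "psd_on A (\<lambda>a b. (\<Prod>j\<in>insert j J. L j a b) - (\<Prod>j\<in>insert j J. K j a b))" .
  have "psd_on A (\<lambda>a b. K j a b * (\<Prod>j\<in>J. K j a b))"
    by (intro psd_on_mult assms(1) IH Kj)
  also have "(\<lambda>a b. K j a b * (\<Prod>j\<in>J. K j a b)) = (\<lambda>a b. \<Prod>j\<in>insert j J. K j a b)"
    using insert.hyps by simp
  finally show ?case using 1 by simp
qed

section \<open>Semi-inner products\<close>

text \<open>The operations are arbitrary functions on a carrier and satisfy no vector space laws:
  for lists of elementary tensors addition is concatenation, which is not commutative. Only the form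
  sees the linear structure. Degenerate forms are allowed, so that functions can be used in place of
  classes modulo null sets.\<close>

locale semi_inner =
  fixes V :: "'v set" and add :: "'v \<Rightarrow> 'v \<Rightarrow> 'v" and smul :: "real \<Rightarrow> 'v \<Rightarrow> 'v"
    and ip :: "'v \<Rightarrow> 'v \<Rightarrow> real"
  assumes add_closed: "\<And>x y. x \<in> V \<Longrightarrow> y \<in> V \<Longrightarrow> add x y \<in> V"
    and smul_closed: "\<And>c x. x \<in> V \<Longrightarrow> smul c x \<in> V"
    and ip_commute: "\<And>x y. x \<in> V \<Longrightarrow> y \<in> V \<Longrightarrow> ip x y = ip y x"
    and ip_add: "\<And>x y z. x \<in> V \<Longrightarrow> y \<in> V \<Longrightarrow> z \<in> V \<Longrightarrow> ip (add x y) z = ip x z + ip y z"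
    and ip_smul: "\<And>c x y. x \<in> V \<Longrightarrow> y \<in> V \<Longrightarrow> ip (smul c x) y = c * ip x y"
    and ip_nonneg: "\<And>x. x \<in> V \<Longrightarrow> ip x x \<ge> 0"
begin

definition nrm :: "'v \<Rightarrow> real" where "nrm x = sqrt (ip x x)"

lemma nrm_nonneg: "x \<in> V \<Longrightarrow> nrm x \<ge> 0"
  by (simp add: nrm_def ip_nonneg)

lemma nrm_sq: "x \<in> V \<Longrightarrow> (nrm x)\<^sup>2 = ip x x"
  by (simp add: nrm_def ip_nonneg)

lemma ip_add_right: "x \<in> V \<Longrightarrow> y \<in> V \<Longrightarrow> z \<in> V \<Longrightarrow> ip z (add x y) = ip z x + ip z y"
  using ip_add ip_commute add_closed by metis

lemma ip_smul_right: "x \<in> V \<Longrightarrow> y \<in> V \<Longrightarrow> ip x (smul c y) = c * ip x y"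
  using ip_smul ip_commute smul_closed by metis

lemma ip_add_smul_self:
  assumes "x \<in> V" "y \<in> V"
  shows "ip (add x (smul c y)) (add x (smul c y)) = ip x x + 2 * c * ip x y + c\<^sup>2 * ip y y"
  using assms by (simp add: add_closed smul_closed ip_add ip_add_right ip_smul ip_smul_right
      ip_commute[of y x] power2_eq_square algebra_simps)

text \<open>The quadratic \<open>p\<close> in \<open>c\<close> is nonnegative, and its minimum gives
  the inequality if \<open>ip y y\<close> is positive. As the form may be degenerate,
  \<open>ip y y = 0\<close> is a separate case: the quadratic is then affine, so its slope must
  vanish.\<close>

lemma ip_sq_le:
  assumes "x \<in> V" "y \<in> V"
  shows "(ip x y)\<^sup>2 \<le> ip x x * ip y y"
proof -
  have p: "0 \<le> ip x x + 2 * c * ip x y + c\<^sup>2 * ip y y" for c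
    using ip_add_smul_self[OF assms] ip_nonneg add_closed smul_closed assms by metis
  show ?thesis
  proof (cases "ip y y = 0")
    case False
    then have pos: "ip y y > 0" using ip_nonneg[of y] assms by linarith
    have "0 \<le> ip x x - (ip x y)\<^sup>2 / ip y y"
      using p[of "- ip x y / ip y y"] False by (simp add: power2_eq_square field_simps)
    then show ?thesis using pos by (simp add: field_simps)
  next
    case True
    have "ip x y = 0"
    proof (rule ccontr)
      assume ne: "ip x y \<noteq> 0"
      show False using p[of "- (ip x x + 1) / (2 * ip x y)"] True ne by (simp add: field_simps)
    qed
    then show ?thesis using True by simp
  qed
qed

lemma abs_ip_le:
  assumes "x \<in> V" "y \<in> V"
  shows "\<bar>ip x y\<bar> \<le> nrm x * nrm y"
  using real_sqrt_le_mono[OF ip_sq_le[OF assms]] by (simp add: nrm_def real_sqrt_mult)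

lemma nrm_smul: "x \<in> V \<Longrightarrow> nrm (smul c x) = \<bar>c\<bar> * nrm x"
  by (simp add: nrm_def ip_smul ip_smul_right smul_closed real_sqrt_mult flip: mult.assoc power2_eq_square)

lemma nrm_add_le:
  assumes "x \<in> V" "y \<in> V"
  shows "nrm (add x y) \<le> nrm x + nrm y"
proof (rule power2_le_imp_le)
  have "(nrm (add x y))\<^sup>2 = ip x x + 2 * ip x y + ip y y"
    using assms by (simp add: nrm_sq add_closed ip_add ip_add_right ip_commute[of y x])
  also have "\<dots> \<le> (nrm x)\<^sup>2 + 2 * (nrm x * nrm y) + (nrm y)\<^sup>2"
    using abs_ip_le[OF assms] assms by (simp add: nrm_sq)
  also have "\<dots> = (nrm x + nrm y)\<^sup>2" by (simp add: power2_eq_square algebra_simps)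
  finally show "(nrm (add x y))\<^sup>2 \<le> (nrm x + nrm y)\<^sup>2" .
qed (use assms in \<open>simp add: nrm_nonneg\<close>)

abbreviation sub :: "'v \<Rightarrow> 'v \<Rightarrow> 'v" where "sub x y \<equiv> add x (smul (-1) y)"

lemma sub_closed: "x \<in> V \<Longrightarrow> y \<in> V \<Longrightarrow> sub x y \<in> V"
  by (simp add: add_closed smul_closed)

lemma nrm_sub_le: "x \<in> V \<Longrightarrow> y \<in> V \<Longrightarrow> nrm (sub x y) \<le> nrm x + nrm y"
  using nrm_add_le[of x "smul (-1) y"] by (simp add: smul_closed nrm_smul)

lemma ip_sub_self:
  "x \<in> V \<Longrightarrow> y \<in> V \<Longrightarrow> ip (sub x y) (sub x y) = ip x x - 2 * ip x y + ip y y"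
  by (simp add: ip_add_smul_self)

lemma ip_sub_left: "x \<in> V \<Longrightarrow> y \<in> V \<Longrightarrow> z \<in> V \<Longrightarrow> ip (sub x y) z = ip x z - ip y z"
  by (simp add: ip_add ip_smul smul_closed)

lemma ip_sub_right: "x \<in> V \<Longrightarrow> y \<in> V \<Longrightarrow> z \<in> V \<Longrightarrow> ip z (sub x y) = ip z x - ip z y"
  by (simp add: ip_add_right ip_smul_right smul_closed)

lemma nrm_sub_commute: "x \<in> V \<Longrightarrow> y \<in> V \<Longrightarrow> nrm (sub x y) = nrm (sub y x)"
  by (simp add: nrm_def ip_sub_self ip_commute)

text \<open>\<open>sub x z\<close> and \<open>add (sub x y) (sub y z)\<close> may be different
  elements, for example different lists, so they are compared through their inner products with
  themselves.\<close>

lemma nrm_sub_triangle: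
  assumes "x \<in> V" "y \<in> V" "z \<in> V"
  shows "nrm (sub x z) \<le> nrm (sub x y) + nrm (sub y z)"
proof -
  have "ip (sub x z) (sub x z) = ip (add (sub x y) (sub y z)) (add (sub x y) (sub y z))"
    using assms by (simp add: add_closed smul_closed ip_add ip_add_right ip_smul ip_smul_right
      ip_commute algebra_simps)
  then have "nrm (sub x z) = nrm (add (sub x y) (sub y z))" by (simp add: nrm_def)
  then show ?thesis using nrm_add_le[of "sub x y" "sub y z"] assms by (simp add: sub_closed)
qed

lemma abs_nrm_diff_le:
  assumes "x \<in> V" "y \<in> V"
  shows "\<bar>nrm x - nrm y\<bar> \<le> nrm (sub x y)"
proof -
  have *: "nrm x \<le> nrm (sub x y) + nrm y" if "x \<in> V" "y \<in> V" for x y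
  proof -
    have "ip (add (sub x y) y) (add (sub x y) y) = ip x x"
      using that by (simp add: add_closed smul_closed ip_add ip_add_right ip_smul ip_smul_right
          ip_commute algebra_simps)
    then have "nrm x = nrm (add (sub x y) y)" by (simp add: nrm_def)
    then show ?thesis using nrm_add_le[of "sub x y" y] that by (simp add: sub_closed)
  qed
  show ?thesis using *[of x y] *[of y x] assms nrm_sub_commute[of x y] by auto
qed

end

section \<open>Square integrable functions\<close>

definition sq_int :: "'a measure \<Rightarrow> ('a \<Rightarrow> real) set" where
  "sq_int M = {f \<in> borel_measurable M. integrable M (\<lambda>x. (f x)\<^sup>2)}"

lemma sq_int_measurable: "f \<in> sq_int M \<Longrightarrow> f \<in> borel_measurable M"
  and sq_int_integrable_sq: "f \<in> sq_int M \<Longrightarrow> integrable M (\<lambda>x. (f x)\<^sup>2)"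
  by (auto simp: sq_int_def)

lemma sq_int_mult:
  assumes "f \<in> sq_int M" "g \<in> sq_int M"
  shows "integrable M (\<lambda>x. f x * g x)"
proof (rule Bochner_Integration.integrable_bound)
  show "integrable M (\<lambda>x. (f x)\<^sup>2 + (g x)\<^sup>2)"
    using assms by (simp add: sq_int_def)
  show "(\<lambda>x. f x * g x) \<in> borel_measurable M"
    using assms by (auto simp: sq_int_def)
  have "\<bar>a * b\<bar> \<le> a\<^sup>2 + b\<^sup>2" for a b :: real
  proof -
    have "0 \<le> (\<bar>a\<bar> - \<bar>b\<bar>)\<^sup>2" by simp
    then have "2 * \<bar>a * b\<bar> \<le> a\<^sup>2 + b\<^sup>2" by (simp add: power2_diff abs_mult)
    then show ?thesis by linarith
  qed
  then show "AE x in M. norm (f x * g x) \<le> norm ((f x)\<^sup>2 + (g x)\<^sup>2)" by simp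
qed

lemma sq_int_scale: "f \<in> sq_int M \<Longrightarrow> (\<lambda>x. c * f x) \<in> sq_int M"
  by (auto simp: sq_int_def power_mult_distrib)

lemma sq_int_add:
  assumes "f \<in> sq_int M" "g \<in> sq_int M"
  shows "(\<lambda>x. f x + g x) \<in> sq_int M"
  using assms sq_int_mult[OF assms] by (auto simp: sq_int_def power2_sum mult.assoc)

interpretation L2: semi_inner "sq_int M" "\<lambda>f g x. f x + g x" "\<lambda>c f x. c * f x"
  "\<lambda>f g. \<integral>x. f x * g x \<partial>M" for M
proof
  fix f g h :: "'a \<Rightarrow> real" and c
  assume f: "f \<in> sq_int M" and g: "g \<in> sq_int M"
  show "(\<lambda>x. f x + g x) \<in> sq_int M" using f g by (rule sq_int_add)
  show "(\<integral>x. f x * g x \<partial>M) = (\<integral>x. g x * f x \<partial>M)" by (simp add: mult.commute)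
  show "(\<integral>x. c * f x * g x \<partial>M) = c * (\<integral>x. f x * g x \<partial>M)" by (simp add: mult.assoc)
  assume h: "h \<in> sq_int M"
  show "(\<integral>x. (f x + g x) * h x \<partial>M) = (\<integral>x. f x * h x \<partial>M) + (\<integral>x. g x * h x \<partial>M)"
    using sq_int_mult[OF f h] sq_int_mult[OF g h] by (simp add: distrib_right)
qed (auto simp: sq_int_scale)

lemma L2_nrm: "L2.nrm M f = sqrt (\<integral>x. (f x)\<^sup>2 \<partial>M)"
  by (simp add: L2.nrm_def power2_eq_square)

lemma (in finite_measure) sq_int_bounded:
  assumes "f \<in> borel_measurable M" "\<And>x. x \<in> space M \<Longrightarrow> \<bar>f x\<bar> \<le> B"
  shows "f \<in> sq_int M"
  unfolding sq_int_def
proof (intro CollectI conjI assms(1))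
  have "norm ((f x)\<^sup>2) \<le> B\<^sup>2" if "x \<in> space M" for x
    using power_mono[OF assms(2)[OF that], of 2] by simp
  then show "integrable M (\<lambda>x. (f x)\<^sup>2)"
    using assms(1) by (intro integrable_const_bound[of _ "B\<^sup>2"] AE_I2) auto
qed

lemma (in finite_measure) sq_int_integrable:
  assumes "f \<in> sq_int M"
  shows "integrable M f"
  using sq_int_mult[OF assms sq_int_bounded[of "\<lambda>_. 1" 1]] by simp

section \<open>Functions on the unit interval\<close>

abbreviation U01 :: "real measure" where
  "U01 \<equiv> restrict_space lborel {0..1}"

lemma space_U01: "space U01 = {0..1}"
  by (simp add: space_restrict_space)

interpretation U01: prob_space U01
  by standard (simp add: space_restrict_space emeasure_restrict_space)

lemma sets_U01_iff: "A \<in> sets U01 \<longleftrightarrow> A \<in> sets borel \<and> A \<subseteq> {0..1}"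
  by (auto simp: sets_restrict_space_iff)

lemma set_integral_U01:
  fixes g :: "real \<Rightarrow> real"
  assumes "A \<subseteq> {0..1}"
  shows "(LBINT t:A. g t) = (LINT t:A|U01. g t)"
proof -
  have "(LINT t:A|U01. g t) = (LBINT t. indicat_real {0..1} t * (indicat_real A t * g t))"
    unfolding set_lebesgue_integral_def by (subst integral_restrict_space) auto
  also have "\<dots> = (LBINT t. indicat_real A t * g t)"
    using assms by (intro Bochner_Integration.integral_cong) (auto simp: indicator_def)
  finally show ?thesis by (simp add: set_lebesgue_integral_def)
qed

lemma measure_U01_Icc: "0 \<le> a \<Longrightarrow> a \<le> b \<Longrightarrow> b \<le> 1 \<Longrightarrow> measure U01 {a..b} = b - a"
  by (simp add: measure_restrict_space)

lemma measure_U01_Ioc: "0 \<le> a \<Longrightarrow> a \<le> b \<Longrightarrow> b \<le> 1 \<Longrightarrow> measure U01 {a<..b} = b - a"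
  by (subst measure_restrict_space) auto

lemma set_borel_measurable_U01:
  fixes f :: "real \<Rightarrow> real"
  shows "set_borel_measurable lborel {0..1} f \<longleftrightarrow> f \<in> borel_measurable U01"
  unfolding set_borel_measurable_def by (subst borel_measurable_restrict_space_iff) auto

lemma set_integrable_U01:
  fixes f :: "real \<Rightarrow> real"
  shows "set_integrable lborel {0..1} f \<longleftrightarrow> integrable U01 f"
  unfolding set_integrable_def by (subst integrable_restrict_space) auto

lemma integral_U01:
  fixes f :: "real \<Rightarrow> real"
  shows "(LBINT t:{0..1}. f t) = (\<integral>t. f t \<partial>U01)"
  unfolding set_lebesgue_integral_def by (subst integral_restrict_space) auto

lemma set_integrable_U01_subset:
  fixes f :: "real \<Rightarrow> real"
  shows "integrable U01 f \<Longrightarrow> A \<in> sets U01 \<Longrightarrow> set_integrable U01 A f"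
  unfolding set_integrable_def by (rule integrable_mult_indicator)

text \<open>The half lines \<open>{..a}\<close> are stable under intersection and generate the Borel
  sets; they meet the unit interval in the empty set, in some \<open>{0..a}\<close> or in all of it.
  The rule serves to recover a function from its primitive and to approximate integrals over
  measurable sets.\<close>

lemma unit_interval_Dynkin:
  fixes P :: "real set \<Rightarrow> bool"
  assumes empty: "P {}"
    and init: "\<And>x. x \<in> {0..1} \<Longrightarrow> P {0..x}"
    and compl: "\<And>A. A \<in> sets U01 \<Longrightarrow> P A \<Longrightarrow> P ({0..1} - A)"
    and union: "\<And>A :: nat \<Rightarrow> real set. (\<And>i. A i \<in> sets U01) \<Longrightarrow> disjoint_family A \<Longrightarrow>
        (\<And>i. P (A i)) \<Longrightarrow> P (\<Union>i. A i)"
    and A: "A \<in> sets U01"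
  shows "P A"
proof -
  let ?G = "range (\<lambda>a::real. {..a})"
  have "Int_stable ?G" by (auto simp: Int_stable_def)
  have "P (B \<inter> {0..1})" if "B \<in> sigma_sets UNIV ?G" for B
    using \<open>Int_stable ?G\<close> _ that
  proof (rule sigma_sets_induct_disjoint)
    fix C assume "C \<in> ?G"
    then obtain a where C: "C = {..a}" by auto
    consider "a < 0" | "a \<in> {0..1}" | "a > 1" by fastforce
    then show "P (C \<inter> {0..1})"
    proof cases
      case 1
      then have "C \<inter> {0..1} = {}" by (auto simp: C)
      then show ?thesis using empty by simp
    next
      case 2
      then have "C \<inter> {0..1} = {0..a}" by (auto simp: C)
      then show ?thesis using init 2 by simp
    next
      case 3
      then have "C \<inter> {0..1} = {0..1}" by (auto simp: C)
      then show ?thesis using init[of 1] by simp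
    qed
  next
    show "P ({} \<inter> {0..1})" using empty by simp
  next
    fix B assume B: "B \<in> sigma_sets UNIV ?G" "P (B \<inter> {0..1})"
    then have "B \<in> sets borel" by (subst borel_eq_atMost) simp
    then have "B \<inter> {0..1} \<in> sets U01" by (simp add: sets_U01_iff)
    from compl[OF this B(2)] show "P ((UNIV - B) \<inter> {0..1})"
      by (simp add: Diff_Int_distrib2 Int_commute Diff_Int)
  next
    fix B :: "nat \<Rightarrow> real set"
    assume B: "disjoint_family B" "range B \<subseteq> sigma_sets UNIV ?G" "\<And>i. P (B i \<inter> {0..1})"
    then have "B i \<in> sets borel" for i by (subst borel_eq_atMost) (simp add: image_subset_iff)
    then have "B i \<inter> {0..1} \<in> sets U01" for i by (simp add: sets_U01_iff)
    moreover have "disjoint_family (\<lambda>i. B i \<inter> {0..1})"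
      using B(1) by (auto simp: disjoint_family_on_def)
    ultimately have "P (\<Union>i. B i \<inter> {0..1})" using B(3) by (intro union) auto
    then show "P (\<Union> (range B) \<inter> {0..1})" by (simp add: Int_UN_distrib2)
  qed auto
  moreover have "A \<in> sigma_sets UNIV ?G"
    using A unfolding sets_U01_iff borel_eq_atMost by simp
  ultimately show "P A" using A sets_U01_iff by (metis inf.absorb1)
qed

text \<open>The sets over which \<open>h\<close> has integral zero obey the closure rules of the
  Dynkin induction. Hence \<open>h\<close> and zero have equal integrals over every measurable set
  and agree almost everywhere.\<close>

lemma AE_zero_if_primitive_zero:
  fixes h :: "real \<Rightarrow> real"
  assumes h: "integrable U01 h" and zero: "\<And>x. x \<in> {0..1} \<Longrightarrow> (LINT t:{0..x}|U01. h t) = 0"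
  shows "AE x in U01. h x = 0"
proof -
  have "(LINT t:A|U01. h t) = 0" if "A \<in> sets U01" for A
    using _ _ _ _ that
  proof (rule unit_interval_Dynkin)
    fix A assume A: "A \<in> sets U01" "(LINT t:A|U01. h t) = 0"
    have "(LINT t:A \<union> ({0..1} - A)|U01. h t) = (LINT t:A|U01. h t) + (LINT t:{0..1} - A|U01. h t)"
      by (rule set_integral_Un) (use A h in \<open>auto simp: sets_U01_iff intro!: set_integrable_U01_subset\<close>)
    moreover have "A \<union> ({0..1} - A) = {0..1}" using A by (auto simp: sets_U01_iff)
    ultimately show "(LINT t:{0..1} - A|U01. h t) = 0" using A zero[of 1] by simp
  next
    fix A :: "nat \<Rightarrow> real set"
    assume A: "\<And>i. A i \<in> sets U01" "disjoint_family A" "\<And>i. (LINT t:A i|U01. h t) = 0"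
    have "(LINT t:(\<Union>i. A i)|U01. h t) = (\<Sum>i. LINT t:A i|U01. h t)"
      using A h by (intro lebesgue_integral_countable_add)
        (auto simp: disjoint_family_on_def intro!: set_integrable_U01_subset)
    then show "(LINT t:(\<Union>i. A i)|U01. h t) = 0" using A(3) by simp
  qed (use zero in \<open>auto simp: set_lebesgue_integral_def\<close>)
  then show ?thesis
    using h by (intro density_unique_real[of U01 h "\<lambda>_. 0"]) (auto simp: set_lebesgue_integral_def)
qed

section \<open>The space $H^m([0,1])$\<close>

lemma sobolev_derivs_iff:
  "sobolev_derivs m f D \<longleftrightarrow> (\<forall>x\<in>{0..1}. D 0 x = f x) \<and>
     (\<forall>r<m. integrable U01 (D (Suc r)) \<and>
        (\<forall>x\<in>{0..1}. D r x = D r 0 + (LINT t:{0..x}|U01. D (Suc r) t))) \<and> D m \<in> sq_int U01"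
proof -
  have "(LBINT t:{0..x}. D (Suc r) t) = (LINT t:{0..x}|U01. D (Suc r) t)" if "x \<in> {0..1}" for x r
    using that by (intro set_integral_U01) auto
  then show ?thesis
    unfolding sobolev_derivs_def sq_int_def set_borel_measurable_U01 set_integrable_U01 by auto
qed

lemma sobolev_derivs_0: "sobolev_derivs m f D \<Longrightarrow> x \<in> {0..1} \<Longrightarrow> D 0 x = f x"
  and sobolev_derivs_integrable: "sobolev_derivs m f D \<Longrightarrow> r < m \<Longrightarrow> integrable U01 (D (Suc r))"
  and sobolev_derivs_primitive: "sobolev_derivs m f D \<Longrightarrow> r < m \<Longrightarrow> x \<in> {0..1} \<Longrightarrow>
    D r x = D r 0 + (LINT t:{0..x}|U01. D (Suc r) t)"
  and sobolev_derivs_sq_int: "sobolev_derivs m f D \<Longrightarrow> D m \<in> sq_int U01"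
  unfolding sobolev_derivs_iff by blast+

lemma sobolev_derivs_linear:
  assumes "sobolev_derivs m f D" "sobolev_derivs m g E"
  shows "sobolev_derivs m (\<lambda>x. a * f x + b * g x) (\<lambda>r x. a * D r x + b * E r x)"
  unfolding sobolev_derivs_iff
proof (intro conjI allI impI ballI)
  fix r x assume r: "r < m"
  have i: "integrable U01 (D (Suc r))" "integrable U01 (E (Suc r))"
    using assms r by (blast intro: sobolev_derivs_integrable)+
  then show "integrable U01 (\<lambda>x. a * D (Suc r) x + b * E (Suc r) x)" by auto
  assume x: "x \<in> {0..1::real}"
  have s: "set_integrable U01 {0..x} (D (Suc r))" "set_integrable U01 {0..x} (E (Suc r))"
    using i x by (auto intro!: set_integrable_U01_subset simp: sets_U01_iff)
  have d: "D r x = D r 0 + (LINT t:{0..x}|U01. D (Suc r) t)"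
    "E r x = E r 0 + (LINT t:{0..x}|U01. E (Suc r) t)"
    using assms r x by (blast intro: sobolev_derivs_primitive)+
  show "a * D r x + b * E r x = a * D r 0 + b * E r 0 +
      (LINT t:{0..x}|U01. a * D (Suc r) t + b * E (Suc r) t)"
    unfolding d using s by (simp add: set_integral_add algebra_simps)
qed (use assms assms[THEN sobolev_derivs_sq_int] in \<open>auto simp: sobolev_derivs_0 intro!: sq_int_add sq_int_scale\<close>)

lemma sobolev_derivs_continuous:
  assumes "sobolev_derivs m f D" "r < m"
  shows "continuous_on {0..1} (D r)"
proof -
  have i: "set_integrable lborel {0..1} (D (Suc r))"
    and eq: "\<And>x. x \<in> {0..1} \<Longrightarrow> D r x = D r 0 + (LBINT t:{0..x}. D (Suc r) t)"
    using assms unfolding sobolev_derivs_def by blast+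
  have ii: "D (Suc r) integrable_on {0..1}"
    using set_borel_integral_eq_integral(1)[OF i] .
  have "D r x = D r 0 + integral {0..x} (D (Suc r))" if "x \<in> {0..1}" for x
  proof -
    have "set_integrable lborel {0..x} (D (Suc r))"
      by (rule set_integrable_subset[OF i]) (use that in auto)
    then show ?thesis using eq[OF that] set_borel_integral_eq_integral(2) by metis
  qed
  moreover have "continuous_on {0..1} (\<lambda>x. D r 0 + integral {0..x} (D (Suc r)))"
    by (intro continuous_intros indefinite_integral_continuous_1 ii)
  ultimately show ?thesis
    using continuous_on_cong[of "{0..1}" "{0..1}" "D r" "\<lambda>x. D r 0 + integral {0..x} (D (Suc r))"] by blast
qed

lemma continuous_on_U01_measurable:
  "continuous_on {0..1} f \<Longrightarrow> f \<in> borel_measurable U01"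
  by (subst measurable_cong_sets[of U01 "restrict_space borel {0..1}" borel borel])
    (auto simp: sets_restrict_space intro: borel_measurable_continuous_on_restrict)

text \<open>If \<open>D r\<close> vanishes, so do the integrals of \<open>D (Suc r)\<close> over all
  \<open>{0..x}\<close>, and \<open>D (Suc r)\<close> is zero almost everywhere; below order
  \<open>m\<close> it is continuous and therefore zero everywhere. Applied to differences, this
  makes the derivatives, and with them \<open>sobolev_inner\<close>, independent of choices.\<close>

lemma sobolev_derivs_zero:
  assumes "sobolev_derivs m f D" "\<And>x. x \<in> {0..1} \<Longrightarrow> f x = 0"
  shows "(\<forall>r<m. \<forall>x\<in>{0..1}. D r x = 0) \<and> (AE x in U01. D m x = 0)"
proof -
  have D0: "D 0 x = 0" if "x \<in> {0..1}" for x using sobolev_derivs_0[OF assms(1) that] assms(2)[OF that] by simp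
  have step: "AE x in U01. D (Suc r) x = 0" if "r < m" "\<And>x. x \<in> {0..1} \<Longrightarrow> D r x = 0" for r
  proof (rule AE_zero_if_primitive_zero)
    show "integrable U01 (D (Suc r))" using sobolev_derivs_integrable[OF assms(1) that(1)] .
    fix x :: real assume "x \<in> {0..1}"
    then show "(LINT t:{0..x}|U01. D (Suc r) t) = 0"
      using sobolev_derivs_primitive[OF assms(1) that(1), of x] that(2)[of x] that(2)[of 0] by simp
  qed
  have all: "\<forall>x\<in>{0..1}. D r x = 0" if "r < m" for r
    using that
  proof (induction r)
    case 0
    then show ?case using D0 by blast
  next
    case (Suc r)
    then have "AE x in U01. D (Suc r) x = 0" using step[of r] by auto
    then have ae: "AE x in lborel. x \<in> {0..1} \<longrightarrow> D (Suc r) x = 0"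
      by (subst (asm) AE_restrict_space_iff) auto
    have cont: "continuous_on {0..1} (D (Suc r))" using sobolev_derivs_continuous assms(1) Suc.prems by blast
    show ?case
    proof (rule ballI, rule ccontr)
      fix x :: real assume x: "x \<in> {0..1}" and ne: "D (Suc r) x \<noteq> 0"
      obtain e where e: "e > 0" "\<And>y. y \<in> {0..1} \<Longrightarrow> dist y x < e \<Longrightarrow> dist (D (Suc r) y) (D (Suc r) x) < \<bar>D (Suc r) x\<bar>"
        using cont x ne unfolding continuous_on_iff by (metis zero_less_abs_iff)
      \<comment> \<open>A neighbourhood of \<open>x\<close>, clipped to the unit interval, on which
        \<open>D (Suc r)\<close> has no zero. It has positive length even if \<open>x\<close> is an
        endpoint.\<close>
      define a b where "a = max 0 (x - e/2)" and "b = min 1 (x + e/2)"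
      have ab: "a < b" using x e by (auto simp: a_def b_def)
      have "D (Suc r) y \<noteq> 0" if "y \<in> {a..b}" for y
      proof -
        have "y \<in> {0..1}" "dist y x < e" using that e(1) by (auto simp: a_def b_def dist_real_def)
        then show ?thesis using e(2)[of y] by (auto simp: dist_real_def)
      qed
      moreover have "{a..b} \<subseteq> {0..1}" by (auto simp: a_def b_def)
      ultimately have nz: "x \<notin> {a..b}" if "x \<in> {0..1} \<longrightarrow> D (Suc r) x = 0" for x using that by blast
      have "AE x in lborel. x \<notin> {a..b}" by (rule AE_mp[OF ae AE_I2]) (use nz in blast)
      then have "{a..b} \<in> null_sets lborel" by (subst AE_iff_null_sets) auto
      then show False using ab by (simp add: null_sets_def)
    qed
  qed
  have "AE x in U01. D m x = 0"
  proof (cases m)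
    case 0
    then show ?thesis using D0 by (auto intro!: AE_I2 simp: space_U01)
  next
    case (Suc r)
    then show ?thesis using step[of r] all[of r] by auto
  qed
  then show ?thesis using all by blast
qed

lemma sobolev_derivs_unique:
  assumes "sobolev_derivs m f D" "sobolev_derivs m f E"
  shows "r < m \<Longrightarrow> x \<in> {0..1} \<Longrightarrow> D r x = E r x" and "AE x in U01. D m x = E m x"
  using sobolev_derivs_zero[OF sobolev_derivs_linear[OF assms, of 1 "-1"]] by auto

definition sobolev_form :: "nat \<Rightarrow> (nat \<Rightarrow> real \<Rightarrow> real) \<Rightarrow> (nat \<Rightarrow> real \<Rightarrow> real) \<Rightarrow> real" where
  "sobolev_form m D E = (\<Sum>r<m. D r 0 * E r 0) + (\<integral>t. D m t * E m t \<partial>U01)"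

text \<open>Any two families of derivatives agree below order \<open>m\<close> and almost everywhere
  at order \<open>m\<close>, so the description operator has exactly one candidate.\<close>

lemma sobolev_inner_eq:
  assumes "sobolev_derivs m f D" "sobolev_derivs m g E"
  shows "sobolev_inner m f g = sobolev_form m D E"
proof -
  have "sobolev_form m D' E' = sobolev_form m D E"
    if *: "sobolev_derivs m f D'" "sobolev_derivs m g E'" for D' E'
  proof -
    have "(\<Sum>r<m. D' r 0 * E' r 0) = (\<Sum>r<m. D r 0 * E r 0)"
      using sobolev_derivs_unique(1)[OF *(1) assms(1)] sobolev_derivs_unique(1)[OF *(2) assms(2)]
      by (intro sum.cong) auto
    moreover have "(\<integral>t. D' m t * E' m t \<partial>U01) = (\<integral>t. D m t * E m t \<partial>U01)"
    proof (rule integral_cong_AE)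
      show "AE x in U01. D' m x * E' m x = D m x * E m x"
        using sobolev_derivs_unique(2)[OF *(1) assms(1)] sobolev_derivs_unique(2)[OF *(2) assms(2)]
        by eventually_elim simp
    qed (use *[THEN sobolev_derivs_sq_int] assms[THEN sobolev_derivs_sq_int] in \<open>auto simp: sq_int_def\<close>)
    ultimately show ?thesis by (simp add: sobolev_form_def)
  qed
  then show ?thesis
    unfolding sobolev_inner_def integral_U01 sobolev_form_def[symmetric]
    using assms by (intro the_equality) blast+
qed

text \<open>An arbitrary choice; at order \<open>m\<close> it fixes one representative among
  functions that agree almost everywhere.\<close>

definition weak_deriv :: "nat \<Rightarrow> (real \<Rightarrow> real) \<Rightarrow> nat \<Rightarrow> real \<Rightarrow> real" where
  "weak_deriv m f = (SOME D. sobolev_derivs m f D)"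

lemma weak_deriv: "f \<in> sobolev m \<Longrightarrow> sobolev_derivs m f (weak_deriv m f)"
  unfolding sobolev_def weak_deriv_def by (simp add: someI_ex)

lemma sobolev_linear:
  "f \<in> sobolev m \<Longrightarrow> g \<in> sobolev m \<Longrightarrow> (\<lambda>x. a * f x + b * g x) \<in> sobolev m"
  using sobolev_derivs_linear unfolding sobolev_def by blast

lemma sobolev_add: "f \<in> sobolev m \<Longrightarrow> g \<in> sobolev m \<Longrightarrow> (\<lambda>x. f x + g x) \<in> sobolev m"
  using sobolev_linear[of f m g 1 1] by simp

lemma sobolev_scale: "f \<in> sobolev m \<Longrightarrow> (\<lambda>x. a * f x) \<in> sobolev m"
  using sobolev_linear[of f m f a 0] by simp

lemma sobolev_zero: "(\<lambda>x. 0) \<in> sobolev m"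
proof -
  have "sobolev_derivs m (\<lambda>x. 0) (\<lambda>r x. 0)"
    by (simp add: sobolev_derivs_iff sq_int_def set_lebesgue_integral_def)
  then show ?thesis unfolding sobolev_def by blast
qed

lemma sobolev_sum: "finite I \<Longrightarrow> (\<And>i. i \<in> I \<Longrightarrow> f i \<in> sobolev m) \<Longrightarrow> (\<lambda>x. \<Sum>i\<in>I. c i * f i x) \<in> sobolev m"
  by (induction I rule: finite_induct) (simp_all add: sobolev_zero sobolev_add sobolev_scale)

lemma sobolev_form_linear:
  assumes "D m \<in> sq_int U01" "E m \<in> sq_int U01" "G m \<in> sq_int U01"
  shows "sobolev_form m (\<lambda>r x. a * D r x + b * E r x) G = a * sobolev_form m D G + b * sobolev_form m E G"
  using sq_int_mult[OF assms(1,3)] sq_int_mult[OF assms(2,3)]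
  by (simp add: sobolev_form_def distrib_right sum.distrib sum_distrib_left algebra_simps)

interpretation sob: semi_inner "sobolev m" "\<lambda>f g x. f x + g x" "\<lambda>c f x. c * f x" "sobolev_inner m" for m
proof
  fix f g h :: "real \<Rightarrow> real" and c
  assume f: "f \<in> sobolev m"
  note f' = weak_deriv[OF f]
  show "(\<lambda>x. c * f x) \<in> sobolev m" using f by (rule sobolev_scale)
  show "0 \<le> sobolev_inner m f f"
    unfolding sobolev_inner_eq[OF f' f'] sobolev_form_def by (intro add_nonneg_nonneg sum_nonneg) auto
  assume g: "g \<in> sobolev m"
  note g' = weak_deriv[OF g]
  show "(\<lambda>x. f x + g x) \<in> sobolev m" using f g by (rule sobolev_add)
  show "sobolev_inner m f g = sobolev_inner m g f"
    unfolding sobolev_inner_eq[OF f' g'] sobolev_inner_eq[OF g' f'] sobolev_form_def by (simp add: mult.commute)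
  have sq: "weak_deriv m f m \<in> sq_int U01" "weak_deriv m g m \<in> sq_int U01"
    using f' g' by (auto intro: sobolev_derivs_sq_int)
  show "sobolev_inner m (\<lambda>x. c * f x) g = c * sobolev_inner m f g"
    using sobolev_inner_eq[OF sobolev_derivs_linear[OF f' g', of c 0] g'] sobolev_inner_eq[OF f' g']
      sobolev_form_linear[of "weak_deriv m f" m "weak_deriv m g" "weak_deriv m g" c 0] sq  by simp
  assume h: "h \<in> sobolev m"
  note h' = weak_deriv[OF h]
  have "weak_deriv m h m \<in> sq_int U01" using h' by (rule sobolev_derivs_sq_int)
  then show "sobolev_inner m (\<lambda>x. f x + g x) h = sobolev_inner m f h + sobolev_inner m g h"
    using sobolev_inner_eq[OF sobolev_derivs_linear[OF f' g', of 1 1] h'] sobolev_inner_eq[OF f' h']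
      sobolev_inner_eq[OF g' h'] sobolev_form_linear[of "weak_deriv m f" m "weak_deriv m g" "weak_deriv m h" 1 1] sq by simp
qed

lemma sob_nrm_eq:
  assumes "sobolev_derivs m f D"
  shows "(sob.nrm m f)\<^sup>2 = (\<Sum>r<m. (D r 0)\<^sup>2) + (\<integral>t. (D m t)\<^sup>2 \<partial>U01)"
proof -
  have f: "f \<in> sobolev m" using assms by (auto simp: sobolev_def)
  show ?thesis
    unfolding sob.nrm_sq[OF f] sobolev_inner_eq[OF assms assms] sobolev_form_def
    by (simp add: power2_eq_square)
qed

lemma sob_nrm_bounds:
  assumes "sobolev_derivs m f D"
  shows "r < m \<Longrightarrow> \<bar>D r 0\<bar> \<le> sob.nrm m f" and "L2.nrm U01 (D m) \<le> sob.nrm m f"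
proof -
  have f: "f \<in> sobolev m" using assms by (auto simp: sobolev_def)
  have nn: "0 \<le> (\<integral>t. (D m t)\<^sup>2 \<partial>U01)" "0 \<le> (\<Sum>r<m. (D r 0)\<^sup>2)"
    by (auto intro: sum_nonneg)
  show "\<bar>D r 0\<bar> \<le> sob.nrm m f" if "r < m"
  proof (rule abs_le_square_iff[THEN iffD2, THEN order_trans])
    have "(D r 0)\<^sup>2 \<le> (\<Sum>r<m. (D r 0)\<^sup>2)" using that by (intro member_le_sum) auto
    then show "(D r 0)\<^sup>2 \<le> (sob.nrm m f)\<^sup>2" using nn unfolding sob_nrm_eq[OF assms] by linarith
  qed (simp add: sob.nrm_nonneg[OF f])
  show "L2.nrm U01 (D m) \<le> sob.nrm m f"
    by (rule power2_le_imp_le) (use nn sob.nrm_nonneg[OF f] in \<open>simp_all add: L2_nrm sob_nrm_eq[OF assms]\<close>)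
qed

text \<open>Cauchy-Schwarz against the indicator of \<open>A\<close>. The factor
  \<open>sqrt (measure U01 A)\<close> yields Hoelder continuity of the lower derivatives and makes
  integrals over small sets small in operator norm.\<close>

lemma abs_set_integral_U01_le:
  assumes "g \<in> sq_int U01" "A \<in> sets U01"
  shows "\<bar>LINT t:A|U01. g t\<bar> \<le> sqrt (measure U01 A) * L2.nrm U01 g"
proof -
  have "(\<lambda>t. indicat_real A t) \<in> sq_int U01"
    using assms(2) by (intro U01.sq_int_bounded[of _ 1]) (auto simp: indicator_def)
  from L2.abs_ip_le[OF this assms(1)]
  have "\<bar>LINT t:A|U01. g t\<bar> \<le> L2.nrm U01 (indicat_real A) * L2.nrm U01 g"
    by (simp add: set_lebesgue_integral_def)
  also have "L2.nrm U01 (indicat_real A) = sqrt (measure U01 A)"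
  proof -
    have "A \<inter> {0..1} = A" using assms(2) by (auto simp: sets_U01_iff)
    then show ?thesis using assms(2) by (simp add: L2.nrm_def space_U01 flip: indicator_inter_arith)
  qed
  finally show ?thesis .
qed

text \<open>Descending induction on the order: passing from order \<open>r + 1\<close> to
  \<open>r\<close> adds \<open>\<bar>D r 0\<bar>\<close>, which is at most one norm, so order
  \<open>r\<close> costs \<open>m - r + 1\<close> norms. The constant \<open>m + 1\<close> covers
  all orders.\<close>

lemma sobolev_deriv_bounds:
  assumes "sobolev_derivs m f D"
  shows "r < m \<Longrightarrow> x \<in> {0..1} \<Longrightarrow> \<bar>D r x\<bar> \<le> (real m + 1) * sob.nrm m f"
    and "r \<le> m \<Longrightarrow> D r \<in> sq_int U01" and "r \<le> m \<Longrightarrow> L2.nrm U01 (D r) \<le> (real m + 1) * sob.nrm m f"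
proof -
  have f: "f \<in> sobolev m" using assms by (auto simp: sobolev_def)
  note nn = sob.nrm_nonneg[OF f]
  let ?n = "sob.nrm m f"
  have int: "\<bar>LINT t:{0..x}|U01. g t\<bar> \<le> L2.nrm U01 g" if "g \<in> sq_int U01" "x \<in> {0..1}" for g x
  proof -
    have "\<bar>LINT t:{0..x}|U01. g t\<bar> \<le> sqrt (measure U01 {0..x}) * L2.nrm U01 g"
      by (rule abs_set_integral_U01_le) (use that in \<open>auto simp: sets_U01_iff\<close>)
    also have "\<dots> \<le> 1 * L2.nrm U01 g"
      using that by (intro mult_right_mono) (auto simp: measure_U01_Icc L2.nrm_nonneg)
    finally show ?thesis by simp
  qed
  have main: "D r \<in> sq_int U01 \<and> L2.nrm U01 (D r) \<le> (real (m - r) + 1) * ?n \<and>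
     (r < m \<longrightarrow> (\<forall>x\<in>{0..1}. \<bar>D r x\<bar> \<le> (real (m - r) + 1) * ?n))" if "r \<le> m" for r
    using that
  proof (induction rule: inc_induct)
    case base
    then show ?case using sobolev_derivs_sq_int[OF assms] sob_nrm_bounds(2)[OF assms] by simp
  next
    case (step k)
    have b: "\<bar>D k x\<bar> \<le> (real (m - k) + 1) * ?n" if x: "x \<in> {0..1}" for x
    proof -
      have "D k x = D k 0 + (LINT t:{0..x}|U01. D (Suc k) t)"
        using sobolev_derivs_primitive[OF assms] step.hyps x by blast
      then have "\<bar>D k x\<bar> \<le> \<bar>D k 0\<bar> + \<bar>LINT t:{0..x}|U01. D (Suc k) t\<bar>" by linarith
      also have "\<dots> \<le> ?n + (real (m - Suc k) + 1) * ?n"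
        using step.IH sob_nrm_bounds(1)[OF assms, of k] step.hyps int[of "D (Suc k)" x] x
        by (intro add_mono) linarith+
      also have "\<dots> = (real (m - k) + 1) * ?n"
        using step.hyps by (simp add: of_nat_diff algebra_simps)
      finally show ?thesis .
    qed
    have meas: "D k \<in> borel_measurable U01"
      using sobolev_derivs_continuous[OF assms] step.hyps by (intro continuous_on_U01_measurable) auto
    have sq: "D k \<in> sq_int U01" by (rule U01.sq_int_bounded[OF meas b]) (simp add: space_U01)
    have "(\<integral>x. (D k x)\<^sup>2 \<partial>U01) \<le> (\<integral>x. ((real (m - k) + 1) * ?n)\<^sup>2 \<partial>U01)"
      using sq b nn by (intro integral_mono) (auto simp: sq_int_def space_U01 intro!: abs_le_square_iff[THEN iffD1] order_trans[OF b] )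
    also have "\<dots> = ((real (m - k) + 1) * ?n)\<^sup>2" using U01.prob_space by (simp add: space_U01)
    finally have "L2.nrm U01 (D k) \<le> (real (m - k) + 1) * ?n"
      using nn by (simp add: L2_nrm real_le_lsqrt)
    then show ?case using sq b by auto
  qed
  have mono: "(real (m - r) + 1) * ?n \<le> (real m + 1) * ?n" for r
    using nn by (intro mult_right_mono) auto
  show "r < m \<Longrightarrow> x \<in> {0..1} \<Longrightarrow> \<bar>D r x\<bar> \<le> (real m + 1) * sob.nrm m f"
    using main[of r] mono[of r] by fastforce
  show "r \<le> m \<Longrightarrow> D r \<in> sq_int U01" using main[of r] by auto
  show "r \<le> m \<Longrightarrow> L2.nrm U01 (D r) \<le> (real m + 1) * sob.nrm m f"
    using main[of r] mono[of r] by fastforce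
qed

text \<open>The fundamental theorem on \<open>{x<..y}\<close> together with Cauchy-Schwarz: every
  derivative below order \<open>m\<close> is Hoelder continuous with exponent \<open>1/2\<close>,
  uniformly on norm balls.\<close>

lemma sobolev_deriv_increment:
  assumes "sobolev_derivs m f D" "r < m" "0 \<le> x" "x \<le> y" "y \<le> 1"
  shows "D r y - D r x = (LINT t:{x<..y}|U01. D (Suc r) t)"
    and "\<bar>D r y - D r x\<bar> \<le> (real m + 1) * sob.nrm m f * sqrt (y - x)"
proof -
  have i: "integrable U01 (D (Suc r))" using assms by (blast intro: sobolev_derivs_integrable)
  have un: "{0..y} = {0..x} \<union> {x<..y}" using assms by auto
  have "(LINT t:{0..y}|U01. D (Suc r) t) = (LINT t:{0..x}|U01. D (Suc r) t) + (LINT t:{x<..y}|U01. D (Suc r) t)"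
    unfolding un
    by (rule set_integral_Un)
      (use i assms in \<open>auto simp: sets_U01_iff intro!: set_integrable_U01_subset\<close>)
  moreover have "D r z = D r 0 + (LINT t:{0..z}|U01. D (Suc r) t)" if "z \<in> {0..1}" for z
    using assms(1,2) that by (rule sobolev_derivs_primitive)
  from this[of x] this[of y]
  have "D r x = D r 0 + (LINT t:{0..x}|U01. D (Suc r) t)" "D r y = D r 0 + (LINT t:{0..y}|U01. D (Suc r) t)"
    using assms by auto
  ultimately show eq: "D r y - D r x = (LINT t:{x<..y}|U01. D (Suc r) t)" by simp
  have "\<bar>D r y - D r x\<bar> \<le> sqrt (measure U01 {x<..y}) * L2.nrm U01 (D (Suc r))"
    unfolding eq by (rule abs_set_integral_U01_le)
      (use assms sobolev_deriv_bounds(2)[OF assms(1)] in \<open>auto simp: sets_U01_iff\<close>)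
  also have "\<dots> = sqrt (y - x) * L2.nrm U01 (D (Suc r))"
    using assms by (simp add: measure_U01_Ioc)
  also have "\<dots> \<le> sqrt (y - x) * ((real m + 1) * sob.nrm m f)"
    using assms sobolev_deriv_bounds(3)[OF assms(1)] by (intro mult_left_mono) auto
  finally show "\<bar>D r y - D r x\<bar> \<le> (real m + 1) * sob.nrm m f * sqrt (y - x)"
    by (simp add: mult.commute)
qed

lemma sobolev_continuous:
  assumes "f \<in> sobolev m" "m \<ge> 1"
  shows "continuous_on {0..1} f"
proof -
  have "continuous_on {0..1} (weak_deriv m f 0)"
    using sobolev_derivs_continuous[OF weak_deriv[OF assms(1)], of 0] assms by simp
  moreover have "\<forall>x\<in>{0..1}. weak_deriv m f 0 x = f x"
    using sobolev_derivs_0[OF weak_deriv[OF assms(1)]] by blast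
  ultimately show ?thesis by (metis continuous_on_cong)
qed

lemma sobolev_abs_le:
  assumes "f \<in> sobolev m" "m \<ge> 1" "x \<in> {0..1}"
  shows "\<bar>f x\<bar> \<le> (real m + 1) * sob.nrm m f"
  using sobolev_deriv_bounds(1)[OF weak_deriv[OF assms(1)], of 0 x] assms
    sobolev_derivs_0[OF weak_deriv[OF assms(1)], of x]
  by simp

section \<open>Approximation of functionals by point evaluations\<close>

text \<open>The closure of the span of point evaluations in the dual norm. Functionals are defined
  on all functions and tested on \<open>sobolev m\<close> only; \<open>P\<close> lists pairs of a
  coefficient and a node.\<close>

definition eval_limit :: "nat \<Rightarrow> ((real \<Rightarrow> real) \<Rightarrow> real) \<Rightarrow> bool" where
  "eval_limit m L \<longleftrightarrow> (\<forall>e>0. \<exists>P. snd ` set P \<subseteq> {0..1} \<and>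
     (\<forall>F\<in>sobolev m. \<bar>L F - (\<Sum>p\<leftarrow>P. fst p * F (snd p))\<bar> \<le> e * sob.nrm m F))"

lemma eval_limit_eval:
  assumes "x \<in> {0..1}"
  shows "eval_limit m (\<lambda>F. F x)"
  unfolding eval_limit_def
  by (intro allI impI exI[of _ "[(1, x)]"]) (use assms in \<open>auto simp: sob.nrm_nonneg\<close>)

lemma eval_limit_zero: "eval_limit m (\<lambda>F. 0)"
  unfolding eval_limit_def by (intro allI impI exI[of _ "[]"]) (auto simp: sob.nrm_nonneg)

lemma eval_limitE:
  assumes "eval_limit m L" "e > 0"
  obtains P where "snd ` set P \<subseteq> {0..1}"
    "\<And>F. F \<in> sobolev m \<Longrightarrow> \<bar>L F - (\<Sum>p\<leftarrow>P. fst p * F (snd p))\<bar> \<le> e * sob.nrm m F"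
proof -
  have "\<exists>P. snd ` set P \<subseteq> {0..1} \<and>
     (\<forall>F\<in>sobolev m. \<bar>L F - (\<Sum>p\<leftarrow>P. fst p * F (snd p))\<bar> \<le> e * sob.nrm m F)"
    using assms by (simp add: eval_limit_def)
  then show ?thesis using that by meson
qed

lemma real_half_split: "e * n = e / 2 * n + e / 2 * (n::real)"
  by (simp add: field_simps)

lemma eval_limit_add:
  assumes "eval_limit m K" "eval_limit m L"
  shows "eval_limit m (\<lambda>F. K F + L F)"
  unfolding eval_limit_def
proof (intro allI impI)
  fix e :: real assume "e > 0"
  then have e: "e / 2 > 0" by simp
  obtain P where P: "snd ` set P \<subseteq> {0..1}"
    "\<And>F. F \<in> sobolev m \<Longrightarrow> \<bar>K F - (\<Sum>p\<leftarrow>P. fst p * F (snd p))\<bar> \<le> e / 2 * sob.nrm m F"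
    using eval_limitE[OF assms(1) e] by metis
  obtain Q where Q: "snd ` set Q \<subseteq> {0..1}"
    "\<And>F. F \<in> sobolev m \<Longrightarrow> \<bar>L F - (\<Sum>p\<leftarrow>Q. fst p * F (snd p))\<bar> \<le> e / 2 * sob.nrm m F"
    using eval_limitE[OF assms(2) e] by metis
  have "\<bar>K F + L F - (\<Sum>p\<leftarrow>P @ Q. fst p * F (snd p))\<bar> \<le> e * sob.nrm m F" if "F \<in> sobolev m" for F
  proof -
    have "e * sob.nrm m F = e / 2 * sob.nrm m F + e / 2 * sob.nrm m F" by (rule real_half_split)
    then show ?thesis
      unfolding map_append sum_list_append using P(2)[OF that] Q(2)[OF that] by linarith
  qed
  then show "\<exists>P. snd ` set P \<subseteq> {0..1} \<and>
     (\<forall>F\<in>sobolev m. \<bar>K F + L F - (\<Sum>p\<leftarrow>P. fst p * F (snd p))\<bar> \<le> e * sob.nrm m F)"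
    using P(1) Q(1) by (intro exI[of _ "P @ Q"] conjI ballI) (simp_all only: set_append image_Un Un_least)
qed

text \<open>Halving the error shows that the class is closed under operator norm limits. Beyond
  finite combinations, this is how new functionals enter it.\<close>

lemma eval_limit_limit:
  assumes "\<And>e. e > 0 \<Longrightarrow> \<exists>K. eval_limit m K \<and> (\<forall>F\<in>sobolev m. \<bar>L F - K F\<bar> \<le> e * sob.nrm m F)"
  shows "eval_limit m L"
  unfolding eval_limit_def
proof (intro allI impI)
  fix e :: real assume "e > 0"
  then have e: "e / 2 > 0" by simp
  obtain K where K: "eval_limit m K" "\<And>F. F \<in> sobolev m \<Longrightarrow> \<bar>L F - K F\<bar> \<le> e / 2 * sob.nrm m F"
    using assms[OF e] by blast
  obtain P where P: "snd ` set P \<subseteq> {0..1}"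
    "\<And>F. F \<in> sobolev m \<Longrightarrow> \<bar>K F - (\<Sum>p\<leftarrow>P. fst p * F (snd p))\<bar> \<le> e / 2 * sob.nrm m F"
    using eval_limitE[OF K(1) e] by metis
  have "\<bar>L F - (\<Sum>p\<leftarrow>P. fst p * F (snd p))\<bar> \<le> e * sob.nrm m F" if "F \<in> sobolev m" for F
  proof -
    have "e * sob.nrm m F = e / 2 * sob.nrm m F + e / 2 * sob.nrm m F" by (rule real_half_split)
    then show ?thesis using K(2)[OF that] P(2)[OF that] by linarith
  qed
  then show "\<exists>P. snd ` set P \<subseteq> {0..1} \<and>
     (\<forall>F\<in>sobolev m. \<bar>L F - (\<Sum>p\<leftarrow>P. fst p * F (snd p))\<bar> \<le> e * sob.nrm m F)"
    using P(1) by (intro exI[of _ P] conjI ballI)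
qed

lemma eval_limit_scale:
  assumes "eval_limit m K"
  shows "eval_limit m (\<lambda>F. c * K F)"
  unfolding eval_limit_def
proof (intro allI impI)
  fix e :: real assume "e > 0"
  then have e: "e / (\<bar>c\<bar> + 1) > 0" by simp
  obtain P where P: "snd ` set P \<subseteq> {0..1}"
    "\<And>F. F \<in> sobolev m \<Longrightarrow> \<bar>K F - (\<Sum>p\<leftarrow>P. fst p * F (snd p))\<bar> \<le> e / (\<bar>c\<bar> + 1) * sob.nrm m F"
    using eval_limitE[OF assms e] by metis
  let ?Q = "map (\<lambda>p. (c * fst p, snd p)) P"
  have "\<bar>c * K F - (\<Sum>p\<leftarrow>?Q. fst p * F (snd p))\<bar> \<le> e * sob.nrm m F" if F: "F \<in> sobolev m" for F
  proof -
    have "(\<Sum>p\<leftarrow>?Q. fst p * F (snd p)) = c * (\<Sum>p\<leftarrow>P. fst p * F (snd p))"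
      by (induction P) (simp_all add: distrib_left mult.assoc)
    then have "\<bar>c * K F - (\<Sum>p\<leftarrow>?Q. fst p * F (snd p))\<bar> = \<bar>c\<bar> * \<bar>K F - (\<Sum>p\<leftarrow>P. fst p * F (snd p))\<bar>"
      by (simp add: abs_mult[symmetric] right_diff_distrib)
    also have "\<dots> \<le> (\<bar>c\<bar> + 1) * (e / (\<bar>c\<bar> + 1) * sob.nrm m F)"
      by (intro mult_mono P(2) F) auto
    finally show ?thesis by simp
  qed
  then show "\<exists>P. snd ` set P \<subseteq> {0..1} \<and>
     (\<forall>F\<in>sobolev m. \<bar>c * K F - (\<Sum>p\<leftarrow>P. fst p * F (snd p))\<bar> \<le> e * sob.nrm m F)"
    using P(1) by (intro exI[of _ ?Q] conjI ballI) (auto simp del: map_map)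
qed

lemma eval_limit_diff:
  "eval_limit m K \<Longrightarrow> eval_limit m L \<Longrightarrow> eval_limit m (\<lambda>F. K F - L F)"
  using eval_limit_add[OF _ eval_limit_scale, of m K L "-1"] by simp

lemma eval_limit_sum:
  "finite I \<Longrightarrow> (\<And>i. i \<in> I \<Longrightarrow> eval_limit m (L i)) \<Longrightarrow> eval_limit m (\<lambda>F. \<Sum>i\<in>I. L i F)"
  by (induction I rule: finite_induct) (simp_all add: eval_limit_zero eval_limit_add)

lemma eval_limit_cong:
  assumes "eval_limit m K" "\<And>F. F \<in> sobolev m \<Longrightarrow> K F = L F"
  shows "eval_limit m L"
  using assms by (simp add: eval_limit_def)

lemma difference_quotient_error:
  assumes D: "sobolev_derivs m F D" and r: "Suc r < m" and ab: "0 \<le> a" "a < b" "b \<le> 1"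
    and c: "c = a \<or> c = b"
  shows "\<bar>D (Suc r) c - (D r b - D r a) / (b - a)\<bar> \<le> sqrt (b - a) * (real m + 1) * sob.nrm m F"
proof -
  let ?B = "(real m + 1) * sob.nrm m F * sqrt (b - a)"
  have F: "F \<in> sobolev m" using D by (auto simp: sobolev_def)
  have B: "?B \<ge> 0" using ab sob.nrm_nonneg[OF F] by simp
  have i: "integrable U01 (D (Suc r))" using D r by (auto intro: sobolev_derivs_integrable)
  have A: "{a<..b} \<in> sets U01" using ab by (auto simp: sets_U01_iff)
  have i1: "set_integrable U01 {a<..b} (\<lambda>t. D (Suc r) t)" "set_integrable U01 {a<..b} (\<lambda>t. D (Suc r) c)"
    using A i by (auto intro!: set_integrable_U01_subset)
  have const: "(LINT t:{a<..b}|U01. k) = k * (b - a)" for k :: real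
    using A ab by (simp add: set_lebesgue_integral_def measure_U01_Ioc space_U01 Int_absorb2 subset_eq)
  have pt: "\<bar>D (Suc r) t - D (Suc r) c\<bar> \<le> ?B" if t: "t \<in> {a<..b}" for t
  proof -
    have "\<bar>D (Suc r) t - D (Suc r) c\<bar> \<le> (real m + 1) * sob.nrm m F * sqrt \<bar>t - c\<bar>"
      using c
    proof
      assume "c = a"
      then show ?thesis using sobolev_deriv_increment(2)[OF D r, of a t] t ab by simp
    next
      assume "c = b"
      then show ?thesis using sobolev_deriv_increment(2)[OF D r, of t b] t ab by (simp add: abs_minus_commute)
    qed
    also have "\<dots> \<le> ?B"
      using t c ab sob.nrm_nonneg[OF F] by (intro mult_left_mono) auto
    finally show ?thesis .
  qed
  have "D r b - D r a - D (Suc r) c * (b - a) = (LINT t:{a<..b}|U01. D (Suc r) t - D (Suc r) c)"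
    using sobolev_deriv_increment(1)[OF D, of r a b] r ab i1 const by simp
  also have "\<bar>\<dots>\<bar> \<le> (LINT t:{a<..b}|U01. \<bar>D (Suc r) t - D (Suc r) c\<bar>)"
    unfolding set_lebesgue_integral_def
    by (rule order_trans[OF integral_abs_bound]) (simp add: abs_mult)
  also have "\<dots> \<le> (LINT t:{a<..b}|U01. ?B)"
    by (rule set_integral_mono) (use i1 pt A in \<open>auto intro!: set_integrable_U01_subset set_integrable_abs set_integral_diff\<close>)
  also have "\<dots> = ?B * (b - a)" by (rule const)
  finally have "\<bar>D r b - D r a - D (Suc r) c * (b - a)\<bar> \<le> ?B * (b - a)" .
  then have "\<bar>D r b - D r a - D (Suc r) c * (b - a)\<bar> / (b - a) \<le> ?B" using ab by (simp add: pos_divide_le_eq)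
  moreover have "\<bar>D r b - D r a - D (Suc r) c * (b - a)\<bar> / (b - a) = \<bar>D (Suc r) c - (D r b - D r a) / (b - a)\<bar>"
  proof -
    have "D (Suc r) c - (D r b - D r a) / (b - a) = - ((D r b - D r a - D (Suc r) c * (b - a)) / (b - a))"
      using ab by (simp add: field_simps)
    then show ?thesis using ab by (simp add: abs_divide)
  qed
  ultimately show ?thesis by (simp add: mult.commute mult.left_commute)
qed

text \<open>A derivative of order \<open>r + 1\<close> is an operator norm limit of difference
  quotients of the derivative of order \<open>r\<close>. The Hoelder bound behind the error is
  available below order \<open>m\<close>; order \<open>m\<close> itself is reached through
  integrals.\<close>

lemma eval_limit_deriv:
  assumes "r < m" "x \<in> {0..1}"
  shows "eval_limit m (\<lambda>F. weak_deriv m F r x)"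
  using assms
proof (induction r arbitrary: x)
  case 0
  show ?case
    by (rule eval_limit_cong[OF eval_limit_eval[OF 0(2)]])
      (use 0 in \<open>simp add: sobolev_derivs_0[OF weak_deriv]\<close>)
next
  case (Suc r)
  show ?case
  proof (rule eval_limit_limit)
    fix e :: real assume e: "e > 0"
    \<comment> \<open>The error bound \<open>sqrt h * (m + 1)\<close> has to be at most
      \<open>e\<close>, and \<open>h \<le> 1/2\<close> leaves room for a step of length
      \<open>h\<close> on one side of \<open>x\<close>.\<close>
    define h where "h = min (1/2) ((e / (real m + 1))\<^sup>2)"
    have h: "0 < h" "h \<le> 1/2" "sqrt h \<le> e / (real m + 1)"
      using e by (auto simp: h_def real_sqrt_le_iff intro!: real_le_lsqrt)
    define a b where "a = (if x \<le> 1/2 then x else x - h)" and "b = (if x \<le> 1/2 then x + h else x)"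
    have ab: "0 \<le> a" "a < b" "b \<le> 1" "x = a \<or> x = b" "b - a = h"
      using Suc.prems h by (auto simp: a_def b_def)
    let ?K = "\<lambda>F. (1 / h) * (weak_deriv m F r b - weak_deriv m F r a)"
    have "eval_limit m ?K"
      using Suc ab by (intro eval_limit_scale eval_limit_diff Suc.IH) auto
    moreover have "\<bar>weak_deriv m F (Suc r) x - ?K F\<bar> \<le> e * sob.nrm m F" if F: "F \<in> sobolev m" for F
    proof -
      have "\<bar>weak_deriv m F (Suc r) x - ?K F\<bar> \<le> sqrt h * (real m + 1) * sob.nrm m F"
        using difference_quotient_error[OF weak_deriv[OF F] Suc.prems(1) ab(1-4)] ab(5) by simp
      also have "\<dots> \<le> e * sob.nrm m F"
        using h(3) sob.nrm_nonneg[OF F] by (intro mult_right_mono) (auto simp: field_simps)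
      finally show ?thesis .
    qed
    ultimately show "\<exists>K. eval_limit m K \<and> (\<forall>F\<in>sobolev m. \<bar>weak_deriv m F (Suc r) x - K F\<bar> \<le> e * sob.nrm m F)"
      by blast
  qed
qed

lemma weak_deriv_sq_int: "F \<in> sobolev m \<Longrightarrow> weak_deriv m F m \<in> sq_int U01"
  using sobolev_derivs_sq_int weak_deriv by blast

lemma weak_deriv_set_integrable:
  "F \<in> sobolev m \<Longrightarrow> A \<in> sets U01 \<Longrightarrow> set_integrable U01 A (weak_deriv m F m)"
  by (intro set_integrable_U01_subset U01.sq_int_integrable weak_deriv_sq_int)

text \<open>Dynkin induction on \<open>A\<close>. Over \<open>{0..x}\<close> the integral is an
  increment of the derivative of order \<open>m - 1\<close>; complements use the integral over the
  whole interval; for a countable union the tail has small measure, hence small operator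
  norm.\<close>

lemma eval_limit_set_integral:
  assumes m: "m \<ge> 1" and A: "A \<in> sets U01"
  shows "eval_limit m (\<lambda>F. LINT t:A|U01. weak_deriv m F m t)"
  using _ _ _ _ A
proof (rule unit_interval_Dynkin)
  show "eval_limit m (\<lambda>F. LINT t:{}|U01. weak_deriv m F m t)"
    using eval_limit_zero by (simp add: set_lebesgue_integral_def)
next
  fix x :: real assume x: "x \<in> {0..1}"
  show "eval_limit m (\<lambda>F. LINT t:{0..x}|U01. weak_deriv m F m t)"
  proof (rule eval_limit_cong)
    show "eval_limit m (\<lambda>F. weak_deriv m F (m - 1) x - weak_deriv m F (m - 1) 0)"
      using x m by (intro eval_limit_diff eval_limit_deriv) auto
    fix F assume F: "F \<in> sobolev m"
    show "weak_deriv m F (m - 1) x - weak_deriv m F (m - 1) 0 = (LINT t:{0..x}|U01. weak_deriv m F m t)"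
      using sobolev_derivs_primitive[OF weak_deriv[OF F], of "m - 1" x] m x by simp
  qed
next
  fix A assume A: "A \<in> sets U01" "eval_limit m (\<lambda>F. LINT t:A|U01. weak_deriv m F m t)"
  show "eval_limit m (\<lambda>F. LINT t:{0..1} - A|U01. weak_deriv m F m t)"
  proof (rule eval_limit_cong)
    show "eval_limit m (\<lambda>F. (weak_deriv m F (m - 1) 1 - weak_deriv m F (m - 1) 0) - (LINT t:A|U01. weak_deriv m F m t))"
      using m by (intro eval_limit_diff eval_limit_deriv A(2)) auto
    fix F assume F: "F \<in> sobolev m"
    have "(LINT t:A \<union> ({0..1} - A)|U01. weak_deriv m F m t)
        = (LINT t:A|U01. weak_deriv m F m t) + (LINT t:{0..1} - A|U01. weak_deriv m F m t)"
      using A F by (intro set_integral_Un weak_deriv_set_integrable) (auto simp: sets_U01_iff)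
    moreover have "A \<union> ({0..1} - A) = {0..1}" using A by (auto simp: sets_U01_iff)
    ultimately show "(weak_deriv m F (m - 1) 1 - weak_deriv m F (m - 1) 0) - (LINT t:A|U01. weak_deriv m F m t)
        = (LINT t:{0..1} - A|U01. weak_deriv m F m t)"
      using sobolev_derivs_primitive[OF weak_deriv[OF F], of "m - 1" 1] m by simp
  qed
next
  fix A :: "nat \<Rightarrow> real set"
  assume A: "\<And>i. A i \<in> sets U01" "disjoint_family A" "\<And>i. eval_limit m (\<lambda>F. LINT t:A i|U01. weak_deriv m F m t)"
  \<comment> \<open>What is left of the union after the first \<open>n\<close> sets; these
    remainders decrease to the empty set.\<close>
  define B where "B n = (\<Union>i. A i) - (\<Union>i<n. A i)" for n :: nat
  have Bs: "B n \<in> sets U01" for n unfolding B_def using A(1) by auto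
  have dec: "decseq B" unfolding B_def decseq_def by (auto intro: order_less_le_trans)
  have emp: "(\<Inter>n. B n) = {}" unfolding B_def by auto
  have lim: "(\<lambda>n. measure U01 (B n)) \<longlonglongrightarrow> 0"
    using U01.finite_Lim_measure_decseq[OF _ dec] Bs emp by (auto simp: image_subset_iff)
  show "eval_limit m (\<lambda>F. LINT t:(\<Union>i. A i)|U01. weak_deriv m F m t)"
  proof (rule eval_limit_limit)
    fix e :: real assume e: "e > 0"
    have "(\<lambda>n. sqrt (measure U01 (B n))) \<longlonglongrightarrow> sqrt 0" by (intro tendsto_real_sqrt lim)
    then have "\<forall>\<^sub>F n in sequentially. sqrt (measure U01 (B n)) < e"
      using e by (intro order_tendstoD(2)) auto
    then obtain n where n: "sqrt (measure U01 (B n)) < e" by (auto simp: eventually_sequentially)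
    let ?K = "\<lambda>F. \<Sum>i<n. LINT t:A i|U01. weak_deriv m F m t"
    have "eval_limit m ?K" using A(3) by (intro eval_limit_sum) auto
    moreover have "\<bar>(LINT t:(\<Union>i. A i)|U01. weak_deriv m F m t) - ?K F\<bar> \<le> e * sob.nrm m F"
      if F: "F \<in> sobolev m" for F
    proof -
      have "(LINT t:(\<Union>i<n. A i)|U01. weak_deriv m F m t) = ?K F"
        using A(1,2) F by (intro set_integral_finite_Union weak_deriv_set_integrable)
          (auto simp: disjoint_family_on_def)
      moreover have "(LINT t:(\<Union>i<n. A i) \<union> B n|U01. weak_deriv m F m t)
          = (LINT t:(\<Union>i<n. A i)|U01. weak_deriv m F m t) + (LINT t:B n|U01. weak_deriv m F m t)"
        using A(1) Bs F by (intro set_integral_Un weak_deriv_set_integrable) (auto simp: B_def)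
      moreover have "(\<Union>i<n. A i) \<union> B n = (\<Union>i. A i)" by (auto simp: B_def)
      ultimately have "\<bar>(LINT t:(\<Union>i. A i)|U01. weak_deriv m F m t) - ?K F\<bar> = \<bar>LINT t:B n|U01. weak_deriv m F m t\<bar>"
        by simp
      also have "\<dots> \<le> sqrt (measure U01 (B n)) * L2.nrm U01 (weak_deriv m F m)"
        by (intro abs_set_integral_U01_le weak_deriv_sq_int F Bs)
      also have "\<dots> \<le> e * sob.nrm m F"
        using n e sob_nrm_bounds(2)[OF weak_deriv[OF F]]
        by (intro mult_mono) (auto intro: L2.nrm_nonneg weak_deriv_sq_int F)
      finally show ?thesis .
    qed
    ultimately show "\<exists>K. eval_limit m K \<and>
      (\<forall>F\<in>sobolev m. \<bar>(LINT t:(\<Union>i. A i)|U01. weak_deriv m F m t) - K F\<bar> \<le> e * sob.nrm m F)"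
      by blast
  qed
qed

text \<open>For a simple weight the integral is a finite combination of integrals over level sets.
  Simple functions are dense in \<open>L_2\<close>, and Cauchy-Schwarz turns \<open>L_2\<close>
  closeness of the weights into closeness in operator norm.\<close>

lemma eval_limit_integral_mult:
  assumes m: "m \<ge> 1" and g: "g \<in> sq_int U01"
  shows "eval_limit m (\<lambda>F. \<integral>t. g t * weak_deriv m F m t \<partial>U01)"
proof (rule eval_limit_limit)
  fix e :: real assume e: "e > 0"
  obtain s where s: "\<And>i. simple_function U01 (s i)" "\<And>x. x \<in> space U01 \<Longrightarrow> (\<lambda>i. s i x) \<longlonglongrightarrow> g x"
    "\<And>i x. x \<in> space U01 \<Longrightarrow> dist (s i x) 0 \<le> 2 * dist (g x) 0"
    using borel_measurable_implies_sequence_metric[of g U01 0] sq_int_measurable[OF g] by blast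
  have sm: "s i \<in> borel_measurable U01" for i using s(1) by (rule borel_measurable_simple_function)
  have gm: "g \<in> borel_measurable U01" using g by (rule sq_int_measurable)
  have ssq: "s i \<in> sq_int U01" for i
    unfolding sq_int_def
  proof (intro CollectI conjI sm)
    show "integrable U01 (\<lambda>x. (s i x)\<^sup>2)"
    proof (rule Bochner_Integration.integrable_bound)
      show "integrable U01 (\<lambda>x. 4 * (g x)\<^sup>2)" using g by (simp add: sq_int_def)
      show "(\<lambda>x. (s i x)\<^sup>2) \<in> borel_measurable U01" using sm by simp
      show "AE x in U01. norm ((s i x)\<^sup>2) \<le> norm (4 * (g x)\<^sup>2)"
      proof (rule AE_I2)
        fix x assume "x \<in> space U01"
        then have "\<bar>s i x\<bar> \<le> 2 * \<bar>g x\<bar>" using s(3) by simp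
        then have "\<bar>s i x\<bar>\<^sup>2 \<le> (2 * \<bar>g x\<bar>)\<^sup>2" by (intro power_mono) auto
        then show "norm ((s i x)\<^sup>2) \<le> norm (4 * (g x)\<^sup>2)" by (simp add: power_mult_distrib)
      qed
    qed
  qed
  \<comment> \<open>From \<open>\<bar>s i x\<bar> \<le> 2 * \<bar>g x\<bar>\<close> the difference
    is at most \<open>3 * \<bar>g x\<bar>\<close>, which explains the dominating function.\<close>
  have "(\<lambda>i. \<integral>x. (g x - s i x)\<^sup>2 \<partial>U01) \<longlonglongrightarrow> (\<integral>x. 0 \<partial>U01)"
  proof (rule integral_dominated_convergence[where w = "\<lambda>x. 9 * (g x)\<^sup>2"])
    show "AE x in U01. (\<lambda>i. (g x - s i x)\<^sup>2) \<longlonglongrightarrow> 0"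
    proof (rule AE_I2)
      fix x assume "x \<in> space U01"
      then have "(\<lambda>i. (g x - s i x)\<^sup>2) \<longlonglongrightarrow> (g x - g x)\<^sup>2" by (intro tendsto_intros s(2))
      then show "(\<lambda>i. (g x - s i x)\<^sup>2) \<longlonglongrightarrow> 0" by simp
    qed
    show "AE x in U01. norm ((g x - s i x)\<^sup>2) \<le> 9 * (g x)\<^sup>2" for i
    proof (rule AE_I2)
      fix x assume "x \<in> space U01"
      then have "\<bar>s i x\<bar> \<le> 2 * \<bar>g x\<bar>" using s(3) by simp
      then have "\<bar>g x - s i x\<bar> \<le> 3 * \<bar>g x\<bar>" by linarith
      then have "\<bar>g x - s i x\<bar>\<^sup>2 \<le> (3 * \<bar>g x\<bar>)\<^sup>2" by (intro power_mono) auto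
      then show "norm ((g x - s i x)\<^sup>2) \<le> 9 * (g x)\<^sup>2" by (simp add: power_mult_distrib)
    qed
  qed (use g sm gm in \<open>auto simp: sq_int_def\<close>)
  then have "(\<lambda>i. sqrt (\<integral>x. (g x - s i x)\<^sup>2 \<partial>U01)) \<longlonglongrightarrow> sqrt 0" by (intro tendsto_real_sqrt) simp
  then have "\<forall>\<^sub>F i in sequentially. sqrt (\<integral>x. (g x - s i x)\<^sup>2 \<partial>U01) < e"
    using e by (intro order_tendstoD(2)) auto
  then obtain i where i: "sqrt (\<integral>x. (g x - s i x)\<^sup>2 \<partial>U01) < e" by (auto simp: eventually_sequentially)
  let ?S = "s i ` space U01"
  let ?K = "\<lambda>F. \<Sum>y\<in>?S. y * (LINT t:s i -` {y} \<inter> space U01|U01. weak_deriv m F m t)"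
  have fin: "finite ?S" using s(1) by (simp add: simple_function_def)
  have meas: "s i -` {y} \<inter> space U01 \<in> sets U01" for y
    using s(1) by (rule simple_functionD(2))
  have "eval_limit m ?K"
    by (intro eval_limit_sum fin eval_limit_scale eval_limit_set_integral m meas)
  moreover have "\<bar>(\<integral>t. g t * weak_deriv m F m t \<partial>U01) - ?K F\<bar> \<le> e * sob.nrm m F"
    if F: "F \<in> sobolev m" for F
  proof -
    let ?D = "weak_deriv m F m"
    have D: "?D \<in> sq_int U01" using F by (rule weak_deriv_sq_int)
    have "(\<integral>t. s i t * ?D t \<partial>U01) = (\<integral>t. (\<Sum>y\<in>?S. y * (indicat_real (s i -` {y} \<inter> space U01) t * ?D t)) \<partial>U01)"
    proof (rule Bochner_Integration.integral_cong[OF refl])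
      fix t assume t: "t \<in> space U01"
      have "(\<Sum>y\<in>?S. y * (indicat_real (s i -` {y} \<inter> space U01) t * ?D t)) = (\<Sum>y\<in>?S. if y = s i t then y * ?D t else 0)"
        using t by (intro sum.cong) (auto simp: indicator_def)
      also have "\<dots> = s i t * ?D t" using fin t by (simp add: sum.delta)
      finally show "s i t * ?D t = (\<Sum>y\<in>?S. y * (indicat_real (s i -` {y} \<inter> space U01) t * ?D t))" by simp
    qed
    also have "\<dots> = ?K F"
      using weak_deriv_set_integrable[OF F meas]
      by (subst Bochner_Integration.integral_sum) (auto simp: set_lebesgue_integral_def set_integrable_def)
    finally have K: "?K F = (\<integral>t. s i t * ?D t \<partial>U01)" by simp
    have gs: "(\<lambda>t. g t + -1 * s i t) \<in> sq_int U01" by (intro L2.sub_closed g ssq)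
    have "(\<integral>t. g t * ?D t \<partial>U01) - ?K F = (\<integral>t. (g t + -1 * s i t) * ?D t \<partial>U01)"
      unfolding K using L2.ip_sub_left[OF g ssq D, of i] by simp
    then have "\<bar>(\<integral>t. g t * ?D t \<partial>U01) - ?K F\<bar> \<le> L2.nrm U01 (\<lambda>t. g t + -1 * s i t) * L2.nrm U01 ?D"
      using L2.abs_ip_le[OF gs D] by simp
    also have "\<dots> \<le> e * sob.nrm m F"
      using i e sob_nrm_bounds(2)[OF weak_deriv[OF F]]
      by (intro mult_mono) (auto simp: L2_nrm intro: L2.nrm_nonneg D)
    finally show ?thesis .
  qed
  ultimately show "\<exists>K. eval_limit m K \<and>
    (\<forall>F\<in>sobolev m. \<bar>(\<integral>t. g t * weak_deriv m F m t \<partial>U01) - K F\<bar> \<le> e * sob.nrm m F)"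
    by blast
qed

lemma eval_limit_inner:
  assumes "m \<ge> 1" "G \<in> sobolev m"
  shows "eval_limit m (\<lambda>F. sobolev_inner m F G)"
proof (rule eval_limit_cong)
  show "eval_limit m (\<lambda>F. (\<Sum>r<m. weak_deriv m G r 0 * weak_deriv m F r 0)
    + (\<integral>t. weak_deriv m G m t * weak_deriv m F m t \<partial>U01))"
    using assms by (intro eval_limit_add eval_limit_sum eval_limit_scale eval_limit_deriv
        eval_limit_integral_mult weak_deriv_sq_int) auto
  fix F assume F: "F \<in> sobolev m"
  show "(\<Sum>r<m. weak_deriv m G r 0 * weak_deriv m F r 0)
    + (\<integral>t. weak_deriv m G m t * weak_deriv m F m t \<partial>U01) = sobolev_inner m F G"
    unfolding sobolev_inner_eq[OF weak_deriv[OF F] weak_deriv[OF assms(2)]] sobolev_form_def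
    by (simp add: mult.commute)
qed

section \<open>The algebraic tensor product\<close>

text \<open>The forms \<open>q\<close> in question are products of functional values and
  \<open>L_2\<close> inner products of images under operators. They are compared with the inner
  product of \<open>sobolev m\<close>, while the linear structure stays fixed.\<close>

abbreviation sobolev_semi_inner :: "nat \<Rightarrow> ((real \<Rightarrow> real) \<Rightarrow> (real \<Rightarrow> real) \<Rightarrow> real) \<Rightarrow> bool" where
  "sobolev_semi_inner m q \<equiv> semi_inner (sobolev m) (\<lambda>f g x. f x + g x) (\<lambda>c f x. c * f x) q"

lemma sobolev_semi_inner_sum:
  assumes "sobolev_semi_inner m q" "finite A" "\<And>a. a \<in> A \<Longrightarrow> f a \<in> sobolev m" "g \<in> sobolev m"
  shows "q (\<lambda>x. \<Sum>a\<in>A. c a * f a x) g = (\<Sum>a\<in>A. c a * q (f a) g)"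
  using assms(2,3)
proof (induction A rule: finite_induct)
  case empty
  have "q (\<lambda>x. 0 * g x) g = 0 * q g g"
    by (rule semi_inner.ip_smul[OF assms(1,4,4)])
  then show ?case by simp
next
  case (insert a A)
  have "q (\<lambda>x. c a * f a x + (\<Sum>a\<in>A. c a * f a x)) g = q (\<lambda>x. c a * f a x) g + q (\<lambda>x. \<Sum>a\<in>A. c a * f a x) g"
    using insert assms(4) by (intro semi_inner.ip_add[OF assms(1)] sobolev_sum sobolev_scale) auto
  also have "q (\<lambda>x. c a * f a x) g = c a * q (f a) g"
    using insert assms(4) by (intro semi_inner.ip_smul[OF assms(1)]) auto
  finally show ?case using insert by simp
qed

lemma sobolev_semi_inner_sum2:
  assumes "sobolev_semi_inner m q" "finite A" "\<And>a. a \<in> A \<Longrightarrow> f a \<in> sobolev m"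
  shows "q (\<lambda>x. \<Sum>a\<in>A. c a * f a x) (\<lambda>x. \<Sum>a\<in>A. c a * f a x) = (\<Sum>a\<in>A. \<Sum>b\<in>A. c a * c b * q (f a) (f b))"
proof -
  let ?g = "\<lambda>x. \<Sum>a\<in>A. c a * f a x"
  have g: "?g \<in> sobolev m" using assms by (intro sobolev_sum) auto
  have "q ?g ?g = (\<Sum>a\<in>A. c a * q (f a) ?g)"
    by (rule sobolev_semi_inner_sum[OF assms g])
  also have "\<dots> = (\<Sum>a\<in>A. c a * q ?g (f a))"
    using assms g semi_inner.ip_commute[OF assms(1)] by (intro sum.cong) auto
  also have "\<dots> = (\<Sum>a\<in>A. \<Sum>b\<in>A. c a * c b * q (f b) (f a))"
    using sobolev_semi_inner_sum[OF assms] assms(3)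
    by (intro sum.cong) (auto simp: sum_distrib_left mult.assoc)
  also have "\<dots> = (\<Sum>a\<in>A. \<Sum>b\<in>A. c a * c b * q (f a) (f b))"
    using assms semi_inner.ip_commute[OF assms(1)] by (intro sum.cong refl) auto
  finally show ?thesis .
qed

definition tensor_form ::
    "nat \<Rightarrow> (nat \<Rightarrow> (real \<Rightarrow> real) \<Rightarrow> (real \<Rightarrow> real) \<Rightarrow> real) \<Rightarrow> (nat \<Rightarrow> real \<Rightarrow> real) list \<Rightarrow>
      (nat \<Rightarrow> real \<Rightarrow> real) list \<Rightarrow> real" where
  "tensor_form d q S T = (\<Sum>F\<leftarrow>S. \<Sum>G\<leftarrow>T. \<Prod>j=1..d. q j (F j) (G j))"

lemma tensor_inner_form: "tensor_inner m d S T = tensor_form d (\<lambda>_. sobolev_inner m) S T"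
  by (simp add: tensor_inner_def tensor_form_def)

lemma tensor_form_index:
  "tensor_form d q S T = (\<Sum>a<length S. \<Sum>b<length T. \<Prod>j=1..d. q j ((S ! a) j) ((T ! b) j))"
  by (simp add: tensor_form_def sum_list_sum_nth atLeast0LessThan)

text \<open>This is the Schur product theorem for the Gram matrices of the coordinates.\<close>

lemma tensor_form_le:
  assumes S: "S \<in> tensors m d"
    and q: "\<And>j. j \<in> {1..d} \<Longrightarrow> sobolev_semi_inner m (q j)"
    and le: "\<And>j F. j \<in> {1..d} \<Longrightarrow> F \<in> sobolev m \<Longrightarrow> q j F F \<le> (b j)\<^sup>2 * sobolev_inner m F F"
  shows "0 \<le> tensor_form d q S S" and "tensor_form d q S S \<le> (\<Prod>j=1..d. b j)\<^sup>2 * tensor_inner m d S S"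
proof -
  let ?A = "{..<length S}"
  let ?F = "\<lambda>j a. (S ! a) j"
  let ?K = "\<lambda>j a c. q j (?F j a) (?F j c)"
  let ?L = "\<lambda>j a c. (b j)\<^sup>2 * sobolev_inner m (?F j a) (?F j c)"
  have F: "?F j a \<in> sobolev m" if "j \<in> {1..d}" "a \<in> ?A" for j a
    using S that by (auto simp: tensors_def)
  have K: "psd_on ?A (?K j)" if j: "j \<in> {1..d}" for j
    unfolding psd_on_def
  proof (intro conjI ballI allI)
    show "?K j a c = ?K j c a" if "a \<in> ?A" "c \<in> ?A" for a c
      using semi_inner.ip_commute[OF q[OF j]] F j that by blast
    fix c
    have "0 \<le> q j (\<lambda>x. \<Sum>a\<in>?A. c a * ?F j a x) (\<lambda>x. \<Sum>a\<in>?A. c a * ?F j a x)"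
      using F j by (intro semi_inner.ip_nonneg[OF q] sobolev_sum) auto
    then show "0 \<le> (\<Sum>a\<in>?A. \<Sum>e\<in>?A. c a * c e * ?K j a e)"
      using sobolev_semi_inner_sum2[OF q[OF j], of ?A "?F j" c] F j by simp
  qed
  have L: "psd_on ?A (\<lambda>a c. ?L j a c - ?K j a c)" if j: "j \<in> {1..d}" for j
    unfolding psd_on_def
  proof (intro conjI ballI allI)
    show "?L j a c - ?K j a c = ?L j c a - ?K j c a" if "a \<in> ?A" "c \<in> ?A" for a c
      using semi_inner.ip_commute[OF q[OF j] F[OF j that(1)] F[OF j that(2)]]
        sob.ip_commute[OF F[OF j that(1)] F[OF j that(2)]] by simp
    fix c
    let ?g = "\<lambda>x. \<Sum>a\<in>?A. c a * ?F j a x"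
    have "?g \<in> sobolev m" using F j by (intro sobolev_sum) auto
    then have "0 \<le> (b j)\<^sup>2 * sobolev_inner m ?g ?g - q j ?g ?g" using le j by simp
    also have "\<dots> = (\<Sum>a\<in>?A. \<Sum>e\<in>?A. c a * c e * (?L j a e - ?K j a e))"
      using sobolev_semi_inner_sum2[OF q[OF j], of ?A "?F j" c]
        sobolev_semi_inner_sum2[OF sob.semi_inner_axioms, of ?A "?F j" m c] F j
      by (simp add: sum_distrib_left sum_subtractf right_diff_distrib algebra_simps)
    finally show "0 \<le> (\<Sum>a\<in>?A. \<Sum>e\<in>?A. c a * c e * (?L j a e - ?K j a e))" .
  qed
  from psd_on_prod_mono[of ?A "{1..d}" ?K ?L, OF _ _ K L]
  have *: "psd_on ?A (\<lambda>a c. \<Prod>j=1..d. ?K j a c)"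
    "psd_on ?A (\<lambda>a c. (\<Prod>j=1..d. ?L j a c) - (\<Prod>j=1..d. ?K j a c))" by auto
  show "0 \<le> tensor_form d q S S"
    using psd_onD[OF *(1), of "\<lambda>_. 1"] by (simp add: tensor_form_index)
  have "0 \<le> (\<Sum>a<length S. \<Sum>c<length S. \<Prod>j=1..d. ?L j a c) - tensor_form d q S S"
    using psd_onD[OF *(2), of "\<lambda>_. 1"] by (simp add: tensor_form_index sum_subtractf)
  also have "(\<Sum>a<length S. \<Sum>c<length S. \<Prod>j=1..d. ?L j a c) = (\<Prod>j=1..d. b j)\<^sup>2 * tensor_inner m d S S"
    by (simp add: tensor_inner_form tensor_form_index prod.distrib sum_distrib_left prod_power_distrib)
  finally show "tensor_form d q S S \<le> (\<Prod>j=1..d. b j)\<^sup>2 * tensor_inner m d S S" by simp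
qed

text \<open>An elementary tensor carries no coefficient of its own, so a scalar is moved into one
  factor. The first is used; it exists as soon as \<open>d \<ge> 1\<close>.\<close>

definition tensor_scale :: "real \<Rightarrow> (nat \<Rightarrow> real \<Rightarrow> real) list \<Rightarrow> (nat \<Rightarrow> real \<Rightarrow> real) list" where
  "tensor_scale c S = map (\<lambda>F. F(1 := (\<lambda>x. c * F 1 x))) S"

definition tensor_functional :: "nat \<Rightarrow> (nat \<Rightarrow> (real \<Rightarrow> real) \<Rightarrow> real) \<Rightarrow> (nat \<Rightarrow> real \<Rightarrow> real) list \<Rightarrow> real" where
  "tensor_functional d L S = (\<Sum>F\<leftarrow>S. \<Prod>j=1..d. L j (F j))"

lemma tensor_fun_functional: "tensor_fun d S x = tensor_functional d (\<lambda>j F. F (x j)) S"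
  by (simp add: tensor_fun_def tensor_functional_def)

definition sobolev_functional :: "nat \<Rightarrow> real \<Rightarrow> ((real \<Rightarrow> real) \<Rightarrow> real) \<Rightarrow> bool" where
  "sobolev_functional m b L \<longleftrightarrow> b \<ge> 0 \<and>
     (\<forall>F\<in>sobolev m. \<forall>G\<in>sobolev m. L (\<lambda>x. F x + G x) = L F + L G) \<and>
     (\<forall>c. \<forall>F\<in>sobolev m. L (\<lambda>x. c * F x) = c * L F) \<and>
     (\<forall>F\<in>sobolev m. \<bar>L F\<bar> \<le> b * sob.nrm m F)"

text \<open>A functional gives the rank one form \<open>L F * L G\<close>, dominated by
  \<open>b^2\<close> times the inner product. The tensor form built from these rank one forms is the
  square of the tensor functional.\<close>

lemma tensor_functional_bound:
  assumes S: "S \<in> tensors m d" and L: "\<And>j. j \<in> {1..d} \<Longrightarrow> sobolev_functional m (b j) (L j)"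
  shows "\<bar>tensor_functional d L S\<bar> \<le> (\<Prod>j=1..d. b j) * sqrt (tensor_inner m d S S)"
proof -
  have "tensor_form d (\<lambda>j F G. L j F * L j G) S S \<le> (\<Prod>j=1..d. b j)\<^sup>2 * tensor_inner m d S S"
  proof (rule tensor_form_le(2)[OF S])
    fix j assume j: "j \<in> {1..d}"
    show "sobolev_semi_inner m (\<lambda>F G. L j F * L j G)"
      by unfold_locales (use L[OF j] in \<open>auto simp: sobolev_functional_def algebra_simps intro: sobolev_add sobolev_scale\<close>)
    fix F assume F: "F \<in> sobolev m"
    have "\<bar>L j F\<bar>\<^sup>2 \<le> (b j * sob.nrm m F)\<^sup>2"
      using L[OF j] F by (intro power_mono) (auto simp: sobolev_functional_def)
    then show "L j F * L j F \<le> (b j)\<^sup>2 * sobolev_inner m F F"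
      using F by (simp add: power_mult_distrib sob.nrm_sq flip: power2_eq_square)
  qed
  moreover have "tensor_form d (\<lambda>j F G. L j F * L j G) S S = (tensor_functional d L S)\<^sup>2"
    unfolding tensor_form_index tensor_functional_def
    by (simp add: sum_list_sum_nth atLeast0LessThan power2_eq_square sum_product prod.distrib)
  ultimately have "sqrt ((tensor_functional d L S)\<^sup>2) \<le> sqrt ((\<Prod>j=1..d. b j)\<^sup>2 * tensor_inner m d S S)"
    by (intro real_sqrt_le_mono) (simp only:)
  moreover have "(\<Prod>j=1..d. b j) \<ge> 0"
    using L by (intro prod_nonneg) (auto simp: sobolev_functional_def)
  ultimately show ?thesis by (simp add: real_sqrt_mult)
qed

section \<open>Linear structure of tensor lists for fixed \<open>m\<close> and
  \<open>d\<close>\<close>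

locale mixed_sobolev =
  fixes m d :: nat
  assumes m: "m \<ge> 1" and d: "d \<ge> 1"
begin

lemma prod_update_first:
  fixes h :: "nat \<Rightarrow> real \<Rightarrow> real"
  shows "(\<Prod>j=1..d. g j ((F(1 := z)) j)) = g 1 z * (\<Prod>j=2..d. g j (F j))"
proof -
  have "{1..d} = insert 1 {2..d}" using d by auto
  then have "(\<Prod>j=1..d. g j ((F(1 := z)) j)) = g 1 z * (\<Prod>j=2..d. g j ((F(1 := z)) j))" by simp
  also have "(\<Prod>j=2..d. g j ((F(1 := z)) j)) = (\<Prod>j=2..d. g j (F j))" by (intro prod.cong) auto
  finally show ?thesis .
qed

lemma prod_first: "(\<Prod>j=1..d. g j) = g 1 * (\<Prod>j=2..d. g j)"
proof -
  have "{1..d} = insert 1 {2..d}" using d by auto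
  then show ?thesis by simp
qed

lemma tensors_append: "S \<in> tensors m d \<Longrightarrow> T \<in> tensors m d \<Longrightarrow> S @ T \<in> tensors m d"
  by (auto simp: tensors_def)

lemma tensors_scale: "S \<in> tensors m d \<Longrightarrow> tensor_scale c S \<in> tensors m d"
  by (auto simp: tensors_def tensor_scale_def intro: sobolev_scale)

lemma tensor_functional_append:
  "tensor_functional d L (S @ T) = tensor_functional d L S + tensor_functional d L T"
  by (simp add: tensor_functional_def)

lemma tensor_functional_scale:
  assumes "S \<in> tensors m d" "\<And>F. F \<in> sobolev m \<Longrightarrow> L 1 (\<lambda>x. c * F x) = c * L 1 F"
  shows "tensor_functional d L (tensor_scale c S) = c * tensor_functional d L S"
proof -
  have "tensor_functional d L (tensor_scale c S) = (\<Sum>F\<leftarrow>S. c * (\<Prod>j=1..d. L j (F j)))"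
    unfolding tensor_functional_def tensor_scale_def map_map o_def prod_update_first prod_first
    using assms d by (intro arg_cong[of _ _ sum_list] map_cong refl) (auto simp: tensors_def)
  then show ?thesis by (simp add: tensor_functional_def sum_list_const_mult)
qed

text \<open>For fixed \<open>T\<close> the inner product is a finite sum of tensor functionals of
  \<open>S\<close>, to which the approximation by point evaluations applies.\<close>

lemma tensor_inner_functional:
  "tensor_inner m d S T = (\<Sum>G\<leftarrow>T. tensor_functional d (\<lambda>j F. sobolev_inner m F (G j)) S)"
  unfolding tensor_inner_form tensor_form_index tensor_functional_def
  by (simp add: sum_list_sum_nth atLeast0LessThan) (rule sum.swap)

sublocale tens: semi_inner "tensors m d" "(@)" tensor_scale "tensor_inner m d"
proof
  fix S T R :: "(nat \<Rightarrow> real \<Rightarrow> real) list" and c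
  assume S: "S \<in> tensors m d"
  show "tensor_scale c S \<in> tensors m d" using S by (rule tensors_scale)
  show "0 \<le> tensor_inner m d S S"
    unfolding tensor_inner_form
    by (rule tensor_form_le(1)[OF S, where b = "\<lambda>_. 1"]) (auto intro: sob.semi_inner_axioms)
  assume T: "T \<in> tensors m d"
  show "S @ T \<in> tensors m d" using S T by (rule tensors_append)
  show "tensor_inner m d S T = tensor_inner m d T S"
  proof -
    have "(\<Prod>j=1..d. sobolev_inner m ((S ! a) j) ((T ! b) j)) = (\<Prod>j=1..d. sobolev_inner m ((T ! b) j) ((S ! a) j))"
      if "a < length S" "b < length T" for a b
      using S T that by (intro prod.cong refl sob.ip_commute) (auto simp: tensors_def)
    then show ?thesis
      unfolding tensor_inner_form tensor_form_index by (subst sum.swap) (auto intro!: sum.cong)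
  qed
  show "tensor_inner m d (tensor_scale c S) T = c * tensor_inner m d S T"
  proof -
    have "tensor_functional d (\<lambda>j F. sobolev_inner m F (G j)) (tensor_scale c S)
        = c * tensor_functional d (\<lambda>j F. sobolev_inner m F (G j)) S" if "G \<in> set T" for G
      using T that d by (intro tensor_functional_scale S sob.ip_smul) (auto simp: tensors_def)
    then show ?thesis
      unfolding tensor_inner_functional by (simp add: sum_list_const_mult[symmetric] cong: map_cong)
  qed
  assume "R \<in> tensors m d"
  show "tensor_inner m d (S @ T) R = tensor_inner m d S R + tensor_inner m d T R"
    unfolding tensor_inner_functional tensor_functional_append by (simp add: sum_list_addf)
qed

lemma tensor_dist_nrm:
  assumes "S \<in> tensors m d" "T \<in> tensors m d"
  shows "tensor_dist m d S T = tens.nrm (tens.sub S T)"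
  using assms by (simp add: tensor_dist_def tens.nrm_def tens.ip_sub_self)

lemma sobolev_functional_eval: "x \<in> {0..1} \<Longrightarrow> sobolev_functional m (real m + 1) (\<lambda>F. F x)"
  using m by (auto simp: sobolev_functional_def intro: sobolev_abs_le)

lemma sobolev_functional_inner:
  "G \<in> sobolev m \<Longrightarrow> sobolev_functional m (sob.nrm m G) (\<lambda>F. sobolev_inner m F G)"
  using sob.abs_ip_le[of _ m G]
  by (auto simp: sobolev_functional_def sob.nrm_nonneg sob.ip_add sob.ip_smul mult.commute)

lemma tensor_functional_update:
  assumes i: "i \<in> {1..d}"
  shows "tensor_functional d (L(i := K)) S = (\<Sum>F\<leftarrow>S. K (F i) * (\<Prod>j\<in>{1..d} - {i}. L j (F j)))"
proof -
  have "(\<Prod>j=1..d. (L(i := K)) j (F j)) = K (F i) * (\<Prod>j\<in>{1..d} - {i}. L j (F j))" for F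
  proof -
    have "(\<Prod>j=1..d. (L(i := K)) j (F j)) = (L(i := K)) i (F i) * (\<Prod>j\<in>{1..d} - {i}. (L(i := K)) j (F j))"
      using i by (intro prod.remove) auto
    also have "(\<Prod>j\<in>{1..d} - {i}. (L(i := K)) j (F j)) = (\<Prod>j\<in>{1..d} - {i}. L j (F j))"
      by (intro prod.cong) auto
    finally show ?thesis by simp
  qed
  then show ?thesis by (simp add: tensor_functional_def)
qed

text \<open>Functionals on the coordinates are replaced by point evaluations one coordinate at a time.\<close>

lemma tensor_functional_tendsto_zero:
  assumes S: "\<And>k. S k \<in> tensors m d" and B: "\<And>k. tens.nrm (S k) \<le> B"
    and lim: "\<And>x. x \<in> cube d \<Longrightarrow> (\<lambda>k. tensor_fun d (S k) x) \<longlonglongrightarrow> 0"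
    and "finite J" and "J \<subseteq> {1..d}"
    and "\<And>j. j \<in> {1..d} \<Longrightarrow> sobolev_functional m (b j) (L j)"
    and "\<And>j. j \<in> J \<Longrightarrow> eval_limit m (L j)"
    and "\<And>j. j \<in> {1..d} - J \<Longrightarrow> \<exists>x\<in>{0..1}. L j = (\<lambda>F. F x)"
  shows "(\<lambda>k. tensor_functional d L (S k)) \<longlonglongrightarrow> 0"
  using assms(4-)
proof (induction J arbitrary: L b rule: finite_induct)
  case empty
  have "\<exists>x\<in>{0..1}. L j = (\<lambda>F. F x)" if "j \<in> {1..d}" for j
    using empty.prems(4) that by simp
  then obtain x where x: "\<And>j. j \<in> {1..d} \<Longrightarrow> x j \<in> {0..1} \<and> L j = (\<lambda>F. F (x j))" by metis
  have "restrict x {1..d} \<in> cube d" using x by (auto simp: cube_def)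
  from lim[OF this] have "(\<lambda>k. tensor_fun d (S k) (restrict x {1..d})) \<longlonglongrightarrow> 0" .
  moreover have "tensor_fun d T (restrict x {1..d}) = tensor_functional d L T" for T
    unfolding tensor_fun_def tensor_functional_def
    using x by (intro arg_cong[of _ _ sum_list] map_cong refl prod.cong) auto
  ultimately show ?case by (simp only:)
next
  case (insert i J)
  have i: "i \<in> {1..d}" using insert.prems by simp
  have B0: "B \<ge> 0" using B[of 0] tens.nrm_nonneg[OF S[of 0]] by linarith
  \<comment> \<open>\<open>M\<close> dominates the bounds of the functionals on the other
    coordinates times the norms of the tensors. The summand \<open>1\<close> makes it positive, so
    that \<open>e\<close> can be defined by division.\<close>
  define M where "M = (\<Prod>j\<in>{1..d} - {i}. b j) * B + 1"
  have bnn: "b j \<ge> 0" if "j \<in> {1..d}" for j using insert.prems(2)[OF that] by (simp add: sobolev_functional_def)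
  have M: "M > 0" unfolding M_def using B0 bnn by (intro add_nonneg_pos mult_nonneg_nonneg prod_nonneg) auto
  show ?case
  proof (rule LIMSEQ_I)
    fix r :: real assume r: "r > 0"
    define e where "e = r / (2 * M)"
    have e: "e > 0" using r M by (simp add: e_def)
    have "eval_limit m (L i)" using insert.prems by simp
    from eval_limitE[OF this e] obtain P where P: "snd ` set P \<subseteq> {0..1}"
      "\<And>F. F \<in> sobolev m \<Longrightarrow> \<bar>L i F - (\<Sum>p\<leftarrow>P. fst p * F (snd p))\<bar> \<le> e * sob.nrm m F" by metis
    let ?E = "\<lambda>F :: real \<Rightarrow> real. \<Sum>p\<leftarrow>P. fst p * F (snd p)"
    have E: "tensor_functional d (L(i := ?E)) T = (\<Sum>p\<leftarrow>P. fst p * tensor_functional d (L(i := (\<lambda>F. F (snd p)))) T)" for T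
    proof -
      have "tensor_functional d (L(i := ?E)) T =
          (\<Sum>F\<leftarrow>T. (\<Sum>p\<leftarrow>P. fst p * (F i (snd p) * (\<Prod>j\<in>{1..d} - {i}. L j (F j)))))"
        unfolding tensor_functional_update[OF i] by (simp add: sum_list_mult_const[symmetric] mult.assoc)
      also have "\<dots> = (\<Sum>p\<leftarrow>P. fst p * tensor_functional d (L(i := (\<lambda>F. F (snd p)))) T)"
        unfolding tensor_functional_update[OF i] by (induction T) (simp_all add: sum_list_addf distrib_left)
      finally show ?thesis .
    qed
    have "(\<lambda>k. tensor_functional d (L(i := (\<lambda>F. F (snd p)))) (S k)) \<longlonglongrightarrow> 0" if p: "p \<in> set P" for p
    proof (rule insert.IH[where b = "b(i := real m + 1)"])
      have sp: "snd p \<in> {0..1}" using P(1) p by auto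
      show "J \<subseteq> {1..d}" using insert.prems by simp
      show "sobolev_functional m ((b(i := real m + 1)) j) ((L(i := (\<lambda>F. F (snd p)))) j)" if "j \<in> {1..d}" for j
        using insert.prems(2)[OF that] sobolev_functional_eval[OF sp] by simp
      show "eval_limit m ((L(i := (\<lambda>F. F (snd p)))) j)" if "j \<in> J" for j
        using insert.prems(3)[of j] insert.hyps that by auto
      show "\<exists>x\<in>{0..1}. (L(i := (\<lambda>F. F (snd p)))) j = (\<lambda>F. F x)" if "j \<in> {1..d} - J" for j
        using insert.prems(4)[of j] sp that by auto
    qed
    then have "(\<lambda>k. tensor_functional d (L(i := ?E)) (S k)) \<longlonglongrightarrow> (\<Sum>p\<leftarrow>P. fst p * 0)"
      unfolding E by (induction P) (auto intro!: tendsto_add_zero tendsto_mult_right_zero)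
    then have "(\<lambda>k. tensor_functional d (L(i := ?E)) (S k)) \<longlonglongrightarrow> 0" by simp
    from LIMSEQ_D[OF this, of "r / 2"] r obtain K where
      K: "\<And>k. k \<ge> K \<Longrightarrow> \<bar>tensor_functional d (L(i := ?E)) (S k)\<bar> < r / 2" by auto
    \<comment> \<open>The error of the replacement is itself a functional with bound
      \<open>e\<close> on coordinate \<open>i\<close>. Its contribution is at most
      \<open>e * M = r / 2\<close>, uniformly in \<open>k\<close>.\<close>
    let ?D = "L(i := (\<lambda>F. L i F - ?E F))"
    have sf: "sobolev_functional m ((b(i := e)) j) (?D j)" if j: "j \<in> {1..d}" for j
    proof (cases "j = i")
      case True
      have add: "?E (\<lambda>x. F x + G x) = ?E F + ?E G" for F G
        by (simp add: distrib_left sum_list_addf)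
      have sc: "?E (\<lambda>x. c * F x) = c * ?E F" for c F
        by (simp add: sum_list_const_mult[symmetric] mult.left_commute)
      show ?thesis
        using insert.prems(2)[OF i] P(2) e True
        unfolding sobolev_functional_def by (simp add: add sc right_diff_distrib)
    next
      case False
      then show ?thesis using insert.prems(2)[OF j] by simp
    qed
    have "\<bar>tensor_functional d L (S k)\<bar> < r" if k: "k \<ge> K" for k
    proof -
      have "tensor_functional d L (S k) = tensor_functional d (L(i := L i)) (S k)" by simp
      also have "\<dots> = tensor_functional d ?D (S k) + tensor_functional d (L(i := ?E)) (S k)"
        unfolding tensor_functional_update[OF i]
        by (simp add: sum_list_addf[symmetric] left_diff_distrib)
      finally have "\<bar>tensor_functional d L (S k)\<bar> \<le> \<bar>tensor_functional d ?D (S k)\<bar> + \<bar>tensor_functional d (L(i := ?E)) (S k)\<bar>"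
        by simp
      also have "\<bar>tensor_functional d ?D (S k)\<bar> \<le> (\<Prod>j=1..d. (b(i := e)) j) * tens.nrm (S k)"
        unfolding tens.nrm_def by (rule tensor_functional_bound[OF S sf])
      also have "(\<Prod>j=1..d. (b(i := e)) j) = e * (\<Prod>j\<in>{1..d} - {i}. b j)"
      proof -
        have "(\<Prod>j=1..d. (b(i := e)) j) = (b(i := e)) i * (\<Prod>j\<in>{1..d} - {i}. (b(i := e)) j)"
          using i by (intro prod.remove) auto
        also have "(\<Prod>j\<in>{1..d} - {i}. (b(i := e)) j) = (\<Prod>j\<in>{1..d} - {i}. b j)" by (intro prod.cong) auto
        finally show ?thesis by simp
      qed
      also have "e * (\<Prod>j\<in>{1..d} - {i}. b j) * tens.nrm (S k) \<le> e * ((\<Prod>j\<in>{1..d} - {i}. b j) * B)"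
        unfolding mult.assoc using e B bnn by (intro mult_left_mono prod_nonneg) auto
      also have "\<dots> \<le> e * M" using e by (intro mult_left_mono) (auto simp: M_def)
      also have "e * M = r / 2" using M by (simp add: e_def)
      finally show ?thesis using K[OF k] by linarith
    qed
    then show "\<exists>K. \<forall>k\<ge>K. norm (tensor_functional d L (S k) - 0) < r" by auto
  qed
qed

text \<open>Every factor \<open>sobolev_inner m F (G j)\<close> is an operator norm limit of point
  evaluations, so all coordinates may be replaced. The conclusion is weak convergence, tested
  against a fixed tensor.\<close>

lemma tensor_inner_tendsto_zero:
  assumes S: "\<And>k. S k \<in> tensors m d" and B: "\<And>k. tens.nrm (S k) \<le> B"
    and lim: "\<And>x. x \<in> cube d \<Longrightarrow> (\<lambda>k. tensor_fun d (S k) x) \<longlonglongrightarrow> 0"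
    and T: "T \<in> tensors m d"
  shows "(\<lambda>k. tensor_inner m d (S k) T) \<longlonglongrightarrow> 0"
proof -
  have "(\<lambda>k. tensor_functional d (\<lambda>j F. sobolev_inner m F (G j)) (S k)) \<longlonglongrightarrow> 0" if "G \<in> set T" for G
    using T that
    by (intro tensor_functional_tendsto_zero[OF S B lim, where J = "{1..d}" and b = "\<lambda>j. sob.nrm m (G j)"])
      (auto simp: tensors_def intro: sobolev_functional_inner eval_limit_inner[OF m])
  then have "(\<lambda>k. \<Sum>G\<leftarrow>T. tensor_functional d (\<lambda>j F. sobolev_inner m F (G j)) (S k)) \<longlonglongrightarrow> (\<Sum>G\<leftarrow>T. 0)"
    by (induction T) (auto intro!: tendsto_add_zero)
  then show ?thesis unfolding tensor_inner_functional by simp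
qed

section \<open>Cauchy sequences of tensors and injectivity of the completion\<close>

definition tensor_Cauchy :: "(nat \<Rightarrow> (nat \<Rightarrow> real \<Rightarrow> real) list) \<Rightarrow> bool" where
  "tensor_Cauchy S \<longleftrightarrow> (\<forall>k. S k \<in> tensors m d) \<and>
     (\<forall>e>0. \<exists>K. \<forall>k\<ge>K. \<forall>l\<ge>K. tens.nrm (tens.sub (S k) (S l)) < e)"

lemma tensor_approx_iff:
  "tensor_approx m d S f \<longleftrightarrow> tensor_Cauchy S \<and> (\<forall>x\<in>cube d. (\<lambda>k. tensor_fun d (S k) x) \<longlonglongrightarrow> f x)"
  unfolding tensor_approx_def tensor_Cauchy_def by (auto simp: tensor_dist_nrm)

lemma tensor_Cauchy_bounded:
  assumes "tensor_Cauchy S"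
  obtains B where "B > 0" "\<And>k. tens.nrm (S k) \<le> B"
proof -
  have S: "S k \<in> tensors m d" for k using assms by (simp add: tensor_Cauchy_def)
  obtain K where K: "\<And>k. k \<ge> K \<Longrightarrow> tens.nrm (tens.sub (S k) (S K)) < 1"
    using assms unfolding tensor_Cauchy_def by (meson order_refl zero_less_one)
  define B where "B = (\<Sum>k\<le>K. tens.nrm (S k)) + 1"
  have nn: "tens.nrm (S k) \<ge> 0" for k using S by (rule tens.nrm_nonneg)
  have le: "tens.nrm (S k) \<le> (\<Sum>k\<le>K. tens.nrm (S k))" if "k \<le> K" for k
    using that nn by (intro member_le_sum) auto
  have "tens.nrm (S k) \<le> B" for k
  proof (cases "k \<le> K")
    case True
    then show ?thesis using le[of k] by (simp add: B_def)
  next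
    case False
    then show ?thesis
      using tens.abs_nrm_diff_le[OF S S, of k K] K[of k] le[of K] by (simp add: B_def)
  qed
  moreover have "B > 0" unfolding B_def using nn by (intro add_nonneg_pos sum_nonneg) auto
  ultimately show ?thesis using that by blast
qed

text \<open>The completion embeds injectively into the functions on the cube.\<close>

lemma tensor_null_sequence:
  assumes C: "tensor_Cauchy S" and lim: "\<And>x. x \<in> cube d \<Longrightarrow> (\<lambda>k. tensor_fun d (S k) x) \<longlonglongrightarrow> 0"
  shows "(\<lambda>k. tens.nrm (S k)) \<longlonglongrightarrow> 0"
proof -
  have S: "S k \<in> tensors m d" for k using C by (simp add: tensor_Cauchy_def)
  obtain B where B: "B > 0" "\<And>k. tens.nrm (S k) \<le> B" using tensor_Cauchy_bounded[OF C] by blast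
  have "(\<lambda>k. tensor_inner m d (S k) (S k)) \<longlonglongrightarrow> 0"
  proof (rule LIMSEQ_I)
    fix r :: real assume r: "r > 0"
    then have "r / (2 * B) > 0" using B by simp
    then obtain K where K: "\<And>k. k \<ge> K \<Longrightarrow> tens.nrm (tens.sub (S k) (S K)) < r / (2 * B)"
      using C unfolding tensor_Cauchy_def by (meson order_refl)
    from LIMSEQ_D[OF tensor_inner_tendsto_zero[OF S B(2) lim S[of K]], of "r / 2"] r
    obtain K' where K': "\<And>k. k \<ge> K' \<Longrightarrow> \<bar>tensor_inner m d (S k) (S K)\<bar> < r / 2" by auto
    have "\<bar>tensor_inner m d (S k) (S k)\<bar> < r" if k: "k \<ge> max K K'" for k
    proof -
      \<comment> \<open>The first term is small by weak convergence against the fixed tensor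
        \<open>S K\<close>, the second by the Cauchy property and boundedness.\<close>
      have "tensor_inner m d (S k) (S k) = tensor_inner m d (S k) (S K) + tensor_inner m d (S k) (tens.sub (S k) (S K))"
        using S by (simp add: tens.ip_sub_right)
      moreover have "\<bar>tensor_inner m d (S k) (tens.sub (S k) (S K))\<bar> \<le> B * (r / (2 * B))"
        using tens.abs_ip_le[OF S[of k] tens.sub_closed[OF S[of k] S[of K]]] B K[of k] k
          tens.nrm_nonneg[OF tens.sub_closed[OF S[of k] S[of K]]]
        by (elim order_trans, intro mult_mono) auto
      moreover have "B * (r / (2 * B)) = r / 2" using B by simp
      ultimately show ?thesis using K'[of k] k by simp
    qed
    then show "\<exists>K. \<forall>k\<ge>K. norm (tensor_inner m d (S k) (S k) - 0) < r"
      by (intro exI[of _ "max K K'"]) auto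
  qed
  then have "(\<lambda>k. sqrt (tensor_inner m d (S k) (S k))) \<longlonglongrightarrow> sqrt 0" by (rule tendsto_real_sqrt)
  then show ?thesis by (simp add: tens.nrm_def)
qed

end

section \<open>The Hilbert space $H^m_{\mathrm{mix}}(I^d)$\<close>

context mixed_sobolev
begin

lemma tensor_Cauchy_tensors: "tensor_Cauchy S \<Longrightarrow> S k \<in> tensors m d"
  by (simp add: tensor_Cauchy_def)

lemma tensor_Cauchy_linear:
  assumes "tensor_Cauchy S" "tensor_Cauchy T"
  shows "tensor_Cauchy (\<lambda>k. S k @ tensor_scale c (T k))"
  unfolding tensor_Cauchy_def
proof (intro conjI allI impI)
  note S = tensor_Cauchy_tensors[OF assms(1)] and T = tensor_Cauchy_tensors[OF assms(2)]
  show "S k @ tensor_scale c (T k) \<in> tensors m d" for k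
    using S T by (intro tensors_append tensors_scale)
  fix e :: real assume e: "e > 0"
  obtain K where K: "\<And>k l. k \<ge> K \<Longrightarrow> l \<ge> K \<Longrightarrow> tens.nrm (tens.sub (S k) (S l)) < e / 2"
    using assms(1) e unfolding tensor_Cauchy_def by (meson half_gt_zero)
  have "e / (2 * (\<bar>c\<bar> + 1)) > 0" using e by simp
  then obtain L where L: "\<And>k l. k \<ge> L \<Longrightarrow> l \<ge> L \<Longrightarrow> tens.nrm (tens.sub (T k) (T l)) < e / (2 * (\<bar>c\<bar> + 1))"
    using assms(2) unfolding tensor_Cauchy_def by meson
  have "tens.nrm (tens.sub (S k @ tensor_scale c (T k)) (S l @ tensor_scale c (T l))) < e"
    if k: "k \<ge> max K L" and l: "l \<ge> max K L" for k l
  proof -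
    let ?a = "tens.sub (S k) (S l)" and ?b = "tens.sub (T k) (T l)"
    let ?l = "tens.sub (S k @ tensor_scale c (T k)) (S l @ tensor_scale c (T l))"
    let ?r = "?a @ tensor_scale c ?b"
    \<comment> \<open>The two lists differ in the order of their entries, so they are compared
      through their inner products with themselves.\<close>
    have "tensor_inner m d ?l ?l = tensor_inner m d ?r ?r"
      using S[of k] S[of l] T[of k] T[of l]
      by (simp add: tensors_append tensors_scale tens.ip_add tens.ip_add_right tens.ip_smul
          tens.ip_smul_right tens.ip_commute algebra_simps del: append_assoc)
    then have "tens.nrm ?l = tens.nrm ?r" by (simp add: tens.nrm_def)
    also have "\<dots> \<le> tens.nrm ?a + tens.nrm (tensor_scale c ?b)"
      using S T by (intro tens.nrm_add_le tensors_append tensors_scale)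
    also have "tens.nrm (tensor_scale c ?b) = \<bar>c\<bar> * tens.nrm ?b"
      using T by (intro tens.nrm_smul tensors_append tensors_scale)
    also have "\<dots> \<le> (\<bar>c\<bar> + 1) * (e / (2 * (\<bar>c\<bar> + 1)))"
      using L[of k l] k l T e by (intro mult_mono) (auto intro!: tens.nrm_nonneg tensors_append tensors_scale)
    also have "\<dots> = e / 2"
    proof -
      have "x * (e / (2 * x)) = e / 2" if "x \<noteq> 0" for x :: real using that by simp
      from this[of "\<bar>c\<bar> + 1"] show ?thesis by linarith
    qed
    finally show ?thesis using K[of k l] k l by simp
  qed
  then show "\<exists>K. \<forall>k\<ge>K. \<forall>l\<ge>K.
      tens.nrm (tens.sub (S k @ tensor_scale c (T k)) (S l @ tensor_scale c (T l))) < e"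
    by (intro exI[of _ "max K L"]) blast
qed

lemma tensor_fun_linear:
  assumes "S \<in> tensors m d" "T \<in> tensors m d"
  shows "tensor_fun d (S @ tensor_scale c T) x = tensor_fun d S x + c * tensor_fun d T x"
  unfolding tensor_fun_functional tensor_functional_append
  by (subst tensor_functional_scale) (use assms in auto)

lemma tensor_approx_linear:
  assumes "tensor_approx m d S f" "tensor_approx m d T g"
  shows "tensor_approx m d (\<lambda>k. S k @ tensor_scale c (T k)) (\<lambda>x. f x + c * g x)"
  unfolding tensor_approx_iff
proof (intro conjI ballI)
  show "tensor_Cauchy (\<lambda>k. S k @ tensor_scale c (T k))"
    using assms by (intro tensor_Cauchy_linear) (auto simp: tensor_approx_iff)
  fix x assume x: "x \<in> cube d"
  have "(\<lambda>k. tensor_fun d (S k) x + c * tensor_fun d (T k) x) \<longlonglongrightarrow> f x + c * g x"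
    using assms x by (intro tendsto_intros) (auto simp: tensor_approx_iff)
  then show "(\<lambda>k. tensor_fun d (S k @ tensor_scale c (T k)) x) \<longlonglongrightarrow> f x + c * g x"
    using assms by (subst tensor_fun_linear) (auto simp: tensor_approx_iff intro: tensor_Cauchy_tensors)
qed

text \<open>The difference of the two sequences is Cauchy and tends pointwise to zero, so it tends
  to zero in norm. An element of the completion is thus determined by its function.\<close>

lemma tensor_approx_unique_limit:
  assumes "tensor_approx m d S f" "tensor_approx m d T f"
  shows "(\<lambda>k. tens.nrm (tens.sub (S k) (T k))) \<longlonglongrightarrow> 0"
  using tensor_approx_linear[OF assms, of "-1"]
  by (intro tensor_null_sequence) (auto simp: tensor_approx_iff)

lemma tensor_inner_diff_bound:
  assumes "S \<in> tensors m d" "S' \<in> tensors m d" "T \<in> tensors m d" "T' \<in> tensors m d"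
    and "tens.nrm T \<le> B" "tens.nrm S' \<le> B"
  shows "\<bar>tensor_inner m d S T - tensor_inner m d S' T'\<bar>
    \<le> B * (tens.nrm (tens.sub S S') + tens.nrm (tens.sub T T'))"
proof -
  have "tensor_inner m d S T - tensor_inner m d S' T'
    = tensor_inner m d (tens.sub S S') T + tensor_inner m d S' (tens.sub T T')"
    using assms by (simp add: tens.ip_sub_left tens.ip_sub_right)
  then have "\<bar>tensor_inner m d S T - tensor_inner m d S' T'\<bar>
    \<le> \<bar>tensor_inner m d (tens.sub S S') T\<bar> + \<bar>tensor_inner m d S' (tens.sub T T')\<bar>" by linarith
  also have "\<dots> \<le> tens.nrm (tens.sub S S') * tens.nrm T + tens.nrm S' * tens.nrm (tens.sub T T')"
    using assms by (intro add_mono tens.abs_ip_le tensors_append tensors_scale)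
  also have "\<dots> \<le> tens.nrm (tens.sub S S') * B + B * tens.nrm (tens.sub T T')"
    using assms by (intro add_mono mult_left_mono mult_right_mono tens.nrm_nonneg tensors_append tensors_scale)
  finally show ?thesis by (simp add: algebra_simps)
qed

lemma tensor_inner_convergent:
  assumes "tensor_Cauchy S" "tensor_Cauchy T"
  shows "convergent (\<lambda>k. tensor_inner m d (S k) (T k))"
proof -
  note S = tensor_Cauchy_tensors[OF assms(1)] and T = tensor_Cauchy_tensors[OF assms(2)]
  obtain B1 where B1: "B1 > 0" "\<And>k. tens.nrm (S k) \<le> B1" using tensor_Cauchy_bounded[OF assms(1)] by blast
  obtain B2 where B2: "B2 > 0" "\<And>k. tens.nrm (T k) \<le> B2" using tensor_Cauchy_bounded[OF assms(2)] by blast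
  define B where "B = max B1 B2"
  have B: "B > 0" "tens.nrm (S k) \<le> B" "tens.nrm (T k) \<le> B" for k
    using B1 B2(2)[of k] B1(2)[of k] by (auto simp: B_def le_max_iff_disj)
  have "Cauchy (\<lambda>k. tensor_inner m d (S k) (T k))"
  proof (rule metric_CauchyI)
    fix e :: real assume e: "e > 0"
    then have e': "e / (2 * B) > 0" using B by simp
    obtain K where K: "\<And>k l. k \<ge> K \<Longrightarrow> l \<ge> K \<Longrightarrow> tens.nrm (tens.sub (S k) (S l)) < e / (2 * B)"
      using assms(1) e' unfolding tensor_Cauchy_def by meson
    obtain L where L: "\<And>k l. k \<ge> L \<Longrightarrow> l \<ge> L \<Longrightarrow> tens.nrm (tens.sub (T k) (T l)) < e / (2 * B)"
      using assms(2) e' unfolding tensor_Cauchy_def by meson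
    have "dist (tensor_inner m d (S k) (T k)) (tensor_inner m d (S l) (T l)) < e"
      if "k \<ge> max K L" "l \<ge> max K L" for k l
    proof -
      have "dist (tensor_inner m d (S k) (T k)) (tensor_inner m d (S l) (T l))
        \<le> B * (tens.nrm (tens.sub (S k) (S l)) + tens.nrm (tens.sub (T k) (T l)))"
        unfolding dist_real_def by (intro tensor_inner_diff_bound S T B)
      also have "\<dots> < B * (e / (2 * B) + e / (2 * B))"
        using K[of k l] L[of k l] that B by (intro mult_strict_left_mono add_strict_mono) auto
      also have "\<dots> = e" using B by (simp add: field_simps)
      finally show ?thesis .
    qed
    then show "\<exists>M. \<forall>k\<ge>M. \<forall>l\<ge>M. dist (tensor_inner m d (S k) (T k)) (tensor_inner m d (S l) (T l)) < e"
      by (intro exI[of _ "max K L"]) blast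
  qed
  then show ?thesis by (rule Cauchy_convergent)
qed

text \<open>The limit exists since both sequences are Cauchy and bounded, and it is independent of
  them since two sequences for one function differ by a null sequence. This justifies the
  description operator in \<open>hmix_inner\<close>.\<close>

lemma hmix_inner_limit:
  assumes S: "tensor_approx m d S f" and T: "tensor_approx m d T g"
  shows "(\<lambda>k. tensor_inner m d (S k) (T k)) \<longlonglongrightarrow> hmix_inner m d f g"
proof -
  have conv: "convergent (\<lambda>k. tensor_inner m d (S k) (T k))"
    using S T by (intro tensor_inner_convergent) (auto simp: tensor_approx_iff)
  then obtain c where c: "(\<lambda>k. tensor_inner m d (S k) (T k)) \<longlonglongrightarrow> c" by (auto simp: convergent_def)
  have uniq: "c' = c" if S': "tensor_approx m d S' f" and T': "tensor_approx m d T' g"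
    and c': "(\<lambda>k. tensor_inner m d (S' k) (T' k)) \<longlonglongrightarrow> c'" for S' T' c'
  proof -
    have t: "S k \<in> tensors m d" "T k \<in> tensors m d" "S' k \<in> tensors m d" "T' k \<in> tensors m d" for k
      using S T S' T' by (auto simp: tensor_approx_iff tensor_Cauchy_def)
    obtain B1 where B1: "B1 > 0" "\<And>k. tens.nrm (T k) \<le> B1"
      using tensor_Cauchy_bounded[of T] T by (auto simp: tensor_approx_iff)
    obtain B2 where B2: "B2 > 0" "\<And>k. tens.nrm (S' k) \<le> B2"
      using tensor_Cauchy_bounded[of S'] S' by (auto simp: tensor_approx_iff)
    define B where "B = max B1 B2"
    have B: "tens.nrm (T k) \<le> B" "tens.nrm (S' k) \<le> B" for k
      using B1(2)[of k] B2(2)[of k] by (auto simp: B_def le_max_iff_disj)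
    have "(\<lambda>k. tensor_inner m d (S k) (T k) - tensor_inner m d (S' k) (T' k)) \<longlonglongrightarrow> 0"
    proof (rule Lim_null_comparison)
      show "\<forall>\<^sub>F k in sequentially. norm (tensor_inner m d (S k) (T k) - tensor_inner m d (S' k) (T' k))
        \<le> B * (tens.nrm (tens.sub (S k) (S' k)) + tens.nrm (tens.sub (T k) (T' k)))"
        unfolding real_norm_def by (intro always_eventually allI tensor_inner_diff_bound t B)
      show "(\<lambda>k. B * (tens.nrm (tens.sub (S k) (S' k)) + tens.nrm (tens.sub (T k) (T' k)))) \<longlonglongrightarrow> 0"
        by (intro tendsto_mult_right_zero tendsto_add_zero tensor_approx_unique_limit[OF S S']
            tensor_approx_unique_limit[OF T T'])
    qed
    moreover have "(\<lambda>k. tensor_inner m d (S k) (T k) - tensor_inner m d (S' k) (T' k)) \<longlonglongrightarrow> c - c'"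
      by (intro tendsto_diff c c')
    ultimately show ?thesis using LIMSEQ_unique by fastforce
  qed
  have "hmix_inner m d f g = c"
    unfolding hmix_inner_def using S T c uniq by (intro the_equality) blast+
  then show ?thesis using c by simp
qed

lemma hmix_approxE:
  assumes "f \<in> hmix m d"
  obtains S where "tensor_approx m d S f"
  using assms by (auto simp: hmix_def)

lemma hmix_linear:
  assumes "f \<in> hmix m d" "g \<in> hmix m d"
  shows "(\<lambda>x. f x + c * g x) \<in> hmix m d"
  using assms tensor_approx_linear[of _ f _ g c] unfolding hmix_def by auto

lemma hmix_zero: "(\<lambda>x. 0) \<in> hmix m d"
proof -
  have "tensor_approx m d (\<lambda>_. []) (\<lambda>x. 0)"
    by (simp add: tensor_approx_def tensors_def tensor_dist_def tensor_inner_def tensor_fun_def)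
  then show ?thesis by (auto simp: hmix_def)
qed

lemma hmix_add: "f \<in> hmix m d \<Longrightarrow> g \<in> hmix m d \<Longrightarrow> (\<lambda>x. f x + g x) \<in> hmix m d"
  using hmix_linear[of f g 1] by simp

lemma hmix_scale: "f \<in> hmix m d \<Longrightarrow> (\<lambda>x. c * f x) \<in> hmix m d"
  using hmix_linear[OF hmix_zero, of f c] by simp

lemma hmix_inner_linear:
  assumes "f \<in> hmix m d" "g \<in> hmix m d" "h \<in> hmix m d"
  shows "hmix_inner m d (\<lambda>x. f x + c * g x) h = hmix_inner m d f h + c * hmix_inner m d g h"
proof -
  obtain S T R where S: "tensor_approx m d S f" and T: "tensor_approx m d T g" and R: "tensor_approx m d R h"
    using assms by (meson hmix_approxE)
  have t: "S k \<in> tensors m d" "T k \<in> tensors m d" "R k \<in> tensors m d" for k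
    using S T R by (auto simp: tensor_approx_iff tensor_Cauchy_def)
  have "(\<lambda>k. tensor_inner m d (S k) (R k) + c * tensor_inner m d (T k) (R k)) \<longlonglongrightarrow>
      hmix_inner m d f h + c * hmix_inner m d g h"
    by (intro tendsto_intros hmix_inner_limit S T R)
  moreover have "(\<lambda>k. tensor_inner m d (S k @ tensor_scale c (T k)) (R k)) \<longlonglongrightarrow> hmix_inner m d (\<lambda>x. f x + c * g x) h"
    by (intro hmix_inner_limit tensor_approx_linear S T R)
  moreover have "tensor_inner m d (S k @ tensor_scale c (T k)) (R k)
      = tensor_inner m d (S k) (R k) + c * tensor_inner m d (T k) (R k)" for k
    using t by (simp add: tens.ip_add tens.ip_smul tensors_scale)
  ultimately show ?thesis using LIMSEQ_unique by simp
qed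

lemma hmix_inner_zero: "g \<in> hmix m d \<Longrightarrow> hmix_inner m d (\<lambda>x. 0) g = 0"
  using hmix_inner_linear[OF hmix_zero hmix_zero, of g 1] by simp

sublocale hm: semi_inner "hmix m d" "\<lambda>f g x. f x + g x" "\<lambda>c f x. c * f x" "hmix_inner m d"
proof
  fix f g h :: "(nat \<Rightarrow> real) \<Rightarrow> real" and c
  assume f: "f \<in> hmix m d"
  obtain S where S: "tensor_approx m d S f" using f by (rule hmix_approxE)
  have Sk: "S k \<in> tensors m d" for k using S by (auto simp: tensor_approx_iff tensor_Cauchy_def)
  show "(\<lambda>x. c * f x) \<in> hmix m d" using f by (rule hmix_scale)
  show "0 \<le> hmix_inner m d f f"
    by (rule LIMSEQ_le_const[OF hmix_inner_limit[OF S S]]) (use tens.ip_nonneg Sk in auto)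
  assume g: "g \<in> hmix m d"
  obtain T where T: "tensor_approx m d T g" using g by (rule hmix_approxE)
  have Tk: "T k \<in> tensors m d" for k using T by (auto simp: tensor_approx_iff tensor_Cauchy_def)
  show "(\<lambda>x. f x + g x) \<in> hmix m d" using f g by (rule hmix_add)
  show "hmix_inner m d f g = hmix_inner m d g f"
    using hmix_inner_limit[OF S T] hmix_inner_limit[OF T S] tens.ip_commute[OF Sk Tk] LIMSEQ_unique by simp
  show "hmix_inner m d (\<lambda>x. c * f x) g = c * hmix_inner m d f g"
    using hmix_inner_linear[OF hmix_zero f g, of c] hmix_inner_zero[OF g] by simp
  assume h: "h \<in> hmix m d"
  show "hmix_inner m d (\<lambda>x. f x + g x) h = hmix_inner m d f h + hmix_inner m d g h"
    using hmix_inner_linear[OF f g h, of 1] by simp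
qed

lemma hmix_norm_nrm: "hmix_norm m d f = hm.nrm f"
  by (simp add: hmix_norm_def hm.nrm_def)

lemma hmix_nrm_limit:
  assumes "tensor_approx m d S f"
  shows "(\<lambda>k. tens.nrm (S k)) \<longlonglongrightarrow> hm.nrm f"
  unfolding tens.nrm_def hm.nrm_def by (intro tendsto_real_sqrt hmix_inner_limit assms)

text \<open>The product over the \<open>d\<close> coordinates of the univariate bound
  \<open>m + 1\<close> for point evaluations.\<close>

definition eval_bound :: real where "eval_bound = (real m + 1) ^ d"

lemma eval_bound_ge_1: "eval_bound \<ge> 1"
  unfolding eval_bound_def by (rule one_le_power) simp

lemma tensor_fun_le:
  assumes "S \<in> tensors m d" "x \<in> cube d"
  shows "\<bar>tensor_fun d S x\<bar> \<le> eval_bound * tens.nrm S"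
proof -
  have "\<bar>tensor_fun d S x\<bar> \<le> (\<Prod>j=1..d. real m + 1) * tens.nrm S"
    unfolding tensor_fun_functional tens.nrm_def
    using assms by (intro tensor_functional_bound sobolev_functional_eval) (auto simp: cube_def PiE_iff)
  then show ?thesis by (simp add: eval_bound_def)
qed

lemma hmix_le:
  assumes "f \<in> hmix m d" "x \<in> cube d"
  shows "\<bar>f x\<bar> \<le> eval_bound * hm.nrm f"
proof -
  obtain S where S: "tensor_approx m d S f" using assms(1) by (rule hmix_approxE)
  have "(\<lambda>k. \<bar>tensor_fun d (S k) x\<bar>) \<longlonglongrightarrow> \<bar>f x\<bar>"
    using S assms(2) by (intro tendsto_intros) (auto simp: tensor_approx_iff)
  moreover have "(\<lambda>k. eval_bound * tens.nrm (S k)) \<longlonglongrightarrow> eval_bound * hm.nrm f"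
    by (intro tendsto_intros hmix_nrm_limit S)
  ultimately show ?thesis
    using S assms(2)
    by (elim LIMSEQ_le) (auto intro!: tensor_fun_le tensor_Cauchy_tensors simp: tensor_approx_iff)
qed

lemma hmix_outside: "f \<in> hmix m d \<Longrightarrow> x \<notin> cube d \<Longrightarrow> f x = 0"
  by (simp add: hmix_def)

text \<open>Point values on the cube are bounded by the norm, and elements vanish off the cube, so
  the form is definite on functions. This gives equality of functions in the uniqueness of the
  minimizer.\<close>

lemma hmix_nrm_zero:
  assumes "f \<in> hmix m d" "hm.nrm f = 0"
  shows "f = (\<lambda>x. 0)"
proof
  fix x show "f x = 0"
    using hmix_le[OF assms(1), of x] hmix_outside[OF assms(1), of x] assms(2) by (cases "x \<in> cube d") auto
qed

section \<open>Density of tensors and completeness\<close>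

lemma constant_tensor_approx:
  assumes "S \<in> tensors m d"
  shows "tensor_approx m d (\<lambda>_. S) (\<lambda>x. if x \<in> cube d then tensor_fun d S x else 0)"
  unfolding tensor_approx_iff tensor_Cauchy_def
  using assms by (auto simp: tens.nrm_def tens.ip_sub_self)

lemma hmix_tensor_distance:
  assumes f: "tensor_approx m d S f" and e: "e > 0"
  shows "\<exists>K. \<forall>k\<ge>K. hm.nrm (hm.sub f (\<lambda>x. if x \<in> cube d then tensor_fun d (S k) x else 0)) \<le> e"
proof -
  have C: "tensor_Cauchy S" using f by (simp add: tensor_approx_iff)
  note S = tensor_Cauchy_tensors[OF C]
  obtain K where K: "\<And>k l. k \<ge> K \<Longrightarrow> l \<ge> K \<Longrightarrow> tens.nrm (tens.sub (S k) (S l)) < e"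
    using C e unfolding tensor_Cauchy_def by meson
  have "hm.nrm (hm.sub f (\<lambda>x. if x \<in> cube d then tensor_fun d (S k) x else 0)) \<le> e" if "k \<ge> K" for k
  proof (rule LIMSEQ_le_const2)
    show "(\<lambda>l. tens.nrm (tens.sub (S l) (S k))) \<longlonglongrightarrow> hm.nrm (hm.sub f (\<lambda>x. if x \<in> cube d then tensor_fun d (S k) x else 0))"
      by (intro hmix_nrm_limit tensor_approx_linear f constant_tensor_approx S)
    show "\<exists>N. \<forall>l\<ge>N. tens.nrm (tens.sub (S l) (S k)) \<le> e"
      using K that by (intro exI[of _ K]) (auto intro: less_imp_le)
  qed
  then show ?thesis by blast
qed

text \<open>Each \<open>F k\<close> is replaced by a finite tensor within
  \<open>1 / (k + 1)\<close>. These tensors form a Cauchy sequence, their values converge at every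
  point of the cube, and the limit function belongs to the space by construction.\<close>

lemma hmix_complete:
  assumes F: "\<And>k. F k \<in> hmix m d"
    and C: "\<And>e. e > 0 \<Longrightarrow> \<exists>K. \<forall>k\<ge>K. \<forall>l\<ge>K. hm.nrm (hm.sub (F k) (F l)) < e"
  obtains f where "f \<in> hmix m d" "(\<lambda>k. hm.nrm (hm.sub (F k) f)) \<longlonglongrightarrow> 0"
proof -
  let ?tf = "\<lambda>S x. if x \<in> cube d then tensor_fun d S x else 0"
  have tf: "?tf S \<in> hmix m d" if "S \<in> tensors m d" for S
    using constant_tensor_approx[OF that] by (auto simp: hmix_def)
  have "\<exists>S. S \<in> tensors m d \<and> hm.nrm (hm.sub (F k) (?tf S)) \<le> 1 / real (Suc k)" for k
  proof -
    obtain S where S: "tensor_approx m d S (F k)" using F by (rule hmix_approxE)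
    obtain K where K: "\<forall>l\<ge>K. hm.nrm (hm.sub (F k) (?tf (S l))) \<le> 1 / real (Suc k)"
      using hmix_tensor_distance[OF S, of "1 / real (Suc k)"] by auto
    then show ?thesis using S by (intro exI[of _ "S K"]) (auto simp: tensor_approx_iff tensor_Cauchy_def)
  qed
  then have "\<exists>S. \<forall>k. S k \<in> tensors m d \<and> hm.nrm (hm.sub (F k) (?tf (S k))) \<le> 1 / real (Suc k)"
    by (intro choice allI)
  then obtain S where S0: "\<forall>k. S k \<in> tensors m d \<and> hm.nrm (hm.sub (F k) (?tf (S k))) \<le> 1 / real (Suc k)"
    by (elim exE)
  have S: "S k \<in> tensors m d" "hm.nrm (hm.sub (F k) (?tf (S k))) \<le> 1 / real (Suc k)" for k
    using S0[THEN spec, of k] by (rule conjunct1, rule conjunct2)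
  have null: "(\<lambda>k. hm.nrm (hm.sub (F k) (?tf (S k)))) \<longlonglongrightarrow> 0"
  proof (rule Lim_null_comparison)
    show "\<forall>\<^sub>F k in sequentially. norm (hm.nrm (hm.sub (F k) (?tf (S k)))) \<le> 1 / real (Suc k)"
      using S hm.nrm_nonneg[OF hm.sub_closed[OF F tf[OF S(1)]]] by (intro always_eventually) auto
    show "(\<lambda>k. 1 / real (Suc k)) \<longlonglongrightarrow> 0" using LIMSEQ_inverse_real_of_nat by (simp add: field_simps)
  qed
  \<comment> \<open>Constant sequences represent the functions \<open>?tf (S k)\<close>, so
    distances of tensors and of their functions coincide.\<close>
  have nn: "tens.nrm (tens.sub (S k) (S l)) = hm.nrm (hm.sub (?tf (S k)) (?tf (S l)))" for k l
  proof -
    have "(\<lambda>_::nat. tens.nrm (tens.sub (S k) (S l))) \<longlonglongrightarrow> hm.nrm (hm.sub (?tf (S k)) (?tf (S l)))"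
      by (intro hmix_nrm_limit tensor_approx_linear constant_tensor_approx S)
    then show ?thesis using LIMSEQ_unique tendsto_const by blast
  qed
  have TC: "tensor_Cauchy S"
    unfolding tensor_Cauchy_def
  proof (intro conjI allI impI S)
    fix e :: real assume e: "e > 0"
    then have e3: "e / 3 > 0" by simp
    obtain K where K: "\<And>k l. k \<ge> K \<Longrightarrow> l \<ge> K \<Longrightarrow> hm.nrm (hm.sub (F k) (F l)) < e / 3"
      using C[OF e3] by blast
    obtain L where L: "\<And>k. k \<ge> L \<Longrightarrow> hm.nrm (hm.sub (F k) (?tf (S k))) < e / 3"
      using order_tendstoD(2)[OF null e3] by (auto simp: eventually_sequentially)
    have "tens.nrm (tens.sub (S k) (S l)) < e" if k: "k \<ge> max K L" and l: "l \<ge> max K L" for k l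
    proof -
      have "tens.nrm (tens.sub (S k) (S l)) \<le> hm.nrm (hm.sub (?tf (S k)) (F k)) + hm.nrm (hm.sub (F k) (?tf (S l)))"
        unfolding nn by (rule hm.nrm_sub_triangle[OF tf[OF S(1)] F tf[OF S(1)]])
      also have "hm.nrm (hm.sub (F k) (?tf (S l))) \<le> hm.nrm (hm.sub (F k) (F l)) + hm.nrm (hm.sub (F l) (?tf (S l)))"
        by (rule hm.nrm_sub_triangle[OF F F tf[OF S(1)]])
      finally show ?thesis
        using K[of k l] L[of k] L[of l] k l hm.nrm_sub_commute[OF F tf[OF S(1)], of k k] by simp
    qed
    then show "\<exists>K. \<forall>k\<ge>K. \<forall>l\<ge>K. tens.nrm (tens.sub (S k) (S l)) < e"
      by (intro exI[of _ "max K L"]) blast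
  qed
  have conv: "convergent (\<lambda>k. tensor_fun d (S k) x)" if x: "x \<in> cube d" for x
  proof -
    have "Cauchy (\<lambda>k. tensor_fun d (S k) x)"
    proof (rule metric_CauchyI)
      fix e :: real assume "e > 0"
      then have e: "e / eval_bound > 0" using eval_bound_ge_1 by simp
      then obtain K where K: "\<And>k l. k \<ge> K \<Longrightarrow> l \<ge> K \<Longrightarrow> tens.nrm (tens.sub (S k) (S l)) < e / eval_bound"
        using TC unfolding tensor_Cauchy_def by meson
      have "dist (tensor_fun d (S k) x) (tensor_fun d (S l) x) < e" if "k \<ge> K" "l \<ge> K" for k l
      proof -
        have "dist (tensor_fun d (S k) x) (tensor_fun d (S l) x) = \<bar>tensor_fun d (tens.sub (S k) (S l)) x\<bar>"
          using S by (simp add: tensor_fun_linear dist_real_def)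
        also have "\<dots> \<le> eval_bound * tens.nrm (tens.sub (S k) (S l))"
          using S x by (intro tensor_fun_le tensors_append tensors_scale)
        also have "\<dots> < eval_bound * (e / eval_bound)"
          using K[OF that] eval_bound_ge_1 by (intro mult_strict_left_mono) auto
        also have "\<dots> = e" using eval_bound_ge_1 by simp
        finally show ?thesis .
      qed
      then show "\<exists>M. \<forall>k\<ge>M. \<forall>l\<ge>M. dist (tensor_fun d (S k) x) (tensor_fun d (S l) x) < e" by blast
    qed
    then show ?thesis by (rule Cauchy_convergent)
  qed
  define f where "f x = (if x \<in> cube d then lim (\<lambda>k. tensor_fun d (S k) x) else 0)" for x
  have Sf: "tensor_approx m d S f"
    unfolding tensor_approx_iff using TC conv by (auto simp: f_def convergent_LIMSEQ_iff)
  have f: "f \<in> hmix m d" using Sf by (auto simp: hmix_def f_def)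
  have null2: "(\<lambda>k. hm.nrm (hm.sub (?tf (S k)) f)) \<longlonglongrightarrow> 0"
  proof (rule LIMSEQ_I)
    fix e :: real assume e: "e > 0"
    then have "e / 2 > 0" by simp
    from hmix_tensor_distance[OF Sf this] obtain K where K: "\<forall>k\<ge>K. hm.nrm (hm.sub f (?tf (S k))) \<le> e / 2" by blast
    have "norm (hm.nrm (hm.sub (?tf (S k)) f) - 0) < e" if k: "k \<ge> K" for k
    proof -
      have "hm.nrm (hm.sub f (?tf (S k))) \<le> e / 2" using K k by blast
      moreover have "0 \<le> hm.nrm (hm.sub (?tf (S k)) f)" by (intro hm.nrm_nonneg hm.sub_closed f tf S)
      ultimately show ?thesis
        unfolding hm.nrm_sub_commute[OF f tf[OF S(1)]] using e by simp
    qed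
    then show "\<exists>K. \<forall>k\<ge>K. norm (hm.nrm (hm.sub (?tf (S k)) f) - 0) < e" by blast
  qed
  have "(\<lambda>k. hm.nrm (hm.sub (F k) f)) \<longlonglongrightarrow> 0"
  proof (rule Lim_null_comparison)
    show "\<forall>\<^sub>F k in sequentially. norm (hm.nrm (hm.sub (F k) f))
        \<le> hm.nrm (hm.sub (F k) (?tf (S k))) + hm.nrm (hm.sub (?tf (S k)) f)"
      using hm.nrm_sub_triangle[OF F tf[OF S(1)] f] hm.nrm_nonneg[OF hm.sub_closed[OF F f]]
      by (intro always_eventually) auto
    show "(\<lambda>k. hm.nrm (hm.sub (F k) (?tf (S k))) + hm.nrm (hm.sub (?tf (S k)) f)) \<longlonglongrightarrow> 0"
      by (intro tendsto_add_zero null null2)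
  qed
  with f that show ?thesis by blast
qed

end

section \<open>Effective-variable subspaces\<close>

lemma anchor_extend_cube: "x \<in> cube d \<Longrightarrow> anchor_extend d v x \<in> cube d"
  by (auto simp: cube_def anchor_extend_def PiE_iff)

lemma anchor_extend_twice: "anchor_extend d w (anchor_extend d v x) = anchor_extend d (v \<inter> w) x"
  by (auto simp: anchor_extend_def fun_eq_iff)

lemma restrict_anchor_extend:
  "u \<subseteq> {1..d} \<Longrightarrow> restrict (anchor_extend d w x) u = (\<lambda>j\<in>u. if j \<in> w then restrict x u j else 0)"
  by (auto simp: anchor_extend_def fun_eq_iff)

text \<open>The coefficients are obtained by splitting off a maximal element of \<open>\<Lambda>\<close>.\<close>

lemma anchor_representation:
  assumes "finite \<Lambda>" "\<Lambda> \<subseteq> Pow {1..d}" "downward_closed \<Lambda>"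
  shows "\<exists>c. \<forall>f g. (\<forall>x\<in>cube d. f x = (\<Sum>u\<in>\<Lambda>. g u (restrict x u))) \<longrightarrow>
    (\<forall>x\<in>cube d. f x = (\<Sum>v\<in>\<Lambda>. c v * f (anchor_extend d v x) :: real))"
  using assms
proof (induction \<Lambda> rule: finite_psubset_induct)
  case (psubset \<Lambda>)
  show ?case
  proof (cases "\<Lambda> = {}")
    case True
    then show ?thesis by simp
  next
    case False
    then obtain w where w: "w \<in> \<Lambda>" and max: "\<And>u. u \<in> \<Lambda> \<Longrightarrow> w \<subseteq> u \<Longrightarrow> w = u"
      using finite_has_maximal[OF psubset.hyps] by metis
    let ?\<Lambda>' = "\<Lambda> - {w}"
    have down: "v \<in> \<Lambda>" if "u \<in> \<Lambda>" "v \<subseteq> u" for u v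
      using psubset.prems(2) that by (auto simp: downward_closed_def)
    have "downward_closed ?\<Lambda>'"
      unfolding downward_closed_def using down max by blast
    moreover have "?\<Lambda>' \<subset> \<Lambda>" "?\<Lambda>' \<subseteq> Pow {1..d}" using w psubset.prems(1) by auto
    ultimately have "\<exists>c. \<forall>f g. (\<forall>x\<in>cube d. f x = (\<Sum>u\<in>?\<Lambda>'. g u (restrict x u))) \<longrightarrow>
        (\<forall>x\<in>cube d. f x = (\<Sum>v\<in>?\<Lambda>'. c v * f (anchor_extend d v x) :: real))"
      by (intro psubset.IH)
    then obtain c' where c': "\<forall>f g. (\<forall>x\<in>cube d. f x = (\<Sum>u\<in>?\<Lambda>'. g u (restrict x u))) \<longrightarrow>
        (\<forall>x\<in>cube d. f x = (\<Sum>v\<in>?\<Lambda>'. c' v * f (anchor_extend d v x) :: real))"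
      by (elim exE)
    \<comment> \<open>Inserting \<open>f' x = f x - f (anchor_extend d w x)\<close> into the
      representation over the smaller set produces values at \<open>v\<close> and at
      \<open>v \<inter> w\<close>; \<open>c z\<close> collects everything evaluated at
      \<open>z\<close>. Downward closedness keeps \<open>v \<inter> w\<close> in \<Lambda>.\<close>
    define c where "c z = (if z = w then 1 else c' z) - (\<Sum>v\<in>{v\<in>?\<Lambda>'. v \<inter> w = z}. c' v)" for z
    have "f x = (\<Sum>v\<in>\<Lambda>. c v * f (anchor_extend d v x))"
      if f: "\<forall>x\<in>cube d. f x = (\<Sum>u\<in>\<Lambda>. g u (restrict x u))" and x: "x \<in> cube d" for f g x
    proof -
      \<comment> \<open>Subtracting the restriction to the variables in \<open>w\<close> removes the
        component \<open>g w\<close>, and every other component remains a function of the variables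
        in its own set.\<close>
      define f' where "f' x = f x - f (anchor_extend d w x)" for x
      define g' where "g' u y = g u y - g u (\<lambda>j\<in>u. if j \<in> w then y j else 0)" for u y
      have f'g': "f' x = (\<Sum>u\<in>?\<Lambda>'. g' u (restrict x u))" if x: "x \<in> cube d" for x
      proof -
        have "f' x = (\<Sum>u\<in>\<Lambda>. g u (restrict x u) - g u (restrict (anchor_extend d w x) u))"
          using f x anchor_extend_cube[OF x] by (simp add: f'_def sum_subtractf)
        also have "\<dots> = (\<Sum>u\<in>\<Lambda>. g' u (restrict x u))"
          using psubset.prems(1) by (intro sum.cong refl) (subst restrict_anchor_extend, auto simp: g'_def)
        also have "\<dots> = g' w (restrict x w) + (\<Sum>u\<in>?\<Lambda>'. g' u (restrict x u))"
          using w psubset.hyps by (rule sum.remove[rotated])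
        also have "g' w (restrict x w) = 0"
        proof -
          have "(\<lambda>j\<in>w. if j \<in> w then restrict x w j else 0) = restrict x w" by auto
          then show ?thesis by (simp add: g'_def)
        qed
        finally show ?thesis by (simp only: add_0_left)
      qed
      have "f x = f (anchor_extend d w x) + (\<Sum>v\<in>?\<Lambda>'. c' v * f' (anchor_extend d v x))"
      proof -
        from c'[rule_format, of f' g', OF f'g' x] show ?thesis by (simp add: f'_def)
      qed
      also have "\<dots> = f (anchor_extend d w x) + (\<Sum>v\<in>?\<Lambda>'. c' v * f (anchor_extend d v x))
          - (\<Sum>v\<in>?\<Lambda>'. c' v * f (anchor_extend d (v \<inter> w) x))"
        by (simp add: f'_def anchor_extend_twice right_diff_distrib sum_subtractf)
      also have "f (anchor_extend d w x) + (\<Sum>v\<in>?\<Lambda>'. c' v * f (anchor_extend d v x))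
          = (\<Sum>v\<in>\<Lambda>. (if v = w then 1 else c' v) * f (anchor_extend d v x))"
        using w psubset.hyps by (subst sum.remove[of \<Lambda> w]) (auto intro!: sum.cong)
      also have "(\<Sum>v\<in>?\<Lambda>'. c' v * f (anchor_extend d (v \<inter> w) x))
          = (\<Sum>z\<in>\<Lambda>. \<Sum>v\<in>{v\<in>?\<Lambda>'. v \<inter> w = z}. c' v * f (anchor_extend d (v \<inter> w) x))"
        using psubset.hyps down by (intro sum.group[symmetric]) auto
      also have "\<dots> = (\<Sum>z\<in>\<Lambda>. (\<Sum>v\<in>{v\<in>?\<Lambda>'. v \<inter> w = z}. c' v) * f (anchor_extend d z x))"
        unfolding sum_distrib_right by (intro sum.cong refl) auto
      finally show ?thesis by (simp add: c_def left_diff_distrib sum_subtractf)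
    qed
    then show ?thesis by (intro exI[of _ c]) blast
  qed
qed

context mixed_sobolev
begin

lemma hmix_sub_hmix: "f \<in> hmix_sub m d \<Lambda> \<Longrightarrow> f \<in> hmix m d"
  by (simp add: hmix_sub_def)

lemma hmix_subI:
  assumes "f \<in> hmix m d" "\<And>x. x \<in> cube d \<Longrightarrow> f x = (\<Sum>u\<in>\<Lambda>. g u (restrict x u))"
  shows "f \<in> hmix_sub m d \<Lambda>"
  unfolding hmix_sub_def using assms by (intro CollectI conjI exI[of _ g] ballI)

lemma hmix_sub_linear:
  assumes "f \<in> hmix_sub m d \<Lambda>" "g \<in> hmix_sub m d \<Lambda>"
  shows "(\<lambda>x. f x + c * g x) \<in> hmix_sub m d \<Lambda>"
proof -
  obtain a b where "\<forall>x\<in>cube d. f x = (\<Sum>u\<in>\<Lambda>. a u (restrict x u))" "\<forall>x\<in>cube d. g x = (\<Sum>u\<in>\<Lambda>. b u (restrict x u))"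
    using assms unfolding hmix_sub_def by blast
  then show ?thesis
    by (intro hmix_subI[where g = "\<lambda>u y. a u y + c * b u y"] hmix_linear assms[THEN hmix_sub_hmix])
      (simp add: sum.distrib sum_distrib_left)
qed

lemma hmix_sub_zero: "(\<lambda>x. 0) \<in> hmix_sub m d \<Lambda>"
  unfolding hmix_sub_def using hmix_zero by (auto intro!: exI[of _ "\<lambda>_ _. 0"])

text \<open>Replaces the existence of unspecified components by a linear identity between point
  values with fixed coefficients. Conversely, the right-hand side of the identity has the required
  form, since an anchored value depends on \<open>restrict x v\<close> only.\<close>

lemma hmix_sub_iff:
  assumes "\<Lambda> \<subseteq> Pow {1..d}" "downward_closed \<Lambda>"
  shows "\<exists>c. \<forall>f. f \<in> hmix_sub m d \<Lambda> \<longleftrightarrow>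
    f \<in> hmix m d \<and> (\<forall>x\<in>cube d. f x = (\<Sum>v\<in>\<Lambda>. c v * f (anchor_extend d v x)))"
proof -
  have "finite \<Lambda>" using assms(1) finite_subset by blast
  from anchor_representation[OF this assms] obtain c where
    c: "\<And>f g. (\<forall>x\<in>cube d. f x = (\<Sum>u\<in>\<Lambda>. g u (restrict x u))) \<Longrightarrow>
      (\<forall>x\<in>cube d. f x = (\<Sum>v\<in>\<Lambda>. c v * f (anchor_extend d v x) :: real))" by blast
  have "f \<in> hmix_sub m d \<Lambda>" if f: "f \<in> hmix m d" and
    eq: "\<forall>x\<in>cube d. f x = (\<Sum>v\<in>\<Lambda>. c v * f (anchor_extend d v x))" for f
  proof -
    have "anchor_extend d v (restrict x v) = anchor_extend d v x" for v x
      by (auto simp: anchor_extend_def fun_eq_iff)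
    then show ?thesis
      using eq by (intro hmix_subI[where g = "\<lambda>u y. c u * f (anchor_extend d u y)"] f) simp
  qed
  moreover have "f \<in> hmix m d \<and> (\<forall>x\<in>cube d. f x = (\<Sum>v\<in>\<Lambda>. c v * f (anchor_extend d v x)))"
    if "f \<in> hmix_sub m d \<Lambda>" for f
    using that c unfolding hmix_sub_def by blast
  ultimately show ?thesis by blast
qed

section \<open>Norm limits and closedness of the subspaces\<close>

lemma hmix_abs_le: "f \<in> hmix m d \<Longrightarrow> \<bar>f x\<bar> \<le> eval_bound * hm.nrm f"
  using hmix_le[of f x] hmix_outside[of f x] eval_bound_ge_1 hm.nrm_nonneg[of f] by (cases "x \<in> cube d") auto

lemma hmix_pointwise:
  assumes "\<And>k. F k \<in> hmix m d" "f \<in> hmix m d" "(\<lambda>k. hm.nrm (hm.sub (F k) f)) \<longlonglongrightarrow> 0"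
  shows "(\<lambda>k. F k x) \<longlonglongrightarrow> f x"
proof -
  have "(\<lambda>k. F k x - f x) \<longlonglongrightarrow> 0"
  proof (rule Lim_null_comparison)
    show "\<forall>\<^sub>F k in sequentially. norm (F k x - f x) \<le> eval_bound * hm.nrm (hm.sub (F k) f)"
      using hmix_abs_le[OF hm.sub_closed[OF assms(1,2)]] by (intro always_eventually) auto
    show "(\<lambda>k. eval_bound * hm.nrm (hm.sub (F k) f)) \<longlonglongrightarrow> 0"
      by (intro tendsto_mult_right_zero assms(3))
  qed
  then show ?thesis by (simp add: LIM_zero_iff)
qed

lemma hmix_nrm_tendsto:
  assumes "\<And>k. F k \<in> hmix m d" "f \<in> hmix m d" "(\<lambda>k. hm.nrm (hm.sub (F k) f)) \<longlonglongrightarrow> 0"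
  shows "(\<lambda>k. hm.nrm (F k)) \<longlonglongrightarrow> hm.nrm f"
proof -
  have "(\<lambda>k. hm.nrm (F k) - hm.nrm f) \<longlonglongrightarrow> 0"
    by (rule Lim_null_comparison[OF _ assms(3)])
      (use hm.abs_nrm_diff_le[OF assms(1,2)] in \<open>auto intro: always_eventually\<close>)
  then show ?thesis by (simp add: LIM_zero_iff)
qed

text \<open>The identity that characterizes membership involves finitely many point values for each
  \<open>x\<close>, and point values pass to norm limits.\<close>

lemma hmix_sub_closed:
  assumes \<Lambda>: "\<Lambda> \<subseteq> Pow {1..d}" "downward_closed \<Lambda>"
    and F: "\<And>k. F k \<in> hmix_sub m d \<Lambda>" and f: "f \<in> hmix m d"
    and lim: "(\<lambda>k. hm.nrm (hm.sub (F k) f)) \<longlonglongrightarrow> 0"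
  shows "f \<in> hmix_sub m d \<Lambda>"
proof -
  obtain c where c: "\<And>f. f \<in> hmix_sub m d \<Lambda> \<longleftrightarrow>
    f \<in> hmix m d \<and> (\<forall>x\<in>cube d. f x = (\<Sum>v\<in>\<Lambda>. c v * f (anchor_extend d v x)))"
    using hmix_sub_iff[OF \<Lambda>] by blast
  have pt: "(\<lambda>k. F k x) \<longlonglongrightarrow> f x" for x
    by (rule hmix_pointwise[OF hmix_sub_hmix[OF F] f lim])
  have "f x = (\<Sum>v\<in>\<Lambda>. c v * f (anchor_extend d v x))" if x: "x \<in> cube d" for x
  proof -
    have "(\<lambda>k. \<Sum>v\<in>\<Lambda>. c v * F k (anchor_extend d v x)) \<longlonglongrightarrow> (\<Sum>v\<in>\<Lambda>. c v * f (anchor_extend d v x))"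
      by (intro tendsto_intros pt)
    moreover have "(\<Sum>v\<in>\<Lambda>. c v * F k (anchor_extend d v x)) = F k x" for k
      by (rule bspec[OF conjunct2[OF iffD1[OF c F]] x, symmetric])
    ultimately show ?thesis using pt[of x] LIMSEQ_unique by simp
  qed
  then show ?thesis using c f by blast
qed

section \<open>Penalized least squares\<close>

end

text \<open>All functions form the carrier, because a multiset of points makes every sum finite. The
  form is degenerate: it sees a function on \<open>X\<close> only.\<close>

interpretation sample: semi_inner UNIV "\<lambda>f g x. f x + g x" "\<lambda>c f x. c * f x" "\<lambda>f g. \<Sum>x\<in>#X. f x * g x :: real"
  for X :: "'a multiset"
proof
  fix f g h :: "'a \<Rightarrow> real" and c
  show "(\<Sum>x\<in>#X. f x * g x) = (\<Sum>x\<in>#X. g x * f x)" by (simp add: mult.commute)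
  show "(\<Sum>x\<in>#X. (f x + g x) * h x) = (\<Sum>x\<in>#X. f x * h x) + (\<Sum>x\<in>#X. g x * h x)"
    by (induction X) (simp_all add: algebra_simps)
  show "(\<Sum>x\<in>#X. c * f x * g x) = c * (\<Sum>x\<in>#X. f x * g x)"
    by (induction X) (simp_all add: algebra_simps)
  show "0 \<le> (\<Sum>x\<in>#X. f x * f x)"
    by (induction X) simp_all
qed auto

lemma l2_sample_nrm: "l2_sample_norm X g = sample.nrm X g"
  by (simp add: l2_sample_norm_def sample.nrm_def power2_eq_square)

context mixed_sobolev
begin

lemma pls_functional_eq:
  "s \<in> hmix m d \<Longrightarrow> pls_functional m d X lam f s = (sample.nrm X (sample.sub f s))\<^sup>2 + lam * (hm.nrm s)\<^sup>2"
  by (simp add: pls_functional_def hmix_norm_nrm sample.nrm_sq) (simp add: power2_eq_square)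

text \<open>The parallelogram law yields both the existence and the uniqueness of the minimizer.\<close>

lemma pls_functional_midpoint:
  assumes s: "s \<in> hmix m d" and t: "t \<in> hmix m d"
  shows "pls_functional m d X lam f (\<lambda>x. s x / 2 + 1/2 * t x) \<le>
    (pls_functional m d X lam f s + pls_functional m d X lam f t) / 2 - lam / 4 * (hm.nrm (hm.sub s t))\<^sup>2"
proof -
  have mid: "(\<lambda>x. 1/2 * s x + 1/2 * t x) \<in> hmix m d"
    by (intro hmix_add hmix_scale s t)
  have H: "(hm.nrm (\<lambda>x. 1/2 * s x + 1/2 * t x))\<^sup>2 = ((hm.nrm s)\<^sup>2 + (hm.nrm t)\<^sup>2) / 2 - 1/4 * (hm.nrm (hm.sub s t))\<^sup>2"
  proof -
    have "hmix_inner m d (\<lambda>x. 1/2 * s x + 1/2 * t x) (\<lambda>x. 1/2 * s x + 1/2 * t x)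
      = hmix_inner m d (\<lambda>x. 1/2 * s x) (\<lambda>x. 1/2 * s x) + 2 * (1/2) * hmix_inner m d (\<lambda>x. 1/2 * s x) t
        + (1/2)\<^sup>2 * hmix_inner m d t t"
      by (rule hm.ip_add_smul_self[OF hmix_scale[OF s] t])
    also have "hmix_inner m d (\<lambda>x. 1/2 * s x) (\<lambda>x. 1/2 * s x) = 1/2 * (1/2 * hmix_inner m d s s)"
      unfolding hm.ip_smul[OF s hmix_scale[OF s]] hm.ip_smul_right[OF s s] ..
    also have "hmix_inner m d (\<lambda>x. 1/2 * s x) t = 1/2 * hmix_inner m d s t"
      by (rule hm.ip_smul[OF s t])
    finally show ?thesis
      unfolding hm.nrm_sq[OF mid] hm.nrm_sq[OF s] hm.nrm_sq[OF t] hm.nrm_sq[OF hm.sub_closed[OF s t]]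
        hm.ip_sub_self[OF s t]
      by (simp add: power2_eq_square field_simps)
  qed
  have "(f x - (1/2 * s x + 1/2 * t x))\<^sup>2 \<le> ((f x - s x)\<^sup>2 + (f x - t x)\<^sup>2) / 2" for x
  proof -
    have "((f x - s x)\<^sup>2 + (f x - t x)\<^sup>2) / 2 - (f x - (1/2 * s x + 1/2 * t x))\<^sup>2 = ((s x - t x) / 2)\<^sup>2"
      by (simp add: power2_eq_square field_simps)
    then show ?thesis by (smt (verit) zero_le_power2)
  qed
  then have "(\<Sum>x\<in>#X. (f x - (1/2 * s x + 1/2 * t x))\<^sup>2) \<le> (\<Sum>x\<in>#X. ((f x - s x)\<^sup>2 + (f x - t x)\<^sup>2) / 2)"
    by (intro sum_mset_mono)
  also have "\<dots> = ((\<Sum>x\<in>#X. (f x - s x)\<^sup>2) + (\<Sum>x\<in>#X. (f x - t x)\<^sup>2)) / 2"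
    by (induction X) (simp_all add: field_simps)
  finally have "(\<Sum>x\<in>#X. (f x - (1/2 * s x + 1/2 * t x))\<^sup>2)
      \<le> ((\<Sum>x\<in>#X. (f x - s x)\<^sup>2) + (\<Sum>x\<in>#X. (f x - t x)\<^sup>2)) / 2" .
  moreover have "lam * (hm.nrm (\<lambda>x. 1/2 * s x + 1/2 * t x))\<^sup>2
      = lam * ((hm.nrm s)\<^sup>2 + (hm.nrm t)\<^sup>2) / 2 - lam / 4 * (hm.nrm (hm.sub s t))\<^sup>2"
    unfolding H by (simp add: field_simps)
  ultimately show ?thesis
    by (simp add: pls_functional_def hmix_norm_nrm field_simps)
qed

text \<open>By the midpoint inequality the squared distance of two elements is controlled by the
  excess of their functional values over the infimum. So a minimizing sequence is Cauchy; its limit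
  lies in the closed subspace and the functional is continuous along it. The same inequality for two
  minimizers gives uniqueness.\<close>

lemma pls_exists_unique:
  assumes \<Lambda>: "\<Lambda> \<subseteq> Pow {1..d}" "downward_closed \<Lambda>" and lam: "lam > 0"
  shows "\<exists>!s. is_arg_min (pls_functional m d X lam f) (\<lambda>s. s \<in> hmix_sub m d \<Lambda>) s"
proof -
  let ?J = "pls_functional m d X lam f" and ?V = "hmix_sub m d \<Lambda>"
  have V: "s \<in> hmix m d" if "s \<in> ?V" for s using that by (rule hmix_sub_hmix)
  have Jnn: "?J s \<ge> 0" if "s \<in> ?V" for s
    using pls_functional_eq[OF V[OF that], of X lam f] lam by simp
  have bdd: "bdd_below (?J ` ?V)" using Jnn by (intro bdd_belowI2)
  define I where "I = (INF s\<in>?V. ?J s)"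
  have I: "I \<le> ?J s" if "s \<in> ?V" for s unfolding I_def by (rule cINF_lower[OF bdd that])
  have mid: "(\<lambda>x. s x / 2 + 1/2 * t x) \<in> ?V" if "s \<in> ?V" "t \<in> ?V" for s t
    using hmix_sub_linear[OF hmix_sub_linear[OF hmix_sub_zero that(1), of "1/2"] that(2), of "1/2"] by simp
  have key: "lam / 4 * (hm.nrm (hm.sub s t))\<^sup>2 \<le> (?J s + ?J t) / 2 - I" if "s \<in> ?V" "t \<in> ?V" for s t
    using pls_functional_midpoint[OF V[OF that(1)] V[OF that(2)], of X lam f] I[OF mid[OF that]] by linarith
  have "\<exists>s\<in>?V. ?J s < I + 1 / real (Suc k)" for k
  proof -
    have "\<exists>y\<in>?J ` ?V. y < I + 1 / real (Suc k)"
      using hmix_sub_zero by (intro cInf_lessD) (auto simp: I_def)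
    then show ?thesis by blast
  qed
  then obtain S where S: "\<And>k. S k \<in> ?V" "\<And>k. ?J (S k) < I + 1 / real (Suc k)" by metis
  obtain s where s: "s \<in> hmix m d" "(\<lambda>k. hm.nrm (hm.sub (S k) s)) \<longlonglongrightarrow> 0"
  proof (rule hmix_complete[of S])
    show "S k \<in> hmix m d" for k using V S by blast
    fix e :: real assume e: "e > 0"
    then have "lam / 4 * e\<^sup>2 > 0" using lam by simp
    \<comment> \<open>The excess enters through the average over the two elements, so it suffices
      that each is below this bound.\<close>
    then obtain K where K: "inverse (real (Suc K)) < lam / 4 * e\<^sup>2" using reals_Archimedean by blast
    have arith: "x < y" if "x \<le> (a + b) / 2 - i" "a < i + p" "b < i + q" "p \<le> r" "q \<le> r" "r < y"
      for x y a b i p q r :: real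
      using that by (simp add: field_simps)
    have "hm.nrm (hm.sub (S k) (S l)) < e" if k: "k \<ge> K" and l: "l \<ge> K" for k l
    proof -
      have "1 / real (Suc k) \<le> 1 / real (Suc K)" "1 / real (Suc l) \<le> 1 / real (Suc K)"
        using k l by (auto intro!: divide_left_mono)
      then have "lam / 4 * (hm.nrm (hm.sub (S k) (S l)))\<^sup>2 < lam / 4 * e\<^sup>2"
        by (rule arith[OF key[OF S(1) S(1)] S(2) S(2) _ _ K[unfolded inverse_eq_divide]])
      then have "(hm.nrm (hm.sub (S k) (S l)))\<^sup>2 < e\<^sup>2" using lam by simp
      then show ?thesis using e by (simp add: power2_less_imp_less)
    qed
    then show "\<exists>K. \<forall>k\<ge>K. \<forall>l\<ge>K. hm.nrm (hm.sub (S k) (S l)) < e" by blast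
  qed blast
  have Sh: "S k \<in> hmix m d" for k using V S by blast
  have sV: "s \<in> ?V" by (rule hmix_sub_closed[OF \<Lambda> S(1) s])
  have "(\<lambda>k. ?J (S k)) \<longlonglongrightarrow> ?J s"
    unfolding pls_functional_def hmix_norm_nrm
  proof (intro tendsto_add tendsto_mult tendsto_const tendsto_power)
    show "(\<lambda>k. hm.nrm (S k)) \<longlonglongrightarrow> hm.nrm s" by (rule hmix_nrm_tendsto[OF Sh s])
    show "(\<lambda>k. \<Sum>x\<in>#X. (f x - S k x)\<^sup>2) \<longlonglongrightarrow> (\<Sum>x\<in>#X. (f x - s x)\<^sup>2)"
    proof (induction X)
      case (add x X)
      have "(\<lambda>k. S k x) \<longlonglongrightarrow> s x" by (rule hmix_pointwise[OF Sh s])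
      then have "(\<lambda>k. (f x - S k x)\<^sup>2) \<longlonglongrightarrow> (f x - s x)\<^sup>2" by (intro tendsto_intros)
      then show ?case using add by (simp add: tendsto_add)
    qed simp
  qed
  moreover have "(\<lambda>k. I + 1 / real (Suc k)) \<longlonglongrightarrow> I + 0"
    using LIMSEQ_inverse_real_of_nat by (intro tendsto_intros) (simp add: inverse_eq_divide)
  ultimately have "?J s \<le> I + 0"
    by (rule LIMSEQ_le) (use S(2) in \<open>auto intro: less_imp_le\<close>)
  then have Js: "?J s \<le> I" by simp
  show ?thesis
  proof (rule ex1I[of _ s])
    show "is_arg_min ?J (\<lambda>s. s \<in> ?V) s"
      unfolding is_arg_min_def using sV I Js by fastforce
    fix t assume t: "is_arg_min ?J (\<lambda>s. s \<in> ?V) t"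
    then have tV: "t \<in> ?V" and Jt: "?J t \<le> ?J s" using sV by (auto simp: is_arg_min_def not_less)
    have arith: "x \<le> 0" if "x \<le> (a + b) / 2 - i" "a \<le> b" "b \<le> i" for x a b i :: real
      using that by (simp add: field_simps)
    have "lam / 4 * (hm.nrm (hm.sub t s))\<^sup>2 \<le> 0" by (rule arith[OF key[OF tV sV] Jt Js])
    then have "hm.nrm (hm.sub t s) = 0" using lam by (simp add: mult_le_0_iff)
    then have "hm.sub t s = (\<lambda>x. 0)"
      by (intro hmix_nrm_zero hm.sub_closed V tV sV)
    then show "t = s" by (auto simp: fun_eq_iff)
  qed
qed

lemma pls_minimizer:
  assumes "\<Lambda> \<subseteq> Pow {1..d}" "downward_closed \<Lambda>" "lam > 0"
  shows "pls m d X lam \<Lambda> f \<in> hmix_sub m d \<Lambda>"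
    and "s \<in> hmix_sub m d \<Lambda> \<Longrightarrow> pls_functional m d X lam f (pls m d X lam \<Lambda> f) \<le> pls_functional m d X lam f s"
proof -
  have "is_arg_min (pls_functional m d X lam f) (\<lambda>s. s \<in> hmix_sub m d \<Lambda>) (pls m d X lam \<Lambda> f)"
    unfolding pls_def by (rule theI'[OF pls_exists_unique[OF assms]])
  then show "pls m d X lam \<Lambda> f \<in> hmix_sub m d \<Lambda>"
    and "s \<in> hmix_sub m d \<Lambda> \<Longrightarrow> pls_functional m d X lam f (pls m d X lam \<Lambda> f) \<le> pls_functional m d X lam f s"
    by (auto simp: is_arg_min_def not_less)
qed

text \<open>Comparison with the competitor \<open>f1\<close>, whose residual is \<open>f2\<close>,
  bounds both terms of the functional at the minimizer. The bounds for \<open>f1 - s\<close> follow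
  from the triangle inequality, in the sample norm through
  \<open>f1 - s = (f - s) - f2\<close>.\<close>

lemma pls_stability:
  fixes X :: "(nat \<Rightarrow> real) multiset"
  assumes \<Lambda>: "\<Lambda> \<subseteq> Pow {1..d}" "downward_closed \<Lambda>" and lam: "lam > 0"
    and f1: "f1 \<in> hmix_sub m d \<Lambda>" and f: "f = (\<lambda>x. f1 x + f2 x)"
  defines "s \<equiv> pls m d X lam \<Lambda> f"
  shows "hm.nrm (hm.sub f1 s) \<le> 2 * hm.nrm f1 + sample.nrm X f2 / sqrt lam"
    and "sample.nrm X (hm.sub f1 s) \<le> 2 * sample.nrm X f2 + sqrt lam * hm.nrm f1"
proof -
  have sV: "s \<in> hmix_sub m d \<Lambda>" unfolding s_def by (rule pls_minimizer(1)[OF \<Lambda> lam])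
  note h = hmix_sub_hmix[OF sV] hmix_sub_hmix[OF f1]
  let ?a = "sample.nrm X (sample.sub f s)" and ?b = "hm.nrm s"
  let ?c = "sample.nrm X f2" and ?e = "sqrt lam * hm.nrm f1"
  have nn: "?a \<ge> 0" "?b \<ge> 0" "?c \<ge> 0" "hm.nrm f1 \<ge> 0"
    using h by (auto intro: sample.nrm_nonneg hm.nrm_nonneg)
  have "?a\<^sup>2 + lam * ?b\<^sup>2 \<le> (sample.nrm X (sample.sub f f1))\<^sup>2 + lam * (hm.nrm f1)\<^sup>2"
    using pls_minimizer(2)[OF \<Lambda> lam f1, of X f] h by (simp add: pls_functional_eq s_def)
  moreover have "sample.sub f f1 = f2" unfolding f by (simp add: fun_eq_iff)
  ultimately have le: "?a\<^sup>2 + lam * ?b\<^sup>2 \<le> ?c\<^sup>2 + lam * (hm.nrm f1)\<^sup>2" by simp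
  also have "\<dots> = ?c\<^sup>2 + ?e\<^sup>2" using lam by (simp add: power_mult_distrib)
  \<comment> \<open>The sum of two squares is enlarged to one square so that square roots can be
    taken.\<close>
  also have "\<dots> \<le> (?c + ?e)\<^sup>2" using nn lam by (simp add: power2_sum)
  finally have le: "?a\<^sup>2 + lam * ?b\<^sup>2 \<le> (?c + ?e)\<^sup>2" .
  have nn2: "?c + ?e \<ge> 0" using nn lam by simp
  have a: "?a \<le> ?c + ?e"
  proof (rule power2_le_imp_le[OF _ nn2])
    have "0 \<le> lam * ?b\<^sup>2" using lam by simp
    then show "?a\<^sup>2 \<le> (?c + ?e)\<^sup>2" using le by linarith
  qed
  have "sqrt lam * ?b \<le> ?c + ?e"
  proof (rule power2_le_imp_le[OF _ nn2])
    have "(sqrt lam * ?b)\<^sup>2 = lam * ?b\<^sup>2" using lam by (simp add: power_mult_distrib)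
    then show "(sqrt lam * ?b)\<^sup>2 \<le> (?c + ?e)\<^sup>2" using le by (smt (verit) zero_le_power2)
  qed
  then have b: "?b \<le> ?c / sqrt lam + hm.nrm f1" using lam by (simp add: field_simps)
  show "hm.nrm (hm.sub f1 s) \<le> 2 * hm.nrm f1 + ?c / sqrt lam"
    using hm.nrm_sub_le[OF h(2) h(1)] b by linarith
  have "hm.sub f1 s = sample.sub (sample.sub f s) f2" unfolding f by (simp add: fun_eq_iff)
  then have "sample.nrm X (hm.sub f1 s) \<le> ?a + ?c"
    using sample.nrm_sub_le[of "sample.sub f s" f2 X] by simp
  then show "sample.nrm X (hm.sub f1 s) \<le> 2 * ?c + ?e" using a by linarith
qed

text \<open>Pythagoras for the orthogonal parts. It allows the norm of \<open>f1\<close> from the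
  stability bounds to be replaced by the norm of \<open>f\<close>.\<close>

lemma hmix_compl_nrm_le:
  assumes f1: "f1 \<in> hmix_sub m d \<Lambda>" and f2: "f2 \<in> hmix_compl m d \<Lambda>"
  shows "hm.nrm f1 \<le> hm.nrm (\<lambda>x. f1 x + f2 x)"
proof (rule power2_le_imp_le)
  have h: "f1 \<in> hmix m d" "f2 \<in> hmix m d" "hmix_inner m d f2 f1 = 0"
    using assms by (auto simp: hmix_sub_def hmix_compl_def)
  show "(hm.nrm f1)\<^sup>2 \<le> (hm.nrm (\<lambda>x. f1 x + f2 x))\<^sup>2"
    using h hm.ip_commute[OF h(1,2)] hm.ip_nonneg[OF h(2)]
    by (simp add: hm.nrm_sq hmix_add hm.ip_add hm.ip_add_right)
  show "0 \<le> hm.nrm (\<lambda>x. f1 x + f2 x)" by (intro hm.nrm_nonneg hmix_add h)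
qed

end

section \<open>Norms on the cube\<close>

lemma space_cube_measure: "space (cube_measure d) = cube d"
  by (simp add: cube_measure_def cube_def space_PiM space_U01)

interpretation U01_prod: product_prob_space "\<lambda>_ :: nat. U01" J for J
  by (intro product_prob_spaceI U01.prob_space_axioms)

lemma prob_space_cube_measure: "prob_space (cube_measure d)"
  unfolding cube_measure_def by (intro prob_space_PiM U01.prob_space_axioms)

lemma cube_integral_prod:
  assumes "\<And>j. j \<in> {1..d} \<Longrightarrow> integrable U01 (g j)"
  shows "(\<integral>x. (\<Prod>j=1..d. g j (x j)) \<partial>cube_measure d) = (\<Prod>j=1..d. \<integral>t. g j t \<partial>U01)"
    and "integrable (cube_measure d) (\<lambda>x. \<Prod>j=1..d. g j (x j) :: real)"
proof -
  show "(\<integral>x. (\<Prod>j=1..d. g j (x j)) \<partial>cube_measure d) = (\<Prod>j=1..d. \<integral>t. g j t \<partial>U01)"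
    unfolding cube_measure_def using assms by (intro U01_prod.product_integral_prod) auto
  show "integrable (cube_measure d) (\<lambda>x. \<Prod>j=1..d. g j (x j))"
    unfolding cube_measure_def using assms by (intro U01_prod.product_integrable_prod) auto
qed

lemma cube_component_measurable:
  assumes "j \<in> {1..d}" "g \<in> borel_measurable U01"
  shows "(\<lambda>x. g (x j)) \<in> borel_measurable (cube_measure d)"
  unfolding cube_measure_def
  by (rule measurable_compose[OF measurable_component_singleton[OF assms(1)] assms(2)])

lemma cube_prod_measurable:
  assumes "\<And>j. j \<in> {1..d} \<Longrightarrow> g j \<in> borel_measurable U01"
  shows "(\<lambda>x. \<Prod>j=1..d. g j (x j) :: real) \<in> borel_measurable (cube_measure d)"
  using assms by (intro borel_measurable_prod cube_component_measurable) auto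

lemma sum_list_measurable:
  assumes "\<And>a. a \<in> set xs \<Longrightarrow> f a \<in> borel_measurable M"
  shows "(\<lambda>x. \<Sum>a\<leftarrow>xs. f a x :: real) \<in> borel_measurable M"
  using assms by (induction xs) auto

lemma L2_cube_nrm: "L2_cube_norm d f = L2.nrm (cube_measure d) f"
  by (simp add: L2_cube_norm_def L2_nrm)

text \<open>Boxes around a point of the cube carry mass even at the boundary, where the sides are
  cut at \<open>0\<close> or \<open>1\<close>. This connects the essential supremum with point
  values.\<close>

lemma small_box_measure_pos:
  assumes x: "x \<in> cube d" and e: "e > 0"
  shows "emeasure (cube_measure d) (\<Pi>\<^sub>E j\<in>{1..d}. {t\<in>{0..1}. \<bar>t - x j\<bar> < e}) > 0"
proof -
  let ?A = "\<lambda>j. {t\<in>{0..1}. \<bar>t - x j\<bar> < e}"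
  have Ab: "?A j \<in> sets U01" for j
  proof -
    have "?A j = {0..1} \<inter> ({x j - e<..<x j + e})" by (auto simp: abs_less_iff)
    then show ?thesis by (simp add: sets_U01_iff)
  qed
  have pos: "emeasure U01 (?A j) > 0" if "j \<in> {1..d}" for j
  proof -
    define a b where "a = max 0 (x j - e / 2)" and "b = min 1 (x j + e / 2)"
    have xj: "x j \<in> {0..1}" using x that by (auto simp: cube_def PiE_iff)
    then have ab: "0 \<le> a" "a < b" "b \<le> 1" using e by (auto simp: a_def b_def)
    have "0 < emeasure U01 {a..b}"
      using ab by (simp add: emeasure_restrict_space)
    also have "\<dots> \<le> emeasure U01 (?A j)"
      using e by (intro emeasure_mono Ab) (auto simp: a_def b_def)
    finally show ?thesis .
  qed
  have "emeasure (cube_measure d) (\<Pi>\<^sub>E j\<in>{1..d}. ?A j) = (\<Prod>j\<in>{1..d}. emeasure U01 (?A j))"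
    unfolding cube_measure_def using Ab by (intro U01_prod.emeasure_PiM) auto
  also have "\<dots> > 0"
  proof -
    have pp: "0 < prod g A" if "finite A" "\<And>a. a \<in> A \<Longrightarrow> 0 < g a" for A :: "nat set" and g :: "nat \<Rightarrow> ennreal"
      using that by (induction A rule: finite_induct) (auto simp: ennreal_zero_less_mult_iff)
    show ?thesis by (rule pp) (use pos in auto)
  qed
  finally show ?thesis .
qed

section \<open>Measurability, continuity and sup norm bounds of elements\<close>

context mixed_sobolev
begin

lemma tensor_fun_measurable:
  assumes "S \<in> tensors m d"
  shows "tensor_fun d S \<in> borel_measurable (cube_measure d)"
  unfolding tensor_fun_def
  using assms m by (intro sum_list_measurable cube_prod_measurable continuous_on_U01_measurable)
    (auto simp: tensors_def intro!: sobolev_continuous[of _ m])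

lemma hmix_measurable:
  assumes "f \<in> hmix m d"
  shows "f \<in> borel_measurable (cube_measure d)"
proof -
  obtain S where S: "tensor_approx m d S f" using assms by (rule hmix_approxE)
  show ?thesis
    by (rule borel_measurable_LIMSEQ_real[of _ "\<lambda>k. tensor_fun d (S k)"])
      (use S in \<open>auto simp: tensor_approx_iff space_cube_measure tensor_Cauchy_tensors intro: tensor_fun_measurable\<close>)
qed

lemma hmix_sq_int: "f \<in> hmix m d \<Longrightarrow> f \<in> sq_int (cube_measure d)"
proof -
  assume f: "f \<in> hmix m d"
  interpret prob_space "cube_measure d" by (rule prob_space_cube_measure)
  show ?thesis by (rule sq_int_bounded[OF hmix_measurable[OF f] hmix_abs_le[OF f]])
qed

lemma tensor_fun_tendsto:
  assumes S: "S \<in> tensors m d" and x: "x \<in> cube d" and y: "\<And>n. y n \<in> cube d"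
    and lim: "\<And>j. j \<in> {1..d} \<Longrightarrow> (\<lambda>n. y n j) \<longlonglongrightarrow> x j"
  shows "(\<lambda>n. tensor_fun d S (y n)) \<longlonglongrightarrow> tensor_fun d S x"
proof -
  have "(\<lambda>n. F j (y n j)) \<longlonglongrightarrow> F j (x j)" if "F \<in> set S" "j \<in> {1..d}" for F j
  proof (rule continuous_on_tendsto_compose[where f = "F j" and s = "{0..1}"])
    show "continuous_on {0..1} (F j)" using S that m by (auto simp: tensors_def intro!: sobolev_continuous[of _ m])
    show "(\<lambda>n. y n j) \<longlonglongrightarrow> x j" by (rule lim[OF that(2)])
  qed (use x y that in \<open>auto simp: cube_def PiE_iff\<close>)
  then have "(\<lambda>n. \<Prod>j=1..d. F j (y n j)) \<longlonglongrightarrow> (\<Prod>j=1..d. F j (x j))" if "F \<in> set S" for F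
    using that by (intro tendsto_prod) auto
  then show ?thesis unfolding tensor_fun_def by (induction S) (auto intro!: tendsto_add)
qed

text \<open>Tensor functions are continuous, and by \<open>hmix_le\<close> they approximate
  \<open>f\<close> uniformly on the cube. Continuity is expressed by sequences converging in each
  coordinate.\<close>

lemma hmix_tendsto:
  assumes f: "f \<in> hmix m d" and x: "x \<in> cube d" and y: "\<And>n. y n \<in> cube d"
    and lim: "\<And>j. j \<in> {1..d} \<Longrightarrow> (\<lambda>n. y n j) \<longlonglongrightarrow> x j"
  shows "(\<lambda>n. f (y n)) \<longlonglongrightarrow> f x"
proof (rule LIMSEQ_I)
  fix r :: real assume r: "r > 0"
  define e where "e = r / (3 * eval_bound)"
  have e: "e > 0" "eval_bound * e = r / 3" using r eval_bound_ge_1 by (auto simp: e_def)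
  obtain S where S: "tensor_approx m d S f" using f by (rule hmix_approxE)
  obtain k where k: "hm.nrm (hm.sub f (\<lambda>x. if x \<in> cube d then tensor_fun d (S k) x else 0)) \<le> e"
    using hmix_tensor_distance[OF S e(1)] by blast
  have Sk: "S k \<in> tensors m d" using S by (simp add: tensor_approx_iff tensor_Cauchy_def)
  have tf: "(\<lambda>x. if x \<in> cube d then tensor_fun d (S k) x else 0) \<in> hmix m d"
    using constant_tensor_approx[OF Sk] by (auto simp: hmix_def)
  have close: "\<bar>f z - tensor_fun d (S k) z\<bar> \<le> r / 3" if z: "z \<in> cube d" for z
  proof -
    have "\<bar>f z - tensor_fun d (S k) z\<bar> \<le> eval_bound * hm.nrm (hm.sub f (\<lambda>x. if x \<in> cube d then tensor_fun d (S k) x else 0))"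
      using hmix_le[OF hm.sub_closed[OF f tf] z] z by simp
    also have "\<dots> \<le> eval_bound * e" using k eval_bound_ge_1 by (intro mult_left_mono) auto
    finally show ?thesis using e by simp
  qed
  from LIMSEQ_D[OF tensor_fun_tendsto[OF Sk x y lim], of "r / 3"] r
  obtain N where N: "\<And>n. n \<ge> N \<Longrightarrow> \<bar>tensor_fun d (S k) (y n) - tensor_fun d (S k) x\<bar> < r / 3" by auto
  have "norm (f (y n) - f x) < r" if "n \<ge> N" for n
    using N[OF that] close[OF x] close[OF y[of n]] unfolding real_norm_def by linarith
  then show "\<exists>N. \<forall>n\<ge>N. norm (f (y n) - f x) < r" by blast
qed

text \<open>Boxes of radius \<open>1 / (n + 1)\<close> about \<open>x\<close> have positive measure,
  so each contains a point where the bound holds, and continuity carries it to \<open>x\<close>.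
  Point samples of \<open>f2\<close> can thus be bounded by its essential supremum.\<close>

lemma hmix_AE_le:
  assumes f: "f \<in> hmix m d" and ae: "AE x in cube_measure d. \<bar>f x\<bar> \<le> c" and x: "x \<in> cube d"
  shows "\<bar>f x\<bar> \<le> c"
proof -
  let ?B = "\<lambda>n::nat. \<Pi>\<^sub>E j\<in>{1..d}. {t\<in>{0..1}. \<bar>t - x j\<bar> < 1 / real (Suc n)}"
  have "\<exists>y\<in>?B n. y \<in> cube d \<and> \<bar>f y\<bar> \<le> c" for n
  proof (rule ccontr)
    assume "\<not> ?thesis"
    moreover have sub: "?B n \<subseteq> cube d" by (auto simp: cube_def PiE_iff)
    ultimately have no: "\<not> \<bar>f y\<bar> \<le> c" if "y \<in> ?B n" for y using that by blast
    have "?B n \<in> null_sets (cube_measure d)"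
    proof -
      obtain N where N: "N \<in> null_sets (cube_measure d)" "{x \<in> space (cube_measure d). \<not> \<bar>f x\<bar> \<le> c} \<subseteq> N"
        using ae by (auto simp: eventually_ae_filter)
      have "?B n \<subseteq> N" using no sub N(2) by (auto simp: space_cube_measure)
      moreover have "?B n \<in> sets (cube_measure d)"
        using small_box_measure_pos[OF x, of "1 / real (Suc n)"] emeasure_notin_sets
        by fastforce
      ultimately show ?thesis using N(1) null_sets_subset by blast
    qed
    then show False using small_box_measure_pos[OF x, of "1 / real (Suc n)"] by (simp add: null_sets_def)
  qed
  then have "\<forall>n. \<exists>y. y \<in> ?B n \<and> y \<in> cube d \<and> \<bar>f y\<bar> \<le> c" by blast
  from choice[OF this] obtain y where "\<forall>n. y n \<in> ?B n \<and> y n \<in> cube d \<and> \<bar>f (y n)\<bar> \<le> c" ..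
  then have y: "\<And>n. y n \<in> ?B n" "\<And>n. y n \<in> cube d" "\<And>n. \<bar>f (y n)\<bar> \<le> c" by blast+
  have "(\<lambda>n. f (y n)) \<longlonglongrightarrow> f x"
  proof (rule hmix_tendsto[OF f x y(2)])
    fix j assume j: "j \<in> {1..d}"
    have "(\<lambda>n. y n j - x j) \<longlonglongrightarrow> 0"
    proof (rule Lim_null_comparison)
      have "\<bar>y n j - x j\<bar> < 1 / real (Suc n)" for n using y(1)[of n] j by (auto simp: PiE_iff)
      then show "\<forall>\<^sub>F n in sequentially. norm (y n j - x j) \<le> 1 / real (Suc n)"
        by (intro always_eventually allI) (simp add: less_imp_le)
      show "(\<lambda>n. 1 / real (Suc n)) \<longlonglongrightarrow> 0" using LIMSEQ_inverse_real_of_nat by (simp add: inverse_eq_divide)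
    qed
    then show "(\<lambda>n. y n j) \<longlonglongrightarrow> x j" by (simp add: LIM_zero_iff)
  qed
  then have "(\<lambda>n. \<bar>f (y n)\<bar>) \<longlonglongrightarrow> \<bar>f x\<bar>" by (rule tendsto_rabs)
  then show ?thesis using y(3) by (elim LIMSEQ_le_const2) auto
qed

lemma Linf_cube_norm_ge:
  assumes f: "f \<in> hmix m d"
  shows "\<bar>f x\<bar> \<le> Linf_cube_norm d f"
proof -
  interpret prob_space "cube_measure d" by (rule prob_space_cube_measure)
  let ?E = "esssup (cube_measure d) (\<lambda>x. ereal \<bar>f x\<bar>)"
  have meas: "(\<lambda>x. ereal \<bar>f x\<bar>) \<in> borel_measurable (cube_measure d)"
    using hmix_measurable[OF f] by measurable
  have up: "?E \<le> ereal (eval_bound * hm.nrm f)"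
    by (rule esssup_I[OF meas]) (use hmix_abs_le[OF f] in simp)
  have AE: "AE x in cube_measure d. ereal \<bar>f x\<bar> \<le> ?E" by (rule esssup_AE)
  have low: "0 \<le> ?E"
  proof (rule ccontr)
    assume "\<not> 0 \<le> ?E"
    then have "AE x in cube_measure d. False" using AE
      by (elim eventually_mono) (metis abs_ge_zero ereal_less_eq(5) order_trans)
    then show False by simp
  qed
  \<comment> \<open>The essential supremum is finite and nonnegative, so its conversion to a real
    number loses nothing.\<close>
  have E: "?E = ereal (Linf_cube_norm d f)"
    unfolding Linf_cube_norm_def using up low by (cases ?E) auto
  have le: "\<bar>f x\<bar> \<le> Linf_cube_norm d f" if "x \<in> cube d" for x
    using AE unfolding E by (intro hmix_AE_le[OF f _ that]) auto
  have "0 \<le> Linf_cube_norm d f" using low unfolding E by simp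
  then show ?thesis using le hmix_outside[OF f, of x] by (cases "x \<in> cube d") auto
qed

lemma L2_le_Linf:
  assumes f: "f \<in> hmix m d"
  shows "L2_cube_norm d f \<le> Linf_cube_norm d f"
proof -
  interpret prob_space "cube_measure d" by (rule prob_space_cube_measure)
  have nn: "0 \<le> Linf_cube_norm d f" using Linf_cube_norm_ge[OF f] abs_ge_zero order_trans by blast
  have "(f x)\<^sup>2 \<le> (Linf_cube_norm d f)\<^sup>2" for x
    using power_mono[OF Linf_cube_norm_ge[OF f, of x], of 2] by simp
  then have "(\<integral>x. (f x)\<^sup>2 \<partial>cube_measure d) \<le> (\<integral>x. (Linf_cube_norm d f)\<^sup>2 \<partial>cube_measure d)"
    using hmix_sq_int[OF f] by (intro integral_mono) (auto simp: sq_int_def)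
  also have "\<dots> = (Linf_cube_norm d f)\<^sup>2" by (simp add: prob_space)
  finally show ?thesis unfolding L2_cube_norm_def using nn by (intro real_le_lsqrt) auto
qed

text \<open>The factor \<open>sqrt (size X)\<close> counts points with multiplicity and will cancel
  the power \<open>-1/2\<close> of \<open>N\<close> in \<open>rate2\<close>.\<close>

lemma sample_le_Linf:
  assumes f: "f \<in> hmix m d"
  shows "l2_sample_norm X f \<le> sqrt (real (size X)) * Linf_cube_norm d f"
proof -
  have nn: "0 \<le> Linf_cube_norm d f" using Linf_cube_norm_ge[OF f] abs_ge_zero order_trans by blast
  have "(f x)\<^sup>2 \<le> (Linf_cube_norm d f)\<^sup>2" for x
    using power_mono[OF Linf_cube_norm_ge[OF f, of x], of 2] by simp
  then have "(\<Sum>x\<in>#X. (f x)\<^sup>2) \<le> (\<Sum>x\<in>#X. (Linf_cube_norm d f)\<^sup>2)" by (intro sum_mset_mono)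
  also have "\<dots> = real (size X) * (Linf_cube_norm d f)\<^sup>2" by simp
  finally have "sqrt (\<Sum>x\<in>#X. (f x)\<^sup>2) \<le> sqrt (real (size X) * (Linf_cube_norm d f)\<^sup>2)" by simp
  then show ?thesis unfolding l2_sample_norm_def using nn by (simp add: real_sqrt_mult)
qed

end

section \<open>Local polynomial reproduction on the interval\<close>

lemma sobolev_deriv_has_derivative:
  assumes D: "sobolev_derivs m f D" and r: "Suc r < m" and x: "x \<in> {0..1}"
  shows "(D r has_real_derivative D (Suc r) x) (at x within {0..1})"
proof -
  have cont: "continuous_on {0..1} (D (Suc r))" using D r by (rule sobolev_derivs_continuous)
  have "((\<lambda>u. D r 0 + integral {0..u} (D (Suc r))) has_real_derivative 0 + D (Suc r) x) (at x within {0..1})"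
    by (intro DERIV_add DERIV_const integral_has_real_derivative cont x)
  moreover have "D r 0 + integral {0..u} (D (Suc r)) = D r u" if "u \<in> {0..1}" for u
  proof -
    have i: "set_integrable lborel {0..u} (D (Suc r))"
    proof (rule set_integrable_subset)
      show "set_integrable lborel {0..1} (D (Suc r))"
        unfolding set_integrable_U01 using D r by (auto intro: sobolev_derivs_integrable)
    qed (use that in auto)
    have "(LINT t:{0..u}|U01. D (Suc r) t) = (LBINT t:{0..u}. D (Suc r) t)"
      using that by (intro set_integral_U01[symmetric]) auto
    then show ?thesis
      using sobolev_derivs_primitive[OF D, of r u] r that set_borel_integral_eq_integral(2)[OF i] by simp
  qed
  ultimately show ?thesis
    using x by (auto intro: has_field_derivative_transform_within[where d = 1])
qed

lemma poly_antiderivative: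
  fixes p :: "real poly"
  shows "\<exists>P. pderiv P = p \<and> degree P \<le> Suc (degree p)"
proof -
  define P where "P = (\<Sum>i\<le>degree p. monom (coeff p i / real (Suc i)) (Suc i))"
  have c: "coeff P (Suc n) = coeff p n / real (Suc n)" for n
  proof -
    have "coeff P (Suc n) = (\<Sum>i\<le>degree p. if i = n then coeff p n / real (Suc n) else 0)"
      unfolding P_def coeff_sum by (intro sum.cong) auto
    also have "\<dots> = coeff p n / real (Suc n)"
      by (cases "n \<le> degree p") (auto simp: coeff_eq_0)
    finally show ?thesis .
  qed
  have "pderiv P = p" by (rule poly_eqI) (simp add: coeff_pderiv c)
  moreover have "degree P \<le> Suc (degree p)"
    unfolding P_def by (rule degree_sum_le) (auto intro: order_trans[OF degree_monom_le])
  ultimately show ?thesis by blast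
qed

text \<open>A polynomial close to \<open>D 1\<close> is integrated and matched to \<open>f\<close>
  at \<open>a\<close>; the mean value inequality costs one factor \<open>b - a\<close> per order.
  The bound uses the top derivative on the small interval only, so that errors of disjoint intervals
  can be summed.\<close>

lemma sobolev_taylor:
  assumes "sobolev_derivs (Suc k) f D" "0 \<le> a" "a < b" "b \<le> 1"
  shows "\<exists>p. degree p \<le> k \<and>
    (\<forall>x\<in>{a..b}. \<bar>f x - poly p x\<bar> \<le> (b - a) ^ k * (LINT t:{a<..b}|U01. \<bar>D (Suc k) t\<bar>))"
  using assms(1)
proof (induction k arbitrary: f D)
  case 0
  have i: "integrable U01 (\<lambda>t. \<bar>D (Suc 0) t\<bar>)"
    using 0 by (intro integrable_abs sobolev_derivs_integrable[of "Suc 0" f]) auto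
  have "\<bar>f x - f a\<bar> \<le> (LINT t:{a<..b}|U01. \<bar>D (Suc 0) t\<bar>)" if x: "x \<in> {a..b}" for x
  proof -
    have "f x - f a = D 0 x - D 0 a" using sobolev_derivs_0[OF 0] x assms by simp
    also have "\<dots> = (LINT t:{a<..x}|U01. D (Suc 0) t)"
      using sobolev_deriv_increment(1)[OF 0, of 0 a x] x assms by simp
    finally have "\<bar>f x - f a\<bar> = \<bar>LINT t:{a<..x}|U01. D (Suc 0) t\<bar>" by simp
    also have "\<dots> \<le> (\<integral>t. \<bar>indicat_real {a<..x} t *\<^sub>R D (Suc 0) t\<bar> \<partial>U01)"
      unfolding set_lebesgue_integral_def by (rule integral_abs_bound)
    also have "\<dots> = (LINT t:{a<..x}|U01. \<bar>D (Suc 0) t\<bar>)"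
      by (simp add: set_lebesgue_integral_def abs_mult)
    also have "\<dots> \<le> (LINT t:{a<..b}|U01. \<bar>D (Suc 0) t\<bar>)"
      using i x assms
      unfolding set_lebesgue_integral_def
      by (intro integral_mono integrable_mult_indicator)
        (auto simp: sets_U01_iff indicator_def set_integrable_def)
    finally show ?thesis .
  qed
  then show ?case by (intro exI[of _ "[:f a:]"]) auto
next
  case (Suc k)
  have D1: "sobolev_derivs (Suc k) (D 1) (\<lambda>r. D (Suc r))"
    unfolding sobolev_derivs_iff
  proof (intro conjI ballI allI impI)
    fix r assume r: "r < Suc k"
    show "integrable U01 (D (Suc (Suc r)))" using Suc.prems r by (intro sobolev_derivs_integrable) auto
    show "D (Suc r) x = D (Suc r) 0 + (LINT t:{0..x}|U01. D (Suc (Suc r)) t)" if "x \<in> {0..1}" for x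
      using Suc.prems r that by (intro sobolev_derivs_primitive) auto
  qed (use sobolev_derivs_sq_int[OF Suc.prems] in auto)
  define B where "B = (b - a) ^ k * (LINT t:{a<..b}|U01. \<bar>D (Suc (Suc k)) t\<bar>)"
  obtain p where p: "degree p \<le> k" "\<And>x. x \<in> {a..b} \<Longrightarrow> \<bar>D 1 x - poly p x\<bar> \<le> B"
    using Suc.IH[OF D1] unfolding B_def by blast
  obtain P where P: "pderiv P = p" "degree P \<le> Suc (degree p)" using poly_antiderivative by blast
  define q where "q = P + [:f a - poly P a:]"
  have B0: "B \<ge> 0" using order_trans[OF abs_ge_zero p(2)[of a]] assms by simp
  have "\<bar>f x - poly q x\<bar> \<le> (b - a) * B" if x: "x \<in> {a..b}" for x
  proof -
    have "norm ((D 0 x - poly q x) - (D 0 a - poly q a)) \<le> B * norm (x - a)"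
    proof (rule field_differentiable_bound[where S = "{a..b}" and f' = "\<lambda>x. D 1 x - poly p x"])
      fix z assume z: "z \<in> {a..b}"
      have "(D 0 has_real_derivative D 1 z) (at z within {a..b})"
      proof -
        have z01: "z \<in> {0..1}" and sub: "{a..b} \<subseteq> {0..1}" using z assms by auto
        have "(D 0 has_real_derivative D (Suc 0) z) (at z within {0..1})"
          by (rule sobolev_deriv_has_derivative[OF Suc.prems _ z01]) simp
        from has_field_derivative_subset[OF this sub] show ?thesis by simp
      qed
      moreover have "(poly q has_real_derivative poly p z) (at z within {a..b})"
      proof -
        have "pderiv q = p" using P by (simp add: q_def pderiv_add pderiv_pCons)
        then show ?thesis using poly_DERIV[of q z] by (simp only: has_field_derivative_at_within)
      qed
      ultimately show "((\<lambda>x. D 0 x - poly q x) has_field_derivative D 1 z - poly p z) (at z within {a..b})"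
        by (rule DERIV_diff)
      show "norm (D 1 z - poly p z) \<le> B" using p(2)[OF z] by simp
    qed (use x assms in auto)
    moreover have "D 0 x = f x" "D 0 a = f a" using sobolev_derivs_0[OF Suc.prems] x assms by auto
    moreover have "poly q a = f a" by (simp add: q_def)
    ultimately have "\<bar>f x - poly q x\<bar> \<le> B * \<bar>x - a\<bar>" by simp
    also have "\<dots> \<le> B * (b - a)" using B0 x by (intro mult_left_mono) auto
    finally show ?thesis by (simp add: mult.commute)
  qed
  moreover have "degree q \<le> Suc k"
    unfolding q_def by (rule degree_add_le) (use P p in auto)
  ultimately show ?case by (intro exI[of _ q]) (auto simp: B_def mult.assoc)
qed

section \<open>Lagrange interpolation\<close>

definition lagrange_basis :: "real set \<Rightarrow> real \<Rightarrow> real \<Rightarrow> real" where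
  "lagrange_basis Z y x = (\<Prod>z\<in>Z - {y}. (x - z) / (y - z))"

text \<open>The interpolating polynomial \<open>q\<close> agrees with \<open>p\<close> at
  \<open>card Z\<close> points, and both have degree below \<open>card Z\<close>.\<close>

lemma lagrange_basis_reproduces:
  assumes Z: "finite Z" and p: "degree p < card Z"
  shows "(\<Sum>y\<in>Z. poly p y * lagrange_basis Z y x) = poly p x"
proof -
  define q where "q = (\<Sum>y\<in>Z. smult (poly p y) (\<Prod>z\<in>Z - {y}. [:- z / (y - z), 1 / (y - z):]))"
  have q: "poly q x = (\<Sum>y\<in>Z. poly p y * lagrange_basis Z y x)" for x
    unfolding q_def lagrange_basis_def poly_sum poly_smult poly_prod
    by (intro sum.cong refl arg_cong2[of _ _ _ _ "(*)"] prod.cong) (simp add: diff_divide_distrib)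
  have qp: "q = p"
  proof (rule poly_eqI_degree[of Z])
    fix x assume x: "x \<in> Z"
    have "lagrange_basis Z y x = (if y = x then 1 else 0)" if "y \<in> Z" for y
      using that x Z by (auto simp: lagrange_basis_def intro!: prod.neutral prod_zero)
    then have "poly q x = (\<Sum>y\<in>Z. if y = x then poly p y else 0)"
      unfolding q by (intro sum.cong) auto
    then show "poly q x = poly p x" using x Z by simp
  next
    have "degree q \<le> card Z - 1"
      unfolding q_def
    proof (rule degree_sum_le[OF Z])
      fix y assume y: "y \<in> Z"
      have "degree (\<Prod>z\<in>Z - {y}. [:- z / (y - z), 1 / (y - z):]) \<le> (\<Sum>z\<in>Z - {y}. degree [:- z / (y - z), 1 / (y - z):])"
        by (rule order_trans[OF degree_prod_sum_le]) (use Z in auto)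
      also have "\<dots> \<le> (\<Sum>z\<in>Z - {y}. 1)" by (intro sum_mono) auto
      also have "\<dots> = card Z - 1" using y Z by simp
      finally show "degree (smult (poly p y) (\<Prod>z\<in>Z - {y}. [:- z / (y - z), 1 / (y - z):])) \<le> card Z - 1"
        using degree_smult_le order_trans by blast
    qed
    then show "degree q < card Z" using p by simp
  qed (rule p)
  show ?thesis using q[of x] unfolding qp by (rule sym)
qed

section \<open>Univariate quasi-interpolation\<close>

text \<open>\<open>M\<close> is the number of panels. The density \<open>1 / (4 m M)\<close> is half
  the length of a piece, so a point of \<open>Y\<close> within this distance of the midpoint of a
  piece lies in that piece.\<close>

locale panel_nodes =
  fixes m M :: nat and Y :: "real set"
  assumes m: "m \<ge> 1" and M: "M \<ge> 1" and Y: "finite Y"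
    and dense: "\<And>x. x \<in> {0..1} \<Longrightarrow> \<exists>y\<in>Y. \<bar>x - y\<bar> \<le> 1 / (4 * real m * real M)"
begin

text \<open>Each panel $[i/M,(i+1)/M)$ is cut into $2m$ pieces. A node is chosen in every other piece, so
  that nodes of a panel have distance at least the length of a piece.\<close>

definition piece :: real where "piece = 1 / (2 * real m * real M)"

definition node :: "nat \<Rightarrow> nat \<Rightarrow> real" where
  "node i t = (SOME y. y \<in> Y \<and> y \<in> {real i / M + 2 * real t * piece .. real i / M + (2 * real t + 1) * piece})"

definition nodes :: "nat \<Rightarrow> real set" where "nodes i = node i ` {..<m}"

definition panel :: "nat \<Rightarrow> real set" where "panel i = {real i / M ..< real (Suc i) / M}"

text \<open>The weight of \<open>y\<close> is its Lagrange polynomial on the panel for which it was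
  chosen as a node; points of \<open>Y\<close> that were not chosen get weight zero. Panels are half
  open, so all weights vanish at \<open>x = 1\<close>, which does not affect \<open>L_2\<close>
  norms.\<close>

definition weight :: "real \<Rightarrow> real \<Rightarrow> real" where
  "weight y x = (\<Sum>i<M. indicat_real (panel i) x * (if y \<in> nodes i then lagrange_basis (nodes i) y x else 0))"

lemma piece_pos: "piece > 0"
  using m M by (simp add: piece_def)

lemma piece_panel: "2 * real m * piece = 1 / M"
  using m M by (simp add: piece_def)

lemma panel_end: "real (Suc i) / M = real i / M + 1 / M"
  by (simp add: add_divide_distrib)

lemma panel_le_1: "i < M \<Longrightarrow> real (Suc i) / M \<le> 1"
  using M by simp

lemma node:
  assumes "i < M" "t < m"
  shows "node i t \<in> Y" and "real i / M + 2 * real t * piece \<le> node i t"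
    and "node i t \<le> real i / M + (2 * real t + 1) * piece"
proof -
  let ?x = "real i / M + 2 * real t * piece + piece / 2"
  have p: "1 / (4 * real m * real M) = piece / 2" by (simp add: piece_def)
  have "(2 * real t + 1) * piece \<le> 2 * real m * piece"
    using assms piece_pos by (intro mult_right_mono) auto
  then have le: "2 * real t * piece + piece \<le> 1 / M" using piece_panel by (simp add: distrib_right)
  have "?x \<in> {0..1}"
    using le piece_pos panel_le_1[OF assms(1)] panel_end[of i] by auto
  from dense[OF this] obtain y where y: "y \<in> Y" "\<bar>?x - y\<bar> \<le> piece / 2" unfolding p by blast
  have "(2 * real t + 1) * piece = 2 * real t * piece + piece" by (simp add: distrib_right)
  then have "real i / M + 2 * real t * piece \<le> y" "y \<le> real i / M + (2 * real t + 1) * piece"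
    using y(2) by linarith+
  then have "y \<in> Y \<and> y \<in> {real i / M + 2 * real t * piece .. real i / M + (2 * real t + 1) * piece}"
    using y(1) unfolding atLeastAtMost_iff by blast
  then have "node i t \<in> Y \<and> node i t \<in> {real i / M + 2 * real t * piece .. real i / M + (2 * real t + 1) * piece}"
    unfolding node_def by (rule someI)
  then show "node i t \<in> Y" and "real i / M + 2 * real t * piece \<le> node i t"
    and "node i t \<le> real i / M + (2 * real t + 1) * piece"
    unfolding atLeastAtMost_iff by blast+
qed

lemma nodes_subset: "i < M \<Longrightarrow> nodes i \<subseteq> Y"
  using node(1) by (auto simp: nodes_def)

lemma finite_nodes: "finite (nodes i)"
  by (simp add: nodes_def)

lemma nodes_panel:
  assumes "i < M" "y \<in> nodes i"
  shows "real i / M \<le> y" and "y < real (Suc i) / M"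
proof -
  obtain t where t: "t < m" "y = node i t" using assms by (auto simp: nodes_def)
  show "real i / M \<le> y"
    using node(2)[OF assms(1) t(1)] t(2) piece_pos
    by (smt (verit, ccfv_SIG) mult_nonneg_nonneg of_nat_0_le_iff)
  have "2 * real t + 1 < 2 * real m" using t by linarith
  then have "(2 * real t + 1) * piece < 2 * real m * piece"
    using piece_pos by (rule mult_strict_right_mono)
  then show "y < real (Suc i) / M"
    using node(3)[OF assms(1) t(1)] t(2) piece_panel panel_end[of i] by linarith
qed

lemma node_separation:
  assumes "i < M" "s < t" "t < m"
  shows "node i s + piece \<le> node i t"
proof -
  have "real (2 * s + 2) * piece \<le> 2 * real t * piece"
    using assms piece_pos by (intro mult_right_mono) auto
  then show ?thesis
    using node(3)[of i s] node(2)[of i t] assms by (simp add: distrib_right)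
qed

lemma card_nodes: "i < M \<Longrightarrow> card (nodes i) = m"
proof -
  assume i: "i < M"
  have "inj_on (node i) {..<m}"
  proof (rule inj_onI)
    fix s t assume "s \<in> {..<m}" "t \<in> {..<m}" "node i s = node i t"
    then show "s = t"
      using node_separation[OF i, of s t] node_separation[OF i, of t s] piece_pos
      by (cases s t rule: linorder_cases) auto
  qed
  then show ?thesis by (simp add: nodes_def card_image)
qed

lemma nodes_separation:
  assumes "i < M" "y \<in> nodes i" "z \<in> nodes i" "y \<noteq> z"
  shows "piece \<le> \<bar>y - z\<bar>"
proof -
  obtain s t where st: "s < m" "y = node i s" "t < m" "z = node i t" using assms by (auto simp: nodes_def)
  then show ?thesis
    using assms(4) node_separation[OF assms(1), of s t] node_separation[OF assms(1), of t s]
    by (cases s t rule: linorder_cases) auto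
qed

text \<open>\<open>m\<close> nodes per panel times the bound \<open>(2 m)^m\<close> for each
  Lagrange polynomial. It depends neither on \<open>M\<close> nor on \<open>Y\<close>.\<close>

definition lebesgue_const :: real where "lebesgue_const = real m * (2 * real m) ^ m"

text \<open>Each factor has a numerator of at most the panel length, which is \<open>2 m\<close>
  pieces, and a denominator of at least one piece.\<close>

lemma lagrange_nodes_le:
  assumes "i < M" "y \<in> nodes i" "x \<in> panel i"
  shows "\<bar>lagrange_basis (nodes i) y x\<bar> \<le> (2 * real m) ^ m"
proof -
  have "\<bar>lagrange_basis (nodes i) y x\<bar> = (\<Prod>z\<in>nodes i - {y}. \<bar>(x - z) / (y - z)\<bar>)"
    by (simp add: lagrange_basis_def abs_prod)
  also have "\<dots> \<le> (\<Prod>z\<in>nodes i - {y}. 2 * real m)"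
  proof (intro prod_mono conjI)
    fix z assume z: "z \<in> nodes i - {y}"
    have "\<bar>x - z\<bar> \<le> 1 / M"
      using nodes_panel[OF assms(1), of z] z assms(3) panel_end[of i] by (auto simp: panel_def)
    then have "\<bar>x - z\<bar> \<le> 2 * real m * piece" using piece_panel by simp
    also have "\<dots> \<le> 2 * real m * \<bar>y - z\<bar>"
      using nodes_separation[OF assms(1,2), of z] z by (intro mult_left_mono) auto
    finally have "\<bar>x - z\<bar> / \<bar>y - z\<bar> \<le> 2 * real m" using z by (simp add: pos_divide_le_eq)
    then show "\<bar>(x - z) / (y - z)\<bar> \<le> 2 * real m" by (simp add: abs_divide)
  qed auto
  also have "\<dots> = (2 * real m) ^ (m - 1)"
    using assms finite_nodes card_nodes by simp
  also have "\<dots> \<le> (2 * real m) ^ m" using m by (intro power_increasing) auto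
  finally show ?thesis .
qed

lemma panel_disjoint: "x \<in> panel i \<Longrightarrow> x \<in> panel j \<Longrightarrow> i = j"
proof (rule ccontr)
  assume x: "x \<in> panel i" "x \<in> panel j" and "i \<noteq> j"
  have False if "x \<in> panel i" "x \<in> panel j" "i < j" for i j
  proof -
    have "real (Suc i) / M \<le> real j / M" using that(3) by (intro divide_right_mono) auto
    then show False using that by (auto simp: panel_def)
  qed
  then show False using x \<open>i \<noteq> j\<close> by (meson linorder_neqE_nat)
qed

lemma panel_covers:
  assumes "0 \<le> x" "x < 1"
  obtains i where "i < M" "x \<in> panel i"
proof -
  let ?i = "nat \<lfloor>x * M\<rfloor>"
  have fl: "real ?i = of_int \<lfloor>x * M\<rfloor>" using assms by simp
  have b: "real ?i \<le> x * M" "x * M < real ?i + 1" unfolding fl by linarith+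
  then have p: "x \<in> panel ?i" using M by (simp add: panel_def field_simps)
  have "real ?i < M"
  proof -
    have "x * M < 1 * real M" using assms M by (intro mult_strict_right_mono) auto
    then show ?thesis using b(1) by linarith
  qed
  then show ?thesis by (intro that[of ?i] p) simp
qed

lemma panel_sum:
  assumes "i < M" "x \<in> panel i"
  shows "(\<Sum>i<M. indicat_real (panel i) x * g i) = g i"
proof -
  have "(\<Sum>k<M. indicat_real (panel k) x * g k) = (\<Sum>k<M. if k = i then g k else 0)"
  proof (intro sum.cong refl)
    fix k
    show "indicat_real (panel k) x * g k = (if k = i then g k else 0)"
      using panel_disjoint[OF assms(2), of k] assms(2) by (cases "k = i") (auto simp: indicator_def)
  qed
  then show ?thesis using assms by simp
qed

lemma weight_panel:
  assumes "i < M" "x \<in> panel i"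
  shows "weight y x = (if y \<in> nodes i then lagrange_basis (nodes i) y x else 0)"
  unfolding weight_def by (rule panel_sum[OF assms])

lemma panel_subset: "i < M \<Longrightarrow> panel i \<subseteq> {0..<1}"
proof -
  assume i: "i < M"
  show ?thesis using panel_le_1[OF i] by (auto simp: panel_def intro: order_trans[rotated])
qed

lemma weight_at_1: "weight y 1 = 0"
proof -
  have "1 \<notin> panel i" if "i < M" for i using panel_subset[OF that] by auto
  then show ?thesis by (simp add: weight_def)
qed

lemma unit_interval_cases:
  assumes "x \<in> {0..1::real}"
  obtains "x = 1" | i where "i < M" "x \<in> panel i"
  using assms panel_covers[of x] by (metis atLeastAtMost_iff less_eq_real_def)

lemma panel_sets: "i < M \<Longrightarrow> panel i \<in> sets U01"
  unfolding sets_U01_iff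
proof
  show "panel i \<in> sets borel" by (simp add: panel_def)
  assume "i < M"
  then show "panel i \<subseteq> {0..1}" using panel_subset[of i] by auto
qed

lemma weight_measurable: "weight y \<in> borel_measurable U01"
proof -
  have "lagrange_basis Z y \<in> borel_measurable U01" for Z
  proof -
    have "continuous_on {0..1} (lagrange_basis Z y)"
      unfolding lagrange_basis_def divide_inverse by (intro continuous_intros)
    then show ?thesis by (rule continuous_on_U01_measurable)
  qed
  then show ?thesis
    unfolding weight_def using panel_sets by (intro borel_measurable_sum borel_measurable_times) auto
qed

lemma measure_panel: "i < M \<Longrightarrow> measure U01 (panel i) = 1 / M"
proof -
  assume i: "i < M"
  have "measure U01 (panel i) = measure lborel (panel i)"
    using panel_subset[OF i] by (intro measure_restrict_space) auto
  also have "\<dots> = real (Suc i) / M - real i / M"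
    unfolding panel_def by (rule measure_lborel_Ico) (simp add: divide_right_mono)
  finally show ?thesis unfolding panel_end by simp
qed

lemma integral_panel: "i < M \<Longrightarrow> (\<integral>x. indicat_real (panel i) x \<partial>U01) = 1 / M"
proof -
  assume i: "i < M"
  have "panel i \<inter> {0..1} = panel i" using panel_subset[OF i] by auto
  then show ?thesis using measure_panel[OF i] by (simp add: space_U01)
qed

lemma lebesgue_const_pos: "lebesgue_const > 0"
  using m by (simp add: lebesgue_const_def)

lemma weight_sum_le:
  assumes "x \<in> {0..1}"
  shows "(\<Sum>y\<in>Y. \<bar>weight y x\<bar>) \<le> lebesgue_const"
  using assms
proof (cases rule: unit_interval_cases)
  case 1
  then show ?thesis using lebesgue_const_pos by (simp add: weight_at_1)
next
  case (2 i)
  have "(\<Sum>y\<in>Y. \<bar>weight y x\<bar>) = (\<Sum>y\<in>nodes i. \<bar>lagrange_basis (nodes i) y x\<bar>)"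
    using nodes_subset[OF 2(1)] Y by (intro sum.mono_neutral_cong_right) (auto simp: weight_panel[OF 2])
  also have "\<dots> \<le> (\<Sum>y\<in>nodes i. (2 * real m) ^ m)"
    by (intro sum_mono lagrange_nodes_le 2)
  finally show ?thesis using 2 by (simp add: card_nodes lebesgue_const_def)
qed

text \<open>A node belongs to a single panel, so its weight is supported on a set of measure
  \<open>1 / M\<close>. Together with \<open>weight_sum_le\<close> this provides the two bounds of a
  Schur test for \<open>L_2\<close> stability.\<close>

lemma weight_integral_le:
  shows "integrable U01 (\<lambda>x. \<bar>weight y x\<bar>)" and "(\<integral>x. \<bar>weight y x\<bar> \<partial>U01) \<le> lebesgue_const / M"
proof -
  let ?c = "(2 * real m) ^ m"
  have cl: "?c \<le> lebesgue_const" using m mult_right_mono[of 1 "real m" ?c] by (simp add: lebesgue_const_def)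
  have "\<exists>k<M. \<forall>x\<in>{0..1}. \<bar>weight y x\<bar> \<le> ?c * indicat_real (panel k) x"
  proof (cases "\<exists>k<M. y \<in> nodes k")
    case True
    then obtain k where k: "k < M" "y \<in> nodes k" by blast
    have yk: "y \<in> panel k" using nodes_panel[OF k] by (simp add: panel_def)
    have "\<bar>weight y x\<bar> \<le> ?c * indicat_real (panel k) x" if "x \<in> {0..1}" for x
      using that
    proof (cases rule: unit_interval_cases)
      case 1
      then show ?thesis by (simp add: weight_at_1)
    next
      case (2 i)
      show ?thesis
      proof (cases "i = k")
        case True
        then show ?thesis using lagrange_nodes_le[OF 2(1), of y x] k 2 by (simp add: weight_panel[OF 2])
      next
        case False
        have "y \<notin> nodes i"
          using nodes_panel[OF 2(1), of y] panel_disjoint[OF yk, of i] False by (auto simp: panel_def)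
        then show ?thesis by (simp add: weight_panel[OF 2])
      qed
    qed
    then show ?thesis using k by blast
  next
    case False
    then have "weight y x = 0" for x by (simp add: weight_def)
    then show ?thesis using M by (intro exI[of _ 0]) auto
  qed
  then obtain k where k: "k < M" "\<And>x. x \<in> {0..1} \<Longrightarrow> \<bar>weight y x\<bar> \<le> ?c * indicat_real (panel k) x" by blast
  have i: "integrable U01 (\<lambda>x. ?c * indicat_real (panel k) x)"
    using panel_sets[OF k(1)] by (intro integrable_mult_right) (simp add: U01.emeasure_eq_measure)
  show int: "integrable U01 (\<lambda>x. \<bar>weight y x\<bar>)"
    by (rule Bochner_Integration.integrable_bound[OF i])
      (use weight_measurable k(2) in \<open>auto simp: space_U01 intro!: AE_I2\<close>)
  have "(\<integral>x. \<bar>weight y x\<bar> \<partial>U01) \<le> (\<integral>x. ?c * indicat_real (panel k) x \<partial>U01)"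
    using k(2) by (intro integral_mono int i) (auto simp: space_U01)
  also have "\<dots> = ?c * (1 / M)"
    unfolding integral_panel[OF k(1), symmetric] by (rule integral_mult_right_zero)
  also have "\<dots> \<le> lebesgue_const * (1 / M)" using cl by (intro mult_right_mono) auto
  finally show "(\<integral>x. \<bar>weight y x\<bar> \<partial>U01) \<le> lebesgue_const / M" by simp
qed

text \<open>Interpolation on a panel reproduces polynomials of degree below \<open>m\<close>, so
  only the deviation from a local polynomial is interpolated; this costs
  \<open>1 + lebesgue_const\<close>. Cauchy-Schwarz replaces the \<open>L_1\<close> norm of the
  derivative by its \<open>L_2\<close> norm and adds one factor \<open>1 / M\<close> to the square,
  whence \<open>2 (m - 1) + 1 = 2 m - 1\<close>.\<close>

lemma interpolation_error_pointwise:
  assumes F: "F \<in> sobolev m" and i: "i < M" and x: "x \<in> panel i"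
  shows "(F x - (\<Sum>y\<in>Y. weight y x * F y))\<^sup>2
    \<le> (1 + lebesgue_const)\<^sup>2 / real M ^ (2 * m - 1) * (LINT t:panel i|U01. (weak_deriv m F m t)\<^sup>2)"
proof -
  let ?D = "weak_deriv m F m" and ?a = "real i / M" and ?b = "real (Suc i) / M"
  let ?E = "(1 / M) ^ (m - 1) * (LINT t:{?a<..?b}|U01. \<bar>?D t\<bar>)"
  have D: "sobolev_derivs (Suc (m - 1)) F (weak_deriv m F)" using weak_deriv[OF F] m by simp
  have ab: "0 \<le> ?a" "?a < ?b" "?b \<le> 1" using M panel_le_1[OF i] by (auto simp: divide_strict_right_mono)
  have ba: "?b - ?a = 1 / M" unfolding panel_end by simp
  obtain p where p: "degree p \<le> m - 1" "\<And>z. z \<in> {?a..?b} \<Longrightarrow> \<bar>F z - poly p z\<bar> \<le> ?E"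
    using sobolev_taylor[OF D ab] m unfolding ba by auto
  have sum: "(\<Sum>y\<in>Y. weight y x * g y) = (\<Sum>y\<in>nodes i. lagrange_basis (nodes i) y x * g y)" for g
    using nodes_subset[OF i] Y by (intro sum.mono_neutral_cong_right) (auto simp: weight_panel[OF i x])
  have rep: "(\<Sum>y\<in>nodes i. lagrange_basis (nodes i) y x * poly p y) = poly p x"
    using lagrange_basis_reproduces[OF finite_nodes, of p i x] p(1) m card_nodes[OF i] by (simp add: mult.commute)
  have E0: "?E \<ge> 0" using order_trans[OF abs_ge_zero p(2)[of ?a]] ab by simp
  have "\<bar>F x - (\<Sum>y\<in>Y. weight y x * F y)\<bar>
      = \<bar>(F x - poly p x) - (\<Sum>y\<in>nodes i. lagrange_basis (nodes i) y x * (F y - poly p y))\<bar>"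
    unfolding sum using rep by (simp add: right_diff_distrib sum_subtractf)
  also have "\<dots> \<le> \<bar>F x - poly p x\<bar> + (\<Sum>y\<in>nodes i. \<bar>lagrange_basis (nodes i) y x * (F y - poly p y)\<bar>)"
    using sum_abs[of "\<lambda>y. lagrange_basis (nodes i) y x * (F y - poly p y)" "nodes i"] by linarith
  also have "\<dots> \<le> ?E + (\<Sum>y\<in>nodes i. (2 * real m) ^ m * ?E)"
  proof (intro add_mono sum_mono)
    show "\<bar>F x - poly p x\<bar> \<le> ?E" using x by (intro p(2)) (auto simp: panel_def)
    fix y assume y: "y \<in> nodes i"
    have "\<bar>F y - poly p y\<bar> \<le> ?E" using nodes_panel[OF i y] by (intro p(2)) auto
    then show "\<bar>lagrange_basis (nodes i) y x * (F y - poly p y)\<bar> \<le> (2 * real m) ^ m * ?E"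
      unfolding abs_mult by (intro mult_mono lagrange_nodes_le i y x) auto
  qed
  also have "\<dots> = (1 + lebesgue_const) * ?E"
    using card_nodes[OF i] by (simp add: lebesgue_const_def algebra_simps)
  finally have "\<bar>F x - (\<Sum>y\<in>Y. weight y x * F y)\<bar>\<^sup>2 \<le> ((1 + lebesgue_const) * ?E)\<^sup>2"
    by (intro power_mono) auto
  also have "\<dots> = (1 + lebesgue_const)\<^sup>2 * (1 / M) ^ (2 * (m - 1)) * (LINT t:{?a<..?b}|U01. \<bar>?D t\<bar>)\<^sup>2"
    by (simp add: power_mult_distrib power_mult[symmetric] mult.commute[of _ 2])
  also have "(LINT t:{?a<..?b}|U01. \<bar>?D t\<bar>)\<^sup>2 \<le> 1 / M * (LINT t:panel i|U01. (?D t)\<^sup>2)"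
  proof -
    have Dsq: "?D \<in> sq_int U01" using F by (rule weak_deriv_sq_int)
    \<comment> \<open>The panel and \<open>{?a<..?b}\<close> differ in the two endpoints only. The
      indicator is doubled because one copy becomes the second factor in Cauchy-Schwarz.\<close>
    have eq: "(LINT t:{?a<..?b}|U01. \<bar>?D t\<bar>) = (\<integral>t. indicat_real (panel i) t * (indicat_real (panel i) t * \<bar>?D t\<bar>) \<partial>U01)"
      unfolding set_lebesgue_integral_def
    proof (rule integral_cong_AE)
      have "AE t in U01. t \<notin> {?a, ?b}"
      proof -
        have "{?a, ?b} \<in> null_sets U01"
          using ab by (auto simp: null_sets_restrict_space intro: countable_imp_null_set_lborel)
        then show ?thesis by (rule AE_not_in)
      qed
      then show "AE t in U01. indicat_real {?a<..?b} t *\<^sub>R \<bar>?D t\<bar> = indicat_real (panel i) t * (indicat_real (panel i) t * \<bar>?D t\<bar>)"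
        by eventually_elim (auto simp: indicator_def panel_def)
      have "{a<..b} \<in> sets U01" if "0 \<le> a" "b \<le> 1" for a b :: real
        using that by (auto simp: sets_U01_iff)
      from this[OF ab(1,3)] have "{?a<..?b} \<in> sets U01" .
      then show "(\<lambda>t. indicat_real {?a<..?b} t *\<^sub>R \<bar>?D t\<bar>) \<in> borel_measurable U01"
        using sq_int_measurable[OF Dsq] by simp
      show "(\<lambda>t. indicat_real (panel i) t * (indicat_real (panel i) t * \<bar>?D t\<bar>)) \<in> borel_measurable U01"
        using sq_int_measurable[OF Dsq] panel_sets[OF i] by simp
    qed
    have ind: "indicat_real (panel i) \<in> sq_int U01"
      using panel_sets[OF i] by (intro U01.sq_int_bounded[of _ 1]) (auto simp: indicator_def)
    have iD: "(\<lambda>t. indicat_real (panel i) t * \<bar>?D t\<bar>) \<in> sq_int U01"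
      unfolding sq_int_def
    proof (intro CollectI conjI)
      show "(\<lambda>t. indicat_real (panel i) t * \<bar>?D t\<bar>) \<in> borel_measurable U01"
        using sq_int_measurable[OF Dsq] panel_sets[OF i] by simp
      have "integrable U01 (\<lambda>t. indicat_real (panel i) t *\<^sub>R (?D t)\<^sup>2)"
        using Dsq panel_sets[OF i] by (intro integrable_mult_indicator) (auto simp: sq_int_def)
      then show "integrable U01 (\<lambda>t. (indicat_real (panel i) t * \<bar>?D t\<bar>)\<^sup>2)"
        by (rule Bochner_Integration.integrable_cong[THEN iffD1, rotated 2])
          (auto simp: indicator_def power_mult_distrib)
    qed
    have "(LINT t:{?a<..?b}|U01. \<bar>?D t\<bar>)\<^sup>2 \<le> (\<integral>t. indicat_real (panel i) t * indicat_real (panel i) t \<partial>U01)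
        * (\<integral>t. (indicat_real (panel i) t * \<bar>?D t\<bar>) * (indicat_real (panel i) t * \<bar>?D t\<bar>) \<partial>U01)"
      unfolding eq by (rule L2.ip_sq_le[OF ind iD])
    also have "(\<integral>t. indicat_real (panel i) t * indicat_real (panel i) t \<partial>U01) = 1 / M"
    proof -
      have "(\<integral>t. indicat_real (panel i) t * indicat_real (panel i) t \<partial>U01) = (\<integral>t. indicat_real (panel i) t \<partial>U01)"
        by (intro Bochner_Integration.integral_cong) (auto simp: indicator_def)
      then show ?thesis using integral_panel[OF i] by simp
    qed
    also have "(\<integral>t. (indicat_real (panel i) t * \<bar>?D t\<bar>) * (indicat_real (panel i) t * \<bar>?D t\<bar>) \<partial>U01) = (LINT t:panel i|U01. (?D t)\<^sup>2)"
      unfolding set_lebesgue_integral_def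
      by (intro Bochner_Integration.integral_cong) (auto simp: indicator_def power2_eq_square)
    finally show ?thesis .
  qed
  also have "(1 + lebesgue_const)\<^sup>2 * (1 / M) ^ (2 * (m - 1)) * (1 / M * (LINT t:panel i|U01. (?D t)\<^sup>2))
     = (1 + lebesgue_const)\<^sup>2 / real M ^ (2 * m - 1) * (LINT t:panel i|U01. (?D t)\<^sup>2)"
  proof -
    have "2 * m - 1 = Suc (2 * (m - 1))" using m by simp
    then show ?thesis by (simp add: power_one_over)
  qed
  finally show ?thesis
    by (simp add: mult_left_mono)
qed

text \<open>Integrating the pointwise bound over a panel gains another \<open>1 / M\<close>, and the
  panel integrals of the squared derivative add up to at most the squared norm. The point
  \<open>x = 1\<close>, which no panel contains, is a null set.\<close>

lemma interpolation_error:
  assumes F: "F \<in> sobolev m"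
  shows "(\<lambda>x. F x - (\<Sum>y\<in>Y. weight y x * F y)) \<in> sq_int U01"
    and "L2.nrm U01 (\<lambda>x. F x - (\<Sum>y\<in>Y. weight y x * F y)) \<le> (1 + lebesgue_const) / real M ^ m * sob.nrm m F"
proof -
  let ?e = "\<lambda>x. F x - (\<Sum>y\<in>Y. weight y x * F y)" and ?D = "weak_deriv m F m"
  let ?K = "(1 + lebesgue_const)\<^sup>2 / real M ^ (2 * m - 1)"
  let ?c = "\<lambda>i. LINT t:panel i|U01. (?D t)\<^sup>2"
  have Dsq: "?D \<in> sq_int U01" using F by (rule weak_deriv_sq_int)
  have meas: "?e \<in> borel_measurable U01"
    using continuous_on_U01_measurable[OF sobolev_continuous[OF F m]] weight_measurable by simp
  let ?B = "\<lambda>x. \<Sum>i<M. indicat_real (panel i) x * (?K * ?c i)"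
  have iB: "integrable U01 ?B"
    using panel_sets by (intro Bochner_Integration.integrable_sum integrable_mult_left) (simp add: U01.emeasure_eq_measure)
  have ae: "AE x in U01. (?e x)\<^sup>2 \<le> ?B x"
  proof -
    have "AE x in U01. x \<notin> {1}"
    proof (rule AE_not_in)
      show "{1} \<in> null_sets U01"
        by (auto simp: null_sets_restrict_space intro: countable_imp_null_set_lborel)
    qed
    moreover have "AE x in U01. x \<in> {0..1}" by (rule AE_I2) (simp add: space_U01)
    ultimately show ?thesis
    proof eventually_elim
      case (elim x)
      then have "0 \<le> x" "x < 1" by auto
      then obtain i where i: "i < M" "x \<in> panel i" by (rule panel_covers)
      show ?case
        using interpolation_error_pointwise[OF F i] by (simp only: panel_sum[OF i])
    qed
  qed
  have isq: "integrable U01 (\<lambda>x. (?e x)\<^sup>2)"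
    by (rule Bochner_Integration.integrable_bound[OF iB])
      (use meas ae in \<open>auto elim!: eventually_mono\<close>)
  then show "?e \<in> sq_int U01" using meas by (simp add: sq_int_def)
  have "(\<integral>x. (?e x)\<^sup>2 \<partial>U01) \<le> (\<integral>x. ?B x \<partial>U01)"
    by (rule integral_mono_AE[OF isq iB ae])
  also have "\<dots> = (\<Sum>i<M. (1 / M) * (?K * ?c i))"
  proof -
    have "(\<integral>x. ?B x \<partial>U01) = (\<Sum>i<M. \<integral>x. indicat_real (panel i) x * (?K * ?c i) \<partial>U01)"
      using panel_sets by (intro Bochner_Integration.integral_sum integrable_mult_left) (simp add: U01.emeasure_eq_measure)
    also have "\<dots> = (\<Sum>i<M. (1 / M) * (?K * ?c i))"
    proof (intro sum.cong refl)
      fix i assume "i \<in> {..<M}"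
      then have i: "i < M" by simp
      have "(\<integral>x. indicat_real (panel i) x \<partial>U01) = 1 / M"
        by (rule integral_panel[OF i])
      then show "(\<integral>x. indicat_real (panel i) x * (?K * ?c i) \<partial>U01) = (1 / M) * (?K * ?c i)"
        by (simp only: integral_mult_left_zero)
    qed
    finally show ?thesis .
  qed
  also have "\<dots> = (1 + lebesgue_const)\<^sup>2 / real M ^ (2 * m) * (\<Sum>i<M. ?c i)"
  proof -
    have "2 * m = Suc (2 * m - 1)" using m by simp
    then have "real M ^ (2 * m) = real M * real M ^ (2 * m - 1)" by (metis power_Suc)
    then have e: "(1 / M) * ?K = (1 + lebesgue_const)\<^sup>2 / real M ^ (2 * m)" by simp
    show ?thesis unfolding e[symmetric] sum_distrib_left by (simp only: mult.assoc)
  qed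
  finally have le: "(\<integral>x. (?e x)\<^sup>2 \<partial>U01) \<le> (1 + lebesgue_const)\<^sup>2 / real M ^ (2 * m) * (\<Sum>i<M. ?c i)" .
  have "(\<Sum>i<M. ?c i) \<le> (\<integral>t. (?D t)\<^sup>2 \<partial>U01)"
  proof -
    have iD: "integrable U01 (\<lambda>t. (?D t)\<^sup>2)" using Dsq by (simp add: sq_int_def)
    have iDi: "integrable U01 (\<lambda>t. indicat_real (panel i) t *\<^sub>R (?D t)\<^sup>2)" if "i < M" for i
      using panel_sets[OF that] iD by (rule integrable_mult_indicator)
    have "(\<Sum>i<M. ?c i) = (\<integral>t. (\<Sum>i<M. indicat_real (panel i) t *\<^sub>R (?D t)\<^sup>2) \<partial>U01)"
      unfolding set_lebesgue_integral_def using iDi by (intro Bochner_Integration.integral_sum[symmetric]) auto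
    also have "\<dots> \<le> (\<integral>t. (?D t)\<^sup>2 \<partial>U01)"
    proof (intro integral_mono iD Bochner_Integration.integrable_sum iDi)
      fix t assume "t \<in> space U01"
      then have "t \<in> {0..1}" by (simp add: space_U01)
      then show "(\<Sum>i<M. indicat_real (panel i) t *\<^sub>R (?D t)\<^sup>2) \<le> (?D t)\<^sup>2"
      proof (cases rule: unit_interval_cases)
        case 1
        have "1 \<notin> panel i" if "i < M" for i using panel_subset[OF that] by auto
        then show ?thesis using 1 by simp
      next
        case (2 i)
        show ?thesis by (simp only: real_scaleR_def panel_sum[OF 2, of "\<lambda>_. (?D t)\<^sup>2"] order_refl)
      qed
    qed auto
    finally show ?thesis .
  qed
  also have "(\<integral>t. (?D t)\<^sup>2 \<partial>U01) \<le> (sob.nrm m F)\<^sup>2"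
    unfolding sob_nrm_eq[OF weak_deriv[OF F]] by (simp add: sum_nonneg)
  finally have "(\<Sum>i<M. ?c i) \<le> (sob.nrm m F)\<^sup>2" .
  then have "(1 + lebesgue_const)\<^sup>2 / real M ^ (2 * m) * (\<Sum>i<M. ?c i) \<le> (1 + lebesgue_const)\<^sup>2 / real M ^ (2 * m) * (sob.nrm m F)\<^sup>2"
    by (rule mult_left_mono) simp
  also have "(1 + lebesgue_const)\<^sup>2 / real M ^ (2 * m) * (sob.nrm m F)\<^sup>2 = ((1 + lebesgue_const) / real M ^ m * sob.nrm m F)\<^sup>2"
    by (simp add: power_mult_distrib power_divide power_mult[symmetric] mult.commute[of m])
  finally have "(\<integral>x. (?e x)\<^sup>2 \<partial>U01) \<le> ((1 + lebesgue_const) / real M ^ m * sob.nrm m F)\<^sup>2"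
    using le by (rule order_trans[rotated])
  moreover have "0 \<le> (1 + lebesgue_const) / real M ^ m * sob.nrm m F"
    using lebesgue_const_pos sob.nrm_nonneg[OF F] by simp
  ultimately show "L2.nrm U01 ?e \<le> (1 + lebesgue_const) / real M ^ m * sob.nrm m F"
    unfolding L2_nrm by (rule real_le_lsqrt[rotated])
qed

end

section \<open>Univariate sampling operators\<close>

lemma fill_distance_covers:
  assumes "finite Y" "Y \<noteq> {}" "Y \<subseteq> {0..1}" "x \<in> {0..1}"
  shows "\<exists>y\<in>Y. \<bar>x - y\<bar> \<le> fill_distance Y"
proof -
  have fin: "finite ((\<lambda>y. \<bar>x - y\<bar>) ` Y)" "(\<lambda>y. \<bar>x - y\<bar>) ` Y \<noteq> {}" for x using assms by auto
  have le1: "Min ((\<lambda>y. \<bar>x - y\<bar>) ` Y) \<le> 1" if "x \<in> {0..1}" for x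
  proof -
    obtain y where y: "y \<in> Y" using assms by blast
    then have "Min ((\<lambda>y. \<bar>x - y\<bar>) ` Y) \<le> \<bar>x - y\<bar>" using fin by (intro Min_le) auto
    also have "\<bar>x - y\<bar> \<le> 1" using y assms that by (auto simp: abs_le_iff)
    finally show ?thesis .
  qed
  have "Min ((\<lambda>y. \<bar>x - y\<bar>) ` Y) \<le> fill_distance Y"
    unfolding fill_distance_def by (rule cSUP_upper[OF assms(4)]) (rule bdd_aboveI2[where M = 1], rule le1)
  moreover have "Min ((\<lambda>y. \<bar>x - y\<bar>) ` Y) \<in> (\<lambda>y. \<bar>x - y\<bar>) ` Y" using fin by (rule Min_in)
  ultimately show ?thesis by auto
qed

text \<open>A packing argument: distinct points have distance at least \<delta>, so dividing by
  \<delta> and rounding down is injective on \<open>Y\<close>. Counting the possible values gives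
  \<open>n \<le> 1/\<delta>\<close>, and the separation radius is half of \<delta>.\<close>

lemma separation_radius_bound:
  assumes Y: "finite Y" "Y \<subseteq> {0..1}" "card Y = n + 1" "n \<ge> 1"
  shows "separation_radius Y > 0" and "2 * real n * separation_radius Y \<le> 1"
proof -
  let ?D = "{\<bar>y - z\<bar> | y z. y \<in> Y \<and> z \<in> Y \<and> y \<noteq> z}"
  have "?D \<subseteq> (\<lambda>(y, z). \<bar>y - z\<bar>) ` (Y \<times> Y)" by auto
  then have fin: "finite ?D" using Y(1) finite_subset by blast
  have ne: "?D \<noteq> {}"
  proof -
    have "\<not> card Y \<le> Suc 0" using Y by simp
    then obtain y z where "y \<in> Y" "z \<in> Y" "y \<noteq> z" using card_le_Suc0_iff_eq[OF Y(1)] by auto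
    then show ?thesis by blast
  qed
  define \<delta> where "\<delta> = Min ?D"
  have "\<delta> \<in> ?D" unfolding \<delta>_def by (rule Min_in[OF fin ne])
  then have pos: "\<delta> > 0" by auto
  have sep: "\<delta> \<le> \<bar>y - z\<bar>" if "y \<in> Y" "z \<in> Y" "y \<noteq> z" for y z
    unfolding \<delta>_def using that by (intro Min_le[OF fin]) blast
  show "separation_radius Y > 0" using pos by (simp add: separation_radius_def \<delta>_def)
  let ?f = "\<lambda>y. nat \<lfloor>y / \<delta>\<rfloor>"
  have "inj_on ?f Y"
  proof (rule inj_onI, rule ccontr)
    fix y z assume yz: "y \<in> Y" "z \<in> Y" "?f y = ?f z" "y \<noteq> z"
    then have nn: "y / \<delta> \<ge> 0" "z / \<delta> \<ge> 0" using Y(2) pos by auto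
    then have "\<lfloor>y / \<delta>\<rfloor> \<ge> 0" "\<lfloor>z / \<delta>\<rfloor> \<ge> 0" by simp_all
    then have "\<lfloor>y / \<delta>\<rfloor> = \<lfloor>z / \<delta>\<rfloor>" using yz(3) by linarith
    then have "\<bar>y / \<delta> - z / \<delta>\<bar> < 1" by linarith
    then have "\<bar>y - z\<bar> / \<delta> < 1" using pos by (simp add: diff_divide_distrib[symmetric] abs_divide)
    then show False using sep[OF yz(1,2,4)] pos by simp
  qed
  moreover have "?f ` Y \<subseteq> {..nat \<lfloor>1 / \<delta>\<rfloor>}"
    using Y(2) pos by (auto intro!: nat_mono floor_mono divide_right_mono)
  ultimately have "card Y \<le> nat \<lfloor>1 / \<delta>\<rfloor> + 1"
    using card_inj_on_le[of ?f Y "{..nat \<lfloor>1 / \<delta>\<rfloor>}"] by simp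
  then have "real n \<le> real (nat \<lfloor>1 / \<delta>\<rfloor>)" using Y(3) by simp
  also have "\<dots> = of_int \<lfloor>1 / \<delta>\<rfloor>" using pos by simp
  also have "\<dots> \<le> 1 / \<delta>" by (rule of_int_floor_le)
  finally show "2 * real n * separation_radius Y \<le> 1"
    using pos by (simp add: separation_radius_def \<delta>_def[symmetric] field_simps)
qed

text \<open>By packing the separation radius is at most \<open>2^(-l)\<close>, and quasi-uniformity
  transfers this order to the fill distance.\<close>

lemma sampling_sequence_dense:
  assumes "sampling_sequence Y"
  shows "\<exists>C>0. \<forall>l\<ge>1. \<forall>x\<in>{0..1}. \<exists>y\<in>Y l. \<bar>x - y\<bar> \<le> C / 2 ^ l"
proof -
  have Y: "finite (Y l)" "Y l \<subseteq> {0..1}" if "l \<ge> 1" for l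
    using assms that by (auto simp: sampling_sequence_def)
  have Y1: "card (Y 1) = 1" and Yl: "\<And>l. l \<ge> 2 \<Longrightarrow> card (Y l) = 2 ^ (l - 1) + 1"
    using assms by (auto simp: sampling_sequence_def)
  obtain \<kappa> where \<kappa>: "\<And>l. l \<ge> 1 \<Longrightarrow> card (Y l) \<ge> 2 \<Longrightarrow> fill_distance (Y l) / separation_radius (Y l) \<le> \<kappa>"
    using assms by (auto simp: sampling_sequence_def quasi_uniform_def)
  \<comment> \<open>The \<open>2\<close> covers level \<open>1\<close>, where a single point has
    distance at most \<open>1 = 2 / 2^1\<close> from everything; it also makes \<open>C\<close>
    positive.\<close>
  define C where "C = max 2 \<kappa>"
  have "\<exists>y\<in>Y l. \<bar>x - y\<bar> \<le> C / 2 ^ l" if l: "l \<ge> 1" and x: "x \<in> {0..1}" for l x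
  proof (cases "l = 1")
    case True
    obtain y where "y \<in> Y 1" using Y1 by (metis card.empty ex_in_conv zero_neq_one)
    moreover have "\<bar>x - y\<bar> \<le> 1" if "y \<in> Y 1" for y using Y(2)[of 1] that x by (fastforce simp: abs_le_iff)
    moreover have "1 \<le> C / 2 ^ l" using True by (simp add: C_def)
    ultimately show ?thesis using True by force
  next
    case False
    then have l2: "l \<ge> 2" using l by simp
    have c: "card (Y l) = 2 ^ (l - 1) + 1" using Yl l2 by simp
    note sep = separation_radius_bound[OF Y[OF l] c]
    have c2: "card (Y l) \<ge> 2" unfolding c by simp
    have s0: "separation_radius (Y l) > 0" using sep by simp
    have p2: "2 * 2 ^ (l - 1) = (2::real) ^ l" using l by (cases l) auto
    have "2 * 2 ^ (l - 1) * separation_radius (Y l) \<le> 1" using sep(2) by simp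
    then have "separation_radius (Y l) \<le> 1 / 2 ^ l" unfolding p2 by (simp add: field_simps)
    have "fill_distance (Y l) \<le> \<kappa> * separation_radius (Y l)"
      using \<kappa>[OF l c2] s0 by (simp add: pos_divide_le_eq)
    also have "\<dots> \<le> C * separation_radius (Y l)" using s0 by (intro mult_right_mono) (auto simp: C_def)
    also have "\<dots> \<le> C * (1 / 2 ^ l)"
      using \<open>separation_radius (Y l) \<le> 1 / 2 ^ l\<close> by (intro mult_left_mono) (auto simp: C_def)
    finally have "fill_distance (Y l) \<le> C / 2 ^ l" by simp
    moreover have "Y l \<noteq> {}" using c by auto
    ultimately show ?thesis
      using fill_distance_covers[OF Y(1)[OF l] _ Y(2)[OF l] x] by (meson order_trans)
  qed
  then show ?thesis by (intro exI[of _ C]) (auto simp: C_def)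
qed

definition residual :: "(nat \<Rightarrow> real set) \<Rightarrow> (nat \<Rightarrow> real \<Rightarrow> real \<Rightarrow> real) \<Rightarrow> nat \<Rightarrow> (real \<Rightarrow> real) \<Rightarrow> real \<Rightarrow> real" where
  "residual Y a l F x = F x - (\<Sum>y\<in>Y l. a l y x * F y)"

text \<open>The interface of the univariate operators: an error of order \<open>2^(-m l)\<close>,
  the two bounds of a Schur test for stability, and the zero operator at level \<open>0\<close>,
  from which the differences of consecutive levels start.\<close>

locale sampling_weights =
  fixes m :: nat and Y :: "nat \<Rightarrow> real set" and L :: real and a :: "nat \<Rightarrow> real \<Rightarrow> real \<Rightarrow> real"
  assumes m: "m \<ge> 1" and L: "L \<ge> 1"
    and fin: "\<And>l. l \<ge> 1 \<Longrightarrow> finite (Y l)" and sub: "\<And>l. l \<ge> 1 \<Longrightarrow> Y l \<subseteq> {0..1}"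
    and meas: "\<And>l y. a l y \<in> borel_measurable U01"
    and sum_le: "\<And>l x. l \<ge> 1 \<Longrightarrow> x \<in> {0..1} \<Longrightarrow> (\<Sum>y\<in>Y l. \<bar>a l y x\<bar>) \<le> L"
    and int: "\<And>l y. integrable U01 (\<lambda>x. \<bar>a l y x\<bar>)"
    and int_le: "\<And>l y. (\<integral>x. \<bar>a l y x\<bar> \<partial>U01) \<le> L / 2 ^ l"
    and res_sq: "\<And>l F. F \<in> sobolev m \<Longrightarrow> residual Y a l F \<in> sq_int U01"
    and res_le: "\<And>l F. F \<in> sobolev m \<Longrightarrow> L2.nrm U01 (residual Y a l F) \<le> L / 2 ^ (m * l) * sob.nrm m F"
    and zero: "\<And>y x. a 0 y x = 0"

text \<open>On levels below a fixed \<open>e\<close> the points may be too sparse to supply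
  \<open>m\<close> nodes per panel; there the operator is zero and the loss is absorbed in
  \<open>L\<close>. From level \<open>e\<close> on, \<open>2^(l - e)\<close> panels are
  used.\<close>

lemma sampling_weights_exist:
  assumes m: "m \<ge> 1" and Y: "sampling_sequence Y"
  shows "\<exists>L a. sampling_weights m Y L a"
proof -
  obtain C where C: "C > 0" "\<And>l x. l \<ge> 1 \<Longrightarrow> x \<in> {0..1} \<Longrightarrow> \<exists>y\<in>Y l. \<bar>x - y\<bar> \<le> C / 2 ^ l"
    using sampling_sequence_dense[OF Y] by blast
  have fin: "finite (Y l)" and sub: "Y l \<subseteq> {0..1}" if "l \<ge> 1" for l
    using Y that by (auto simp: sampling_sequence_def)
  \<comment> \<open>This makes \<open>C / 2^l\<close> at most \<open>1 / (4 m 2^(l - e))\<close>,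
    the density required for \<open>2^(l - e)\<close> panels. Passing to the successor ensures
    \<open>e \<ge> 1\<close>, so that level \<open>0\<close> is among the zero operators.\<close>
  obtain e0 :: nat where "4 * real m * C < 2 ^ e0" using real_arch_pow[of 2 "4 * real m * C"] by auto
  then have e: "4 * real m * C \<le> 2 ^ Suc e0" 
    using power_increasing[of e0 "Suc e0" "2::real"] by linarith
  define e where "e = Suc e0"
  have e1: "e \<ge> 1" "4 * real m * C \<le> 2 ^ e" using e by (auto simp: e_def)
  define L0 where "L0 = real m * (2 * real m) ^ m"
  \<comment> \<open>One constant for all requirements: \<open>m + 1\<close> for the norm of
    \<open>F\<close> itself on coarse levels, \<open>1 + L0\<close> for the interpolation error, and
    \<open>2^(e m)\<close> for the shift of levels by \<open>e\<close>.\<close>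
  define L where "L = (real m + 1) * (1 + L0) * 2 ^ (e * m)"
  define a where "a l y x = (if l < e then 0 else panel_nodes.weight m (2 ^ (l - e)) (Y l) y x)" for l y x
  have L0: "L0 \<ge> 0" by (simp add: L0_def)
  have pw: "(1::real) \<le> 2 ^ (e * m)" by simp
  have L0L: "L0 * 2 ^ (e * m) \<le> L" "(1 + L0) * 2 ^ (e * m) \<le> L" "(real m + 1) * 2 ^ (e * m) \<le> L"
    unfolding L_def using L0 by (auto intro!: mult_right_mono simp: algebra_simps)
  have Lpos: "L \<ge> 1"
    unfolding L_def using L0 by (intro mult_ge1_I) auto
  have PN: "panel_nodes m (2 ^ (l - e)) (Y l)" if l: "l \<ge> e" for l
  proof
    show "finite (Y l)" using fin l e1 by simp
    fix x :: real assume x: "x \<in> {0..1}"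
    obtain y where y: "y \<in> Y l" "\<bar>x - y\<bar> \<le> C / 2 ^ l" using C(2)[OF _ x] l e1 by (meson order_trans)
    have "C / 2 ^ l \<le> 1 / (4 * real m * 2 ^ (l - e))"
    proof -
      have "(2::real) ^ l = 2 ^ (l - e) * 2 ^ e" using l by (simp flip: power_add)
      then show ?thesis using e1(2) m by (simp add: field_simps)
    qed
    then show "\<exists>y\<in>Y l. \<bar>x - y\<bar> \<le> 1 / (4 * real m * real (2 ^ (l - e)))" using y by (auto intro: order_trans)
  qed (use m in auto)
  have LC: "panel_nodes.lebesgue_const m = L0"
    using panel_nodes.lebesgue_const_def[OF PN[of e]] by (simp add: L0_def)
  have pow: "1 / real (2 ^ (l - e)) = 2 ^ e / 2 ^ l" if "l \<ge> e" for l
  proof -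
    have "(2::real) ^ l = 2 ^ (l - e) * 2 ^ e" using that by (simp flip: power_add)
    then show ?thesis by simp
  qed
  have "sampling_weights m Y L a"
  proof
    fix l y
    show "a l y \<in> borel_measurable U01"
      unfolding a_def using panel_nodes.weight_measurable[OF PN[of l], of y] by (cases "l < e") auto
    show "integrable U01 (\<lambda>x. \<bar>a l y x\<bar>)"
      unfolding a_def using panel_nodes.weight_integral_le(1)[OF PN[of l], of y] by (cases "l < e") auto
    show "(\<integral>x. \<bar>a l y x\<bar> \<partial>U01) \<le> L / 2 ^ l"
    proof (cases "l < e")
      case True
      then show ?thesis using Lpos by (simp add: a_def)
    next
      case False
      then have "(\<integral>x. \<bar>a l y x\<bar> \<partial>U01) \<le> L0 * (1 / real (2 ^ (l - e)))"
        using panel_nodes.weight_integral_le(2)[OF PN[of l], of y] by (simp add: a_def LC)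
      also have "\<dots> = L0 * 2 ^ e / 2 ^ l" using False by (subst pow) auto
      also have "\<dots> \<le> L0 * 2 ^ (e * m) / 2 ^ l"
        using m L0 by (intro divide_right_mono mult_left_mono power_increasing) auto
      also have "\<dots> \<le> L / 2 ^ l" using L0L(1) by (intro divide_right_mono) auto
      finally show ?thesis .
    qed
  next
    fix l :: nat and x :: real assume l: "l \<ge> 1" and x: "x \<in> {0..1}"
    show "(\<Sum>y\<in>Y l. \<bar>a l y x\<bar>) \<le> L"
    proof (cases "l < e")
      case True
      then show ?thesis using Lpos by (simp add: a_def)
    next
      case False
      have "L0 * 1 \<le> L0 * 2 ^ (e * m)" using L0 by (intro mult_left_mono) auto
      then show ?thesis
        using panel_nodes.weight_sum_le[OF PN[of l] x] False L0L(1) by (simp add: a_def LC)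
    qed
  next
    fix l and F :: "real \<Rightarrow> real" assume F: "F \<in> sobolev m"
    have "residual Y a l F \<in> sq_int U01 \<and> L2.nrm U01 (residual Y a l F) \<le> L / 2 ^ (m * l) * sob.nrm m F"
    proof (cases "l < e")
      case True
      then have r: "residual Y a l F = F" by (simp add: residual_def a_def fun_eq_iff)
      have D0: "weak_deriv m F 0 x = F x" if "x \<in> {0..1}" for x using sobolev_derivs_0[OF weak_deriv[OF F] that] .
      have Fm: "F \<in> borel_measurable U01" by (intro continuous_on_U01_measurable sobolev_continuous[OF F m])
      have Fsq: "F \<in> sq_int U01"
        by (rule U01.sq_int_bounded[OF Fm, of "(real m + 1) * sob.nrm m F"]) (use sobolev_abs_le[OF F m] in \<open>simp add: space_U01\<close>)
      have "L2.nrm U01 F = L2.nrm U01 (weak_deriv m F 0)"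
        unfolding L2_nrm using D0 by (intro arg_cong[of _ _ sqrt] Bochner_Integration.integral_cong) (auto simp: space_U01)
      also have "\<dots> \<le> (real m + 1) * sob.nrm m F" by (rule sobolev_deriv_bounds(3)[OF weak_deriv[OF F]]) simp
      also have "\<dots> \<le> L / 2 ^ (m * l) * sob.nrm m F"
      proof (rule mult_right_mono[OF _ sob.nrm_nonneg[OF F]])
        have "(2::real) ^ (m * l) \<le> 2 ^ (e * m)" using True by (intro power_increasing) auto
        then have "(real m + 1) * 2 ^ (m * l) \<le> (real m + 1) * 2 ^ (e * m)" by (intro mult_left_mono) auto
        also have "\<dots> \<le> L" by (rule L0L)
        finally show "real m + 1 \<le> L / 2 ^ (m * l)" by (simp add: field_simps)
      qed
      finally show ?thesis using Fsq r by simp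
    next
      case False
      then have l: "l \<ge> e" by simp
      have r: "residual Y a l F = (\<lambda>x. F x - (\<Sum>y\<in>Y l. panel_nodes.weight m (2 ^ (l - e)) (Y l) y x * F y))"
        using False by (simp add: residual_def a_def fun_eq_iff)
      have "(1 + L0) / real (2 ^ (l - e)) ^ m = (1 + L0) * 2 ^ (e * m) / 2 ^ (m * l)"
      proof -
        have "(2::real) ^ (m * l) = (2 ^ (l - e)) ^ m * 2 ^ (e * m)"
          using l by (simp add: power_mult[symmetric] power_add[symmetric] algebra_simps)
        then show ?thesis by simp
      qed
      also have "\<dots> \<le> L / 2 ^ (m * l)" using L0L(2) by (intro divide_right_mono) auto
      finally have "(1 + L0) / real (2 ^ (l - e)) ^ m * sob.nrm m F \<le> L / 2 ^ (m * l) * sob.nrm m F"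
        using sob.nrm_nonneg[OF F] by (rule mult_right_mono)
      then show ?thesis
        unfolding r using panel_nodes.interpolation_error[OF PN[OF l] F] by (simp add: LC)
    qed
    then show "residual Y a l F \<in> sq_int U01" "L2.nrm U01 (residual Y a l F) \<le> L / 2 ^ (m * l) * sob.nrm m F"
      by auto
  qed (use m Lpos fin sub e1 in \<open>auto simp: a_def\<close>)
  then show ?thesis by blast
qed

section \<open>The combination formula\<close>

text \<open>The coefficient of level \<open>l\<close> after expanding the differences of consecutive
  levels. With \<open>k = card u\<close> and \<open>q = s - sum l u\<close> between \<open>0\<close>
  and \<open>k - 1\<close> it equals \<open>(-1)^q\<close> times the binomial coefficient
  \<open>k - 1\<close> over \<open>q\<close>, the usual weight of the combination technique.\<close>

definition combination_coeff :: "nat set \<Rightarrow> nat \<Rightarrow> (nat \<Rightarrow> nat) \<Rightarrow> real" where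
  "combination_coeff u s l = (\<Sum>v\<in>Pow u. (-1) ^ card v * of_bool (sum l u + card v \<le> s))"

definition level_simplex :: "nat set \<Rightarrow> nat \<Rightarrow> (nat \<Rightarrow> nat) set" where
  "level_simplex u s = {l \<in> u \<rightarrow>\<^sub>E {1..}. sum l u \<le> s}"

definition level_band :: "nat set \<Rightarrow> nat \<Rightarrow> (nat \<Rightarrow> nat) set" where
  "level_band u s = {l \<in> u \<rightarrow>\<^sub>E {1..}. s + 1 \<le> sum l u + card u \<and> sum l u \<le> s}"

lemma level_simplex_le: "finite u \<Longrightarrow> l \<in> level_simplex u s \<Longrightarrow> j \<in> u \<Longrightarrow> 1 \<le> l j \<and> l j \<le> s"
  using member_le_sum[of j u l] by (fastforce simp: level_simplex_def PiE_iff)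

lemma finite_level_simplex: "finite u \<Longrightarrow> finite (level_simplex u s)"
proof (rule finite_subset[of _ "u \<rightarrow>\<^sub>E {1..s}"])
  assume u: "finite u"
  show "level_simplex u s \<subseteq> u \<rightarrow>\<^sub>E {1..s}"
  proof
    fix l assume l: "l \<in> level_simplex u s"
    then have "l \<in> extensional u" by (simp add: level_simplex_def PiE_iff)
    then show "l \<in> u \<rightarrow>\<^sub>E {1..s}" using level_simplex_le[OF u l] by (simp add: PiE_iff)
  qed
  show "finite (u \<rightarrow>\<^sub>E {1..s})" using u by (intro finite_PiE) auto
qed

lemma level_band_simplex: "level_band u s \<subseteq> level_simplex u s"
  by (auto simp: level_band_def level_simplex_def)

lemma finite_level_band: "finite u \<Longrightarrow> finite (level_band u s)"
  by (rule finite_subset[OF level_band_simplex finite_level_simplex])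

lemma abs_combination_coeff_le: "finite u \<Longrightarrow> \<bar>combination_coeff u s l\<bar> \<le> 2 ^ card u"
proof -
  assume u: "finite u"
  have "\<bar>combination_coeff u s l\<bar> \<le> (\<Sum>v\<in>Pow u. \<bar>(-1) ^ card v * of_bool (sum l u + card v \<le> s)\<bar>)"
    unfolding combination_coeff_def by (rule sum_abs)
  also have "\<dots> \<le> (\<Sum>v\<in>Pow u. 1)" by (intro sum_mono) (simp add: abs_mult)
  finally show ?thesis using u by (simp add: card_Pow)
qed

text \<open>The condition in the coefficient holds for all subsets, so the alternating sum over
  \<open>Pow u\<close> is \<open>(1 - 1)^card u\<close>. This confines the combination to the band
  of levels whose points are sampled.\<close>

lemma combination_coeff_zero:
  assumes "finite u" "u \<noteq> {}" "sum l u + card u \<le> s"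
  shows "combination_coeff u s l = 0"
proof -
  have "combination_coeff u s l = (\<Sum>v\<in>Pow u. (-1) ^ card v * (\<Prod>j\<in>v. 1) * (\<Prod>j\<in>u - v. 1))"
    unfolding combination_coeff_def
  proof (intro sum.cong refl)
    fix v assume "v \<in> Pow u"
    then have "card v \<le> card u" using assms by (intro card_mono) auto
    then show "(-1) ^ card v * of_bool (sum l u + card v \<le> s) = (-1) ^ card v * (\<Prod>j\<in>v. 1) * (\<Prod>j\<in>u - v. 1 :: real)"
      using assms by simp
  qed
  also have "\<dots> = (\<Prod>j\<in>u. 1 - 1)" by (rule prod_diff_conv_sum[symmetric, OF assms(1)])
  also have "\<dots> = 0" using assms by (simp add: card_gt_0_iff)
  finally show ?thesis .
qed

text \<open>Lowering the levels on \<open>v\<close> by one maps the indices with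
  \<open>l j \<ge> 2\<close> on \<open>v\<close> bijectively onto those with
  \<open>sum l u + card v \<le> s\<close>. An index with \<open>l j = 1\<close> for some
  \<open>j\<close> in \<open>v\<close> contributes nothing, since level \<open>0\<close> is
  zero.\<close>

lemma shifted_simplex_sum:
  fixes \<alpha> :: "nat \<Rightarrow> nat \<Rightarrow> real"
  assumes u: "finite u" and v: "v \<subseteq> u" and zero: "\<And>j. \<alpha> j 0 = 0"
  shows "(\<Sum>l\<in>level_simplex u s. \<Prod>j\<in>u. \<alpha> j (l j - of_bool (j \<in> v)))
    = (\<Sum>l\<in>level_simplex u s. of_bool (sum l u + card v \<le> s) * (\<Prod>j\<in>u. \<alpha> j (l j)))"
proof -
  let ?S = "level_simplex u s"
  have cardv: "(\<Sum>j\<in>u. of_bool (j \<in> v)) = card v"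
    using u v by (simp add: of_bool_def sum.If_cases Int_absorb1)
  have "(\<Sum>l\<in>?S. \<Prod>j\<in>u. \<alpha> j (l j - of_bool (j \<in> v)))
      = (\<Sum>l\<in>{l\<in>?S. \<forall>j\<in>v. 2 \<le> l j}. \<Prod>j\<in>u. \<alpha> j (l j - of_bool (j \<in> v)))"
  proof (intro sum.mono_neutral_right finite_level_simplex u ballI)
    fix l assume "l \<in> ?S - {l\<in>?S. \<forall>j\<in>v. 2 \<le> l j}"
    then obtain j where j: "j \<in> v" "l j < 2" "l \<in> ?S" by auto
    then have "l j - of_bool (j \<in> v) = 0" by simp
    then show "(\<Prod>j\<in>u. \<alpha> j (l j - of_bool (j \<in> v))) = 0"
      using j v u zero by (intro prod_zero) (auto intro!: bexI[of _ j])
  qed auto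
  also have "\<dots> = (\<Sum>l\<in>{l\<in>?S. sum l u + card v \<le> s}. \<Prod>j\<in>u. \<alpha> j (l j))"
  proof (rule sum.reindex_bij_witness[where i = "\<lambda>l. \<lambda>j\<in>u. l j + of_bool (j \<in> v)"
        and j = "\<lambda>l. \<lambda>j\<in>u. l j - of_bool (j \<in> v)"])
    fix l assume l: "l \<in> {l\<in>?S. \<forall>j\<in>v. 2 \<le> l j}"
    then have ext: "l \<in> u \<rightarrow>\<^sub>E {1..}" and lv: "\<And>j. j \<in> v \<Longrightarrow> 2 \<le> l j" and ls: "sum l u \<le> s"
      by (auto simp: level_simplex_def)
    show "(\<lambda>j\<in>u. (\<lambda>j\<in>u. l j - of_bool (j \<in> v)) j + of_bool (j \<in> v)) = l"
    proof
      fix j show "(\<lambda>j\<in>u. (\<lambda>j\<in>u. l j - of_bool (j \<in> v)) j + of_bool (j \<in> v)) j = l j"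
        using ext lv[of j] by (cases "j \<in> u"; cases "j \<in> v") (auto simp: PiE_iff extensional_def)
    qed
    have "sum l u = (\<Sum>j\<in>u. (l j - of_bool (j \<in> v)) + of_bool (j \<in> v))"
      using lv by (intro sum.cong) force+
    also have "\<dots> = (\<Sum>j\<in>u. l j - of_bool (j \<in> v)) + card v" by (simp add: sum.distrib cardv)
    finally have "(\<Sum>j\<in>u. l j - of_bool (j \<in> v)) + card v \<le> s" using ls by simp
    moreover have "1 \<le> l j - of_bool (j \<in> v)" if "j \<in> u" for j
      using ext lv[of j] that by (cases "j \<in> v") (auto simp: PiE_iff)
    ultimately show "(\<lambda>j\<in>u. l j - of_bool (j \<in> v)) \<in> {l\<in>?S. sum l u + card v \<le> s}"
      by (auto simp: level_simplex_def)
    show "(\<Prod>j\<in>u. \<alpha> j ((\<lambda>j\<in>u. l j - of_bool (j \<in> v)) j)) = (\<Prod>j\<in>u. \<alpha> j (l j - of_bool (j \<in> v)))"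
      by (intro prod.cong) auto
  next
    fix l assume l: "l \<in> {l\<in>?S. sum l u + card v \<le> s}"
    then have ext: "l \<in> u \<rightarrow>\<^sub>E {1..}" and ls: "sum l u + card v \<le> s" by (auto simp: level_simplex_def)
    show "(\<lambda>j\<in>u. (\<lambda>j\<in>u. l j + of_bool (j \<in> v)) j - of_bool (j \<in> v)) = l"
    proof
      fix j show "(\<lambda>j\<in>u. (\<lambda>j\<in>u. l j + of_bool (j \<in> v)) j - of_bool (j \<in> v)) j = l j"
        using ext by (cases "j \<in> u") (auto simp: PiE_iff extensional_def)
    qed
    have "(\<Sum>j\<in>u. l j + of_bool (j \<in> v)) = sum l u + card v" by (simp add: sum.distrib cardv)
    moreover have "2 \<le> l j + of_bool (j \<in> v)" if "j \<in> v" for j using ext that v by (auto simp: PiE_iff)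
    moreover have "1 \<le> l j" if "j \<in> u" for j using ext that by (auto simp: PiE_iff)
    ultimately show "(\<lambda>j\<in>u. l j + of_bool (j \<in> v)) \<in> {l\<in>?S. \<forall>j\<in>v. 2 \<le> l j}"
      using ls v by (auto simp: level_simplex_def intro: trans_le_add1)
  qed
  also have "\<dots> = (\<Sum>l\<in>?S. of_bool (sum l u + card v \<le> s) * (\<Prod>j\<in>u. \<alpha> j (l j)))"
    using finite_level_simplex[OF u] by (intro sum.mono_neutral_cong_left) auto
  finally show ?thesis .
qed

text \<open>Each product of differences is expanded over the subsets \<open>v\<close> of coordinates
  that take the lower level. Shifting the summation index collects the coefficient of every level,
  and coefficients below the band vanish.\<close>

lemma combination_formula:
  fixes \<alpha> :: "nat \<Rightarrow> nat \<Rightarrow> real"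
  assumes u: "finite u" "u \<noteq> {}" and zero: "\<And>j. \<alpha> j 0 = 0"
  shows "(\<Sum>l\<in>level_simplex u s. \<Prod>j\<in>u. \<alpha> j (l j) - \<alpha> j (l j - 1))
    = (\<Sum>l\<in>level_band u s. combination_coeff u s l * (\<Prod>j\<in>u. \<alpha> j (l j)))"
proof -
  let ?S = "level_simplex u s"
  have "(\<Sum>l\<in>?S. \<Prod>j\<in>u. \<alpha> j (l j) - \<alpha> j (l j - 1))
      = (\<Sum>l\<in>?S. \<Sum>v\<in>Pow u. (-1) ^ card v * (\<Prod>j\<in>u. \<alpha> j (l j - of_bool (j \<in> v))))"
  proof (rule sum.cong[OF refl])
    fix l
    have "(\<Prod>j\<in>v. \<alpha> j (l j - 1)) * (\<Prod>j\<in>u - v. \<alpha> j (l j)) = (\<Prod>j\<in>u. \<alpha> j (l j - of_bool (j \<in> v)))"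
      if "v \<in> Pow u" for v
    proof -
      have "(\<Prod>j\<in>u. \<alpha> j (l j - of_bool (j \<in> v))) = (\<Prod>j\<in>u - v. \<alpha> j (l j - of_bool (j \<in> v))) * (\<Prod>j\<in>v. \<alpha> j (l j - of_bool (j \<in> v)))"
        using that u by (intro prod.subset_diff) auto
      also have "\<dots> = (\<Prod>j\<in>u - v. \<alpha> j (l j)) * (\<Prod>j\<in>v. \<alpha> j (l j - 1))"
        by (intro arg_cong2[of _ _ _ _ "(*)"] prod.cong) auto
      finally show ?thesis by (simp add: mult.commute)
    qed
    then show "(\<Prod>j\<in>u. \<alpha> j (l j) - \<alpha> j (l j - 1)) = (\<Sum>v\<in>Pow u. (-1) ^ card v * (\<Prod>j\<in>u. \<alpha> j (l j - of_bool (j \<in> v))))"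
      unfolding prod_diff_conv_sum[OF u(1)] by (intro sum.cong refl) (simp add: mult.assoc)
  qed
  also have "\<dots> = (\<Sum>v\<in>Pow u. (-1) ^ card v * (\<Sum>l\<in>?S. \<Prod>j\<in>u. \<alpha> j (l j - of_bool (j \<in> v))))"
    by (subst sum.swap) (simp add: sum_distrib_left)
  also have "\<dots> = (\<Sum>v\<in>Pow u. (-1) ^ card v * (\<Sum>l\<in>?S. of_bool (sum l u + card v \<le> s) * (\<Prod>j\<in>u. \<alpha> j (l j))))"
    by (intro sum.cong refl arg_cong2[of _ _ _ _ "(*)"] shifted_simplex_sum u zero) auto
  also have "\<dots> = (\<Sum>l\<in>?S. combination_coeff u s l * (\<Prod>j\<in>u. \<alpha> j (l j)))"
    unfolding combination_coeff_def sum_distrib_left sum_distrib_right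
    by (subst sum.swap) (simp add: mult.assoc)
  also have "\<dots> = (\<Sum>l\<in>level_band u s. combination_coeff u s l * (\<Prod>j\<in>u. \<alpha> j (l j)))"
  proof (intro sum.mono_neutral_right finite_level_simplex u(1) level_band_simplex ballI)
    fix l assume "l \<in> ?S - level_band u s"
    then have "sum l u + card u \<le> s" by (auto simp: level_simplex_def level_band_def)
    then show "combination_coeff u s l * (\<Prod>j\<in>u. \<alpha> j (l j)) = 0"
      using combination_coeff_zero[OF u] by simp
  qed
  finally show ?thesis .
qed

text \<open>Levels are cut at \<open>s + 1\<close>, which stands for everything beyond level
  \<open>s\<close> in that coordinate; the tail is therefore finite.\<close>

definition level_tail :: "nat set \<Rightarrow> nat \<Rightarrow> (nat \<Rightarrow> nat) set" where
  "level_tail u s = {l \<in> u \<rightarrow>\<^sub>E {1..s + 1}. s < sum l u}"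

lemma finite_level_tail: "finite u \<Longrightarrow> finite (level_tail u s)"
  by (rule finite_subset[of _ "u \<rightarrow>\<^sub>E {1..s + 1}"]) (auto simp: level_tail_def intro!: finite_PiE)

text \<open>The difference at level \<open>s + 1\<close> is the remainder, so that the differences sum up to \<open>a\<close>.\<close>

lemma smolyak_identity:
  fixes \<alpha> :: "nat \<Rightarrow> nat \<Rightarrow> real" and a :: "nat \<Rightarrow> real"
  assumes u: "finite u" "u \<noteq> {}" and zero: "\<And>j. \<alpha> j 0 = 0"
  shows "(\<Prod>j\<in>u. a j) - (\<Sum>l\<in>level_band u s. combination_coeff u s l * (\<Prod>j\<in>u. \<alpha> j (l j)))
    = (\<Sum>l\<in>level_tail u s. \<Prod>j\<in>u. (a j - \<alpha> j (l j - 1)) - (if l j \<le> s then a j - \<alpha> j (l j) else 0))"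
proof -
  let ?\<Delta> = "\<lambda>j k. (a j - \<alpha> j (k - 1)) - (if k \<le> s then a j - \<alpha> j k else 0)"
  have tele: "(\<Sum>k=1..s + 1. ?\<Delta> j k) = a j" for j
  proof -
    have "(\<Sum>k=1..s. ?\<Delta> j k) = (\<Sum>k=1..s. \<alpha> j k - \<alpha> j (k - 1))" by (intro sum.cong) auto
    also have "\<dots> = \<alpha> j s - \<alpha> j 0"
      by (induction s) (auto simp: sum.atLeast_Suc_atMost_Suc_shift)
    finally show ?thesis using zero by simp
  qed
  have "(\<Prod>j\<in>u. a j) = (\<Prod>j\<in>u. \<Sum>k\<in>{1..s + 1}. ?\<Delta> j k)" by (simp only: tele)
  also have "\<dots> = (\<Sum>l\<in>u \<rightarrow>\<^sub>E {1..s + 1}. \<Prod>j\<in>u. ?\<Delta> j (l j))"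
    using u by (intro prod_sum_PiE) auto
  also have "u \<rightarrow>\<^sub>E {1..s + 1} = level_simplex u s \<union> level_tail u s"
  proof (intro equalityI subsetI)
    fix l assume "l \<in> u \<rightarrow>\<^sub>E {1..s + 1}"
    then show "l \<in> level_simplex u s \<union> level_tail u s"
      by (cases "sum l u \<le> s") (auto simp: level_simplex_def level_tail_def PiE_iff)
  next
    fix l assume l: "l \<in> level_simplex u s \<union> level_tail u s"
    show "l \<in> u \<rightarrow>\<^sub>E {1..s + 1}"
    proof (cases "l \<in> level_tail u s")
      case False
      then have l: "l \<in> level_simplex u s" using l by blast
      then have "l \<in> extensional u" by (simp add: level_simplex_def PiE_iff)
      moreover have "l j \<in> {1..s + 1}" if "j \<in> u" for j using level_simplex_le[OF u(1) l that] by simp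
      ultimately show ?thesis by (simp add: PiE_iff)
    qed (simp add: level_tail_def)
  qed
  also have "(\<Sum>l\<in>level_simplex u s \<union> level_tail u s. \<Prod>j\<in>u. ?\<Delta> j (l j))
      = (\<Sum>l\<in>level_simplex u s. \<Prod>j\<in>u. ?\<Delta> j (l j)) + (\<Sum>l\<in>level_tail u s. \<Prod>j\<in>u. ?\<Delta> j (l j))"
    using u by (intro sum.union_disjoint finite_level_simplex finite_level_tail)
      (auto simp: level_simplex_def level_tail_def)
  also have "(\<Sum>l\<in>level_simplex u s. \<Prod>j\<in>u. ?\<Delta> j (l j)) = (\<Sum>l\<in>level_simplex u s. \<Prod>j\<in>u. \<alpha> j (l j) - \<alpha> j (l j - 1))"
    using level_simplex_le[OF u(1)] by (intro sum.cong prod.cong refl) auto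
  also have "\<dots> = (\<Sum>l\<in>level_band u s. combination_coeff u s l * (\<Prod>j\<in>u. \<alpha> j (l j)))"
    by (rule combination_formula[where \<alpha> = \<alpha>, OF u zero])
  finally show ?thesis by simp
qed

section \<open>Counting levels\<close>

text \<open>All coordinates but one determine the last, and each of them lies in
  \<open>{1..q}\<close>.\<close>

lemma card_levels_le:
  assumes u: "finite u" "u \<noteq> {}"
  shows "card {l \<in> u \<rightarrow>\<^sub>E {1..}. sum l u = q} \<le> q ^ (card u - 1)"
proof -
  let ?T = "{l \<in> u \<rightarrow>\<^sub>E {1..}. sum l u = q}"
  obtain i where i: "i \<in> u" using u by blast
  have "inj_on (\<lambda>l. restrict l (u - {i})) ?T"
  proof (rule inj_onI)
    fix l l' assume l: "l \<in> ?T" and l': "l' \<in> ?T" and eq: "restrict l (u - {i}) = restrict l' (u - {i})"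
    have e: "l j = l' j" if "j \<in> u - {i}" for j using fun_cong[OF eq, of j] that by simp
    have "sum l u = l i + sum l (u - {i})" "sum l' u = l' i + sum l' (u - {i})"
      using u i by (auto simp: sum.remove)
    moreover have "sum l (u - {i}) = sum l' (u - {i})" using e by (intro sum.cong) auto
    ultimately have "l i = l' i" using l l' by simp
    then show "l = l'" using e l l' by (intro PiE_ext[of l u "\<lambda>_. {1..}" l']) auto
  qed
  moreover have "(\<lambda>l. restrict l (u - {i})) ` ?T \<subseteq> (u - {i}) \<rightarrow>\<^sub>E {1..q}"
    using member_le_sum[of _ u] u by (fastforce simp: PiE_iff)
  ultimately have "card ?T \<le> card ((u - {i}) \<rightarrow>\<^sub>E {1..q})"
    using u by (intro card_inj_on_le finite_PiE) auto
  then show ?thesis using u i by (simp add: card_PiE)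
qed

lemma card_level_band_le:
  assumes u: "finite u" "u \<noteq> {}"
  shows "card (level_band u s) \<le> card u * s ^ (card u - 1)"
proof -
  have "level_band u s \<subseteq> (\<Union>q\<in>{s + 1 - card u..s}. {l \<in> u \<rightarrow>\<^sub>E {1..}. sum l u = q})"
    by (auto simp: level_band_def)
  moreover have fin: "finite {l \<in> u \<rightarrow>\<^sub>E {1..}. sum l u = q}" for q :: nat
    by (rule finite_subset[OF _ finite_level_simplex[OF u(1), of q]]) (auto simp: level_simplex_def)
  ultimately have "card (level_band u s) \<le> card (\<Union>q\<in>{s + 1 - card u..s}. {l \<in> u \<rightarrow>\<^sub>E {1..}. sum l u = q})"
    by (intro card_mono) auto
  also have "\<dots> \<le> (\<Sum>q\<in>{s + 1 - card u..s}. card {l \<in> u \<rightarrow>\<^sub>E {1..}. sum l u = q})"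
    by (rule card_UN_le) simp
  also have "\<dots> \<le> (\<Sum>q\<in>{s + 1 - card u..s}. s ^ (card u - 1))"
    by (intro sum_mono order_trans[OF card_levels_le[OF u]] power_mono) auto
  also have "\<dots> \<le> card u * s ^ (card u - 1)"
  proof -
    have "card {s + 1 - card u..s} \<le> card u" by (cases "card u \<le> s + 1") auto
    then show ?thesis by simp
  qed
  finally show ?thesis .
qed

text \<open>Indices are grouped by the excess \<open>i\<close> of their sum over \<open>s\<close>. A
  group has at most \<open>(s + i)^(k - 1)\<close> elements, and
  \<open>s + i \<le> (i + 1) s\<close> for \<open>s \<ge> 1\<close>, so the power of
  \<open>s\<close> factors out of a convergent series.\<close>

lemma level_tail_sum:
  assumes u: "finite u" "u \<noteq> {}"
  shows "\<exists>K>0. \<forall>s\<ge>1. (\<Sum>l\<in>level_tail u s. (1 / 2) ^ (sum l u - s)) \<le> K * real s ^ (card u - 1)"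
proof -
  define k where "k = card u"
  define K where "K = (\<Sum>i. real (Suc i) ^ (k - 1) * (1 / 2) ^ i)"
  have "summable (\<lambda>i. real (Suc i) ^ (k - 1) * (1 / 2) ^ i)"
  proof -
    have "(\<lambda>i. (real (Suc (Suc i)) / real (Suc i)) ^ (k - 1)) \<longlonglongrightarrow> 1 ^ (k - 1)"
      by (intro tendsto_power LIMSEQ_Suc[OF LIMSEQ_Suc_n_over_n])
    then have "\<forall>\<^sub>F i in sequentially. (real (Suc (Suc i)) / real (Suc i)) ^ (k - 1) < 3 / 2"
      by (rule order_tendstoD(2)) simp
    then obtain N where N: "\<And>i. i \<ge> N \<Longrightarrow> (real (Suc (Suc i)) / real (Suc i)) ^ (k - 1) < 3 / 2"
      by (auto simp: eventually_sequentially)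
    show ?thesis
    proof (rule summable_ratio_test[of "3/4" N])
      fix i assume "N \<le> i"
      have "real (Suc (Suc i)) ^ (k - 1) = (real (Suc (Suc i)) / real (Suc i)) ^ (k - 1) * real (Suc i) ^ (k - 1)"
        by (simp add: power_divide)
      also have "\<dots> \<le> 3 / 2 * real (Suc i) ^ (k - 1)"
        using N[OF \<open>N \<le> i\<close>] by (intro mult_right_mono) auto
      finally have "real (Suc (Suc i)) ^ (k - 1) * (1 / 2) ^ Suc i \<le> 3 / 2 * real (Suc i) ^ (k - 1) * (1 / 2) ^ Suc i"
        by (rule mult_right_mono) simp
      then show "norm (real (Suc (Suc i)) ^ (k - 1) * (1 / 2) ^ Suc i) \<le> 3 / 4 * norm (real (Suc i) ^ (k - 1) * (1 / 2) ^ i)"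
        by simp
    qed simp
  qed
  then have sum: "(\<Sum>i\<in>I. real (Suc i) ^ (k - 1) * (1 / 2) ^ i) \<le> K" if "finite I" for I
    unfolding K_def using that by (intro sum_le_suminf) auto
  have "K > 0" using sum[of "{0}"] by simp
  moreover have "(\<Sum>l\<in>level_tail u s. (1 / 2) ^ (sum l u - s)) \<le> K * real s ^ (k - 1)" if s: "s \<ge> 1" for s
  proof -
    let ?I = "(\<lambda>l. sum l u - s) ` level_tail u s"
    have fin: "finite (level_tail u s)" using u by (intro finite_level_tail)
    have "(\<Sum>l\<in>level_tail u s. (1 / 2) ^ (sum l u - s))
        = (\<Sum>i\<in>?I. \<Sum>l\<in>{l\<in>level_tail u s. sum l u - s = i}. (1 / 2) ^ (sum l u - s))"
      using fin by (intro sum.group[symmetric]) auto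
    also have "\<dots> = (\<Sum>i\<in>?I. real (card {l\<in>level_tail u s. sum l u - s = i}) * (1 / 2) ^ i)"
      by (intro sum.cong refl) simp
    also have "\<dots> \<le> (\<Sum>i\<in>?I. (real (Suc i) ^ (k - 1) * real s ^ (k - 1)) * (1 / 2) ^ i)"
    proof (intro sum_mono mult_right_mono)
      fix i
      have "card {l\<in>level_tail u s. sum l u - s = i} \<le> card {l \<in> u \<rightarrow>\<^sub>E {1..}. sum l u = s + i}"
        by (rule card_mono) (auto simp: level_tail_def PiE_iff
            intro!: finite_subset[OF _ finite_level_simplex[OF u(1), of "s + i"]] simp: level_simplex_def)
      also have "\<dots> \<le> (s + i) ^ (k - 1)" unfolding k_def by (rule card_levels_le[OF u])
      also have "\<dots> \<le> (Suc i * s) ^ (k - 1)"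
      proof (rule power_mono)
        have "i * 1 \<le> i * s" using s by (intro mult_left_mono) auto
        then show "s + i \<le> Suc i * s" by simp
      qed simp
      finally have "real (card {l\<in>level_tail u s. sum l u - s = i}) \<le> real ((Suc i * s) ^ (k - 1))" by (simp only: of_nat_le_iff)
      then show "real (card {l\<in>level_tail u s. sum l u - s = i}) \<le> real (Suc i) ^ (k - 1) * real s ^ (k - 1)"
        by (simp only: of_nat_power of_nat_mult power_mult_distrib)
    qed simp
    also have "\<dots> = real s ^ (k - 1) * (\<Sum>i\<in>?I. real (Suc i) ^ (k - 1) * (1 / 2) ^ i)"
      by (simp add: sum_distrib_left mult_ac)
    also have "\<dots> \<le> real s ^ (k - 1) * K" using fin by (intro mult_left_mono sum) auto
    finally show ?thesis by (simp add: mult.commute)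
  qed
  ultimately show ?thesis unfolding k_def by blast
qed

section \<open>Tensor products of operators\<close>

definition sobolev_operator :: "nat \<Rightarrow> real \<Rightarrow> ((real \<Rightarrow> real) \<Rightarrow> real \<Rightarrow> real) \<Rightarrow> bool" where
  "sobolev_operator m b B \<longleftrightarrow>
     (\<forall>F\<in>sobolev m. \<forall>G\<in>sobolev m. B (\<lambda>x. F x + G x) = (\<lambda>x. B F x + B G x)) \<and>
     (\<forall>c. \<forall>F\<in>sobolev m. B (\<lambda>x. c * F x) = (\<lambda>x. c * B F x)) \<and>
     (\<forall>F\<in>sobolev m. B F \<in> sq_int U01 \<and> L2.nrm U01 (B F) \<le> b * sob.nrm m F)"

lemma sq_int_sum:
  assumes "finite I" "\<And>i. i \<in> I \<Longrightarrow> f i \<in> sq_int M"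
  shows "(\<lambda>x. \<Sum>i\<in>I. f i x) \<in> sq_int M"
  using assms
proof (induction I rule: finite_induct)
  case empty
  show ?case by (simp add: sq_int_def)
qed (simp add: sq_int_add)

lemma L2_nrm_sum_le:
  assumes "finite I" "\<And>i. i \<in> I \<Longrightarrow> f i \<in> sq_int M"
  shows "L2.nrm M (\<lambda>x. \<Sum>i\<in>I. f i x) \<le> (\<Sum>i\<in>I. L2.nrm M (f i))"
  using assms
proof (induction I rule: finite_induct)
  case empty
  show ?case by (simp add: L2_nrm)
next
  case (insert i I)
  have "L2.nrm M (\<lambda>x. f i x + (\<Sum>i\<in>I. f i x)) \<le> L2.nrm M (f i) + L2.nrm M (\<lambda>x. \<Sum>i\<in>I. f i x)"
    using insert by (intro L2.nrm_add_le sq_int_sum) auto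
  then show ?case using insert by simp
qed

text \<open>Fubini turns the squared \<open>L_2\<close> norm into the tensor form built from the
  \<open>L_2\<close> inner products of the images, and each of these is dominated by
  \<open>b^2\<close> times the inner product of \<open>sobolev m\<close>.\<close>

lemma tensor_operator_bound:
  assumes S: "S \<in> tensors m d" and B: "\<And>j. j \<in> {1..d} \<Longrightarrow> sobolev_operator m (b j) (B j)"
    and b: "\<And>j. j \<in> {1..d} \<Longrightarrow> b j \<ge> 0"
  shows "(\<lambda>x. \<Sum>F\<leftarrow>S. \<Prod>j=1..d. B j (F j) (x j)) \<in> sq_int (cube_measure d)"
    and "L2.nrm (cube_measure d) (\<lambda>x. \<Sum>F\<leftarrow>S. \<Prod>j=1..d. B j (F j) (x j))
      \<le> (\<Prod>j=1..d. b j) * sqrt (tensor_inner m d S S)"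
proof -
  let ?n = "length S"
  let ?G = "\<lambda>i j. B j ((S ! i) j)"
  let ?P = "\<lambda>i x. \<Prod>j=1..d. ?G i j (x j)"
  have F: "(S ! i) j \<in> sobolev m" if "i < ?n" "j \<in> {1..d}" for i j
    using S that by (auto simp: tensors_def)
  have G: "?G i j \<in> sq_int U01" if "i < ?n" "j \<in> {1..d}" for i j
    using B[OF that(2)] F[OF that] by (simp add: sobolev_operator_def)
  have P: "?P i \<in> sq_int (cube_measure d)" if i: "i < ?n" for i
    unfolding sq_int_def
  proof (intro CollectI conjI)
    show "?P i \<in> borel_measurable (cube_measure d)"
      using G[OF i] by (intro cube_prod_measurable sq_int_measurable) auto
    have "integrable (cube_measure d) (\<lambda>x. \<Prod>j=1..d. (?G i j (x j))\<^sup>2)"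
      using G[OF i] by (intro cube_integral_prod(2)[of d "\<lambda>j t. (?G i j t)\<^sup>2"] sq_int_integrable_sq) auto
    then show "integrable (cube_measure d) (\<lambda>x. (?P i x)\<^sup>2)" by (simp add: prod_power_distrib)
  qed
  have W: "(\<Sum>F\<leftarrow>S. \<Prod>j=1..d. B j (F j) (x j)) = (\<Sum>i<?n. ?P i x)" for x
    by (simp add: sum_list_sum_nth atLeast0LessThan)
  show "(\<lambda>x. \<Sum>F\<leftarrow>S. \<Prod>j=1..d. B j (F j) (x j)) \<in> sq_int (cube_measure d)"
    unfolding W using P by (intro sq_int_sum) auto
  let ?q = "\<lambda>j F G. \<integral>t. B j F t * B j G t \<partial>U01"
  have PP: "(\<integral>x. ?P i x * ?P k x \<partial>cube_measure d) = (\<Prod>j=1..d. ?q j ((S ! i) j) ((S ! k) j))"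
    if "i < ?n" "k < ?n" for i k
  proof -
    have "(\<integral>x. ?P i x * ?P k x \<partial>cube_measure d) = (\<integral>x. (\<Prod>j=1..d. ?G i j (x j) * ?G k j (x j)) \<partial>cube_measure d)"
      by (simp add: prod.distrib)
    also have "\<dots> = (\<Prod>j=1..d. ?q j ((S ! i) j) ((S ! k) j))"
      using G that by (intro cube_integral_prod(1)[of d "\<lambda>j t. ?G i j t * ?G k j t"] sq_int_mult) auto
    finally show ?thesis .
  qed
  have "(\<integral>x. (\<Sum>i<?n. ?P i x)\<^sup>2 \<partial>cube_measure d) = (\<integral>x. (\<Sum>i<?n. \<Sum>k<?n. ?P i x * ?P k x) \<partial>cube_measure d)"
    by (simp add: power2_eq_square sum_product)
  also have "\<dots> = (\<Sum>i<?n. \<Sum>k<?n. \<integral>x. ?P i x * ?P k x \<partial>cube_measure d)"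
    using P by (subst Bochner_Integration.integral_sum)
      (auto intro!: Bochner_Integration.integrable_sum sq_int_mult sum.cong Bochner_Integration.integral_sum)
  also have "\<dots> = tensor_form d ?q S S"
    unfolding tensor_form_index using PP by (intro sum.cong refl) auto
  also have "\<dots> \<le> (\<Prod>j=1..d. b j)\<^sup>2 * tensor_inner m d S S"
  proof (rule tensor_form_le(2)[OF S])
    fix j assume j: "j \<in> {1..d}"
    note Bj = B[OF j, unfolded sobolev_operator_def]
    show "sobolev_semi_inner m (?q j)"
    proof
      fix F G H :: "real \<Rightarrow> real" and c
      assume F: "F \<in> sobolev m"
      show "(\<lambda>x. c * F x) \<in> sobolev m" using F by (rule sobolev_scale)
      show "0 \<le> ?q j F F" by simp
      assume G: "G \<in> sobolev m"
      show "(\<lambda>x. F x + G x) \<in> sobolev m" using F G by (rule sobolev_add)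
      show "?q j F G = ?q j G F" by (simp add: mult.commute)
      show "?q j (\<lambda>x. c * F x) G = c * ?q j F G" using Bj F G by (simp add: L2.ip_smul)
      assume H: "H \<in> sobolev m"
      show "?q j (\<lambda>x. F x + G x) H = ?q j F H + ?q j G H" using Bj F G H by (simp add: L2.ip_add)
    qed
    fix F assume F: "F \<in> sobolev m"
    have "?q j F F = (L2.nrm U01 (B j F))\<^sup>2" using Bj F by (simp add: L2.nrm_sq)
    also have "\<dots> \<le> (b j * sob.nrm m F)\<^sup>2" using Bj F by (intro power_mono L2.nrm_nonneg) auto
    also have "\<dots> = (b j)\<^sup>2 * sobolev_inner m F F" using F by (simp add: power_mult_distrib sob.nrm_sq)
    finally show "?q j F F \<le> (b j)\<^sup>2 * sobolev_inner m F F" .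
  qed
  finally have "sqrt (\<integral>x. (\<Sum>i<?n. ?P i x)\<^sup>2 \<partial>cube_measure d) \<le> sqrt ((\<Prod>j=1..d. b j)\<^sup>2 * tensor_inner m d S S)"
    by simp
  moreover have "(\<Prod>j=1..d. b j) \<ge> 0" using b by (intro prod_nonneg) auto
  ultimately show "L2.nrm (cube_measure d) (\<lambda>x. \<Sum>F\<leftarrow>S. \<Prod>j=1..d. B j (F j) (x j))
      \<le> (\<Prod>j=1..d. b j) * sqrt (tensor_inner m d S S)"
    unfolding W L2_nrm by (simp add: real_sqrt_mult)
qed

section \<open>The sampling inequality on sparse grids\<close>

locale mixed_sampling = mixed_sobolev m d + W: sampling_weights m Y L a for m d Y L a
begin

text \<open>Written with values at anchored grid points, so that it applies to every function on the
  cube; on an elementary tensor it factorizes into univariate operators.\<close>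

definition grid_operator :: "nat set \<Rightarrow> (nat \<Rightarrow> nat) \<Rightarrow> ((nat \<Rightarrow> real) \<Rightarrow> real) \<Rightarrow> (nat \<Rightarrow> real) \<Rightarrow> real" where
  "grid_operator u l f x =
     (\<Sum>y\<in>(\<Pi>\<^sub>E j\<in>u. Y (l j)). (\<Prod>j\<in>u. a (l j) (y j) (x j)) * f (anchor_extend d u y))"

definition smolyak :: "nat set \<Rightarrow> nat \<Rightarrow> ((nat \<Rightarrow> real) \<Rightarrow> real) \<Rightarrow> (nat \<Rightarrow> real) \<Rightarrow> real" where
  "smolyak u s f x = (\<Sum>l\<in>level_band u s. combination_coeff u s l * grid_operator u l f x)"

text \<open>In a coordinate of \<open>u\<close> this is the difference of remainders from
  \<open>smolyak_identity\<close>; in the other coordinates anchoring amounts to evaluation at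
  \<open>0\<close>.\<close>

definition tail_operator :: "nat set \<Rightarrow> nat \<Rightarrow> (nat \<Rightarrow> nat) \<Rightarrow> nat \<Rightarrow> (real \<Rightarrow> real) \<Rightarrow> real \<Rightarrow> real" where
  "tail_operator u s l j F x = (if j \<in> u
     then residual Y a (l j - 1) F x - (if l j \<le> s then residual Y a (l j) F x else 0) else F 0)"

text \<open>The residuals at levels \<open>l j - 1\<close> and \<open>l j\<close> together give
  \<open>L * (2^m + 1)\<close> relative to the finer level, and \<open>m + 1\<close> bounds the
  evaluation at \<open>0\<close>. The product covers both kinds of coordinates.\<close>

definition tail_const :: real where "tail_const = L * (2 ^ m + 1) * (real m + 1)"

lemma residual_add: "residual Y a l (\<lambda>x. F x + G x) x = residual Y a l F x + residual Y a l G x"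
  by (simp add: residual_def distrib_left sum.distrib)

lemma residual_scale: "residual Y a l (\<lambda>x. c * F x) x = c * residual Y a l F x"
  by (simp add: residual_def sum_distrib_left right_diff_distrib mult.left_commute)

text \<open>For \<open>l j = 1\<close> the coarser residual is at level \<open>0\<close>, where the
  operator vanishes and the residual is the function itself; the bound for residuals includes this
  level.\<close>

lemma tail_operator_bound:
  assumes l: "j \<in> u \<Longrightarrow> 1 \<le> l j"
  shows "sobolev_operator m (tail_const * (if j \<in> u then (1 / 2) ^ (m * l j) else 1)) (tail_operator u s l j)"
proof (cases "j \<in> u")
  case True
  have "L2.nrm U01 (tail_operator u s l j F) \<le> tail_const * (1 / 2) ^ (m * l j) * sob.nrm m F
      \<and> tail_operator u s l j F \<in> sq_int U01" if F: "F \<in> sobolev m" for F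
  proof -
    let ?e = "\<lambda>k. residual Y a k F"
    let ?z = "\<lambda>x. if l j \<le> s then ?e (l j) x else 0"
    have z: "?z \<in> sq_int U01" "L2.nrm U01 ?z \<le> L2.nrm U01 (?e (l j))"
      using W.res_sq[OF F] L2.nrm_nonneg[OF W.res_sq[OF F]]
      by (cases "l j \<le> s"; simp add: L2_nrm sq_int_def)+
    have t: "tail_operator u s l j F = L2.sub (?e (l j - 1)) ?z"
      using True by (simp add: tail_operator_def fun_eq_iff)
    have "L2.nrm U01 (tail_operator u s l j F) \<le> L2.nrm U01 (?e (l j - 1)) + L2.nrm U01 ?z"
      unfolding t by (intro L2.nrm_sub_le W.res_sq F z)
    also have "\<dots> \<le> L / 2 ^ (m * (l j - 1)) * sob.nrm m F + L / 2 ^ (m * l j) * sob.nrm m F"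
      using z(2) W.res_le[OF F, of "l j"] W.res_le[OF F, of "l j - 1"] by linarith
    also have "\<dots> = L * (2 ^ m + 1) * (1 / 2) ^ (m * l j) * sob.nrm m F"
    proof -
      have "m * l j = m + m * (l j - 1)" using l[OF True] by (simp add: algebra_simps)
      then have "(2::real) ^ (m * l j) = 2 ^ m * 2 ^ (m * (l j - 1))" by (simp only: power_add)
      then show ?thesis by (simp add: power_one_over field_simps)
    qed
    also have "\<dots> \<le> tail_const * (1 / 2) ^ (m * l j) * sob.nrm m F"
    proof (intro mult_right_mono sob.nrm_nonneg F)
      show "L * (2 ^ m + 1) \<le> tail_const"
        unfolding tail_const_def using W.L mult_left_mono[of 1 "real m + 1" "L * (2 ^ m + 1)"] by simp
    qed simp
    finally show ?thesis unfolding t using L2.sub_closed[OF W.res_sq[OF F] z(1)] by simp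
  qed
  then show ?thesis
    using True unfolding sobolev_operator_def
    by (auto simp: tail_operator_def residual_add residual_scale fun_eq_iff right_diff_distrib)
next
  case False
  have t: "tail_operator u s l j F = (\<lambda>x. F 0)" for F
    using False by (simp add: tail_operator_def fun_eq_iff)
  have "(\<lambda>x. F 0) \<in> sq_int U01 \<and> L2.nrm U01 (\<lambda>x. F 0) \<le> tail_const * sob.nrm m F" if F: "F \<in> sobolev m" for F
  proof
    show "(\<lambda>x. F 0) \<in> sq_int U01" by (rule U01.sq_int_bounded[of _ "\<bar>F 0\<bar>"]) auto
    have "L2.nrm U01 (\<lambda>x. F 0) = \<bar>F 0\<bar>" using U01.prob_space by (simp add: L2_nrm)
    also have "\<dots> \<le> (real m + 1) * sob.nrm m F" using sobolev_abs_le[OF F m, of 0] by simp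
    also have "\<dots> \<le> tail_const * sob.nrm m F"
    proof (intro mult_right_mono sob.nrm_nonneg F)
      have "1 * 1 \<le> L * (2 ^ m + 1)" using W.L by (intro mult_mono) auto
      then show "real m + 1 \<le> tail_const"
        unfolding tail_const_def using mult_right_mono[of 1 "L * (2 ^ m + 1)" "real m + 1"] by simp
    qed
    finally show "L2.nrm U01 (\<lambda>x. F 0) \<le> tail_const * sob.nrm m F" .
  qed
  then show ?thesis using False unfolding sobolev_operator_def t by simp
qed

lemma tail_const_nonneg: "tail_const \<ge> 0"
  using W.L by (simp add: tail_const_def)

lemma prod_split: "u \<subseteq> {1..d} \<Longrightarrow> (\<Prod>j=1..d. g j) = (\<Prod>j\<in>u. g j) * (\<Prod>j\<in>{1..d} - u. g j :: real)"
  by (subst prod.subset_diff[of u]) (auto simp: mult.commute)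

lemma smolyak_add: "smolyak u s (\<lambda>x. f x + g x) x = smolyak u s f x + smolyak u s g x"
  by (simp add: smolyak_def grid_operator_def distrib_left sum.distrib)

text \<open>On an elementary tensor everything factorizes, so at each \<open>x\<close> the identity
  for products of numbers applies, with \<open>F j (x j)\<close> as the full values.\<close>

lemma smolyak_elementary:
  assumes u: "u \<subseteq> {1..d}" "u \<noteq> {}"
  shows "(\<Prod>j=1..d. F j (anchor_extend d u x j)) - smolyak u s (\<lambda>x. \<Prod>j=1..d. F j (x j)) x
    = (\<Sum>l\<in>level_tail u s. \<Prod>j=1..d. tail_operator u s l j (F j) (x j))"
proof -
  have fu: "finite u" using u finite_subset by blast
  let ?\<alpha> = "\<lambda>j k. \<Sum>y\<in>Y k. a k y (x j) * F j y"
  let ?R = "\<Prod>j\<in>{1..d} - u. F j 0"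
  have anch: "(\<Prod>j=1..d. F j (anchor_extend d u y j)) = (\<Prod>j\<in>u. F j (y j)) * ?R" for y
    unfolding prod_split[OF u(1)] using u(1)
    by (intro arg_cong2[of _ _ _ _ "(*)"] prod.cong) (auto simp: anchor_extend_def)
  have grid: "grid_operator u l (\<lambda>x. \<Prod>j=1..d. F j (x j)) x = (\<Prod>j\<in>u. ?\<alpha> j (l j)) * ?R"
    if l: "l \<in> level_band u s" for l
  proof -
    have "(\<Prod>j\<in>u. ?\<alpha> j (l j)) = (\<Sum>y\<in>(\<Pi>\<^sub>E j\<in>u. Y (l j)). \<Prod>j\<in>u. a (l j) (y j) (x j) * F j (y j))"
      using l fu W.fin by (intro prod_sum_PiE) (auto simp: level_band_def PiE_iff)
    then show ?thesis
      unfolding grid_operator_def anch by (simp add: prod.distrib sum_distrib_right mult.assoc)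
  qed
  have zero: "?\<alpha> j 0 = 0" for j by (simp add: W.zero)
  have "(\<Prod>j=1..d. F j (anchor_extend d u x j)) - smolyak u s (\<lambda>x. \<Prod>j=1..d. F j (x j)) x
    = ((\<Prod>j\<in>u. F j (x j)) - (\<Sum>l\<in>level_band u s. combination_coeff u s l * (\<Prod>j\<in>u. ?\<alpha> j (l j)))) * ?R"
    unfolding anch smolyak_def using grid by (simp add: left_diff_distrib sum_distrib_right mult.assoc)
  also have "\<dots> = (\<Sum>l\<in>level_tail u s. (\<Prod>j\<in>u. (F j (x j) - ?\<alpha> j (l j - 1)) - (if l j \<le> s then F j (x j) - ?\<alpha> j (l j) else 0)) * ?R)"
    unfolding smolyak_identity[where \<alpha> = ?\<alpha> and a = "\<lambda>j. F j (x j)", OF fu u(2) zero] sum_distrib_right ..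
  also have "\<dots> = (\<Sum>l\<in>level_tail u s. \<Prod>j=1..d. tail_operator u s l j (F j) (x j))"
    unfolding prod_split[OF u(1)]
    by (intro sum.cong refl arg_cong2[of _ _ _ _ "(*)"] prod.cong) (auto simp: tail_operator_def residual_def)
  finally show ?thesis .
qed

lemma smolyak_tensor:
  assumes u: "u \<subseteq> {1..d}" "u \<noteq> {}"
  shows "tensor_fun d S (anchor_extend d u x) - smolyak u s (tensor_fun d S) x
    = (\<Sum>l\<in>level_tail u s. \<Sum>F\<leftarrow>S. \<Prod>j=1..d. tail_operator u s l j (F j) (x j))"
proof (induction S)
  case Nil
  then show ?case by (simp add: tensor_fun_def smolyak_def grid_operator_def)
next
  case (Cons F S)
  have "tensor_fun d (F # S) = (\<lambda>x. (\<Prod>j=1..d. F j (x j)) + tensor_fun d S x)"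
    by (simp add: tensor_fun_def fun_eq_iff)
  then have "tensor_fun d (F # S) (anchor_extend d u x) - smolyak u s (tensor_fun d (F # S)) x
    = ((\<Prod>j=1..d. F j (anchor_extend d u x j)) - smolyak u s (\<lambda>x. \<Prod>j=1..d. F j (x j)) x)
      + (tensor_fun d S (anchor_extend d u x) - smolyak u s (tensor_fun d S) x)"
    by (simp add: smolyak_add)
  then show ?case unfolding Cons.IH smolyak_elementary[OF u] by (simp add: sum.distrib)
qed

text \<open>A tail index contributes a product of operator norms, with decay
  \<open>2^(-m l j)\<close> per coordinate of \<open>u\<close>. Summation over the tail leaves
  \<open>2^(-m s)\<close> times a power of \<open>s\<close>.\<close>

lemma tensor_smolyak_error:
  assumes u: "u \<subseteq> {1..d}" "u \<noteq> {}"
  shows "\<exists>K>0. \<forall>s\<ge>1. \<forall>S\<in>tensors m d.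
    (\<lambda>x. tensor_fun d S (anchor_extend d u x) - smolyak u s (tensor_fun d S) x) \<in> sq_int (cube_measure d) \<and>
    L2.nrm (cube_measure d) (\<lambda>x. tensor_fun d S (anchor_extend d u x) - smolyak u s (tensor_fun d S) x)
      \<le> K * (1 / 2) ^ (m * s) * real s ^ (card u - 1) * tens.nrm S"
proof -
  have fu: "finite u" using u finite_subset by blast
  obtain K where K: "K > 0" "\<And>s. s \<ge> 1 \<Longrightarrow> (\<Sum>l\<in>level_tail u s. (1 / 2) ^ (sum l u - s)) \<le> K * real s ^ (card u - 1)"
    using level_tail_sum[OF fu u(2)] by blast
  have "(\<lambda>x. tensor_fun d S (anchor_extend d u x) - smolyak u s (tensor_fun d S) x) \<in> sq_int (cube_measure d) \<and>
    L2.nrm (cube_measure d) (\<lambda>x. tensor_fun d S (anchor_extend d u x) - smolyak u s (tensor_fun d S) x)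
      \<le> ((tail_const ^ d + 1) * K) * (1 / 2) ^ (m * s) * real s ^ (card u - 1) * tens.nrm S"
    if s: "s \<ge> 1" and S: "S \<in> tensors m d" for s S
  proof -
    let ?b = "\<lambda>l j. tail_const * (if j \<in> u then (1 / 2) ^ (m * l j) else 1)"
    let ?T = "\<lambda>l x. \<Sum>F\<leftarrow>S. \<Prod>j=1..d. tail_operator u s l j (F j) (x j)"
    have T: "?T l \<in> sq_int (cube_measure d)" "L2.nrm (cube_measure d) (?T l) \<le> (\<Prod>j=1..d. ?b l j) * tens.nrm S"
      if l: "l \<in> level_tail u s" for l
    proof -
      have op: "sobolev_operator m (?b l j) (tail_operator u s l j)" for j
        using l by (intro tail_operator_bound) (auto simp: level_tail_def PiE_iff)
      have nn: "?b l j \<ge> 0" for j using tail_const_nonneg by simp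
      show "?T l \<in> sq_int (cube_measure d)" by (rule tensor_operator_bound(1)[OF S op nn])
      show "L2.nrm (cube_measure d) (?T l) \<le> (\<Prod>j=1..d. ?b l j) * tens.nrm S"
        unfolding tens.nrm_def by (rule tensor_operator_bound(2)[OF S op nn])
    qed
    have bl: "(\<Prod>j=1..d. ?b l j) \<le> tail_const ^ d * ((1 / 2) ^ (m * s) * (1 / 2) ^ (sum l u - s))"
      if l: "l \<in> level_tail u s" for l
    proof -
      have "(\<Prod>j=1..d. ?b l j) = tail_const ^ d * (\<Prod>j=1..d. if j \<in> u then (1 / 2) ^ (m * l j) else 1)"
        by (simp add: prod.distrib)
      also have "(\<Prod>j=1..d. if j \<in> u then (1 / 2) ^ (m * l j) else 1) = (\<Prod>j\<in>u. (1 / 2 :: real) ^ (m * l j))"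
        using u(1) by (simp add: prod.If_cases Int_absorb1)
      also have "\<dots> = (1 / 2) ^ (m * sum l u)" by (simp add: power_sum sum_distrib_left)
      \<comment> \<open>Of the decay beyond \<open>s\<close> only the first power is kept, so that
        the same series serves every \<open>m\<close>.\<close>
      also have "\<dots> \<le> (1 / 2) ^ (m * s + (sum l u - s))"
      proof (rule power_decreasing)
        have sl: "s \<le> sum l u" using l by (simp add: level_tail_def)
        have "1 * (sum l u - s) \<le> m * (sum l u - s)" using m by (intro mult_right_mono) auto
        moreover have "m * sum l u = m * s + m * (sum l u - s)"
          using sl by (metis add_mult_distrib2 le_add_diff_inverse)
        ultimately show "m * s + (sum l u - s) \<le> m * sum l u" by simp
      qed auto
      finally show ?thesis
        using tail_const_nonneg by (simp add: power_add mult_left_mono)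
    qed
    have eq: "(\<lambda>x. tensor_fun d S (anchor_extend d u x) - smolyak u s (tensor_fun d S) x) = (\<lambda>x. \<Sum>l\<in>level_tail u s. ?T l x)"
      by (rule ext) (rule smolyak_tensor[OF u])
    have "L2.nrm (cube_measure d) (\<lambda>x. \<Sum>l\<in>level_tail u s. ?T l x) \<le> (\<Sum>l\<in>level_tail u s. L2.nrm (cube_measure d) (?T l))"
      by (intro L2_nrm_sum_le finite_level_tail fu T)
    also have "\<dots> \<le> (\<Sum>l\<in>level_tail u s. tail_const ^ d * ((1 / 2) ^ (m * s) * (1 / 2) ^ (sum l u - s)) * tens.nrm S)"
      using bl T(2) tens.nrm_nonneg[OF S] by (intro sum_mono) (meson mult_right_mono order_trans)
    also have "\<dots> = (tail_const ^ d * (1 / 2) ^ (m * s) * tens.nrm S) * (\<Sum>l\<in>level_tail u s. (1 / 2) ^ (sum l u - s))"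
      by (simp add: sum_distrib_left mult_ac)
    also have "\<dots> \<le> ((tail_const ^ d + 1) * (1 / 2) ^ (m * s) * tens.nrm S) * (K * real s ^ (card u - 1))"
      using K(2)[OF s] tens.nrm_nonneg[OF S] tail_const_nonneg K(1)
      by (intro mult_mono mult_right_mono) (auto intro!: sum_nonneg)
    finally have "L2.nrm (cube_measure d) (\<lambda>x. \<Sum>l\<in>level_tail u s. ?T l x)
        \<le> ((tail_const ^ d + 1) * K) * (1 / 2) ^ (m * s) * real s ^ (card u - 1) * tens.nrm S"
      by (simp add: mult_ac)
    moreover have "(\<lambda>x. \<Sum>l\<in>level_tail u s. ?T l x) \<in> sq_int (cube_measure d)"
      by (intro sq_int_sum finite_level_tail fu T)
    ultimately show ?thesis unfolding eq by blast
  qed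
  moreover have "(tail_const ^ d + 1) * K > 0"
    using K(1) tail_const_nonneg by (intro mult_pos_pos add_nonneg_pos) auto
  ultimately show ?thesis by blast
qed

section \<open>Boundedness of the grid operators and extension to the mixed space\<close>

lemma grid_in_cube:
  assumes "u \<subseteq> {1..d}" "l \<in> level_band u s" "y \<in> (\<Pi>\<^sub>E j\<in>u. Y (l j))"
  shows "anchor_extend d u y \<in> cube d"
proof -
  have "y j \<in> {0..1}" if "j \<in> u" for j
    using assms that W.sub[of "l j"] by (auto simp: level_band_def PiE_iff)
  then show ?thesis by (auto simp: cube_def anchor_extend_def)
qed

lemma finite_grid: "finite u \<Longrightarrow> l \<in> level_band u s \<Longrightarrow> finite (\<Pi>\<^sub>E j\<in>u. Y (l j))"
  using W.fin by (intro finite_PiE) (auto simp: level_band_def PiE_iff)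

lemma grid_weight_sum_le:
  assumes u: "u \<subseteq> {1..d}" and l: "l \<in> level_band u s" and x: "x \<in> cube d"
  shows "(\<Sum>y\<in>(\<Pi>\<^sub>E j\<in>u. Y (l j)). \<bar>\<Prod>j\<in>u. a (l j) (y j) (x j)\<bar>) \<le> L ^ card u"
proof -
  have fu: "finite u" using u finite_subset by blast
  have l1: "l j \<ge> 1" if "j \<in> u" for j using l that by (auto simp: level_band_def PiE_iff)
  have xj: "x j \<in> {0..1}" if "j \<in> u" for j using x u that by (auto simp: cube_def PiE_iff)
  have "(\<Sum>y\<in>(\<Pi>\<^sub>E j\<in>u. Y (l j)). \<bar>\<Prod>j\<in>u. a (l j) (y j) (x j)\<bar>)
      = (\<Sum>y\<in>(\<Pi>\<^sub>E j\<in>u. Y (l j)). \<Prod>j\<in>u. \<bar>a (l j) (y j) (x j)\<bar>)" by (simp add: abs_prod)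
  also have "\<dots> = (\<Prod>j\<in>u. \<Sum>y\<in>Y (l j). \<bar>a (l j) y (x j)\<bar>)"
    using l1 W.fin fu by (intro prod_sum_PiE[symmetric]) auto
  also have "\<dots> \<le> (\<Prod>j\<in>u. L)"
    using l1 xj by (intro prod_mono conjI W.sum_le sum_nonneg) auto
  finally show ?thesis by simp
qed

lemma grid_operator_abs_le:
  assumes u: "u \<subseteq> {1..d}" and l: "l \<in> level_band u s" and x: "x \<in> cube d"
    and f: "\<And>z. z \<in> cube d \<Longrightarrow> \<bar>f z\<bar> \<le> B"
  shows "\<bar>grid_operator u l f x\<bar> \<le> L ^ card u * B"
proof -
  have B: "B \<ge> 0" using f[OF x] by linarith
  have "\<bar>grid_operator u l f x\<bar> \<le> (\<Sum>y\<in>(\<Pi>\<^sub>E j\<in>u. Y (l j)). \<bar>(\<Prod>j\<in>u. a (l j) (y j) (x j)) * f (anchor_extend d u y)\<bar>)"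
    unfolding grid_operator_def by (rule sum_abs)
  also have "\<dots> \<le> (\<Sum>y\<in>(\<Pi>\<^sub>E j\<in>u. Y (l j)). \<bar>\<Prod>j\<in>u. a (l j) (y j) (x j)\<bar> * B)"
    unfolding abs_mult by (intro sum_mono mult_left_mono f grid_in_cube[OF u l]) auto
  also have "\<dots> \<le> L ^ card u * B"
    unfolding sum_distrib_right[symmetric] by (intro mult_right_mono grid_weight_sum_le[OF u l x] B)
  finally show ?thesis .
qed

lemma smolyak_abs_le:
  assumes u: "u \<subseteq> {1..d}" and x: "x \<in> cube d" and f: "\<And>z. z \<in> cube d \<Longrightarrow> \<bar>f z\<bar> \<le> B"
  shows "\<bar>smolyak u s f x\<bar> \<le> (\<Sum>l\<in>level_band u s. \<bar>combination_coeff u s l\<bar> * (L ^ card u * B))"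
proof -
  have "\<bar>smolyak u s f x\<bar> \<le> (\<Sum>l\<in>level_band u s. \<bar>combination_coeff u s l * grid_operator u l f x\<bar>)"
    unfolding smolyak_def by (rule sum_abs)
  also have "\<dots> \<le> (\<Sum>l\<in>level_band u s. \<bar>combination_coeff u s l\<bar> * (L ^ card u * B))"
    unfolding abs_mult by (intro sum_mono mult_left_mono grid_operator_abs_le[OF u _ x f]) auto
  finally show ?thesis .
qed

text \<open>The bound for tensors is carried to the limit by dominated convergence. The errors are
  bounded on the cube uniformly along the Cauchy sequence, since point values are, and
  \<open>smolyak\<close> combines finitely many of them with bounded weights.\<close>

lemma smolyak_error:
  assumes u: "u \<subseteq> {1..d}" "u \<noteq> {}"
  shows "\<exists>K>0. \<forall>s\<ge>1. \<forall>f\<in>hmix m d.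
    (\<lambda>x. f (anchor_extend d u x) - smolyak u s f x) \<in> sq_int (cube_measure d) \<and>
    L2.nrm (cube_measure d) (\<lambda>x. f (anchor_extend d u x) - smolyak u s f x)
      \<le> K * (1 / 2) ^ (m * s) * real s ^ (card u - 1) * hm.nrm f"
proof -
  obtain K where K: "K > 0" and KS: "\<And>s S. s \<ge> 1 \<Longrightarrow> S \<in> tensors m d \<Longrightarrow>
    (\<lambda>x. tensor_fun d S (anchor_extend d u x) - smolyak u s (tensor_fun d S) x) \<in> sq_int (cube_measure d) \<and>
    L2.nrm (cube_measure d) (\<lambda>x. tensor_fun d S (anchor_extend d u x) - smolyak u s (tensor_fun d S) x)
      \<le> K * (1 / 2) ^ (m * s) * real s ^ (card u - 1) * tens.nrm S"
    using tensor_smolyak_error[OF u] by (elim exE conjE) blast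
  interpret C: prob_space "cube_measure d" by (rule prob_space_cube_measure)
  have "(\<lambda>x. f (anchor_extend d u x) - smolyak u s f x) \<in> sq_int (cube_measure d) \<and>
    L2.nrm (cube_measure d) (\<lambda>x. f (anchor_extend d u x) - smolyak u s f x)
      \<le> K * (1 / 2) ^ (m * s) * real s ^ (card u - 1) * hm.nrm f"
    if s: "s \<ge> 1" and f: "f \<in> hmix m d" for s f
  proof -
    obtain S where S: "tensor_approx m d S f" using f by (rule hmix_approxE)
    have TC: "tensor_Cauchy S" using S by (simp add: tensor_approx_iff)
    note Sk = tensor_Cauchy_tensors[OF TC]
    obtain B where B: "B > 0" "\<And>k. tens.nrm (S k) \<le> B" using tensor_Cauchy_bounded[OF TC] by blast
    define D where "D = eval_bound * B"
    have tfB: "\<bar>tensor_fun d (S k) z\<bar> \<le> D" if "z \<in> cube d" for k z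
      unfolding D_def using tensor_fun_le[OF Sk that] mult_left_mono[OF B(2), of eval_bound k] eval_bound_ge_1
      by (meson order_trans zero_le_one)
    let ?w = "\<lambda>f x. f (anchor_extend d u x) - smolyak u s f x"
    define E where "E = D + (\<Sum>l\<in>level_band u s. \<bar>combination_coeff u s l\<bar> * (L ^ card u * D))"
    have wB: "\<bar>?w (tensor_fun d (S k)) x\<bar> \<le> E" if x: "x \<in> cube d" for k x
    proof -
      have "\<bar>tensor_fun d (S k) (anchor_extend d u x)\<bar> \<le> D" by (rule tfB[OF anchor_extend_cube[OF x]])
      moreover have "\<bar>smolyak u s (tensor_fun d (S k)) x\<bar>
          \<le> (\<Sum>l\<in>level_band u s. \<bar>combination_coeff u s l\<bar> * (L ^ card u * D))"
        by (rule smolyak_abs_le[OF u(1) x tfB])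
      ultimately show ?thesis unfolding E_def by linarith
    qed
    have lim: "(\<lambda>k. tensor_fun d (S k) z) \<longlonglongrightarrow> f z" if "z \<in> cube d" for z
      using S that by (simp add: tensor_approx_iff)
    have wlim: "(\<lambda>k. ?w (tensor_fun d (S k)) x) \<longlonglongrightarrow> ?w f x" if x: "x \<in> cube d" for x
      unfolding smolyak_def grid_operator_def
      by (intro tendsto_diff tendsto_sum tendsto_mult tendsto_const lim anchor_extend_cube x grid_in_cube[OF u(1)])
    have wk: "?w (tensor_fun d (S k)) \<in> borel_measurable (cube_measure d)" for k
      using KS[OF s Sk] by (auto intro: sq_int_measurable)
    have wm: "?w f \<in> borel_measurable (cube_measure d)"
      by (rule borel_measurable_LIMSEQ_real[of _ "\<lambda>k. ?w (tensor_fun d (S k))"])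
        (use wlim wk in \<open>auto simp: space_cube_measure\<close>)
    have wfB: "\<bar>?w f x\<bar> \<le> E" if "x \<in> cube d" for x
      by (rule LIMSEQ_le_const2[OF tendsto_rabs[OF wlim[OF that]]]) (use wB that in auto)
    have wsq: "?w f \<in> sq_int (cube_measure d)"
      by (rule C.sq_int_bounded[OF wm wfB]) (simp add: space_cube_measure)
    have "(\<lambda>k. \<integral>x. (?w (tensor_fun d (S k)) x)\<^sup>2 \<partial>cube_measure d) \<longlonglongrightarrow> (\<integral>x. (?w f x)\<^sup>2 \<partial>cube_measure d)"
    proof (rule integral_dominated_convergence[where w = "\<lambda>_. E\<^sup>2"])
      show "AE x in cube_measure d. (\<lambda>k. (?w (tensor_fun d (S k)) x)\<^sup>2) \<longlonglongrightarrow> (?w f x)\<^sup>2"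
        by (rule AE_I2) (intro tendsto_power wlim, simp add: space_cube_measure)
      show "AE x in cube_measure d. norm ((?w (tensor_fun d (S k)) x)\<^sup>2) \<le> E\<^sup>2" for k
      proof (rule AE_I2)
        fix x assume "x \<in> space (cube_measure d)"
        then have "\<bar>?w (tensor_fun d (S k)) x\<bar>\<^sup>2 \<le> E\<^sup>2" by (intro power_mono wB) (auto simp: space_cube_measure)
        then show "norm ((?w (tensor_fun d (S k)) x)\<^sup>2) \<le> E\<^sup>2" by simp
      qed
    qed (use wk wm in auto)
    then have "(\<lambda>k. L2.nrm (cube_measure d) (?w (tensor_fun d (S k)))) \<longlonglongrightarrow> L2.nrm (cube_measure d) (?w f)"
      unfolding L2_nrm by (rule tendsto_real_sqrt)
    moreover have "(\<lambda>k. K * (1 / 2) ^ (m * s) * real s ^ (card u - 1) * tens.nrm (S k))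
        \<longlonglongrightarrow> K * (1 / 2) ^ (m * s) * real s ^ (card u - 1) * hm.nrm f"
      by (intro tendsto_mult tendsto_const hmix_nrm_limit S)
    ultimately have "L2.nrm (cube_measure d) (?w f) \<le> K * (1 / 2) ^ (m * s) * real s ^ (card u - 1) * hm.nrm f"
      by (rule LIMSEQ_le) (use KS[OF s Sk] in auto)
    then show ?thesis using wsq by blast
  qed
  then show ?thesis using K by blast
qed

text \<open>A Schur test: at each \<open>x\<close> the absolute weights sum to at most
  \<open>L^card u\<close>, and each has integral at most \<open>L^card u * 2^(-sum l u)\<close>.
  Splitting a weight into two square roots gives the pointwise bound \<open>pt\<close>, which is
  then integrated.\<close>

lemma grid_operator_bound:
  assumes u: "u \<subseteq> {1..d}" and l: "l \<in> level_band u s"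
  shows "grid_operator u l f \<in> sq_int (cube_measure d)"
    and "L2.nrm (cube_measure d) (grid_operator u l f)
      \<le> L ^ card u * sqrt ((1 / 2) ^ sum l u) * sqrt (\<Sum>y\<in>(\<Pi>\<^sub>E j\<in>u. Y (l j)). (f (anchor_extend d u y))\<^sup>2)"
proof -
  interpret C: prob_space "cube_measure d" by (rule prob_space_cube_measure)
  have fu: "finite u" using u finite_subset by blast
  let ?G = "\<Pi>\<^sub>E j\<in>u. Y (l j)"
  let ?w = "\<lambda>y x. \<Prod>j\<in>u. a (l j) (y j) (x j)"
  let ?f = "\<lambda>y. f (anchor_extend d u y)"
  have fG: "finite ?G" by (rule finite_grid[OF fu l])
  have wm: "?w y \<in> borel_measurable (cube_measure d)" for y
    using u W.meas by (intro borel_measurable_prod cube_component_measurable) auto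
  have gm: "grid_operator u l f \<in> borel_measurable (cube_measure d)"
    unfolding grid_operator_def using wm by simp
  define B where "B = (\<Sum>y\<in>?G. \<bar>?f y\<bar>)"
  have "\<bar>grid_operator u l f x\<bar> \<le> L ^ card u * B" if x: "x \<in> cube d" for x
  proof -
    have "\<bar>grid_operator u l f x\<bar> \<le> (\<Sum>y\<in>?G. \<bar>?w y x * ?f y\<bar>)"
      unfolding grid_operator_def by (rule sum_abs)
    also have "\<dots> \<le> (\<Sum>y\<in>?G. \<bar>?w y x\<bar> * B)"
      unfolding abs_mult B_def using fG by (intro sum_mono mult_left_mono member_le_sum) auto
    also have "\<dots> \<le> L ^ card u * B"
      unfolding sum_distrib_right[symmetric]
      by (intro mult_right_mono grid_weight_sum_le[OF u l x]) (simp add: B_def sum_nonneg)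
    finally show ?thesis .
  qed
  then show sq: "grid_operator u l f \<in> sq_int (cube_measure d)"
    by (intro C.sq_int_bounded[OF gm]) (simp add: space_cube_measure)
  have int_w: "integrable (cube_measure d) (\<lambda>x. \<bar>?w y x\<bar>)"
    and int_w_le: "(\<integral>x. \<bar>?w y x\<bar> \<partial>cube_measure d) \<le> L ^ card u * (1 / 2) ^ sum l u" for y
  proof -
    let ?g = "\<lambda>j t. if j \<in> u then \<bar>a (l j) (y j) t\<bar> else 1"
    have eq: "\<bar>?w y x\<bar> = (\<Prod>j=1..d. ?g j (x j))" for x
      using u by (simp add: abs_prod prod.If_cases Int_absorb1)
    have ig: "integrable U01 (?g j)" for j using W.int by (cases "j \<in> u") auto
    show "integrable (cube_measure d) (\<lambda>x. \<bar>?w y x\<bar>)"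
      unfolding eq by (rule cube_integral_prod(2)[OF ig])
    have "(\<integral>x. \<bar>?w y x\<bar> \<partial>cube_measure d) = (\<Prod>j=1..d. \<integral>t. ?g j t \<partial>U01)"
      unfolding eq by (rule cube_integral_prod(1)[OF ig])
    also have "\<dots> = (\<Prod>j=1..d. if j \<in> u then \<integral>t. \<bar>a (l j) (y j) t\<bar> \<partial>U01 else 1)"
      using U01.prob_space by (intro prod.cong) auto
    also have "\<dots> = (\<Prod>j\<in>u. \<integral>t. \<bar>a (l j) (y j) t\<bar> \<partial>U01)"
      using u by (simp add: prod.If_cases Int_absorb1)
    also have "\<dots> \<le> (\<Prod>j\<in>u. L * (1 / 2) ^ l j)"
      using W.int_le by (intro prod_mono) (auto simp: power_one_over field_simps)
    also have "\<dots> = L ^ card u * (1 / 2) ^ sum l u" by (simp add: prod.distrib power_sum)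
    finally show "(\<integral>x. \<bar>?w y x\<bar> \<partial>cube_measure d) \<le> L ^ card u * (1 / 2) ^ sum l u" .
  qed
  have pt: "(grid_operator u l f x)\<^sup>2 \<le> L ^ card u * (\<Sum>y\<in>?G. \<bar>?w y x\<bar> * (?f y)\<^sup>2)" if x: "x \<in> cube d" for x
  proof -
    have "\<bar>grid_operator u l f x\<bar> \<le> (\<Sum>y\<in>?G. sqrt \<bar>?w y x\<bar> * (sqrt \<bar>?w y x\<bar> * \<bar>?f y\<bar>))"
      unfolding grid_operator_def by (rule order_trans[OF sum_abs]) (simp add: abs_mult flip: mult.assoc)
    then have "\<bar>grid_operator u l f x\<bar>\<^sup>2 \<le> (\<Sum>y\<in>?G. sqrt \<bar>?w y x\<bar> * (sqrt \<bar>?w y x\<bar> * \<bar>?f y\<bar>))\<^sup>2"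
      by (rule power_mono) simp
    also have "\<dots> \<le> (\<Sum>y\<in>?G. (sqrt \<bar>?w y x\<bar>)\<^sup>2) * (\<Sum>y\<in>?G. (sqrt \<bar>?w y x\<bar> * \<bar>?f y\<bar>)\<^sup>2)"
      by (rule Cauchy_Schwarz_ineq_sum)
    also have "\<dots> = (\<Sum>y\<in>?G. \<bar>?w y x\<bar>) * (\<Sum>y\<in>?G. \<bar>?w y x\<bar> * (?f y)\<^sup>2)"
      by (simp add: power_mult_distrib)
    also have "\<dots> \<le> L ^ card u * (\<Sum>y\<in>?G. \<bar>?w y x\<bar> * (?f y)\<^sup>2)"
      by (intro mult_right_mono grid_weight_sum_le[OF u l x] sum_nonneg) auto
    finally show ?thesis by simp
  qed
  have "(\<integral>x. (grid_operator u l f x)\<^sup>2 \<partial>cube_measure d)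
      \<le> (\<integral>x. L ^ card u * (\<Sum>y\<in>?G. \<bar>?w y x\<bar> * (?f y)\<^sup>2) \<partial>cube_measure d)"
    using pt sq int_w by (intro integral_mono) (auto simp: sq_int_def space_cube_measure)
  also have "\<dots> = L ^ card u * (\<Sum>y\<in>?G. (\<integral>x. \<bar>?w y x\<bar> \<partial>cube_measure d) * (?f y)\<^sup>2)"
    using int_w by simp
  also have "\<dots> \<le> L ^ card u * (\<Sum>y\<in>?G. (L ^ card u * (1 / 2) ^ sum l u) * (?f y)\<^sup>2)"
    using W.L by (intro mult_left_mono sum_mono mult_right_mono int_w_le) auto
  also have "\<dots> = (L ^ card u)\<^sup>2 * (1 / 2) ^ sum l u * (\<Sum>y\<in>?G. (?f y)\<^sup>2)"
    by (simp add: sum_distrib_left power2_eq_square mult_ac)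
  finally have "sqrt (\<integral>x. (grid_operator u l f x)\<^sup>2 \<partial>cube_measure d)
      \<le> sqrt ((L ^ card u)\<^sup>2 * (1 / 2) ^ sum l u * (\<Sum>y\<in>?G. (?f y)\<^sup>2))" by simp
  then show "L2.nrm (cube_measure d) (grid_operator u l f)
      \<le> L ^ card u * sqrt ((1 / 2) ^ sum l u) * sqrt (\<Sum>y\<in>?G. (?f y)\<^sup>2)"
    using W.L by (simp add: L2_nrm real_sqrt_mult)
qed

lemma sparse_grid_band: "sparse_grid Y u s = (\<Union>l\<in>level_band u s. \<Pi>\<^sub>E j\<in>u. Y (l j))"
  by (simp add: sparse_grid_def level_band_def)

lemma finite_sparse_grid: "finite u \<Longrightarrow> finite (sparse_grid Y u s)"
  unfolding sparse_grid_band by (intro finite_UN_I finite_level_band finite_grid)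

text \<open>In the band for \<open>s = p + card u\<close> the levels sum to at least
  \<open>p\<close>, so each grid contributes a factor of at most \<open>sqrt (2^(-p))\<close>, and
  the number of grids gives the power of \<open>s\<close>. Every single grid is part of the sparse
  grid, which bounds its sample norm.\<close>

lemma smolyak_stability:
  assumes u: "u \<subseteq> {1..d}" "u \<noteq> {}"
  shows "smolyak u (p + card u) f \<in> sq_int (cube_measure d)"
    and "L2.nrm (cube_measure d) (smolyak u (p + card u) f)
      \<le> (2 * L) ^ card u * card u * real (p + card u) ^ (card u - 1) * sqrt ((1 / 2) ^ p)
        * sqrt (\<Sum>y\<in>sparse_grid Y u (p + card u). (f (anchor_extend d u y))\<^sup>2)"
proof -
  let ?k = "card u" and ?s = "p + card u"
  have fu: "finite u" using u finite_subset by blast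
  let ?X = "sqrt (\<Sum>y\<in>sparse_grid Y u ?s. (f (anchor_extend d u y))\<^sup>2)"
  let ?g = "\<lambda>l x. combination_coeff u ?s l * grid_operator u l f x"
  have sq: "?g l \<in> sq_int (cube_measure d)" if "l \<in> level_band u ?s" for l
    by (intro sq_int_scale grid_operator_bound[OF u(1) that])
  have eq: "smolyak u ?s f = (\<lambda>x. \<Sum>l\<in>level_band u ?s. ?g l x)" by (simp add: smolyak_def fun_eq_iff)
  show "smolyak u ?s f \<in> sq_int (cube_measure d)"
    unfolding eq by (intro sq_int_sum finite_level_band fu sq)
  have gl: "L2.nrm (cube_measure d) (?g l) \<le> 2 ^ ?k * (L ^ ?k * sqrt ((1 / 2) ^ p) * ?X)" if l: "l \<in> level_band u ?s" for l
  proof -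
    have "L2.nrm (cube_measure d) (?g l) = \<bar>combination_coeff u ?s l\<bar> * L2.nrm (cube_measure d) (grid_operator u l f)"
      by (rule L2.nrm_smul[OF grid_operator_bound(1)[OF u(1) l]])
    also have "\<dots> \<le> 2 ^ ?k * (L ^ ?k * sqrt ((1 / 2) ^ p) * ?X)"
    proof (intro mult_mono abs_combination_coeff_le fu)
      have "sum l u \<ge> p" using l by (auto simp: level_band_def)
      then have "(1 / 2 :: real) ^ sum l u \<le> (1 / 2) ^ p" by (intro power_decreasing) auto
      then have 1: "sqrt ((1 / 2) ^ sum l u) \<le> sqrt ((1 / 2) ^ p)" by simp
      have "(\<Sum>y\<in>(\<Pi>\<^sub>E j\<in>u. Y (l j)). (f (anchor_extend d u y))\<^sup>2) \<le> (\<Sum>y\<in>sparse_grid Y u ?s. (f (anchor_extend d u y))\<^sup>2)"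
        using l by (intro sum_mono2 finite_sparse_grid fu) (auto simp: sparse_grid_band)
      then have 2: "sqrt (\<Sum>y\<in>(\<Pi>\<^sub>E j\<in>u. Y (l j)). (f (anchor_extend d u y))\<^sup>2) \<le> ?X" by simp
      have "L ^ ?k * sqrt ((1 / 2) ^ sum l u) * sqrt (\<Sum>y\<in>(\<Pi>\<^sub>E j\<in>u. Y (l j)). (f (anchor_extend d u y))\<^sup>2)
          \<le> L ^ ?k * sqrt ((1 / 2) ^ p) * ?X"
        using 1 2 W.L by (intro mult_mono mult_left_mono) (auto intro: sum_nonneg)
      then show "L2.nrm (cube_measure d) (grid_operator u l f) \<le> L ^ ?k * sqrt ((1 / 2) ^ p) * ?X"
        using grid_operator_bound(2)[OF u(1) l, of f] by (rule order_trans[rotated])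
    qed (use L2.nrm_nonneg[OF grid_operator_bound(1)[OF u(1) l]] in auto)
    finally show ?thesis .
  qed
  have "L2.nrm (cube_measure d) (smolyak u ?s f) \<le> (\<Sum>l\<in>level_band u ?s. L2.nrm (cube_measure d) (?g l))"
    unfolding eq by (intro L2_nrm_sum_le finite_level_band fu sq)
  also have "\<dots> \<le> (\<Sum>l\<in>level_band u ?s. 2 ^ ?k * (L ^ ?k * sqrt ((1 / 2) ^ p) * ?X))" by (intro sum_mono gl)
  also have "\<dots> = real (card (level_band u ?s)) * (2 ^ ?k * (L ^ ?k * sqrt ((1 / 2) ^ p) * ?X))" by simp
  also have "\<dots> \<le> real (?k * ?s ^ (?k - 1)) * (2 ^ ?k * (L ^ ?k * sqrt ((1 / 2) ^ p) * ?X))"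
  proof (rule mult_right_mono)
    show "real (card (level_band u ?s)) \<le> real (?k * ?s ^ (?k - 1))"
      using card_level_band_le[OF fu u(2), of ?s] by (simp only: of_nat_le_iff)
    show "0 \<le> 2 ^ ?k * (L ^ ?k * sqrt ((1 / 2) ^ p) * ?X)" using W.L by (auto intro!: mult_nonneg_nonneg sum_nonneg)
  qed
  also have "\<dots> = (2 * L) ^ ?k * ?k * real ?s ^ (?k - 1) * sqrt ((1 / 2) ^ p) * ?X"
    by (simp add: power_mult_distrib mult_ac)
  finally show "L2.nrm (cube_measure d) (smolyak u ?s f)
      \<le> (2 * L) ^ ?k * ?k * real ?s ^ (?k - 1) * sqrt ((1 / 2) ^ p) * ?X" .
qed

end

section \<open>The sampling inequality for effective-variable functions\<close>

lemma sum_mset_subset_mono: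
  assumes "A \<subseteq># B" "\<And>x. g x \<ge> (0::real)"
  shows "(\<Sum>x\<in>#A. g x) \<le> (\<Sum>x\<in>#B. g x)"
proof -
  obtain Z where "B = A + Z" using assms(1) mset_subset_eq_exists_conv by blast
  moreover have "0 \<le> (\<Sum>x\<in>#Z. g x)" using assms(2) by (induction Z) (auto intro: add_nonneg_nonneg)
  ultimately show ?thesis by simp
qed

text \<open>The supremum of multisets is controlled once the family is bounded; the sum over
  \<Lambda> is such a bound and later limits the number of points.\<close>

lemma sample_points_bounds:
  assumes "finite \<Lambda>" "\<Lambda> \<noteq> {}"
  shows "u \<in> \<Lambda> \<Longrightarrow> sample_points_at d Y u (p u) \<subseteq># sample_points d Y \<Lambda> p"
    and "sample_points d Y \<Lambda> p \<subseteq># (\<Sum>u\<in>\<Lambda>. sample_points_at d Y u (p u))"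
proof -
  let ?M = "(\<lambda>u. sample_points_at d Y u (p u)) ` \<Lambda>"
  have le: "sample_points_at d Y u (p u) \<subseteq># (\<Sum>u\<in>\<Lambda>. sample_points_at d Y u (p u))" if "u \<in> \<Lambda>" for u
    using assms(1) that by (simp add: sum.remove)
  have bdd: "subset_mset.bdd_above ?M"
    using le by (intro subset_mset.bdd_aboveI[of _ "\<Sum>u\<in>\<Lambda>. sample_points_at d Y u (p u)"]) auto
  show "sample_points_at d Y u (p u) \<subseteq># sample_points d Y \<Lambda> p" if "u \<in> \<Lambda>"
    unfolding sample_points_def using that by (intro subset_mset.cSup_upper bdd) auto
  show "sample_points d Y \<Lambda> p \<subseteq># (\<Sum>u\<in>\<Lambda>. sample_points_at d Y u (p u))"
    unfolding sample_points_def using assms(2) le by (intro subset_mset.cSup_least) auto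
qed

context mixed_sampling
begin

lemma sample_points_at_sum:
  "u \<noteq> {} \<Longrightarrow> (\<Sum>x\<in>#sample_points_at d Y u s. (f x)\<^sup>2) = (\<Sum>y\<in>sparse_grid Y u s. (f (anchor_extend d u y))\<^sup>2)"
  by (simp add: sample_points_at_def sum_unfold_sum_mset image_mset.compositionality o_def)

text \<open>For nonempty \<open>u\<close> the function is split into the Smolyak error and the
  Smolyak operator. For \<open>u = {}\<close> it is the constant value at the anchor, and the
  estimate comes from the multiplicity \<open>card (Y p)\<close> of the anchor, which is at least
  \<open>2^p / 2\<close>.\<close>

lemma anchored_sampling_inequality:
  assumes u: "u \<subseteq> {1..d}" and card_Y: "\<And>p. p \<ge> 1 \<Longrightarrow> 2 ^ p \<le> 2 * card (Y p)"
  shows "\<exists>K>0. \<forall>p\<ge>1. \<forall>f\<in>hmix m d. (\<lambda>x. f (anchor_extend d u x)) \<in> sq_int (cube_measure d) \<and>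
    L2.nrm (cube_measure d) (\<lambda>x. f (anchor_extend d u x))
      \<le> K * real p ^ (card u - 1) * ((1 / 2) ^ (m * p) * hm.nrm f
          + sqrt ((1 / 2) ^ p) * sample.nrm (sample_points_at d Y u (p + card u)) f)"
proof (cases "u = {}")
  case True
  interpret C: prob_space "cube_measure d" by (rule prob_space_cube_measure)
  let ?o = "\<lambda>j\<in>{1..d}. 0 :: real"
  have anch: "anchor_extend d u x = ?o" for x using True by (auto simp: anchor_extend_def fun_eq_iff)
  have "(\<lambda>x. f (anchor_extend d u x)) \<in> sq_int (cube_measure d) \<and>
    L2.nrm (cube_measure d) (\<lambda>x. f (anchor_extend d u x))
      \<le> 2 * real p ^ (card u - 1) * ((1 / 2) ^ (m * p) * hm.nrm f
          + sqrt ((1 / 2) ^ p) * sample.nrm (sample_points_at d Y u (p + card u)) f)"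
    if p: "p \<ge> 1" and f: "f \<in> hmix m d" for p f
  proof
    show "(\<lambda>x. f (anchor_extend d u x)) \<in> sq_int (cube_measure d)"
      unfolding anch by (rule C.sq_int_bounded[of _ "\<bar>f ?o\<bar>"]) auto
    have s: "sample.nrm (sample_points_at d Y u (p + card u)) f = sqrt (card (Y p)) * \<bar>f ?o\<bar>"
      unfolding sample.nrm_def using True
      by (simp add: sample_points_at_def image_mset.compositionality o_def real_sqrt_mult)
    have "L2.nrm (cube_measure d) (\<lambda>x. f (anchor_extend d u x)) = 1 * \<bar>f ?o\<bar>"
      using C.prob_space by (simp add: anch L2_nrm)
    also have "\<dots> \<le> (2 * (sqrt ((1 / 2) ^ p) * sqrt (card (Y p)))) * \<bar>f ?o\<bar>"
    proof (rule mult_right_mono)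
      have "(1 / 2 :: real) \<le> (1 / 2) ^ p * card (Y p)"
      proof -
        have "real (2 ^ p) \<le> real (2 * card (Y p))" using card_Y[OF p] by (simp only: of_nat_le_iff)
        then show ?thesis by (simp add: power_one_over field_simps)
      qed
      then have "sqrt (1 / 4) \<le> sqrt ((1 / 2) ^ p * card (Y p))" by (intro real_sqrt_le_mono) linarith
      then show "1 \<le> 2 * (sqrt ((1 / 2) ^ p) * sqrt (card (Y p)))"
        by (simp add: real_sqrt_mult real_sqrt_divide)
    qed simp
    also have "\<dots> = 2 * (sqrt ((1 / 2) ^ p) * sample.nrm (sample_points_at d Y u (p + card u)) f)"
      unfolding s by (simp only: mult.assoc)
    also have "\<dots> \<le> 2 * ((1 / 2) ^ (m * p) * hm.nrm f
          + sqrt ((1 / 2) ^ p) * sample.nrm (sample_points_at d Y u (p + card u)) f)"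
      using hm.nrm_nonneg[OF f] by (intro mult_left_mono) auto
    finally show "L2.nrm (cube_measure d) (\<lambda>x. f (anchor_extend d u x))
      \<le> 2 * real p ^ (card u - 1) * ((1 / 2) ^ (m * p) * hm.nrm f
          + sqrt ((1 / 2) ^ p) * sample.nrm (sample_points_at d Y u (p + card u)) f)"
      using True by simp
  qed
  then show ?thesis by (intro exI[of _ 2]) auto
next
  case False
  let ?k = "card u"
  obtain K where K: "K > 0" "\<And>s f. s \<ge> 1 \<Longrightarrow> f \<in> hmix m d \<Longrightarrow>
    (\<lambda>x. f (anchor_extend d u x) - smolyak u s f x) \<in> sq_int (cube_measure d) \<and>
    L2.nrm (cube_measure d) (\<lambda>x. f (anchor_extend d u x) - smolyak u s f x)
      \<le> K * (1 / 2) ^ (m * s) * real s ^ (?k - 1) * hm.nrm f"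
    using smolyak_error[OF u False] by (elim exE conjE) blast
  define K1 where "K1 = K + (2 * L) ^ ?k * ?k"
  have K1: "K1 > 0" "K \<le> K1" "(2 * L) ^ ?k * ?k \<le> K1" using K(1) W.L by (auto simp: K1_def intro: add_pos_nonneg)
  have "(\<lambda>x. f (anchor_extend d u x)) \<in> sq_int (cube_measure d) \<and>
    L2.nrm (cube_measure d) (\<lambda>x. f (anchor_extend d u x))
      \<le> (K1 * real (1 + ?k) ^ (?k - 1)) * real p ^ (?k - 1) * ((1 / 2) ^ (m * p) * hm.nrm f
          + sqrt ((1 / 2) ^ p) * sample.nrm (sample_points_at d Y u (p + ?k)) f)"
    if p: "p \<ge> 1" and f: "f \<in> hmix m d" for p f
  proof -
    let ?s = "p + ?k" and ?X = "sample.nrm (sample_points_at d Y u (p + ?k)) f"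
    have X: "?X = sqrt (\<Sum>y\<in>sparse_grid Y u ?s. (f (anchor_extend d u y))\<^sup>2)"
      using sample_points_at_sum[OF False, where s = ?s and f = f] by (simp add: sample.nrm_def power2_eq_square)
    have X0: "?X \<ge> 0" by (rule sample.nrm_nonneg) simp
    have s1: "?s \<ge> 1" using p by simp
    note e = K(2)[OF s1 f] and st = smolyak_stability[OF u False, where p = p and f = f]
    have split: "(\<lambda>x. f (anchor_extend d u x)) = (\<lambda>x. (f (anchor_extend d u x) - smolyak u ?s f x) + smolyak u ?s f x)" by simp
    have sq: "(\<lambda>x. f (anchor_extend d u x)) \<in> sq_int (cube_measure d)"
      by (subst split) (intro sq_int_add st conjunct1[OF e])
    have "L2.nrm (cube_measure d) (\<lambda>x. f (anchor_extend d u x))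
        \<le> L2.nrm (cube_measure d) (\<lambda>x. f (anchor_extend d u x) - smolyak u ?s f x) + L2.nrm (cube_measure d) (smolyak u ?s f)"
      by (subst split) (intro L2.nrm_add_le st conjunct1[OF e])
    also have "\<dots> \<le> K * (1 / 2) ^ (m * ?s) * real ?s ^ (?k - 1) * hm.nrm f
        + (2 * L) ^ ?k * ?k * real ?s ^ (?k - 1) * sqrt ((1 / 2) ^ p) * ?X"
      unfolding X by (intro add_mono conjunct2[OF e] st(2))
    also have "\<dots> \<le> K1 * (1 / 2) ^ (m * p) * real ?s ^ (?k - 1) * hm.nrm f
        + K1 * real ?s ^ (?k - 1) * sqrt ((1 / 2) ^ p) * ?X"
      using K1 K(1) X0 hm.nrm_nonneg[OF f]
      by (intro add_mono mult_right_mono mult_mono power_decreasing) auto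
    also have "\<dots> = K1 * real ?s ^ (?k - 1) * ((1 / 2) ^ (m * p) * hm.nrm f + sqrt ((1 / 2) ^ p) * ?X)"
      by (simp add: algebra_simps)
    \<comment> \<open>Since \<open>p \<ge> 1\<close>, the level \<open>p + card u\<close> is at most
      \<open>(1 + card u) * p\<close>, so its powers are powers of \<open>p\<close> up to a
      constant.\<close>
    also have "\<dots> \<le> K1 * (real (1 + ?k) ^ (?k - 1) * real p ^ (?k - 1)) * ((1 / 2) ^ (m * p) * hm.nrm f + sqrt ((1 / 2) ^ p) * ?X)"
    proof (intro mult_right_mono mult_left_mono)
      have "?k * 1 \<le> ?k * p" using p by (intro mult_left_mono) auto
      then have "?s \<le> (1 + ?k) * p" by simp
      then have "?s ^ (?k - 1) \<le> ((1 + ?k) * p) ^ (?k - 1)" by (rule power_mono) simp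
      then have "real (?s ^ (?k - 1)) \<le> real (((1 + ?k) * p) ^ (?k - 1))" by (simp only: of_nat_le_iff)
      then show "real ?s ^ (?k - 1) \<le> real (1 + ?k) ^ (?k - 1) * real p ^ (?k - 1)"
        by (simp only: of_nat_power of_nat_mult power_mult_distrib)
    qed (use K1 X0 hm.nrm_nonneg[OF f] in auto)
    finally show ?thesis using sq by (simp only: mult.assoc)
  qed
  moreover have "K1 * real (1 + ?k) ^ (?k - 1) > 0" using K1 by simp
  ultimately show ?thesis by blast
qed

text \<open>The anchored representation reduces the norm of \<open>f\<close> to the norms of its
  restrictions. Each of these needs only part of the samples and a power of \<open>p\<close> with
  exponent at most \<open>n - 1\<close>, where \<open>n\<close> is the largest cardinality in
  \<Lambda>.\<close>

lemma hmix_sub_sampling_inequality: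
  assumes \<Lambda>: "\<Lambda> \<subseteq> Pow {1..d}" "\<Lambda> \<noteq> {}" "downward_closed \<Lambda>"
    and card_Y: "\<And>p. p \<ge> 1 \<Longrightarrow> 2 ^ p \<le> 2 * card (Y p)"
  shows "\<exists>K>0. \<forall>p\<ge>1. \<forall>f\<in>hmix_sub m d \<Lambda>. L2.nrm (cube_measure d) f
      \<le> K * real p ^ (Max (card ` \<Lambda>) - 1) * ((1 / 2) ^ (m * p) * hm.nrm f
          + sqrt ((1 / 2) ^ p) * sample.nrm (sample_points d Y \<Lambda> (\<lambda>u. p + card u)) f)"
proof -
  have fin: "finite \<Lambda>" using \<Lambda>(1) finite_subset by blast
  let ?n = "Max (card ` \<Lambda>)"
  obtain c where c: "\<And>f. f \<in> hmix_sub m d \<Lambda> \<longleftrightarrow>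
    f \<in> hmix m d \<and> (\<forall>x\<in>cube d. f x = (\<Sum>v\<in>\<Lambda>. c v * f (anchor_extend d v x)))"
    using hmix_sub_iff[OF \<Lambda>(1,3)] by blast
  have "\<forall>u\<in>\<Lambda>. \<exists>K>0. \<forall>p\<ge>1. \<forall>f\<in>hmix m d. (\<lambda>x. f (anchor_extend d u x)) \<in> sq_int (cube_measure d) \<and>
    L2.nrm (cube_measure d) (\<lambda>x. f (anchor_extend d u x))
      \<le> K * real p ^ (card u - 1) * ((1 / 2) ^ (m * p) * hm.nrm f
          + sqrt ((1 / 2) ^ p) * sample.nrm (sample_points_at d Y u (p + card u)) f)"
    using \<Lambda>(1) card_Y by (intro ballI anchored_sampling_inequality) auto
  from bchoice[OF this] obtain K where "\<forall>u\<in>\<Lambda>. K u > 0 \<and> (\<forall>p\<ge>1. \<forall>f\<in>hmix m d. (\<lambda>x. f (anchor_extend d u x)) \<in> sq_int (cube_measure d) \<and>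
    L2.nrm (cube_measure d) (\<lambda>x. f (anchor_extend d u x))
      \<le> K u * real p ^ (card u - 1) * ((1 / 2) ^ (m * p) * hm.nrm f
          + sqrt ((1 / 2) ^ p) * sample.nrm (sample_points_at d Y u (p + card u)) f))" ..
  then have K: "u \<in> \<Lambda> \<Longrightarrow> K u > 0"
    and Ksq: "u \<in> \<Lambda> \<Longrightarrow> p \<ge> 1 \<Longrightarrow> f \<in> hmix m d \<Longrightarrow> (\<lambda>x. f (anchor_extend d u x)) \<in> sq_int (cube_measure d)"
    and Kle: "u \<in> \<Lambda> \<Longrightarrow> p \<ge> 1 \<Longrightarrow> f \<in> hmix m d \<Longrightarrow> L2.nrm (cube_measure d) (\<lambda>x. f (anchor_extend d u x))
      \<le> K u * real p ^ (card u - 1) * ((1 / 2) ^ (m * p) * hm.nrm f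
          + sqrt ((1 / 2) ^ p) * sample.nrm (sample_points_at d Y u (p + card u)) f)" for u p f
    by blast+
  define C where "C = (\<Sum>u\<in>\<Lambda>. \<bar>c u\<bar> * K u) + 1"
  have C: "C > 0" unfolding C_def using K by (intro add_nonneg_pos sum_nonneg mult_nonneg_nonneg) (auto intro: less_imp_le)
  have "L2.nrm (cube_measure d) f \<le> C * real p ^ (?n - 1) * ((1 / 2) ^ (m * p) * hm.nrm f
          + sqrt ((1 / 2) ^ p) * sample.nrm (sample_points d Y \<Lambda> (\<lambda>u. p + card u)) f)"
    if p: "p \<ge> 1" and f: "f \<in> hmix_sub m d \<Lambda>" for p f
  proof -
    have fh: "f \<in> hmix m d" using f by (rule hmix_sub_hmix)
    let ?E = "(1 / 2) ^ (m * p) * hm.nrm f + sqrt ((1 / 2) ^ p) * sample.nrm (sample_points d Y \<Lambda> (\<lambda>u. p + card u)) f"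
    have E0: "?E \<ge> 0" using hm.nrm_nonneg[OF fh] sample.nrm_nonneg[of f] by simp
    have part: "L2.nrm (cube_measure d) (\<lambda>x. f (anchor_extend d u x)) \<le> K u * (real p ^ (?n - 1) * ?E)" if u: "u \<in> \<Lambda>" for u
    proof -
      have "sample.nrm (sample_points_at d Y u (p + card u)) f \<le> sample.nrm (sample_points d Y \<Lambda> (\<lambda>u. p + card u)) f"
        unfolding sample.nrm_def
        by (intro real_sqrt_le_mono sum_mset_subset_mono sample_points_bounds(1)[OF fin \<Lambda>(2) u]) simp
      then have 1: "(1 / 2) ^ (m * p) * hm.nrm f + sqrt ((1 / 2) ^ p) * sample.nrm (sample_points_at d Y u (p + card u)) f \<le> ?E"
        by (intro add_left_mono mult_left_mono) auto
      have "card u \<le> ?n" using fin u by (intro Max_ge) auto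
      then have 2: "real p ^ (card u - 1) \<le> real p ^ (?n - 1)" using p by (intro power_increasing) auto
      have "L2.nrm (cube_measure d) (\<lambda>x. f (anchor_extend d u x))
        \<le> K u * (real p ^ (card u - 1) * ((1 / 2) ^ (m * p) * hm.nrm f
          + sqrt ((1 / 2) ^ p) * sample.nrm (sample_points_at d Y u (p + card u)) f))"
        using Kle[OF u p fh] by (simp only: mult.assoc)
      also have "\<dots> \<le> K u * (real p ^ (?n - 1) * ?E)"
        using 1 2 K[OF u] hm.nrm_nonneg[OF fh] sample.nrm_nonneg[of f] by (intro mult_left_mono mult_mono) auto
      finally show ?thesis .
    qed
    have sqc: "(\<lambda>x. c u * f (anchor_extend d u x)) \<in> sq_int (cube_measure d)" if "u \<in> \<Lambda>" for u
      using Ksq[OF that p fh] by (rule sq_int_scale)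
    have fx: "f x = (\<Sum>v\<in>\<Lambda>. c v * f (anchor_extend d v x))" if "x \<in> cube d" for x
      using conjunct2[OF iffD1[OF c f]] that by blast
    have "L2.nrm (cube_measure d) f = L2.nrm (cube_measure d) (\<lambda>x. \<Sum>v\<in>\<Lambda>. c v * f (anchor_extend d v x))"
      unfolding L2_nrm by (intro arg_cong[of _ _ sqrt] Bochner_Integration.integral_cong refl arg_cong[of _ _ "\<lambda>t. t\<^sup>2"] fx)
        (simp add: space_cube_measure)
    also have "\<dots> \<le> (\<Sum>v\<in>\<Lambda>. L2.nrm (cube_measure d) (\<lambda>x. c v * f (anchor_extend d v x)))"
      by (intro L2_nrm_sum_le fin sqc)
    also have "\<dots> = (\<Sum>v\<in>\<Lambda>. \<bar>c v\<bar> * L2.nrm (cube_measure d) (\<lambda>x. f (anchor_extend d v x)))"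
      by (intro sum.cong refl L2.nrm_smul Ksq[OF _ p fh])
    also have "\<dots> \<le> (\<Sum>v\<in>\<Lambda>. \<bar>c v\<bar> * (K v * (real p ^ (?n - 1) * ?E)))"
      by (intro sum_mono mult_left_mono part) auto
    also have "\<dots> = (\<Sum>v\<in>\<Lambda>. \<bar>c v\<bar> * K v) * (real p ^ (?n - 1) * ?E)" by (simp only: sum_distrib_right mult.assoc)
    also have "\<dots> \<le> C * (real p ^ (?n - 1) * ?E)" using E0 by (intro mult_right_mono) (auto simp: C_def)
    finally show ?thesis by (simp only: mult.assoc)
  qed
  then show ?thesis using C by blast
qed

end

section \<open>The number of sampling points\<close>

lemma sampling_sequence_card:
  assumes "sampling_sequence Y" "l \<ge> 1"
  shows "card (Y l) \<le> 2 ^ l" and "2 ^ l \<le> 2 * card (Y l)"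
proof -
  have "card (Y l) \<le> 2 ^ l \<and> 2 ^ l \<le> 2 * card (Y l)"
  proof (cases "l = 1")
    case True
    then show ?thesis using assms by (simp add: sampling_sequence_def)
  next
    case False
    then have "card (Y l) = 2 ^ (l - 1) + 1" using assms by (simp add: sampling_sequence_def)
    moreover have "(2::nat) ^ l = 2 * 2 ^ (l - 1)" using assms(2) by (cases l) auto
    ultimately show ?thesis by simp
  qed
  then show "card (Y l) \<le> 2 ^ l" and "2 ^ l \<le> 2 * card (Y l)" by auto
qed

text \<open>A grid in the band has at most \<open>2^(p + card u)\<close> points, and the number of
  grids is at most a constant times \<open>p^(card u - 1)\<close>; points shared by several grids
  are counted repeatedly. The resulting constant depends on \<open>d\<close> alone.\<close>

lemma sample_points_at_size_le:
  assumes Y: "sampling_sequence Y" and u: "u \<subseteq> {1..d}" and p: "p \<ge> 1" and k: "card u \<le> n"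
  shows "size (sample_points_at d Y u (p + card u)) \<le> (d + 1) * (d + 1) ^ d * 2 ^ d * p ^ (n - 1) * 2 ^ p"
proof (cases "u = {}")
  case True
  have "size (sample_points_at d Y u (p + card u)) \<le> 1 * 2 ^ p"
    using True sampling_sequence_card(1)[OF Y p] by (simp add: sample_points_at_def)
  also have "\<dots> \<le> ((d + 1) * (d + 1) ^ d * 2 ^ d * p ^ (n - 1)) * 2 ^ p"
    using p by (intro mult_right_mono) (simp_all add: Suc_leI)
  finally show ?thesis .
next
  case False
  have fu: "finite u" using u finite_subset by blast
  let ?k = "card u" and ?s = "p + card u"
  have kd: "?k \<le> d" using card_mono[OF _ u] by simp
  have lY: "finite (Y (l j))" "card (Y (l j)) \<le> 2 ^ l j" if "l \<in> level_band u ?s" "j \<in> u" for l j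
    using that Y sampling_sequence_card(1)[OF Y, of "l j"] by (auto simp: level_band_def PiE_iff sampling_sequence_def)
  have "size (sample_points_at d Y u ?s) = card (sparse_grid Y u ?s)"
    using False by (simp add: sample_points_at_def)
  also have "\<dots> \<le> (\<Sum>l\<in>level_band u ?s. card (\<Pi>\<^sub>E j\<in>u. Y (l j)))"
    unfolding sparse_grid_def level_band_def[symmetric] by (intro card_UN_le finite_level_band fu)
  also have "\<dots> \<le> (\<Sum>l\<in>level_band u ?s. 2 ^ ?s)"
  proof (rule sum_mono)
    fix l assume l: "l \<in> level_band u ?s"
    have "card (\<Pi>\<^sub>E j\<in>u. Y (l j)) = (\<Prod>j\<in>u. card (Y (l j)))" by (rule card_PiE[OF fu])
    also have "\<dots> \<le> (\<Prod>j\<in>u. 2 ^ l j)" using lY(2)[OF l] by (intro prod_mono) auto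
    also have "\<dots> = 2 ^ sum l u" by (simp add: power_sum)
    also have "\<dots> \<le> 2 ^ ?s" using l by (intro power_increasing) (auto simp: level_band_def)
    finally show "card (\<Pi>\<^sub>E j\<in>u. Y (l j)) \<le> 2 ^ ?s" .
  qed
  also have "\<dots> = card (level_band u ?s) * 2 ^ ?s" by simp
  also have "\<dots> \<le> (?k * ?s ^ (?k - 1)) * 2 ^ ?s"
    by (intro mult_right_mono card_level_band_le fu False) simp
  also have "\<dots> \<le> ((d + 1) * ((d + 1) ^ d * p ^ (n - 1))) * (2 ^ p * 2 ^ d)"
  proof (intro mult_mono)
    have "?k * 1 \<le> d * p" using p kd by (intro mult_mono) auto
    then have "?s \<le> (d + 1) * p" by simp
    then have "?s ^ (?k - 1) \<le> ((d + 1) * p) ^ (?k - 1)" by (rule power_mono) simp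
    also have "\<dots> = (d + 1) ^ (?k - 1) * p ^ (?k - 1)" by (rule power_mult_distrib)
    also have "\<dots> \<le> (d + 1) ^ d * p ^ (n - 1)"
      using kd k p by (intro mult_mono power_increasing) auto
    finally show "?s ^ (?k - 1) \<le> (d + 1) ^ d * p ^ (n - 1)" .
    show "(2::nat) ^ ?s \<le> 2 ^ p * 2 ^ d" using kd by (simp add: power_add)
  qed (use kd in auto)
  finally show ?thesis by (simp only: mult.assoc mult.commute mult.left_commute)
qed

text \<open>Since \<open>n \<ge> 1\<close>, a nonempty set lies in \<Lambda> and with it a
  singleton, whose sparse grid is a copy of \<open>Y (p + 1)\<close> with \<open>2^p + 1\<close>
  points. The upper bound adds up all members of \<Lambda>, of which there are at most
  \<open>2^d\<close>.\<close>

lemma sample_points_size: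
  assumes Y: "sampling_sequence Y" and \<Lambda>: "\<Lambda> \<subseteq> Pow {1..d}" "\<Lambda> \<noteq> {}" "downward_closed \<Lambda>"
    and n: "n = Max (card ` \<Lambda>)" "n \<ge> 1" and p: "p \<ge> 1"
  defines "N \<equiv> size (sample_points d Y \<Lambda> (\<lambda>u. p + card u))"
  shows "2 ^ p + 1 \<le> N" and "N \<le> 2 ^ d * ((d + 1) * (d + 1) ^ d * 2 ^ d) * p ^ (n - 1) * 2 ^ p"
proof -
  have fin: "finite \<Lambda>" using \<Lambda>(1) finite_subset by blast
  note X = sample_points_bounds[OF fin \<Lambda>(2), where d = d and Y = Y and p = "\<lambda>u. p + card u"]
  have "n \<in> card ` \<Lambda>" unfolding n(1) using fin \<Lambda>(2) by (intro Max_in) auto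
  then obtain u where u: "u \<in> \<Lambda>" "card u = n" by auto
  have "u \<noteq> {}" using u(2) n(2) by auto
  then obtain j where ju: "j \<in> u" by blast
  have j: "{j} \<in> \<Lambda>" using \<Lambda>(3) u(1) ju by (auto simp: downward_closed_def)
  let ?l = "\<lambda>i\<in>{j}. p + 1"
  have grid: "sparse_grid Y {j} (p + 1) = (\<Pi>\<^sub>E i\<in>{j}. Y (p + 1))"
  proof -
    have "level_band {j} (p + 1) = {?l}"
    proof (intro equalityI subsetI)
      fix l assume "l \<in> level_band {j} (p + 1)"
      then have "l \<in> extensional {j}" "l j = p + 1" by (auto simp: level_band_def PiE_iff)
      then have "l = ?l" by (auto simp: extensional_def fun_eq_iff)
      then show "l \<in> {?l}" by simp
    qed (use p in \<open>auto simp: level_band_def\<close>)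
    then have "sparse_grid Y {j} (p + 1) = (\<Pi>\<^sub>E i\<in>{j}. Y (?l i))"
      unfolding sparse_grid_def level_band_def[symmetric] by simp
    also have "\<dots> = (\<Pi>\<^sub>E i\<in>{j}. Y (p + 1))" by (rule PiE_cong) simp
    finally show ?thesis .
  qed
  have "card (Y (p + 1)) = 2 ^ p + 1" using Y p by (simp add: sampling_sequence_def)
  then have "size (sample_points_at d Y {j} (p + card {j})) = 2 ^ p + 1"
    using grid by (simp add: sample_points_at_def card_PiE)
  then show "2 ^ p + 1 \<le> N" using size_mset_mono[OF X(1)[OF j]] by (simp add: N_def)
  have "N \<le> (\<Sum>u\<in>\<Lambda>. size (sample_points_at d Y u (p + card u)))"
    using size_mset_mono[OF X(2)] by (simp add: N_def size_multiset_sum)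
  also have "\<dots> \<le> (\<Sum>u\<in>\<Lambda>. (d + 1) * (d + 1) ^ d * 2 ^ d * p ^ (n - 1) * 2 ^ p)"
    using \<Lambda>(1) fin unfolding n(1) by (intro sum_mono sample_points_at_size_le[OF Y _ p]) auto
  also have "\<dots> = card \<Lambda> * ((d + 1) * (d + 1) ^ d * 2 ^ d * p ^ (n - 1) * 2 ^ p)" by simp
  also have "\<dots> \<le> 2 ^ d * ((d + 1) * (d + 1) ^ d * 2 ^ d * p ^ (n - 1) * 2 ^ p)"
    using card_mono[OF _ \<Lambda>(1)] by (intro mult_right_mono) (auto simp: card_Pow)
  finally show "N \<le> 2 ^ d * ((d + 1) * (d + 1) ^ d * 2 ^ d) * p ^ (n - 1) * 2 ^ p" by (simp add: mult_ac)
qed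

section \<open>Rates\<close>

lemma rate1_eq:
  assumes "N \<ge> 2" "n \<ge> 1"
  shows "rate1 m n N = ln (real N) ^ ((m + 1) * (n - 1)) / real N ^ m"
proof -
  have "rho1 m n = real ((m + 1) * (n - 1))" 
    unfolding rho1_def of_nat_mult of_nat_diff[OF assms(2)] by simp
  moreover have "ln (real N) > 0" using assms(1) by simp
  ultimately have "ln (real N) powr rho1 m n = ln (real N) ^ ((m + 1) * (n - 1))" by (simp only: powr_realpow)
  moreover have "real N powr - real m = 1 / real N ^ m"
    using assms(1) by (simp add: powr_minus powr_realpow inverse_eq_divide)
  ultimately show ?thesis by (simp add: rate1_def)
qed

lemma rate2_eq:
  assumes "N \<ge> 2" "n \<ge> 1"
  shows "rate2 n N = ln (real N) ^ (n - 1) * sqrt (ln (real N) ^ (n - 1)) / sqrt (real N)"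
proof -
  let ?x = "ln (real N)"
  have x: "?x > 0" using assms(1) by simp
  have "rho2 n = real (n - 1) + real (n - 1) * (1 / 2)" using assms(2) by (simp add: rho2_def of_nat_diff field_simps)
  then have "?x powr rho2 n = ?x powr real (n - 1) * (?x powr real (n - 1)) powr (1 / 2)"
    by (simp only: powr_add powr_powr)
  also have "\<dots> = ?x ^ (n - 1) * sqrt (?x ^ (n - 1))"
    using x by (simp only: powr_realpow) (simp add: powr_half_sqrt)
  moreover have "real N powr - (1 / 2) = 1 / sqrt (real N)"
    using assms(1) by (simp add: powr_minus powr_half_sqrt inverse_eq_divide)
  ultimately show ?thesis by (simp add: rate2_def)
qed

text \<open>\<open>2^p \<le> N\<close> and \<open>ln 2 \<ge> 1/2\<close> give
  \<open>p \<le> 2 ln N\<close>, and the upper bound on \<open>N\<close> gives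
  \<open>2^(-p) \<le> K p^(n-1) / N\<close>. The parameter \<open>e\<close> dominates
  \<open>n\<close>, so that the constants do not involve \<open>n\<close>.\<close>

lemma level_rates:
  assumes p: "p \<ge> 1" and n: "n \<ge> 1" "n \<le> e" and K: "K \<ge> 1"
    and N: "2 ^ p + 1 \<le> N" "real N \<le> K * real p ^ (n - 1) * 2 ^ p"
  shows "real p ^ (n - 1) * (1 / 2) ^ (m * p) \<le> (K ^ m * 2 ^ ((m + 1) * e)) * rate1 m n N"
    and "real p ^ (n - 1) * sqrt ((1 / 2) ^ p) \<le> (K * 4 ^ e) * rate2 n N"
proof -
  let ?q = "real p ^ (n - 1)" and ?x = "ln (real N)"
  have N2: "N \<ge> 2" using N(1) one_le_power[of "2::nat" p] by linarith
  have Np: "real N > 0" using N2 by simp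
  have x: "?x > 0" using N2 by simp
  have "real (2 ^ p) \<le> real N" using N(1) by (simp only: of_nat_le_iff)
  then have "ln ((2::real) ^ p) \<le> ?x" using Np by simp
  then have "real p * ln 2 \<le> ?x" by (simp add: ln_realpow)
  moreover have "real p * (1 / 2) \<le> real p * ln 2" using ln2_ge_two_thirds by (intro mult_left_mono) auto
  ultimately have px: "real p \<le> 2 * ?x" by simp
  have h: "(1 / 2) ^ p \<le> K * ?q / real N"
    using N(2) Np by (simp add: power_one_over field_simps)
  have q0: "?q \<ge> 0" by simp
  show "?q * (1 / 2) ^ (m * p) \<le> (K ^ m * 2 ^ ((m + 1) * e)) * rate1 m n N"
  proof -
    have "?q * (1 / 2) ^ (m * p) = ?q * ((1 / 2) ^ p) ^ m" by (simp add: power_mult[symmetric] mult.commute)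
    also have "\<dots> \<le> ?q * (K * ?q / real N) ^ m" using h by (intro mult_left_mono power_mono) auto
    also have "\<dots> = K ^ m * real p ^ ((m + 1) * (n - 1)) / real N ^ m"
      by (simp add: power_mult_distrib power_divide power_add power_mult[symmetric] mult.commute[of m])
    also have "\<dots> \<le> K ^ m * (2 * ?x) ^ ((m + 1) * (n - 1)) / real N ^ m"
      using px K by (intro divide_right_mono mult_left_mono power_mono) auto
    also have "\<dots> = K ^ m * 2 ^ ((m + 1) * (n - 1)) * rate1 m n N"
      unfolding rate1_eq[OF N2 n(1)] by (simp only: power_mult_distrib times_divide_eq_right mult.assoc)
    also have "\<dots> \<le> K ^ m * 2 ^ ((m + 1) * e) * rate1 m n N"
      using K n x unfolding rate1_eq[OF N2 n(1)]
      by (intro mult_right_mono mult_left_mono power_increasing divide_nonneg_nonneg) auto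
    finally show ?thesis .
  qed
  show "?q * sqrt ((1 / 2) ^ p) \<le> (K * 4 ^ e) * rate2 n N"
  proof -
    let ?t = "(2::real) ^ (n - 1)" and ?z = "?x ^ (n - 1)"
    have y: "?q \<le> ?t * ?z"
      using px by (simp only: power_mult_distrib[symmetric]) (intro power_mono, auto)
    have t1: "?t \<ge> 1" by simp
    have z0: "?z \<ge> 0" using x by (intro zero_le_power) linarith
    have "?q * sqrt ((1 / 2) ^ p) \<le> ?q * sqrt (K * ?q / real N)" using h by (intro mult_left_mono) auto
    also have "\<dots> = sqrt K * (?q * sqrt ?q) / sqrt (real N)" by (simp add: real_sqrt_mult real_sqrt_divide)
    also have "\<dots> \<le> K * (?t * ?z * sqrt (?t * ?z)) / sqrt (real N)"
    proof (intro divide_right_mono mult_mono)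
      have "K * 1 \<le> K * K" using K by (intro mult_left_mono) auto
      then show "sqrt K \<le> K" using K by (intro real_le_lsqrt) (auto simp: power2_eq_square)
    qed (use y K z0 in auto)
    also have "\<dots> = K * (?t * sqrt ?t) * rate2 n N"
      unfolding rate2_eq[OF N2 n(1)] by (simp add: real_sqrt_mult mult_ac)
    also have "\<dots> \<le> K * 4 ^ e * rate2 n N"
    proof (intro mult_right_mono mult_left_mono)
      have "?t * 1 \<le> ?t * ?t" using t1 by (intro mult_left_mono) auto
      then have "sqrt ?t \<le> ?t" using t1 by (intro real_le_lsqrt) (auto simp: power2_eq_square)
      then have "?t * sqrt ?t \<le> ?t * ?t" by (intro mult_left_mono) auto
      also have "\<dots> = 4 ^ (n - 1)" by (simp flip: power_mult_distrib)
      also have "\<dots> \<le> 4 ^ e" using n by (intro power_increasing) auto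
      finally show "?t * sqrt ?t \<le> 4 ^ e" .
      show "0 \<le> rate2 n N" unfolding rate2_eq[OF N2 n(1)] using x by simp
    qed (use K in auto)
    finally show ?thesis .
  qed
qed

context mixed_sampling
begin

text \<open>For fixed \<open>d\<close> there are finitely many \<Lambda>, so the sum of their
  constants serves all of them, and \<open>n \<le> d\<close> keeps the conversion to rates
  uniform.\<close>

lemma uniform_sampling_inequality:
  assumes Y: "sampling_sequence Y"
  shows "\<exists>C>0. \<forall>\<Lambda> p n X N. \<Lambda> \<subseteq> Pow {1..d} \<and> \<Lambda> \<noteq> {} \<and> downward_closed \<Lambda> \<and> n = Max (card ` \<Lambda>) \<and> n \<ge> 1 \<and> p \<ge> 1 \<and>
      X = sample_points d Y \<Lambda> (\<lambda>u. p + card u) \<and> N = size X \<longrightarrow>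
      (\<forall>f\<in>hmix_sub m d \<Lambda>. L2.nrm (cube_measure d) f \<le> C * (rate1 m n N * hm.nrm f + rate2 n N * sample.nrm X f))"
proof -
  let ?A = "{\<Lambda>. \<Lambda> \<subseteq> Pow {1..d} \<and> \<Lambda> \<noteq> {} \<and> downward_closed \<Lambda>}"
  have "?A \<subseteq> Pow (Pow {1..d})" by blast
  then have fin: "finite ?A" by (rule finite_subset) simp
  have "\<forall>\<Lambda>\<in>?A. \<exists>K>0. \<forall>p\<ge>1. \<forall>f\<in>hmix_sub m d \<Lambda>. L2.nrm (cube_measure d) f
      \<le> K * real p ^ (Max (card ` \<Lambda>) - 1) * ((1 / 2) ^ (m * p) * hm.nrm f
          + sqrt ((1 / 2) ^ p) * sample.nrm (sample_points d Y \<Lambda> (\<lambda>u. p + card u)) f)"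
    using sampling_sequence_card(2)[OF Y] by (intro ballI hmix_sub_sampling_inequality) auto
  from bchoice[OF this] obtain K where K: "\<forall>\<Lambda>\<in>?A. K \<Lambda> > 0 \<and> (\<forall>p\<ge>1. \<forall>f\<in>hmix_sub m d \<Lambda>. L2.nrm (cube_measure d) f
      \<le> K \<Lambda> * real p ^ (Max (card ` \<Lambda>) - 1) * ((1 / 2) ^ (m * p) * hm.nrm f
          + sqrt ((1 / 2) ^ p) * sample.nrm (sample_points d Y \<Lambda> (\<lambda>u. p + card u)) f))" ..
  define K1 where "K1 = (\<Sum>\<Lambda>\<in>?A. K \<Lambda>) + 1"
  have K0: "K \<Lambda> \<ge> 0" if "\<Lambda> \<in> ?A" for \<Lambda> using K that by (blast intro: less_imp_le)
  have K1: "K1 > 0" unfolding K1_def using K0 by (intro add_nonneg_pos sum_nonneg) auto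
  have KK1: "K \<Lambda> \<le> K1" if "\<Lambda> \<in> ?A" for \<Lambda>
  proof -
    have "K \<Lambda> \<le> sum K ?A" by (rule member_le_sum[OF that _ fin]) (use K0 in blast)
    then show ?thesis unfolding K1_def by linarith
  qed
  define Q where "Q = real (2 ^ d * ((d + 1) * (d + 1) ^ d * 2 ^ d))"
  have "1 * (1 * 1 * 1) \<le> 2 ^ d * ((d + 1) * (d + 1) ^ d * 2 ^ d)" by (intro mult_le_mono) auto
  then have "real 1 \<le> Q" unfolding Q_def by (subst of_nat_le_iff) simp
  then have Q: "Q \<ge> 1" by simp
  define R where "R = Q ^ m * 2 ^ ((m + 1) * d) + Q * 4 ^ d"
  have R: "R > 0" "Q ^ m * 2 ^ ((m + 1) * d) \<le> R" "Q * 4 ^ d \<le> R" using Q by (auto simp: R_def intro: add_pos_pos)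
  have "L2.nrm (cube_measure d) f \<le> (K1 * R) * (rate1 m n N * hm.nrm f + rate2 n N * sample.nrm X f)"
    if \<Lambda>: "\<Lambda> \<subseteq> Pow {1..d}" "\<Lambda> \<noteq> {}" "downward_closed \<Lambda>" and n: "n = Max (card ` \<Lambda>)" "n \<ge> 1" and p: "p \<ge> 1"
      and X: "X = sample_points d Y \<Lambda> (\<lambda>u. p + card u)" and N: "N = size X" and f: "f \<in> hmix_sub m d \<Lambda>"
    for \<Lambda> p n X N f
  proof -
    have fh: "f \<in> hmix m d" using f by (rule hmix_sub_hmix)
    have fL: "finite \<Lambda>" using \<Lambda>(1) finite_subset by blast
    have Nl: "2 ^ p + 1 \<le> N" and Nu: "N \<le> 2 ^ d * ((d + 1) * (d + 1) ^ d * 2 ^ d) * p ^ (n - 1) * 2 ^ p"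
      unfolding N X using sample_points_size[OF Y \<Lambda> n p] by auto
    have "real N \<le> real (2 ^ d * ((d + 1) * (d + 1) ^ d * 2 ^ d) * p ^ (n - 1) * 2 ^ p)" using Nu by (simp only: of_nat_le_iff)
    then have Nu: "real N \<le> Q * real p ^ (n - 1) * 2 ^ p" unfolding Q_def by simp
    have "card u \<le> d" if "u \<in> \<Lambda>" for u using card_mono[of "{1..d}" u] \<Lambda>(1) that by auto
    then have nd: "n \<le> d" unfolding n(1) using fL \<Lambda>(2) by simp
    have N2: "N \<ge> 2" using Nl one_le_power[of "2::nat" p] by linarith
    have r: "rate1 m n N \<ge> 0" "rate2 n N \<ge> 0" by (auto simp: rate1_def rate2_def)
    have X0: "sample.nrm X f \<ge> 0" and H0: "hm.nrm f \<ge> 0" using fh by (auto intro: sample.nrm_nonneg hm.nrm_nonneg)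
    have "L2.nrm (cube_measure d) f
      \<le> K \<Lambda> * real p ^ (n - 1) * ((1 / 2) ^ (m * p) * hm.nrm f + sqrt ((1 / 2) ^ p) * sample.nrm X f)"
      unfolding X n(1) using K \<Lambda> p f by blast
    also have "\<dots> = K \<Lambda> * ((real p ^ (n - 1) * (1 / 2) ^ (m * p)) * hm.nrm f + (real p ^ (n - 1) * sqrt ((1 / 2) ^ p)) * sample.nrm X f)"
      by (simp add: algebra_simps)
    also have "\<dots> \<le> K1 * ((R * rate1 m n N) * hm.nrm f + (R * rate2 n N) * sample.nrm X f)"
    proof (rule mult_mono)
      show "K \<Lambda> \<le> K1" using KK1 \<Lambda> by blast
      have 1: "real p ^ (n - 1) * (1 / 2) ^ (m * p) \<le> R * rate1 m n N"
        using level_rates(1)[OF p n(2) nd Q Nl Nu, of m] mult_right_mono[OF R(2) r(1)] by linarith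
      have 2: "real p ^ (n - 1) * sqrt ((1 / 2) ^ p) \<le> R * rate2 n N"
        using level_rates(2)[OF p n(2) nd Q Nl Nu] mult_right_mono[OF R(3) r(2)] by linarith
      show "(real p ^ (n - 1) * (1 / 2) ^ (m * p)) * hm.nrm f + (real p ^ (n - 1) * sqrt ((1 / 2) ^ p)) * sample.nrm X f
          \<le> (R * rate1 m n N) * hm.nrm f + (R * rate2 n N) * sample.nrm X f"
        by (intro add_mono mult_right_mono[OF 1 H0] mult_right_mono[OF 2 X0])
    qed (use K1 X0 H0 in auto)
    also have "\<dots> = (K1 * R) * (rate1 m n N * hm.nrm f + rate2 n N * sample.nrm X f)" by (simp add: algebra_simps)
    finally show ?thesis .
  qed
  moreover have "K1 * R > 0" using K1 R by simp
  ultimately show ?thesis by (intro exI[of _ "K1 * R"]) blast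
qed

text \<open>The error is \<open>(f1 - s) + f2\<close> with the minimizer \<open>s\<close>. The
  sampling inequality applies to the first part, which lies in the subspace, while \<open>f2\<close>
  enters with constant \<open>1\<close>. The factor \<open>2\<close> is that of the stability
  bounds.\<close>

lemma pls_error:
  assumes \<Lambda>: "\<Lambda> \<subseteq> Pow {1..d}" "downward_closed \<Lambda>" and C: "C > 0" and lam: "lam > 0"
    and r: "r1 \<ge> 0" "r2 \<ge> 0"
    and ineq: "\<And>g. g \<in> hmix_sub m d \<Lambda> \<Longrightarrow> L2.nrm (cube_measure d) g \<le> C * (r1 * hm.nrm g + r2 * sample.nrm X g)"
    and f1: "f1 \<in> hmix_sub m d \<Lambda>" and f2: "f2 \<in> hmix_compl m d \<Lambda>" and f: "f = (\<lambda>x. f1 x + f2 x)"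
  shows "L2_cube_norm d (\<lambda>x. f x - pls m d X lam \<Lambda> f x)
    \<le> 2 * C * (r1 + r2 * sqrt lam) * hmix_norm m d f
      + 2 * C * (r1 * (1 / sqrt lam) + r2) * l2_sample_norm X f2 + L2_cube_norm d f2"
proof -
  let ?s = "pls m d X lam \<Lambda> f"
  have sV: "?s \<in> hmix_sub m d \<Lambda>" by (rule pls_minimizer(1)[OF \<Lambda> lam])
  have f2h: "f2 \<in> hmix m d" using f2 by (simp add: hmix_compl_def)
  have gV: "hm.sub f1 ?s \<in> hmix_sub m d \<Lambda>" by (rule hmix_sub_linear[OF f1 sV])
  let ?H = "hm.nrm f" and ?X = "sample.nrm X f2"
  have X0: "?X \<ge> 0" by (rule sample.nrm_nonneg) simp
  have H: "hm.nrm f1 \<le> ?H" unfolding f by (rule hmix_compl_nrm_le[OF f1 f2])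
  have H1: "hm.nrm f1 \<ge> 0" using hmix_sub_hmix[OF f1] by (rule hm.nrm_nonneg)
  have a: "hm.nrm (hm.sub f1 ?s) \<le> 2 * ?H + 2 * (?X / sqrt lam)"
  proof -
    have "0 \<le> ?X / sqrt lam" using X0 lam by simp
    then show ?thesis using pls_stability(1)[OF \<Lambda> lam f1 f, of X] H by linarith
  qed
  have b: "sample.nrm X (hm.sub f1 ?s) \<le> 2 * ?X + 2 * (sqrt lam * ?H)"
  proof -
    have "sqrt lam * hm.nrm f1 \<le> sqrt lam * ?H" using lam H by (intro mult_left_mono) auto
    moreover have "0 \<le> sqrt lam * ?H" using lam H H1 by simp
    ultimately show ?thesis using pls_stability(2)[OF \<Lambda> lam f1 f, of X] by linarith
  qed
  have "(\<lambda>x. f x - ?s x) = (\<lambda>x. hm.sub f1 ?s x + f2 x)" unfolding f by (simp add: fun_eq_iff)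
  then have "L2_cube_norm d (\<lambda>x. f x - ?s x) \<le> L2.nrm (cube_measure d) (hm.sub f1 ?s) + L2_cube_norm d f2"
    unfolding L2_cube_nrm using L2.nrm_add_le[OF hmix_sq_int[OF hmix_sub_hmix[OF gV]] hmix_sq_int[OF f2h]] by simp
  also have "L2.nrm (cube_measure d) (hm.sub f1 ?s) \<le> C * (r1 * hm.nrm (hm.sub f1 ?s) + r2 * sample.nrm X (hm.sub f1 ?s))"
    by (rule ineq[OF gV])
  also have "\<dots> \<le> C * (r1 * (2 * ?H + 2 * (?X / sqrt lam)) + r2 * (2 * ?X + 2 * (sqrt lam * ?H)))"
    using C r a b by (intro mult_left_mono add_mono) auto
  also have "\<dots> = 2 * C * (r1 + r2 * sqrt lam) * ?H + 2 * C * (r1 * (1 / sqrt lam) + r2) * ?X"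
    by (simp add: algebra_simps)
  finally show ?thesis by (simp add: hmix_norm_nrm l2_sample_nrm)
qed

end

theorem corollary5p2:
  fixes m d :: nat and Y :: "nat \<Rightarrow> real set"
  assumes "m \<ge> 1" and "d \<ge> 1" and "sampling_sequence Y"
  shows "\<exists>C1>0. \<exists>C2>0. \<exists>C3>0. \<forall>(\<Lambda> :: nat set set) (p :: nat) (n :: nat) X N.
    \<Lambda> \<subseteq> Pow {1..d} \<and> \<Lambda> \<noteq> {} \<and> downward_closed \<Lambda> \<and> n = Max (card ` \<Lambda>) \<and> n \<ge> 1 \<and> p \<ge> 1 \<and>
    X = sample_points d Y \<Lambda> (\<lambda>u. p + card u) \<and> N = size X \<longrightarrow>
    (\<forall>lam>0. \<forall>f\<in>hmix m d. \<forall>f1\<in>hmix_sub m d \<Lambda>. \<forall>f2\<in>hmix_compl m d \<Lambda>.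
      f = (\<lambda>x. f1 x + f2 x) \<longrightarrow>
      L2_cube_norm d (\<lambda>x. f x - pls m d X lam \<Lambda> f x)
        \<le> C1 * (rate1 m n N + rate2 n N * sqrt lam) * hmix_norm m d f
          + C1 * (rate1 m n N * (1 / sqrt lam) + rate2 n N) * l2_sample_norm X f2
          + L2_cube_norm d f2 \<and>
      (sqrt lam = rate1 m n N / rate2 n N \<longrightarrow>
        L2_cube_norm d (\<lambda>x. f x - pls m d X lam \<Lambda> f x)
          \<le> C2 * rate1 m n N * hmix_norm m d f + C2 * rate2 n N * l2_sample_norm X f2
            + L2_cube_norm d f2 \<and>
        C2 * rate1 m n N * hmix_norm m d f + C2 * rate2 n N * l2_sample_norm X f2
            + L2_cube_norm d f2
          \<le> C3 * (rate1 m n N * hmix_norm m d f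
                   + ln (real N) powr rho2 n * Linf_cube_norm d f2)))"
proof -
  obtain L a where "sampling_weights m Y L a" using sampling_weights_exist[OF assms(1,3)] by blast
  then interpret mixed_sampling m d Y L a
    using assms by (simp add: mixed_sampling_def mixed_sobolev_def)
  obtain C where C: "C > 0" and ineq: "\<And>\<Lambda> p n X N f. \<Lambda> \<subseteq> Pow {1..d} \<Longrightarrow> \<Lambda> \<noteq> {} \<Longrightarrow> downward_closed \<Lambda> \<Longrightarrow>
      n = Max (card ` \<Lambda>) \<Longrightarrow> n \<ge> 1 \<Longrightarrow> p \<ge> 1 \<Longrightarrow> X = sample_points d Y \<Lambda> (\<lambda>u. p + card u) \<Longrightarrow> N = size X \<Longrightarrow>
      f \<in> hmix_sub m d \<Lambda> \<Longrightarrow> L2.nrm (cube_measure d) f \<le> C * (rate1 m n N * hm.nrm f + rate2 n N * sample.nrm X f)"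
    using uniform_sampling_inequality[OF assms(3)] by (elim exE conjE) blast
  have main: "L2_cube_norm d (\<lambda>x. f x - pls m d X lam \<Lambda> f x)
        \<le> 2 * C * (rate1 m n N + rate2 n N * sqrt lam) * hmix_norm m d f
          + 2 * C * (rate1 m n N * (1 / sqrt lam) + rate2 n N) * l2_sample_norm X f2
          + L2_cube_norm d f2 \<and>
      (sqrt lam = rate1 m n N / rate2 n N \<longrightarrow>
        L2_cube_norm d (\<lambda>x. f x - pls m d X lam \<Lambda> f x)
          \<le> 4 * C * rate1 m n N * hmix_norm m d f + 4 * C * rate2 n N * l2_sample_norm X f2
            + L2_cube_norm d f2 \<and>
        4 * C * rate1 m n N * hmix_norm m d f + 4 * C * rate2 n N * l2_sample_norm X f2
            + L2_cube_norm d f2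
          \<le> (4 * C + 1) * (rate1 m n N * hmix_norm m d f
                   + ln (real N) powr rho2 n * Linf_cube_norm d f2))"
    if \<Lambda>: "\<Lambda> \<subseteq> Pow {1..d}" "\<Lambda> \<noteq> {}" "downward_closed \<Lambda>" and n: "n = Max (card ` \<Lambda>)" "n \<ge> 1" and p: "p \<ge> 1"
      and X: "X = sample_points d Y \<Lambda> (\<lambda>u. p + card u)" and N: "N = size X" and lam: "lam > 0"
      and f: "f \<in> hmix m d" and f1: "f1 \<in> hmix_sub m d \<Lambda>" and f2: "f2 \<in> hmix_compl m d \<Lambda>"
      and ff: "f = (\<lambda>x. f1 x + f2 x)"
    for \<Lambda> p n X N lam f f1 f2
  proof (intro conjI impI)
    let ?r1 = "rate1 m n N" and ?r2 = "rate2 n N" and ?l = "ln (real N) powr rho2 n"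
    have r0: "?r1 \<ge> 0" "?r2 \<ge> 0" by (auto simp: rate1_def rate2_def)
    show first: "L2_cube_norm d (\<lambda>x. f x - pls m d X lam \<Lambda> f x)
        \<le> 2 * C * (?r1 + ?r2 * sqrt lam) * hmix_norm m d f
          + 2 * C * (?r1 * (1 / sqrt lam) + ?r2) * l2_sample_norm X f2 + L2_cube_norm d f2"
      by (rule pls_error[OF \<Lambda>(1,3) C lam r0 ineq[OF \<Lambda> n p X N] f1 f2 ff])
    assume sl: "sqrt lam = ?r1 / ?r2"
    \<comment> \<open>A positive \<open>lam\<close> with this square root forces both rates to be
      positive, so the quotient can be cancelled.\<close>
    have pos: "?r1 > 0" "?r2 > 0"
    proof -
      have "?r1 / ?r2 > 0" using lam sl real_sqrt_gt_zero by metis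
      then show "?r1 > 0" "?r2 > 0" using r0 by (auto simp: zero_less_divide_iff)
    qed
    \<comment> \<open>The choice of \<open>lam\<close> balances the two terms: each bracket becomes
      twice its leading rate, which turns \<open>2 * C\<close> into \<open>4 * C\<close>.\<close>
    have e: "?r1 + ?r2 * sqrt lam = 2 * ?r1" "?r1 * (1 / sqrt lam) + ?r2 = 2 * ?r2"
      using pos by (simp_all add: sl)
    show "L2_cube_norm d (\<lambda>x. f x - pls m d X lam \<Lambda> f x)
          \<le> 4 * C * ?r1 * hmix_norm m d f + 4 * C * ?r2 * l2_sample_norm X f2 + L2_cube_norm d f2"
      using first unfolding e by simp
    have f2h: "f2 \<in> hmix m d" using f2 by (simp add: hmix_compl_def)
    let ?I = "Linf_cube_norm d f2"
    have I0: "?I \<ge> 0" using Linf_cube_norm_ge[OF f2h] abs_ge_zero order_trans by blast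
    \<comment> \<open>At least three points give \<open>ln N \<ge> 1\<close>, so the logarithmic
      factor is at least \<open>1\<close> and absorbs the term \<open>L2_cube_norm d f2\<close>.
      This accounts for the \<open>1\<close> in the constant \<open>4 * C + 1\<close>.\<close>
    have N3: "N \<ge> 3"
    proof -
      have "(2::nat) ^ 1 \<le> 2 ^ p" using p by (intro power_increasing) auto
      then show ?thesis unfolding N X using sample_points_size(1)[OF assms(3) \<Lambda> n p] by simp
    qed
    have "exp 1 \<le> real N" using N3 exp_le by linarith
    then have "1 \<le> ln (real N)" using N3 by (subst ln_ge_iff) auto
    then have l1: "1 \<le> ?l" using n by (intro ge_one_powr_ge_zero) (auto simp: rho2_def)
    have "?r2 * l2_sample_norm X f2 \<le> ?r2 * (sqrt (real N) * ?I)"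
      using sample_le_Linf[OF f2h, of X] r0 unfolding N by (intro mult_left_mono) auto
    also have "\<dots> = ?l * ?I"
      using N3 by (simp add: rate2_def powr_minus powr_half_sqrt)
    finally have s: "?r2 * l2_sample_norm X f2 \<le> ?l * ?I" .
    have "L2_cube_norm d f2 \<le> 1 * ?I" using L2_le_Linf[OF f2h] by simp
    also have "\<dots> \<le> ?l * ?I" using l1 I0 by (intro mult_right_mono)
    finally have t: "L2_cube_norm d f2 \<le> ?l * ?I" .
    have h0: "0 \<le> ?r1 * hmix_norm m d f" using r0 hm.nrm_nonneg[OF f] by (simp add: hmix_norm_nrm)
    have "4 * C * (?r2 * l2_sample_norm X f2) \<le> 4 * C * (?l * ?I)" using C s by (intro mult_left_mono) auto
    then have "4 * C * (?r1 * hmix_norm m d f) + 4 * C * (?r2 * l2_sample_norm X f2) + L2_cube_norm d f2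
        \<le> 4 * C * (?r1 * hmix_norm m d f) + 4 * C * (?l * ?I) + ?r1 * hmix_norm m d f + ?l * ?I"
      using t h0 by linarith
    then show "4 * C * ?r1 * hmix_norm m d f + 4 * C * ?r2 * l2_sample_norm X f2 + L2_cube_norm d f2
        \<le> (4 * C + 1) * (?r1 * hmix_norm m d f + ?l * ?I)"
      by (simp add: algebra_simps)
  qed
  have c: "2 * C > 0" "4 * C > 0" "4 * C + 1 > 0" using C by simp_all
  show ?thesis
    by (rule exI[of _ "2 * C"], rule conjI[OF c(1)], rule exI[of _ "4 * C"], rule conjI[OF c(2)],
        rule exI[of _ "4 * C + 1"], rule conjI[OF c(3)], intro allI impI ballI, elim conjE, rule main; assumption)
qed

end
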